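(* Let $\theta\in(0,\pi/2)$ be fixed (and let $M$ be a fixed sufficiently large number). Then, as $\lambda=e^{-\varkappa}\to0$, uniformly in $z\in\tilde\Omega$, $$\Gamma(z;\lambda) = \begin{cases} \Psi_0(z;\varkappa)\left(\mathbf 1+O\left(\frac{M^2}{\varkappa}\right)\right)e^{-\varkappa g(z)\sigma_3}, & z\in\tilde{\Omega},\ \theta<|\arg(z)|<\pi-\theta, \\ \Psi_0(z;\varkappa)\left(\mathbf 1+O\left(\frac{M^2}{\varkappa}\right)\right)\begin{bmatrix} 1 & 0 \\ \pm ie^{\varkappa(2g(z)-1)} & 1 \end{bmatrix}e^{-\varkappa g(z)\sigma_3}, & z\in\tilde{\Omega},\ \pi-\theta<\arg(z)<\pi+\theta, \\ \Psi_0(z;\varkappa)\left(\mathbf 1+O\left(\frac{M^2}{\varkappa}\right)\right)\begin{bmatrix} 1 & \mp ie^{-\varkappa(2g(z)+1)} \\ 0 & 1 \end{bmatrix}e^{-\varkappa g(z)\sigma_3}, & z\in\tilde{\Omega},\ -\theta<\arg(z)<\theta, \end{cases}$$ provided $\pm\Im\lambda\geq0$ (that is, the upper signs are taken for $\Im\lambda\ge0$ and the lower signs for $\Im\lambda\le0$).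
   Context: $\mathbf 1$ is the $2\times2$ identity; $\sigma_1=\begin{bmatrix}0&1\\1&0\end{bmatrix}$, $\sigma_2=\begin{bmatrix}0&-i\\ i&0\end{bmatrix}$, $\sigma_3=\mathrm{diag}(1,-1)$. $\lambda\in\mathbb C\setminus[-1/2,1/2]$, where $\lambda$ on the upper/lower shore of $[-1/2,1/2]$ is also allowed (boundary values in $\lambda$); $\lambda\to0$ with $\Im\lambda\ge0$ or with $\Im\lambda\le0$. $\varkappa=-\ln\lambda$ with $\arg\lambda\in[0,\pi]$ if $\Im\lambda\ge0$ and $\arg\lambda\in[-\pi,0]$ if $\Im\lambda\le0$. $a=a(\lambda)=\frac{1}{i\pi}\ln\left(\frac{i+\sqrt{4\lambda^2-1}}{2\lambda}\right)$, principal logarithm, $\sqrt{4\lambda^2-1}=2\lambda+O(1)$ as $\lambda\to\infty$ (cut $[-1/2,1/2]$), and $g(z)=a(-z/2)$, analytic for $z\in\overline{\mathbb C}\setminus[-1,1]$. $\Gamma(z;\lambda)$: let $h_\infty(\eta)=e^{a\pi i}\eta^{-a}{}_2F_1(a,a+1;2a+2;\frac1\eta)$, $s_\infty(\eta)=-e^{-a\pi i}\eta^{a+1}{}_2F_1(-a-1,-a;-2a;\frac1\eta)$ for $\Im\eta>0$ with principal branches, extended to $\mathbb C\setminus((-\infty,0]\cup[1,\infty))$ by analytic continuation across $(0,1)$; $\hat\Gamma(\eta)=\begin{bmatrix} h_\infty & s_\infty \\ h_\infty' & s_\infty' \end{bmatrix}(\eta)$; $$Q(\lambda)=\begin{bmatrix}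 -\tan(a\pi) & 0 \\ 0 & 4^{2a+1}e^{a\pi i}\frac{\Gamma(a+3/2)\Gamma(a+1/2)}{\Gamma(a)\Gamma(a+2)} \end{bmatrix}\begin{bmatrix} 1 & e^{a\pi i} \\ -e^{a\pi i} & 1 \end{bmatrix},$$ $$\Gamma(z;\lambda)=\sigma_2Q^{-1}(\lambda)\hat{\Gamma}^{-1}\left(\tfrac12\right)\begin{bmatrix} 1 & \frac{-1}{2z(a+1)} \\ 0 & 1 \end{bmatrix}\hat{\Gamma}\left(\tfrac{z+1}{2z}\right)Q(\lambda)\sigma_2$$ (for $z\in[-1,1]\setminus\{0,\pm1\}$, boundary values from above or below; $\Gamma(\cdot)$ with one argument is Euler's Gamma function). $\tilde\Omega=\{z:\ M\le\left|\frac{z+1}{2z}\right|\le2M\}$, a small annulus around $z=0$. $\Phi(z)=\left(\mathbf 1+\frac{i}{2z}\begin{bmatrix}1&-1\\1&-1\end{bmatrix}\right)\left(\frac{z^2-1}{z^2}\right)^{\sigma_1/4}$, where, with $\beta(z)=\left(\frac{z^2-1}{z^2}\right)^{1/4}$ (principal branch, $\beta(\infty)=1$, cut $[-1,1]$), $\left(\frac{z^2-1}{z^2}\right)^{\sigma_1/4}=\beta^{\sigma_1}=\frac{\beta}{2}\begin{bmatrix}1&1\\1&1\end{bmatrix}+\frac{1}{2\beta}\begin{bmatrix}1&-1\\-1&1\end{bmatrix}$. $\Psi_0(z;\varkappa)=\Phi(z)$ for $\Im\varkappa\le0$ (i.e. $\Im\lambda\ge0$) and $\Psi_0(z;\varkappa)=\sigma_1\Phi(z)\sigma_1$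 for $\Im\varkappa\ge0$ (i.e. $\Im\lambda\le0$).
   Formalization: The upper/lower signs in the triangular factors are chosen by ±Im z ≥ 0 (shore of z) instead of ±Im λ ≥ 0; the printed rule fails when Im λ and Im z have opposite signs and z is near the real axis (e.g. λ>0 on the upper shore, z>0 on the lower). *)

theory Defs
  imports "HOL-Analysis.Analysis"
begin

section \<open>Shores of real cuts\<close>

text \<open>
  Both \<open>\<lambda>\<close> and \<open>z\<close> may lie on a shore of a real cut. Such a point is represented by a complex
  number together with the closed half-plane it is regarded as belonging to; the side only
  matters for real points.
\<close>

datatype side = Upper | Lower

fun sg :: "side \<Rightarrow> real" where
  "sg Upper = 1"
| "sg Lower = -1"

definition on_side :: "side \<Rightarrow> complex \<Rightarrow> bool" where
  "on_side p w \<longleftrightarrow> 0 \<le> sg p * Im w"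

text \<open>
  At a real point where \<open>f\<close> is continuous (i.e. off its cut) the limit is just the value of \<open>f\<close>.
\<close>

definition bval :: "(complex \<Rightarrow> 'a::t2_space) \<Rightarrow> side \<Rightarrow> complex \<Rightarrow> 'a" where
  "bval f p w = (if Im w \<noteq> 0 then f w else Lim (at w within {u. 0 < sg p * Im u}) f)"


section \<open>Two-by-two matrices\<close>

definition mat2 :: "complex \<Rightarrow> complex \<Rightarrow> complex \<Rightarrow> complex \<Rightarrow> complex^2^2" where
  "mat2 a b c d = vector [vector [a, b], vector [c, d]]"

definition sigma1 :: "complex^2^2" where
  "sigma1 = mat2 0 1 1 0"

definition sigma2 :: "complex^2^2" where
  "sigma2 = mat2 0 (-\<i>) \<i> 0"

definition exp_sigma3 :: "complex \<Rightarrow> complex^2^2" where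
  \<comment> \<open>\<open>e\<close> to the power \<open>w\<sigma>\<^sub>3\<close>, where \<open>\<sigma>\<^sub>3 = diag(1,-1)\<close>\<close>
  "exp_sigma3 w = mat2 (exp w) 0 0 (exp (- w))"


section \<open>The functions of the spectral parameter\<close>

text \<open>
  The product of the two principal roots is the branch of \<open>(4\<lambda>\<^sup>2-1)\<^sup>1\<^sup>/\<^sup>2\<close> that is analytic off
  \<open>[-1/2,1/2]\<close> and behaves like \<open>2\<lambda>\<close> at infinity: the sign changes of the two factors cancel
  on \<open>(-\<infinity>,-1/2)\<close>.
\<close>

definition sqrt_cut :: "complex \<Rightarrow> complex" where
  "sqrt_cut l = csqrt (2 * l - 1) * csqrt (2 * l + 1)"

definition a_fun :: "complex \<Rightarrow> complex" where
  "a_fun l = 1 / (\<i> * pi) * Ln ((\<i> + sqrt_cut l) / (2 * l))"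

definition g_fun :: "complex \<Rightarrow> complex" where
  "g_fun z = a_fun (- z / 2)"

text \<open>
  The boundary values of \<open>Ln\<close> on the negative reals realise \<open>arg \<lambda> \<in> [0,\<pi>]\<close> on the upper and
  \<open>arg \<lambda> \<in> [-\<pi>,0]\<close> on the lower side.
\<close>

definition kap :: "side \<Rightarrow> complex \<Rightarrow> complex" where
  "kap p l = - bval Ln p l"


section \<open>Hypergeometric functions\<close>

text \<open>
  Analytic continuation of \<open>f\<close> from \<open>U\<close> to \<open>D\<close>. If it exists, it is determined on \<open>D\<close> whenever
  \<open>D\<close> is open and connected and \<open>U\<close> is a nonempty open subset; values outside \<open>D\<close> are junk.
\<close>

definition acont :: "complex set \<Rightarrow> complex set \<Rightarrow> (complex \<Rightarrow> complex) \<Rightarrow> complex \<Rightarrow> complex" where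
  "acont D U f = (SOME F. F holomorphic_on D \<and> (\<forall>x\<in>U. F x = f x))"

definition hyp2F1 :: "complex \<Rightarrow> complex \<Rightarrow> complex \<Rightarrow> complex \<Rightarrow> complex" where
  \<comment> \<open>principal branch, i.e. on the plane cut along \<open>[1,\<infinity>)\<close>\<close>
  "hyp2F1 a b c =
     acont (- (of_real ` {1..})) (ball 0 1)
       (\<lambda>x. \<Sum>n. pochhammer a n * pochhammer b n / (pochhammer c n * fact n) * x ^ n)"

definition eta_dom :: "complex set" where
  "eta_dom = - (of_real ` ({..0} \<union> {1..}))"

definition h_inf :: "complex \<Rightarrow> complex \<Rightarrow> complex" where
  "h_inf a = acont eta_dom {u. 0 < Im u}
     (\<lambda>u. exp (a * pi * \<i>) * u powr (- a) * hyp2F1 a (a + 1) (2 * a + 2) (1 / u))"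

definition s_inf :: "complex \<Rightarrow> complex \<Rightarrow> complex" where
  "s_inf a = acont eta_dom {u. 0 < Im u}
     (\<lambda>u. - exp (- a * pi * \<i>) * u powr (a + 1) * hyp2F1 (- a - 1) (- a) (- 2 * a) (1 / u))"


section \<open>The matrix \<open>\<Gamma>(z;\<lambda>)\<close>\<close>

definition Gamma_hat :: "complex \<Rightarrow> complex \<Rightarrow> complex^2^2" where
  "Gamma_hat a u = mat2 (h_inf a u) (s_inf a u) (deriv (h_inf a) u) (deriv (s_inf a) u)"

definition Q_mat :: "complex \<Rightarrow> complex^2^2" where
  "Q_mat a =
     mat2 (- tan (a * pi)) 0
          0 (4 powr (2 * a + 1) * exp (a * pi * \<i>) *
              (Gamma (a + 3/2) * Gamma (a + 1/2) / (Gamma a * Gamma (a + 2))))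
     ** mat2 1 (exp (a * pi * \<i>)) (- exp (a * pi * \<i>)) 1"

definition Gamma_off :: "complex \<Rightarrow> complex \<Rightarrow> complex^2^2" where
  \<comment> \<open>as a function of \<open>a = a(\<lambda>)\<close> and \<open>z\<close> off \<open>[-1,1]\<close>\<close>
  "Gamma_off a z =
     sigma2 ** matrix_inv (Q_mat a) ** matrix_inv (Gamma_hat a (1/2))
       ** mat2 1 (- 1 / (2 * z * (a + 1))) 0 1
       ** Gamma_hat a ((z + 1) / (2 * z)) ** Q_mat a ** sigma2"

text \<open>
  \<open>p\<close> is the side of \<open>\<lambda>\<close> and \<open>q\<close> the side of \<open>z\<close>. The parameter \<open>\<lambda>\<close> enters only through \<open>a(\<lambda>)\<close>,
  so boundary values in \<open>\<lambda>\<close> are those of \<open>a\<close>.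
\<close>

definition Gamma_mat :: "side \<Rightarrow> side \<Rightarrow> complex \<Rightarrow> complex \<Rightarrow> complex^2^2" where
  "Gamma_mat p q z l = bval (Gamma_off (bval a_fun p l)) q z"


section \<open>The leading term\<close>

definition beta_fun :: "complex \<Rightarrow> complex" where
  \<comment> \<open>the argument lies in \<open>(-\<infinity>,0]\<close> exactly for \<open>z \<in> [-1,1]\<close>\<close>
  "beta_fun z = ((z\<^sup>2 - 1) / z\<^sup>2) powr (1/4)"

definition pow_sigma1 :: "complex \<Rightarrow> complex^2^2" where
  \<comment> \<open>\<open>b\<close> to the power \<open>\<sigma>\<^sub>1\<close>\<close>
  "pow_sigma1 b =
     mat2 (b / 2) (b / 2) (b / 2) (b / 2)
     + mat2 (1 / (2 * b)) (- 1 / (2 * b)) (- 1 / (2 * b)) (1 / (2 * b))"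

definition Phi :: "complex \<Rightarrow> complex^2^2" where
  "Phi z = (mat 1 + mat2 (\<i> / (2 * z)) (- \<i> / (2 * z)) (\<i> / (2 * z)) (- \<i> / (2 * z)))
            ** pow_sigma1 (beta_fun z)"

text \<open>
  The two cases are \<open>Im \<kappa> \<le> 0\<close> and \<open>Im \<kappa> \<ge> 0\<close>; for \<open>\<lambda> > 0\<close>, where \<open>Im \<kappa> = 0\<close>, the shore decides.
\<close>

definition Psi0 :: "side \<Rightarrow> side \<Rightarrow> complex \<Rightarrow> complex^2^2" where
  "Psi0 p q z =
     (case p of Upper \<Rightarrow> bval Phi q z
              | Lower \<Rightarrow> sigma1 ** bval Phi q z ** sigma1)"

definition Omega :: "real \<Rightarrow> complex set" where
  "Omega M = {z. M \<le> cmod ((z + 1) / (2 * z)) \<and> cmod ((z + 1) / (2 * z)) \<le> 2 * M}"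

text \<open>
  The triangular factors. The sign of the off-diagonal entry, \<open>\<plusminus>\<close> near the negative and \<open>\<mp>\<close> near
  the positive half-axis, is the upper one for \<open>z\<close> in the upper and the lower one for \<open>z\<close> in the
  lower half-plane (\<open>q\<close> is the side of \<open>z\<close>), for either side of \<open>\<lambda>\<close>. Letting the side of \<open>\<lambda>\<close>
  select it gives a false asymptotic formula when \<open>Im \<lambda>\<close> and \<open>Im z\<close> have opposite signs. Indeed,
  with \<open>Y = \<Gamma> exp(\<kappa> g \<sigma>\<^sub>3)\<close>, where \<open>\<Gamma>\<close> has a unit-diagonal triangular jump, the matrix
  \<open>Y(z\<^sub>-)\<^sup>-\<^sup>1 Y(z\<^sub>+)\<close> has diagonal \<open>d, 1/d\<close> with \<open>d = exp(\<kappa>(g\<^sub>+ - g\<^sub>-))\<close>. On the negative side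
  \<open>g\<^sub>+ + g\<^sub>- = 1\<close> and the jump of \<open>\<Psi>\<^sub>0\<close> is \<open>c \<sigma>\<^sub>1\<close>, \<open>c = \<plusminus>\<i>\<close>; if the lower left entries of the
  factors are \<open>\<epsilon>\<^sub>\<plusminus> \<i> exp(\<kappa>(2 g\<^sub>\<plusminus> - 1))\<close>, the diagonal is to leading order
  \<open>c \<i> \<epsilon>\<^sub>+ d, - c \<i> \<epsilon>\<^sub>- / d\<close>, which forces \<open>\<epsilon>\<^sub>- = - \<epsilon>\<^sub>+\<close>. The positive side is analogous.
\<close>

definition tri_left :: "side \<Rightarrow> complex \<Rightarrow> complex \<Rightarrow> complex^2^2" where
  "tri_left q k g = mat2 1 0 (sg q * \<i> * exp (k * (2 * g - 1))) 1"

definition tri_right :: "side \<Rightarrow> complex \<Rightarrow> complex \<Rightarrow> complex^2^2" where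
  "tri_right q k g = mat2 1 (- sg q * \<i> * exp (- k * (2 * g + 1))) 0 1"

end

theory Submission
  imports Defs "HOL-Complex_Analysis.Complex_Analysis"
begin

text \<open>
  Substitute \<open>1/z = \<i>(1/v - v)/2\<close> with \<open>v\<close> in the right half of the unit disc, so that \<open>g\<close> is
  \<open>Ln v\<close> up to a constant factor. A quadratic transformation turns the columns of \<open>\<Gamma>\<close> into powers of \<open>v\<close> times
  \<open>2F1(\<nu>,-1/2;\<nu>+3/2;x)\<close> and \<open>2F1(\<nu>+1,1/2;\<nu>+3/2;x)\<close> with \<open>\<nu> = a\<close> and \<open>\<nu> = -a-1\<close>; Bailey's theorem evaluates
  them at the base point \<open>\<eta> = 1/2\<close>, and there the Gamma factors of \<open>Q\<close> cancel. As \<open>\<lambda> \<rightarrow> 0\<close> the imaginary part of \<open>a\<close>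
  tends to infinity, both functions become algebraic up to \<open>O(1/\<kappa>)\<close>, and \<open>\<Gamma>\<close> splits into \<open>\<Phi>\<close>, a factor near
  the identity, and an explicit matrix in \<open>exp (\<kappa> g)\<close>. One of the two off-diagonal entries of that matrix is always
  exponentially small; the other one is the triangular factor. Conjugation covers the other side of \<open>\<lambda>\<close>, and
  conjugation by \<open>\<sigma>\<^sub>1\<close> the other side of \<open>z\<close>.
\<close>

text \<open>Two obstacles shape the proof. First, the large parameter sits in upper and lower slots
  alike, even after the quadratic transformation, so the series have no evident limit. Pfaff's
  transformation leaves it in the lower slot only: the series then tends to 1 and an explicit square
  root splits off. It also moves the base point, where u = -1 lies on the circle of convergence, to
  x = 1/2. Second, \<eta> = 1/2 lies outside the open half-plane in which h and s are given by
  formulas, so their continuation across (0,1) must be made explicit. The form of Q helps here: the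
  equation \<eta>(\<eta>-1)y'' = a(a+1)y is invariant under \<eta> -> 1-\<eta>, and Q combines h and
  s into two columns that are reflections of each other. A single function \<open>Fc\<close>
  therefore describes the whole matrix. Both transformations of the series are obtained from
  first-order systems: the two sides lead to the same system, and a system fixes its power
  series.\<close>

section \<open>Hypergeometric series as formal power series\<close>

definition hyp_coeff :: "complex \<Rightarrow> complex \<Rightarrow> complex \<Rightarrow> nat \<Rightarrow> complex" where
  "hyp_coeff A B C n = pochhammer A n * pochhammer B n / (pochhammer C n * fact n)"

definition hyp_fps :: "complex \<Rightarrow> complex \<Rightarrow> complex \<Rightarrow> complex fps" where
  "hyp_fps A B C = Abs_fps (hyp_coeff A B C)"

definition HS :: "complex \<Rightarrow> complex \<Rightarrow> complex \<Rightarrow> complex \<Rightarrow> complex" where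
  "HS A B C = eval_fps (hyp_fps A B C)"

lemma hyp_fps_nth [simp]: "fps_nth (hyp_fps A B C) n = hyp_coeff A B C n"
  by (simp add: hyp_fps_def)

lemma HS_0 [simp]: "HS A B C 0 = 1"
  by (simp add: HS_def eval_fps_at_0 hyp_coeff_def)

lemma hyp_coeff_Suc:
  "hyp_coeff A B C (Suc n) = hyp_coeff A B C n * ((A + of_nat n) * (B + of_nat n) / ((C + of_nat n) * of_nat (Suc n)))"
  by (simp add: hyp_coeff_def pochhammer_Suc field_simps)

lemma nonint_add_nat:
  fixes C :: complex
  assumes "C \<notin> \<int>\<^sub>\<le>\<^sub>0" shows "C + of_nat n \<noteq> 0"
proof
  assume "C + of_nat n = 0"
  hence "C = - of_nat n" by (simp add: add_eq_0_iff2)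
  thus False using assms by auto
qed

lemma nonint_pochhammer:
  fixes C :: complex
  assumes "C \<notin> \<int>\<^sub>\<le>\<^sub>0" shows "pochhammer C n \<noteq> 0"
  using nonint_add_nat[OF assms] by (auto simp: pochhammer_prod)

lemma nonint_Im: "Im C \<noteq> 0 \<Longrightarrow> C \<notin> \<int>\<^sub>\<le>\<^sub>0"
  by (auto elim!: nonpos_Ints_cases)

lemma tendsto_add_nat_ratio: "(\<lambda>n. (A + of_nat n) / (C + of_nat n :: complex)) \<longlonglongrightarrow> 1"
proof -
  have f: "filterlim (\<lambda>n. C + of_nat n) at_infinity sequentially"
    by (intro tendsto_add_filterlim_at_infinity[OF tendsto_const] tendsto_of_nat)
  have "(\<lambda>n. 1 + (A - C) / (C + of_nat n)) \<longlonglongrightarrow> 1 + 0"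
    by (intro tendsto_add tendsto_const tendsto_divide_0[OF tendsto_const f])
  moreover have "eventually (\<lambda>n. C + of_nat n \<noteq> 0) sequentially"
    using f by (rule filterlim_at_infinity_imp_eventually_ne)
  hence "eventually (\<lambda>n. 1 + (A - C) / (C + of_nat n) = (A + of_nat n) / (C + of_nat n)) sequentially"
    by eventually_elim (simp add: field_simps)
  ultimately show ?thesis
    using tendsto_cong by force
qed

lemma hyp_conv_radius: "fps_conv_radius (hyp_fps A B C) \<ge> 1"
proof -
  have "summable (\<lambda>n. hyp_coeff A B C n * x ^ n)" if x: "norm x < 1" for x
  proof -
    define q where "q n = (A + of_nat n) * (B + of_nat n) / ((C + of_nat n) * of_nat (Suc n))" for n
    have "(\<lambda>n. (A + of_nat n) / (C + of_nat n) * ((B + of_nat n) / (1 + of_nat n))) \<longlonglongrightarrow> 1 * 1"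
      by (intro tendsto_mult tendsto_add_nat_ratio)
    hence "q \<longlonglongrightarrow> 1" by (simp add: q_def[abs_def] mult_ac)
    hence "(\<lambda>n. norm (q n) * norm x) \<longlonglongrightarrow> norm (1::complex) * norm x"
      by (intro tendsto_intros)
    moreover obtain r where r: "norm x < r" "r < 1" using x dense by blast
    ultimately have "eventually (\<lambda>n. norm (q n) * norm x < r) sequentially"
      by (intro order_tendstoD) auto
    then obtain N where N: "\<And>n. n \<ge> N \<Longrightarrow> norm (q n) * norm x < r"
      by (auto simp: eventually_sequentially)
    show ?thesis
    proof (rule summable_ratio_test[OF r(2)])
      fix n assume "n \<ge> N"
      have "norm (hyp_coeff A B C (Suc n) * x ^ Suc n) = norm (q n) * norm x * norm (hyp_coeff A B C n * x ^ n)"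
        by (simp add: hyp_coeff_Suc q_def norm_mult norm_divide norm_power)
      also have "\<dots> \<le> r * norm (hyp_coeff A B C n * x ^ n)"
        using N[OF \<open>n \<ge> N\<close>] by (intro mult_right_mono) auto
      finally show "norm (hyp_coeff A B C (Suc n) * x ^ Suc n) \<le> r * norm (hyp_coeff A B C n * x ^ n)" .
    qed
  qed
  hence "conv_radius (hyp_coeff A B C) \<ge> 1"
    by (intro conv_radius_geI_ex) (metis ereal_less_eq(1) ereal_less(3) less_ereal.simps(1) linorder_not_less norm_of_real one_ereal_def abs_of_pos)
  thus ?thesis by (simp add: fps_conv_radius_def)
qed

lemma HS_in: "norm x < 1 \<Longrightarrow> ereal (norm x) < fps_conv_radius (hyp_fps A B C)"
  using hyp_conv_radius[of A B C] by (metis ereal_less(3) order_less_le_trans)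

lemma HS_sums: "norm x < 1 \<Longrightarrow> (\<lambda>n. hyp_coeff A B C n * x ^ n) sums HS A B C x"
  using sums_eval_fps[OF HS_in[of x A B C]] by (simp add: HS_def)

text \<open>Evaluating the formal derivative, instead of taking \<open>deriv\<close>, lets
  identities between coefficients pass to the functions.\<close>

definition HD :: "complex \<Rightarrow> complex \<Rightarrow> complex \<Rightarrow> complex \<Rightarrow> complex" where
  "HD A B C = eval_fps (fps_deriv (hyp_fps A B C))"

lemma HD_in: "norm x < 1 \<Longrightarrow> ereal (norm x) < fps_conv_radius (fps_deriv (hyp_fps A B C))"
  using HS_in[of x A B C] fps_conv_radius_deriv[of "hyp_fps A B C"] by (rule less_le_trans)

lemma HS_deriv [derivative_intros]:
  assumes "(f has_field_derivative f') (at x)" "norm (f x) < 1"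
  shows "((\<lambda>x. HS A B C (f x)) has_field_derivative HD A B C (f x) * f') (at x)"
proof -
  have "(HS A B C has_field_derivative HD A B C (f x)) (at (f x))"
    unfolding HS_def HD_def
    by (rule has_field_derivative_eval_fps'[THEN DERIV_cong] | rule has_field_derivative_eval_fps[THEN DERIV_cong])
       (use assms(2) HS_in in \<open>auto simp: eval_fps_deriv\<close>)
  from DERIV_chain2[OF this assms(1)] show ?thesis .
qed

lemma HS_hol: "HS A B C holomorphic_on ball 0 1"
  unfolding holomorphic_on_open[OF open_ball]
  using HS_deriv[OF DERIV_ident] by (metis mem_ball_0)

lemma eval_fps_poly_mult:
  assumes "norm x < 1" "fps_conv_radius F \<ge> 1"
  shows "eval_fps (fps_of_poly p * F) (x::complex) = poly p x * eval_fps F x"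
    and "fps_conv_radius (fps_of_poly p * F) \<ge> 1"
proof -
  have x: "ereal (norm x) < fps_conv_radius F"
    using assms by (metis ereal_less(3) order_less_le_trans)
  show "eval_fps (fps_of_poly p * F) x = poly p x * eval_fps F x"
    by (subst eval_fps_mult) (simp_all add: x)
  show "fps_conv_radius (fps_of_poly p * F) \<ge> 1"
    using fps_conv_radius_mult[of "fps_of_poly p" F] assms(2) by simp
qed

lemma eval_fps_poly_add:
  assumes "norm x < 1" "fps_conv_radius F \<ge> 1" "fps_conv_radius G \<ge> 1"
  shows "eval_fps (fps_of_poly p * F + fps_of_poly q * G) (x::complex) = poly p x * eval_fps F x + poly q x * eval_fps G x"
  using assms eval_fps_poly_mult[of x]
  by (subst eval_fps_add) (auto intro: order_less_le_trans[of _ 1])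

lemma hyp_deriv_conv_radius: "fps_conv_radius (fps_deriv (hyp_fps A B C)) \<ge> 1"
  using hyp_conv_radius[of A B C] fps_conv_radius_deriv[of "hyp_fps A B C"] by (rule order_trans)

text \<open>The passage from coefficients to functions: polynomial factors do not reduce the radius
  of convergence below 1, so the relations below only need a comparison of coefficients.\<close>

lemma hyp_first_order:
  assumes "norm x < 1"
    and "fps_of_poly p * hyp_fps A B C + fps_of_poly q * fps_deriv (hyp_fps A B C) = fps_of_poly r * hyp_fps A' B' C'"
  shows "poly p x * HS A B C x + poly q x * HD A B C x = poly r x * HS A' B' C' x"
  using arg_cong[OF assms(2), of "\<lambda>f. eval_fps f x"] assms(1)
  by (simp add: eval_fps_poly_add eval_fps_poly_mult hyp_conv_radius hyp_deriv_conv_radius HS_def HD_def)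

section \<open>First-order systems, differential equation, contiguity\<close>

text \<open>The two functions differ by a unit shift of both upper parameters. Hence every
  coefficient of index \<open>k + 1\<close> in these relations is a rational multiple of
  \<open>P k\<close>, and each relation becomes a polynomial identity in \<nu> and k.\<close>

lemma hyp_u_system:
  fixes \<nu> :: complex
  assumes c: "\<nu> + 3/2 \<notin> \<int>\<^sub>\<le>\<^sub>0" and u: "norm u < 1"
  defines "c \<equiv> \<nu> + 3/2"
  shows "\<nu> * HS \<nu> (-1/2) c u + 2 * u * HD \<nu> (-1/2) c u = \<nu> * (1 - u) * HS (\<nu>+1) (1/2) c u" (is ?A)
    and "(1 - u) * ((\<nu> + 1) * HS (\<nu>+1) (1/2) c u + 2 * u * HD (\<nu>+1) (1/2) c u) = (\<nu> + 1) * HS \<nu> (-1/2) c u" (is ?B)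
proof -
  define P where "P n = pochhammer (\<nu>+1) n * pochhammer (1/2) n / (pochhammer c n * fact n)" for n
  have nz: "c + of_nat n \<noteq> 0" for n using nonint_add_nat[OF c] by (simp add: c_def)
  have J: "hyp_coeff (\<nu>+1) (1/2) c n = P n" for n by (simp add: hyp_coeff_def P_def)
  have J': "hyp_coeff (1+\<nu>) (1/2) c n = P n" for n using J by (simp add: add.commute)
  have J1: "hyp_coeff (\<nu>+1) (1/2) c (Suc n) * ((c + of_nat n) * of_nat (Suc n)) = P n * ((\<nu> + 1 + of_nat n) * (1/2 + of_nat n))" for n
    using nz[of n] by (simp add: hyp_coeff_Suc J del: of_nat_Suc)
  \<comment> \<open>Both upper Pochhammer symbols lose their first factor, \<nu> and -1/2; what is
    left over is the numerator of \<open>P n\<close>.\<close>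
  have G1: "hyp_coeff \<nu> (-1/2) c (Suc n) * ((c + of_nat n) * of_nat (Suc n)) = - \<nu> / 2 * P n" for n
    using nz[of n] 
    by (simp add: hyp_coeff_def P_def pochhammer_rec[of \<nu>] pochhammer_rec[of "-(1/2)"] pochhammer_rec'[of c] fact_Suc del: of_nat_Suc)
  have nz': "(c + of_nat n) * of_nat (Suc n) \<noteq> 0" for n using nz[of n] by (simp del: of_nat_Suc)
  have "fps_of_poly [:\<nu>:] * hyp_fps \<nu> (-1/2) c + fps_of_poly [:0,2:] * fps_deriv (hyp_fps \<nu> (-1/2) c)
     = fps_of_poly [:\<nu>,-\<nu>:] * hyp_fps (\<nu>+1) (1/2) c" (is "?L = ?R")
  proof (rule fps_ext)
    fix n show "fps_nth ?L n = fps_nth ?R n"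
    proof (cases n)
      case 0 thus ?thesis by (simp add: fps_of_poly_pCons hyp_coeff_def algebra_simps)
    next
      case (Suc k)
      have "(\<nu> + 2 * of_nat (Suc k)) * hyp_coeff \<nu> (-1/2) c (Suc k)
          = \<nu> * (hyp_coeff (\<nu>+1) (1/2) c (Suc k) - P k)"
        using J1[of k] G1[of k] nz'[of k] unfolding c_def by simp algebra
      thus ?thesis using Suc by (simp add: fps_of_poly_pCons J J' algebra_simps)
    qed
  qed
  from hyp_first_order[OF u this] show ?A by (simp add: algebra_simps)
  have "fps_of_poly [:\<nu>+1,-(\<nu>+1):] * hyp_fps (\<nu>+1) (1/2) c + fps_of_poly [:0,2,-2:] * fps_deriv (hyp_fps (\<nu>+1) (1/2) c)
     = fps_of_poly [:\<nu>+1:] * hyp_fps \<nu> (-1/2) c" (is "?L = ?R")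
  proof (rule fps_ext)
    fix n show "fps_nth ?L n = fps_nth ?R n"
    proof (cases n)
      case 0 thus ?thesis by (simp add: fps_of_poly_pCons hyp_coeff_def algebra_simps)
    next
      case (Suc k)
      have "(\<nu> + 1 + 2 * of_nat (Suc k)) * hyp_coeff (\<nu>+1) (1/2) c (Suc k) - (\<nu>+1+2 * of_nat k) * P k
          = (\<nu>+1) * hyp_coeff \<nu> (-1/2) c (Suc k)"
        using J1[of k] G1[of k] nz'[of k] unfolding c_def by simp algebra
      thus ?thesis using Suc by (cases k) (simp_all add: fps_of_poly_pCons J J' algebra_simps)
    qed
  qed
  from hyp_first_order[OF u this] show ?B by simp algebra
qed

text \<open>The counterpart of \<open>hyp_u_system\<close> for the pair that appears after Pfaff's
  change of variable. The upper parameters are now fixed numbers.\<close>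

lemma hyp_tau_system:
  fixes \<nu> :: complex
  assumes c: "\<nu> + 3/2 \<notin> \<int>\<^sub>\<le>\<^sub>0" and x: "norm x < 1"
  defines "c \<equiv> \<nu> + 3/2"
  shows "(\<nu> + x) * HS (-1/2) (3/2) c x + 2 * x * (1 - x) * HD (-1/2) (3/2) c x = \<nu> * HS (1/2) (1/2) c x" (is ?A)
    and "(\<nu> + 1 - x) * HS (1/2) (1/2) c x + 2 * x * (1 - x) * HD (1/2) (1/2) c x = (\<nu> + 1) * HS (-1/2) (3/2) c x" (is ?B)
proof -
  define P where "P n = pochhammer (1/2) n * pochhammer (1/2) n / (pochhammer c n * fact n)" for n
  have nz: "c + of_nat n \<noteq> 0" for n using nonint_add_nat[OF c] by (simp add: c_def)
  \<comment> \<open>Parity keeps \<open>n - 1/2\<close> away from 0, so that \<open>G\<close>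
    determines the coefficient of the first series from \<open>P n\<close>.\<close>
  have nzh: "of_nat n - (1/2::complex) \<noteq> 0" for n
  proof
    assume "of_nat n - (1/2::complex) = 0"
    hence "of_nat (2 * n) = (of_nat 1 :: complex)" by (simp add: field_simps)
    hence "2 * n = 1" by (subst (asm) of_nat_eq_iff)
    thus False by presburger
  qed
  have J: "hyp_coeff (1/2) (1/2) c n = P n" for n by (simp add: hyp_coeff_def P_def)
  have h1: "pochhammer (-1/2) n * (of_nat n - 1/2) = - (1/2) * pochhammer (1/2 :: complex) n" for n
    using pochhammer_rec[of "-1/2::complex" n] pochhammer_rec'[of "-1/2::complex" n] by (simp add: algebra_simps)
  have h2: "pochhammer (3/2) n = 2 * (of_nat n + 1/2) * pochhammer (1/2 :: complex) n" for n
    using pochhammer_rec[of "1/2::complex" n] pochhammer_rec'[of "1/2::complex" n] by (simp add: algebra_simps)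
  have G: "hyp_coeff (-1/2) (3/2) c n * (of_nat n - 1/2) = - (of_nat n + 1/2) * P n" for n
  proof -
    have "hyp_coeff (-1/2) (3/2) c n * (of_nat n - 1/2) = (pochhammer (-1/2) n * (of_nat n - 1/2)) * pochhammer (3/2) n / (pochhammer c n * fact n)"
      by (simp add: hyp_coeff_def)
    also have "\<dots> = (- (1/2) * pochhammer (1/2) n) * (2 * (of_nat n + 1/2) * pochhammer (1/2) n) / (pochhammer c n * fact n)"
      by (simp only: h1 h2)
    also have "(- (1/2) * pochhammer (1/2) n) * (2 * (of_nat n + 1/2) * pochhammer (1/2) n) = - (of_nat n + 1/2) * (pochhammer (1/2) n * pochhammer (1/2) n :: complex)"
      by (simp add: algebra_simps)
    finally show ?thesis by (simp only: P_def times_divide_eq_right)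
  qed
  have P1: "P (Suc n) * ((c + of_nat n) * of_nat (Suc n)) = P n * ((1/2 + of_nat n) * (1/2 + of_nat n))" for n
    using nz[of n] unfolding J[symmetric] by (simp add: hyp_coeff_Suc del: of_nat_Suc)
  have nz': "(c + of_nat n) * of_nat (Suc n) \<noteq> 0" for n using nz[of n] by (simp del: of_nat_Suc)
  have "fps_of_poly [:\<nu>,1:] * hyp_fps (-1/2) (3/2) c + fps_of_poly [:0,2,-2:] * fps_deriv (hyp_fps (-1/2) (3/2) c)
     = fps_of_poly [:\<nu>:] * hyp_fps (1/2) (1/2) c" (is "?L = ?R")
  proof (rule fps_ext)
    fix n show "fps_nth ?L n = fps_nth ?R n"
    proof (cases n)
      case 0 thus ?thesis by (simp add: fps_of_poly_pCons hyp_coeff_def algebra_simps)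
    next
      case (Suc k)
      have "(\<nu> + 2 * of_nat (Suc k)) * hyp_coeff (-1/2) (3/2) c (Suc k) + (1 - 2 * of_nat k) * hyp_coeff (-1/2) (3/2) c k
          = \<nu> * P (Suc k)"
        using P1[of k] G[of k] G[of "Suc k"] nz'[of k] nzh[of k] nzh[of "Suc k"] unfolding c_def by simp algebra
      thus ?thesis using Suc by (cases k) (simp_all add: fps_of_poly_pCons J algebra_simps)
    qed
  qed
  from hyp_first_order[OF x this] show ?A by (simp add: algebra_simps)
  have "fps_of_poly [:\<nu>+1,-1:] * hyp_fps (1/2) (1/2) c + fps_of_poly [:0,2,-2:] * fps_deriv (hyp_fps (1/2) (1/2) c)
     = fps_of_poly [:\<nu>+1:] * hyp_fps (-1/2) (3/2) c" (is "?L = ?R")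
  proof (rule fps_ext)
    fix n show "fps_nth ?L n = fps_nth ?R n"
    proof (cases n)
      case 0 thus ?thesis by (simp add: fps_of_poly_pCons hyp_coeff_def algebra_simps)
    next
      case (Suc k)
      have "(\<nu> + 1 + 2 * of_nat (Suc k)) * P (Suc k) - (1 + 2 * of_nat k) * P k
          = (\<nu>+1) * hyp_coeff (-1/2) (3/2) c (Suc k)"
        using P1[of k] G[of "Suc k"] nz'[of k] nzh[of "Suc k"] unfolding c_def by simp algebra
      thus ?thesis using Suc by (cases k) (simp_all add: fps_of_poly_pCons J algebra_simps)
    qed
  qed
  from hyp_first_order[OF x this] show ?B by (simp add: algebra_simps)
qed

definition HDD :: "complex \<Rightarrow> complex \<Rightarrow> complex \<Rightarrow> complex \<Rightarrow> complex" where
  "HDD A B C = eval_fps (fps_deriv (fps_deriv (hyp_fps A B C)))"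

lemma hyp_deriv2_conv_radius: "fps_conv_radius (fps_deriv (fps_deriv (hyp_fps A B C))) \<ge> 1"
  using hyp_deriv_conv_radius fps_conv_radius_deriv by (rule order_trans)

lemma HD_deriv [derivative_intros]:
  assumes "(f has_field_derivative f') (at x)" "norm (f x) < 1"
  shows "((\<lambda>x. HD A B C (f x)) has_field_derivative HDD A B C (f x) * f') (at x)"
proof -
  have "(HD A B C has_field_derivative HDD A B C (f x)) (at (f x))"
    unfolding HD_def HDD_def
    by (rule has_field_derivative_eval_fps[THEN DERIV_cong])
       (use assms(2) HD_in in \<open>auto simp: eval_fps_deriv\<close>)
  from DERIV_chain2[OF this assms(1)] show ?thesis .
qed

lemma eval_fps_three_terms:
  assumes x: "norm (x::complex) < 1"
    and r: "fps_conv_radius F \<ge> 1" "fps_conv_radius G \<ge> 1" "fps_conv_radius H \<ge> 1"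
    and eq: "fps_of_poly p * F + fps_of_poly q * G + fps_of_poly s * H = 0"
  shows "poly p x * eval_fps F x + poly q x * eval_fps G x + poly s x * eval_fps H x = 0"
proof -
  have r2: "fps_conv_radius (fps_of_poly p * F + fps_of_poly q * G) \<ge> 1"
    using fps_conv_radius_add[of "fps_of_poly p * F" "fps_of_poly q * G"]
      eval_fps_poly_mult(2)[OF x r(1), of p] eval_fps_poly_mult(2)[OF x r(2), of q] by (meson min.boundedI order_trans)
  have "eval_fps (fps_of_poly p * F + fps_of_poly q * G + fps_of_poly s * H) x = 
        poly p x * eval_fps F x + poly q x * eval_fps G x + poly s x * eval_fps H x"
    using x r r2 eval_fps_poly_mult(2)[OF x r(3), of s]
    by (subst eval_fps_add) (auto intro: order_less_le_trans[of _ 1] simp: eval_fps_poly_add eval_fps_poly_mult)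
  thus ?thesis by (simp add: eq)
qed

text \<open>Used for the even and the odd solution around \<eta> = 1/2, in
  \<open>Ya_deriv\<close>.\<close>

lemma hypergeometric_ODE:
  assumes C: "C \<notin> \<int>\<^sub>\<le>\<^sub>0" and x: "norm x < 1"
  shows "x * (1 - x) * HDD A B C x + (C - (A + B + 1) * x) * HD A B C x = A * B * HS A B C x"
proof -
  let ?F = "hyp_fps A B C"
  have "fps_of_poly [:0,1,-1:] * fps_deriv (fps_deriv ?F) + fps_of_poly [:C,-(A+B+1):] * fps_deriv ?F
      + fps_of_poly [:-A*B:] * ?F = 0" (is "?L = 0")
  proof (rule fps_ext)
    fix n
    have nz: "(C + of_nat n) * of_nat (Suc n) \<noteq> 0" for n
      using nonint_add_nat[OF C, of n] by (simp del: of_nat_Suc)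
    have *: "hyp_coeff A B C (Suc n) * ((C + of_nat n) * of_nat (Suc n)) = hyp_coeff A B C n * ((A + of_nat n) * (B + of_nat n))" for n
      using nz[of n] by (simp add: hyp_coeff_Suc del: of_nat_Suc)
    show "fps_nth ?L n = fps_nth 0 n"
    proof (cases n)
      case 0 thus ?thesis using *[of 0] by (simp add: fps_of_poly_pCons algebra_simps)
    next
      case (Suc k)
      thus ?thesis using *[of "Suc k"] by (cases k) (simp_all add: fps_of_poly_pCons algebra_simps)
    qed
  qed
  from eval_fps_three_terms[OF x hyp_deriv2_conv_radius hyp_deriv_conv_radius hyp_conv_radius this]
  show ?thesis by (simp add: HS_def HD_def HDD_def algebra_simps)
qed

text \<open>The coefficients for \<open>c - 1\<close> and \<open>c + 1\<close> are rational
  multiples of those for \<open>c\<close> (facts \<open>m\<close> and \<open>p\<close>), so the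
  relation reduces to the recurrence \<open>s\<close>. At x = 1/2 it links lower parameters that
  differ by 2.\<close>

lemma hyp_contiguous:
  assumes c: "Im c \<noteq> 0" and x: "norm x < 1"
  shows "c * (c - 1) * (x - 1) * HS \<alpha> (1-\<alpha>) (c-1) x + c * (c - 1) * (1 - 2 * x) * HS \<alpha> (1-\<alpha>) c x
         + (c - \<alpha>) * (c - 1 + \<alpha>) * x * HS \<alpha> (1-\<alpha>) (c+1) x = 0"
proof -
  define P where "P = hyp_coeff \<alpha> (1-\<alpha>) c"
  have cn: "c + of_nat n \<noteq> 0" "c - 1 + of_nat n \<noteq> 0" "c + 1 + of_nat n \<noteq> 0" for n
    using nonint_add_nat[OF nonint_Im[of c], of n] nonint_add_nat[OF nonint_Im[of "c-1"], of n]
       nonint_add_nat[OF nonint_Im[of "c+1"], of n] c by simp_all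
  have c0: "c \<noteq> 0" "c - 1 \<noteq> 0" using c by auto
  have pn: "pochhammer c n \<noteq> 0" for n using nonint_pochhammer[OF nonint_Im[OF c]] .
  have m: "hyp_coeff \<alpha> (1-\<alpha>) (c-1) n * (c - 1) = P n * (c - 1 + of_nat n)" for n
  proof -
    have "pochhammer (c-1) n * (c - 1 + of_nat n) = (c - 1) * pochhammer c n"
      using pochhammer_rec[of "c-1" n] pochhammer_rec'[of "c-1" n] by (simp add: mult.commute)
    hence "pochhammer (c-1) n = (c - 1) * pochhammer c n / (c - 1 + of_nat n)"
      using cn[of n] by (simp add: field_simps)
    moreover have "pochhammer (c-1) n \<noteq> 0" using c by (intro nonint_pochhammer nonint_Im) simp
    ultimately show ?thesis using c0 pn[of n] cn[of n] by (simp add: hyp_coeff_def P_def divide_simps mult.commute)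
  qed
  have p: "hyp_coeff \<alpha> (1-\<alpha>) (c+1) n * (c + of_nat n) = P n * c" for n
  proof -
    have "c * pochhammer (c+1) n = (c + of_nat n) * pochhammer c n"
      using pochhammer_rec[of "c" n] pochhammer_rec'[of "c" n] by (simp add: mult.commute)
    hence "pochhammer (c+1) n = (c + of_nat n) * pochhammer c n / c"
      using c0 by (simp add: field_simps)
    moreover have "pochhammer (c+1) n \<noteq> 0" using c by (intro nonint_pochhammer nonint_Im) simp
    ultimately show ?thesis using c0 pn[of n] cn[of n] by (simp add: hyp_coeff_def P_def divide_simps mult.commute)
  qed
  have s: "P (Suc n) * ((c + of_nat n) * of_nat (Suc n)) = P n * ((\<alpha> + of_nat n) * (1 - \<alpha> + of_nat n))" for n
    using cn(1)[of n] unfolding P_def by (simp add: hyp_coeff_Suc del: of_nat_Suc)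
  have "fps_of_poly [:-c*(c-1),c*(c-1):] * hyp_fps \<alpha> (1-\<alpha>) (c-1) + fps_of_poly [:c*(c-1),-2*c*(c-1):] * hyp_fps \<alpha> (1-\<alpha>) c
      + fps_of_poly [:0,(c-\<alpha>)*(c-1+\<alpha>):] * hyp_fps \<alpha> (1-\<alpha>) (c+1) = 0" (is "?L = 0")
  proof (rule fps_ext)
    fix n
    show "fps_nth ?L n = fps_nth 0 n"
    proof (cases n)
      case 0 thus ?thesis by (simp add: fps_of_poly_pCons hyp_coeff_def algebra_simps)
    next
      case (Suc k)
      have "- c * (c-1) * hyp_coeff \<alpha> (1-\<alpha>) (c-1) (Suc k) + c * (c-1) * hyp_coeff \<alpha> (1-\<alpha>) (c-1) k
          + c * (c-1) * (P (Suc k) - 2 * P k) + (c-\<alpha>)*(c-1+\<alpha>) * hyp_coeff \<alpha> (1-\<alpha>) (c+1) k = 0"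
        using s[of k] m[of "Suc k"] m[of k] p[of k] cn(1)[of k] by simp algebra
      hence "- c * (c-1) * hyp_coeff \<alpha> (1-\<alpha>) (c-1) (Suc k) + c * (c-1) * hyp_coeff \<alpha> (1-\<alpha>) (c-1) k
          + c * (c-1) * (hyp_coeff \<alpha> (1-\<alpha>) c (Suc k) - 2 * hyp_coeff \<alpha> (1-\<alpha>) c k) + (c-\<alpha>)*(c-1+\<alpha>) * hyp_coeff \<alpha> (1-\<alpha>) (c+1) k = 0"
        by (simp only: P_def)
      thus ?thesis using Suc by (simp add: fps_of_poly_pCons) (simp add: algebra_simps)
    qed
  qed
  from eval_fps_three_terms[OF x hyp_conv_radius hyp_conv_radius hyp_conv_radius this]
  show ?thesis by (simp add: HS_def algebra_simps)
qed

section \<open>Large lower parameter, and the value at 1/2\<close>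

text \<open>Majorant of the series in \<open>HS_bound\<close>, with the factor 1/|c| taken out. Its
  value is 8.\<close>

definition hyp_bound :: real where
  "hyp_bound = (\<Sum>n. real ((n + 1) * (n + 2)) / 2 ^ (n + 1))"

lemma summable_hyp_bound: "summable (\<lambda>n. real ((n + 1) * (n + 2)) / 2 ^ (n + 1))"
proof (rule summable_ratio_test[of "3/4" 6])
  fix n :: nat assume "n \<ge> 6"
  hence "real (n + 2) * (real (n + 3) * 2) \<le> real (n + 2) * (real (n + 1) * 3)"
    by (intro mult_left_mono) auto
  hence "real ((n + 2) * (n + 3)) * 2 \<le> real ((n + 1) * (n + 2)) * 3"
    unfolding of_nat_mult by (simp only: mult_ac)
  hence "real ((n + 2) * (n + 3)) * 2 / (2 ^ (n + 1) * 4) \<le> real ((n + 1) * (n + 2)) * 3 / (2 ^ (n + 1) * 4)"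
    by (rule divide_right_mono) simp
  moreover have "norm (real ((Suc n + 1) * (Suc n + 2)) / 2 ^ (Suc n + 1)) = real ((n + 2) * (n + 3)) * 2 / (2 ^ (n + 1) * 4)"
    by (simp add: field_simps)
  moreover have "3/4 * norm (real ((n + 1) * (n + 2)) / 2 ^ (n + 1)) = real ((n + 1) * (n + 2)) * 3 / (2 ^ (n + 1) * 4)"
    by simp
  ultimately show "norm (real ((Suc n + 1) * (Suc n + 2)) / 2 ^ (Suc n + 1)) \<le> 3/4 * norm (real ((n + 1) * (n + 2)) / 2 ^ (n + 1))"
    by (simp only:)
qed simp

text \<open>The factor 1/|c| comes from the first quotient B/c alone. A later quotient (B+k)/(c+k)
  is at most (k+2)/k, because Re c \<ge> 0 gives |c+k| \<ge> k, and these bounds telescope to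
  (n+1)(n+2)/2. The quotients (A+k)/(k+1) are at most 1.\<close>

lemma HS_bound:
  assumes c: "Re c \<ge> 0" "c \<noteq> 0" and A: "norm A \<le> 1" and B: "norm B \<le> 2" and x: "norm x \<le> 1/2"
  shows "norm (HS A B c x - 1) \<le> hyp_bound / norm c"
proof -
  have a: "norm (pochhammer A n / fact n) \<le> 1" for n
  proof (induction n)
    case (Suc n)
    have "norm (A + of_nat n) \<le> real (Suc n)"
      using norm_triangle_ineq[of A "of_nat n"] A by simp
    hence "norm ((A + of_nat n) / of_nat (Suc n)) \<le> 1" by (simp add: norm_divide del: of_nat_Suc)
    moreover have "pochhammer A (Suc n) / fact (Suc n) = (pochhammer A n / fact n) * ((A + of_nat n) / of_nat (Suc n))"
      by (simp add: pochhammer_Suc field_simps)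
    ultimately show ?case using Suc mult_mono[OF Suc _ _ norm_ge_zero] by (metis mult_1 norm_ge_zero norm_mult zero_le_one)
  qed simp
  have cn: "norm (c + of_nat n) \<ge> real n" for n
    using complex_Re_le_cmod[of "c + of_nat n"] c by simp
  have b: "norm (pochhammer B (Suc n) / pochhammer c (Suc n)) \<le> real ((n+1)*(n+2)) / norm c" for n
  proof (induction n)
    case 0 thus ?case using B by (simp add: norm_divide divide_right_mono)
  next
    case (Suc n)
    have "norm (B + of_nat (Suc n)) \<le> real (n + 3)"
      using norm_triangle_ineq[of B "of_nat (Suc n)"] B by (simp del: of_nat_Suc)
    hence "norm ((B + of_nat (Suc n)) / (c + of_nat (Suc n))) \<le> real (n + 3) / real (Suc n)"
      unfolding norm_divide by (intro frac_le cn) auto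
    moreover have "pochhammer B (Suc (Suc n)) / pochhammer c (Suc (Suc n)) = 
       (pochhammer B (Suc n) / pochhammer c (Suc n)) * ((B + of_nat (Suc n)) / (c + of_nat (Suc n)))"
      by (simp add: pochhammer_Suc[of _ "Suc n"] del: of_nat_Suc)
    ultimately have "norm (pochhammer B (Suc (Suc n)) / pochhammer c (Suc (Suc n))) \<le> real ((n+1)*(n+2)) / norm c * (real (n + 3) / real (Suc n))"
      using Suc by (simp only: norm_mult) (intro mult_mono, auto)
    also have "\<dots> = real ((Suc n+1)*(Suc n+2)) / norm c" using c by (simp add: divide_simps) (simp add: algebra_simps)
    finally show ?case .
  qed
  have x1: "norm x < 1" using x by simp
  have s: "(\<lambda>n. hyp_coeff A B c (Suc n) * x ^ Suc n) sums (HS A B c x - 1)"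
    using HS_sums[OF x1, of A B c] by (subst sums_Suc_iff) (simp add: hyp_coeff_def)
  have le: "norm (hyp_coeff A B c (Suc n) * x ^ Suc n) \<le> real ((n + 1) * (n + 2)) / 2 ^ (n + 1) / norm c" for n
  proof -
    have "hyp_coeff A B c (Suc n) * x ^ Suc n = (pochhammer A (Suc n) / fact (Suc n)) * (pochhammer B (Suc n) / pochhammer c (Suc n)) * x ^ Suc n"
      by (simp add: hyp_coeff_def)
    also have "norm \<dots> \<le> 1 * (real ((n+1)*(n+2)) / norm c) * (1/2) ^ Suc n"
      unfolding norm_mult norm_power by (intro mult_mono a b power_mono x) auto
    finally show ?thesis by (simp add: power_divide mult.commute)
  qed
  have "norm (\<Sum>n. hyp_coeff A B c (Suc n) * x ^ Suc n) \<le> (\<Sum>n. real ((n + 1) * (n + 2)) / 2 ^ (n + 1) / norm c)"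
    by (rule norm_suminf_le[OF le summable_divide[OF summable_hyp_bound]])
  also have "\<dots> = hyp_bound / norm c"
    unfolding hyp_bound_def by (rule suminf_divide[OF summable_hyp_bound])
  finally show ?thesis using sums_unique[OF s] by simp
qed

text \<open>Bailey's summation theorem: at \<open>1/2\<close> the middle term of the contiguity relation drops out.\<close>
lemma HS_half:
  assumes c: "Im c \<noteq> 0" and A: "norm \<alpha> \<le> 1" and B: "norm (1 - \<alpha>) \<le> 2"
  shows "HS \<alpha> (1-\<alpha>) c (1/2) * rGamma (c/2) * rGamma (c/2 + 1/2) = rGamma (c/2 + (1-\<alpha>)/2) * rGamma (c/2 + \<alpha>/2)"
proof -
  define y where "y = c/2"
  define F where "F c = HS \<alpha> (1-\<alpha>) c (1/2)" for c
  have step: "F c * y' * (y' + 1/2) = (y' + (1-\<alpha>)/2) * (y' + \<alpha>/2) * F (c + 2)" if "Im c \<noteq> 0" "y' = c/2" for c y'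
  proof -
    have "(c+1) * c * F c = (c + 1 - \<alpha>) * (c + \<alpha>) * F (c + 2)"
      using hyp_contiguous[of "c+1" "1/2" \<alpha>] that by (simp add: F_def add_ac)
    moreover have c2: "c = 2 * y'" by (simp add: that(2))
    have "4 * (F c * y' * (y' + 1/2)) = (c+1) * c * F c"
      unfolding c2 by (simp add: algebra_simps)
    moreover have e: "y' + (1-\<alpha>)/2 = (c + 1 - \<alpha>) / 2" "y' + \<alpha>/2 = (c + \<alpha>) / 2"
      by (simp_all add: c2 field_simps)
    have "4 * ((y' + (1-\<alpha>)/2) * (y' + \<alpha>/2) * F (c + 2)) = (c + 1 - \<alpha>) * (c + \<alpha>) * F (c + 2)"
      unfolding e by simp
    ultimately have "4 * (F c * y' * (y' + 1/2)) = 4 * ((y' + (1-\<alpha>)/2) * (y' + \<alpha>/2) * F (c + 2))" by (simp only:)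
    thus ?thesis by (simp only: mult_cancel_left) simp
  qed
  have iter: "F c * (pochhammer y n * pochhammer (y+1/2) n) = pochhammer (y + (1-\<alpha>)/2) n * pochhammer (y + \<alpha>/2) n * F (c + 2 * of_nat n)" for n
  proof (induction n)
    case (Suc n)
    have "F c * (pochhammer y (Suc n) * pochhammer (y+1/2) (Suc n)) = F c * (pochhammer y n * pochhammer (y+1/2) n) * ((y + of_nat n) * (y + of_nat n + 1/2))"
      by (simp add: pochhammer_Suc)
    also have "\<dots> = pochhammer (y + (1-\<alpha>)/2) n * pochhammer (y + \<alpha>/2) n * (F (c + 2 * of_nat n) * (y + of_nat n) * (y + of_nat n + 1/2))"
      by (simp add: Suc)
    also have "F (c + 2 * of_nat n) * (y + of_nat n) * (y + of_nat n + 1/2) = (y + of_nat n + (1-\<alpha>)/2) * (y + of_nat n + \<alpha>/2) * F (c + 2 * of_nat n + 2)"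
      by (rule step) (use c in \<open>simp_all add: y_def\<close>)
    finally show ?case by (simp add: pochhammer_Suc mult_ac add_ac)
  qed (simp)
  \<comment> \<open>The index is \<open>Suc n\<close> because \<open>rGamma_series\<close> at n
    contains Pochhammer symbols of length \<open>Suc n\<close>. \<open>HS_bound\<close> applies as
    soon as the growing real part is nonnegative.\<close>
  have lim: "(\<lambda>n. F (c + 2 * of_nat (Suc n))) \<longlonglongrightarrow> 1"
  proof -
    have f: "filterlim (\<lambda>n. c + of_nat (2 * Suc n)) at_infinity sequentially"
      by (intro tendsto_add_filterlim_at_infinity[OF tendsto_const] filterlim_compose[OF tendsto_of_nat])
         (rule filterlim_subseq, simp add: strict_mono_Suc_iff)
    have "(\<lambda>n. norm (hyp_bound / (c + of_nat (2 * Suc n)))) \<longlonglongrightarrow> 0"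
      by (intro tendsto_norm_zero tendsto_divide_0[OF tendsto_const f])
    moreover have "eventually (\<lambda>n. norm (F (c + 2 * of_nat (Suc n)) - 1) \<le> norm (hyp_bound / (c + of_nat (2 * Suc n)))) sequentially"
    proof -
      obtain N where N: "real N \<ge> \<bar>Re c\<bar>" using real_arch_simple by blast
      show ?thesis unfolding eventually_sequentially
      proof (intro exI[of _ N] allI impI)
        fix n assume "n \<ge> N"
        have re: "Re (c + 2 * of_nat (Suc n)) \<ge> 0" using N \<open>n \<ge> N\<close> by simp
        have "norm (F (c + 2 * of_nat (Suc n)) - 1) \<le> hyp_bound / norm (c + 2 * of_nat (Suc n))"
          unfolding F_def by (rule HS_bound[OF re _ A B]) (use c in \<open>auto simp: complex_eq_iff\<close>)
        thus "norm (F (c + 2 * of_nat (Suc n)) - 1) \<le> norm (hyp_bound / (c + of_nat (2 * Suc n)))"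
          by (simp add: norm_divide) (smt (verit) divide_right_mono norm_ge_zero)
      qed
    qed
    ultimately have "(\<lambda>n. F (c + 2 * of_nat (Suc n)) - 1) \<longlonglongrightarrow> 0"
      by (rule Lim_null_comparison[rotated])
    thus ?thesis by (simp add: LIM_zero_iff)
  qed
  \<comment> \<open>Euler's limit for 1/Gamma. The factorials and exponentials agree on both sides
    since the two pairs of arguments have the same sum 2y + 1/2, so \<open>iter\<close> survives the
    normalization.\<close>
  have key: "F c * (rGamma_series y n * rGamma_series (y+1/2) n) = rGamma_series (y + (1-\<alpha>)/2) n * rGamma_series (y + \<alpha>/2) n * F (c + 2 * of_nat (Suc n))" for n
  proof -
    let ?E = "\<lambda>z. fact n * exp (z * of_real (ln (of_nat n))) :: complex"
    have E: "?E y * ?E (y+1/2) = ?E (y + (1-\<alpha>)/2) * ?E (y + \<alpha>/2)"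
    proof -
      have y: "y + (y+1/2) = (y + (1-\<alpha>)/2) + (y + \<alpha>/2)" by (simp add: diff_divide_distrib)
      have "?E u * ?E v = fact n * fact n * exp ((u + v) * of_real (ln (of_nat n)))" for u v
        by (simp add: exp_add distrib_right mult_ac)
      thus ?thesis by (simp only: y)
    qed
    have "F c * (rGamma_series y n * rGamma_series (y+1/2) n) = F c * (pochhammer y (Suc n) * pochhammer (y+1/2) (Suc n)) / (?E y * ?E (y+1/2))"
      by (simp add: rGamma_series_def)
    also have "\<dots> = pochhammer (y + (1-\<alpha>)/2) (Suc n) * pochhammer (y + \<alpha>/2) (Suc n) * F (c + 2 * of_nat (Suc n)) / (?E (y + (1-\<alpha>)/2) * ?E (y + \<alpha>/2))"
      unfolding iter E ..
    finally show ?thesis by (simp add: rGamma_series_def)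
  qed
  have "(\<lambda>n. F c * (rGamma_series y n * rGamma_series (y+1/2) n)) \<longlonglongrightarrow> F c * (rGamma y * rGamma (y+1/2))"
    by (intro tendsto_intros)
  moreover have "(\<lambda>n. F c * (rGamma_series y n * rGamma_series (y+1/2) n)) \<longlonglongrightarrow> rGamma (y + (1-\<alpha>)/2) * rGamma (y + \<alpha>/2) * 1"
    unfolding key by (intro tendsto_intros lim)
  ultimately have "F c * (rGamma y * rGamma (y+1/2)) = rGamma (y + (1-\<alpha>)/2) * rGamma (y + \<alpha>/2) * 1"
    by (rule LIMSEQ_unique)
  thus ?thesis by (simp add: F_def y_def mult.assoc)
qed

section \<open>The slit plane and the Koebe map\<close>

definition slit :: "complex set" where
  "slit = - (of_real ` {1..})"

lemma slit_iff: "t \<in> slit \<longleftrightarrow> 1 - t \<notin> \<real>\<^sub>\<le>\<^sub>0"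
proof -
  have "t \<in> of_real ` {1..} \<longleftrightarrow> 1 - t \<in> \<real>\<^sub>\<le>\<^sub>0"
    by (auto simp: complex_nonpos_Reals_iff image_iff complex_eq_iff intro: bexI[of _ "Re t"])
  thus ?thesis by (simp add: slit_def)
qed

lemma open_slit: "open slit"
proof -
  have "slit = (\<lambda>t. 1 - t) -` (- \<real>\<^sub>\<le>\<^sub>0)" by (auto simp: slit_iff)
  moreover have "open \<dots>" by (intro continuous_open_vimage continuous_intros open_Compl closed_nonpos_Reals_complex)
  ultimately show ?thesis by simp
qed

lemma slit_ball: "ball 0 1 \<subseteq> slit"
proof
  fix t :: complex assume "t \<in> ball 0 1"
  hence "Re (1 - t) > 0" using complex_Re_le_cmod[of t] by simp
  thus "t \<in> slit" by (auto simp: slit_iff complex_nonpos_Reals_iff)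
qed

definition sq :: "complex \<Rightarrow> complex" where "sq t = csqrt (1 - t)"

text \<open>Inverse of the map \<open>w -> 4w/(1+w)^2\<close> from the unit disc onto
  \<open>slit\<close>; see \<open>koebe_wk\<close>.\<close>

definition wk :: "complex \<Rightarrow> complex" where "wk t = (1 - sq t) / (1 + sq t)"

lemma Re_csqrt_pos: "z \<notin> \<real>\<^sub>\<le>\<^sub>0 \<Longrightarrow> Re (csqrt z) > 0"
proof -
  assume z: "z \<notin> \<real>\<^sub>\<le>\<^sub>0"
  have "Re (csqrt z) \<ge> 0" using csqrt_principal[of z] by auto
  moreover have "Re (csqrt z) \<noteq> 0"
  proof
    assume r: "Re (csqrt z) = 0"
    have "z = (csqrt z)\<^sup>2" by simp
    also have "\<dots> = - of_real ((Im (csqrt z))\<^sup>2)"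
      using r by (auto simp: complex_eq_iff power2_eq_square)
    finally have "z = of_real (- (Im (csqrt z))\<^sup>2)" by simp
    hence "z \<in> \<real>\<^sub>\<le>\<^sub>0" by (metis neg_le_0_iff_le nonpos_Reals_of_real_iff zero_le_power2)
    thus False using z by simp
  qed
  ultimately show ?thesis by simp
qed

lemma Re_sq: "t \<in> slit \<Longrightarrow> Re (sq t) > 0"
  unfolding slit_iff sq_def by (rule Re_csqrt_pos)

lemma sq_ne: "t \<in> slit \<Longrightarrow> sq t \<noteq> 0" "t \<in> slit \<Longrightarrow> 1 + sq t \<noteq> 0"
  using Re_sq[of t] by (auto simp: complex_eq_iff)

lemma sq_power2: "(sq t)\<^sup>2 = 1 - t" by (simp add: sq_def)

lemma cmod_cayley: "Re s > 0 \<Longrightarrow> norm ((1 - s) / (1 + s)) < 1"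
proof -
  assume s: "Re s > 0"
  have "(norm (1 - s))\<^sup>2 < (norm (1 + s))\<^sup>2"
    using s by (simp only: cmod_power2) (simp add: power2_eq_square algebra_simps)
  hence "norm (1 - s) < norm (1 + s)" by (rule power_less_imp_less_base) simp
  moreover from this have "1 + s \<noteq> 0" by auto
  ultimately show ?thesis by (simp add: norm_divide)
qed

lemma Re_cayley: "norm w < 1 \<Longrightarrow> Re ((1 - w) / (1 + w)) > 0"
proof -
  assume w: "norm w < 1"
  hence ne: "1 + w \<noteq> 0" by (metis add_eq_0_iff norm_minus_cancel norm_one order_less_irrefl)
  have "(Re w)\<^sup>2 + (Im w)\<^sup>2 < 1" using w by (simp add: cmod_def)
  hence "Re ((1 - w) * cnj (1 + w)) > 0" by (simp add: power2_eq_square algebra_simps)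
  moreover have "(1 - w) / (1 + w) = (1 - w) * cnj (1 + w) / of_real ((norm (1 + w))\<^sup>2)"
    using complex_div_cnj by blast
  ultimately show ?thesis using ne by (simp only: Re_divide_of_real) simp
qed

lemma norm_wk: "t \<in> slit \<Longrightarrow> norm (wk t) < 1"
  unfolding wk_def by (intro cmod_cayley Re_sq)

text \<open>On the disc (1-w)/(1+w) has positive real part, so it is the principal root of its
  square.\<close>

lemma koebe_sq: "norm w < 1 \<Longrightarrow> sq (4 * w / (1 + w)\<^sup>2) = (1 - w) / (1 + w)"
  and koebe_wk: "norm w < 1 \<Longrightarrow> wk (4 * w / (1 + w)\<^sup>2) = w"
proof -
  assume w: "norm w < 1"
  hence ne: "1 + w \<noteq> 0" by (metis add_eq_0_iff norm_minus_cancel norm_one order_less_irrefl)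
  have "1 - 4 * w / (1 + w)\<^sup>2 = ((1 - w) / (1 + w))\<^sup>2"
    using ne by (simp add: power_divide divide_simps) (simp add: power2_eq_square algebra_simps)
  hence "sq (4 * w / (1 + w)\<^sup>2) = csqrt (((1 - w) / (1 + w))\<^sup>2)" by (simp add: sq_def)
  also have "\<dots> = (1 - w) / (1 + w)"
    using Re_cayley[OF w] by (intro csqrt_square) auto
  finally show *: "sq (4 * w / (1 + w)\<^sup>2) = (1 - w) / (1 + w)" .
  have "1 - (1 - w) / (1 + w) = 2 * w / (1 + w)" "1 + (1 - w) / (1 + w) = 2 / (1 + w)"
    using ne by (simp_all add: field_simps)
  thus "wk (4 * w / (1 + w)\<^sup>2) = w" unfolding wk_def * using ne by simp
qed

text \<open>With w = \<open>wk t\<close> this is \<open>(1+w)^(2\<nu>)\<close>, since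
  \<open>1 + sq t = 2/(1+w)\<close>. On \<open>slit\<close> the argument of \<open>Ln\<close> stays
  in the right half-plane.\<close>

definition pk :: "complex \<Rightarrow> complex \<Rightarrow> complex" where
  "pk \<nu> t = exp (2 * \<nu> * Ln (2 / (1 + sq t)))"

lemma pk_plus1: "t \<in> slit \<Longrightarrow> pk (\<nu> + 1) t = pk \<nu> t * (2 / (1 + sq t))\<^sup>2"
proof -
  assume t: "t \<in> slit"
  have "pk (\<nu> + 1) t = pk \<nu> t * (exp (Ln (2 / (1 + sq t))))\<^sup>2"
    by (simp add: pk_def algebra_simps power2_eq_square flip: exp_add)
  thus ?thesis using sq_ne[OF t] by simp
qed

lemma sq_deriv: "t \<in> slit \<Longrightarrow> (sq has_field_derivative - 1 / (2 * sq t)) (at t)"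
  unfolding sq_def[abs_def] by (auto intro!: derivative_eq_intros simp: slit_iff)

lemma wk_deriv: "t \<in> slit \<Longrightarrow> (wk has_field_derivative 1 / (sq t * (1 + sq t)\<^sup>2)) (at t)"
  unfolding wk_def[abs_def]
  apply (rule derivative_eq_intros sq_deriv refl | assumption)+
  using sq_ne[of t] by (auto simp: divide_simps power2_eq_square) 

lemma pk_deriv: "t \<in> slit \<Longrightarrow> (pk \<nu> has_field_derivative pk \<nu> t * (\<nu> / (sq t * (1 + sq t)))) (at t)"
proof -
  assume t: "t \<in> slit"
  have r: "Re (2 / (1 + sq t)) > 0"
  proof -
    have "2 / (1 + sq t) = 2 * cnj (1 + sq t) / of_real ((norm (1 + sq t))\<^sup>2)"
      using complex_div_cnj by blast
    thus ?thesis using Re_sq[OF t] sq_ne[OF t] by (simp only: Re_divide_of_real) simp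
  qed
  hence n: "2 / (1 + sq t) \<notin> \<real>\<^sub>\<le>\<^sub>0" by (auto simp: complex_nonpos_Reals_iff)
  have "((\<lambda>t. exp (2 * \<nu> * Ln (2 / (1 + sq t)))) has_field_derivative pk \<nu> t * (\<nu> / (sq t * (1 + sq t)))) (at t)"
    apply (rule derivative_eq_intros sq_deriv refl t n sq_ne(2)[OF t])+
    using sq_ne[OF t] by (simp add: pk_def divide_simps)
  thus ?thesis unfolding pk_def .
qed

section \<open>The quadratic transformation and Pfaff's transformation\<close>

text \<open>For \<open>G = Gs \<nu>\<close> this is the right-hand side of Gauss' quadratic
  transformation \<open>2F1(\<nu>,\<nu>+1;2\<nu>+2;4w/(1+w)^2) = (1+w)^(2\<nu>)
  2F1(\<nu>,-1/2;\<nu>+3/2;w^2)\<close>. With G arbitrary, the Pfaff form can be inserted as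
  well.\<close>

definition Kf :: "complex \<Rightarrow> (complex \<Rightarrow> complex) \<Rightarrow> complex \<Rightarrow> complex" where
  "Kf \<nu> G t = pk \<nu> t * G ((wk t)\<^sup>2)"

text \<open>The system of the even functions of \<open>w\<close>, i.e. of \<open>2F1(\<nu>,-1/2;\<nu>+3/2;u)\<close> and \<open>2F1(\<nu>+1,1/2;\<nu>+3/2;u)\<close>.\<close>
definition even_system :: "complex \<Rightarrow> (complex \<Rightarrow> complex) \<Rightarrow> (complex \<Rightarrow> complex) \<Rightarrow> complex set \<Rightarrow> bool" where
  "even_system \<nu> G J U \<longleftrightarrow> open U \<and> G holomorphic_on U \<and> J holomorphic_on U \<and>
     (\<forall>u\<in>U. \<nu> * G u + 2 * u * deriv G u = \<nu> * (1 - u) * J u \<and>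
           (1 - u) * ((\<nu> + 1) * J u + 2 * u * deriv J u) = (\<nu> + 1) * G u)"

lemma Kf_deriv:
  assumes "open U" "G holomorphic_on U" "t \<in> slit" "(wk t)\<^sup>2 \<in> U"
  shows "(Kf \<nu> G has_field_derivative (pk \<nu> t / (sq t * (1 + sq t)) * (\<nu> * G ((wk t)\<^sup>2) + 2 * wk t / (1 + sq t) * deriv G ((wk t)\<^sup>2)))) (at t)"
proof -
  have G: "(G has_field_derivative deriv G ((wk t)\<^sup>2)) (at ((wk t)\<^sup>2))"
    using assms holomorphic_derivI by blast
  have w: "((\<lambda>t. (wk t)\<^sup>2) has_field_derivative 2 * wk t * (1 / (sq t * (1 + sq t)\<^sup>2))) (at t)"
    by (rule derivative_eq_intros wk_deriv assms(3) refl)+ simp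
  show ?thesis unfolding Kf_def[abs_def]
    apply (rule DERIV_mult'[OF pk_deriv[OF assms(3)] DERIV_chain2[OF G w], THEN DERIV_cong])
    using sq_ne[OF assms(3)] by (simp add: divide_simps power2_eq_square) (simp add: algebra_simps)?
qed

text \<open>In s = \<open>sq t\<close> everything is rational: t = 1 - s^2, (1-u)(1+s)^2 = 4s, and
  the two values of \<open>pk\<close> differ by the factor 4/(1+s)^2. The resulting system in t is
  free of the root; it yields the power series at 0 as well as the derivatives in \<eta>.\<close>

lemma Kf_system:
  assumes S: "even_system \<nu> G J U" and t: "t \<in> slit" and U: "(wk t)\<^sup>2 \<in> U"
  shows "t * deriv (Kf \<nu> G) t = \<nu> * (Kf (\<nu> + 1) J t - Kf \<nu> G t)"
    and "(1 - t) * (t * deriv (Kf (\<nu> + 1) J) t + (\<nu> + 1) * Kf (\<nu> + 1) J t) = (\<nu> + 1) * Kf \<nu> G t"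
proof -
  define s where "s = sq t"
  define u where "u = (wk t)\<^sup>2"
  define m where "m = pk \<nu> t"
  have ne: "s \<noteq> 0" "1 + s \<noteq> 0" using sq_ne[OF t] by (auto simp: s_def)
  have ts: "t = 1 - s\<^sup>2" by (simp add: s_def sq_power2)
  have w: "wk t * (1 + s) = 1 - s" using ne by (simp add: wk_def s_def)
  have I: "\<nu> * G u + 2 * u * deriv G u = \<nu> * (1 - u) * J u"
    and II: "(1 - u) * ((\<nu> + 1) * J u + 2 * u * deriv J u) = (\<nu> + 1) * G u"
    using S U by (auto simp: even_system_def u_def)
  have u1: "(1 - u) * (1 + s)\<^sup>2 = 4 * s"
  proof -
    have "u * (1 + s)\<^sup>2 = (1 - s)\<^sup>2" unfolding u_def w[symmetric] by (simp add: power_mult_distrib)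
    thus ?thesis by (simp add: power2_eq_square algebra_simps)
  qed
  have dG: "deriv (Kf \<nu> G) t = m / (s * (1 + s)) * (\<nu> * G u + 2 * wk t / (1 + s) * deriv G u)"
    using Kf_deriv[OF _ _ t U, of G \<nu>] S by (auto simp: even_system_def u_def s_def m_def intro: DERIV_imp_deriv)
  have dJ: "deriv (Kf (\<nu>+1) J) t = pk (\<nu>+1) t / (s * (1 + s)) * ((\<nu>+1) * J u + 2 * wk t / (1 + s) * deriv J u)"
    using Kf_deriv[OF _ _ t U, of J "\<nu>+1"] S by (auto simp: even_system_def u_def s_def intro: DERIV_imp_deriv)
  have tt: "t / (s * (1 + s)) = (1 - s) / s"
    using ne unfolding ts by (simp add: divide_simps power2_eq_square) (simp add: algebra_simps)
  have ww: "(1 - s) * (2 * wk t / (1 + s)) = 2 * u"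
    using w ne unfolding u_def by (simp add: divide_simps power2_eq_square)
  have tG: "t * deriv (Kf \<nu> G) t * s = m * ((1 - s) * \<nu> * G u + 2 * u * deriv G u)"
  proof -
    have "t * deriv (Kf \<nu> G) t * s = t / (s * (1 + s)) * s * m * (\<nu> * G u + 2 * wk t / (1 + s) * deriv G u)"
      unfolding dG by simp
    also have "\<dots> = m * ((1 - s) * \<nu> * G u + (1 - s) * (2 * wk t / (1 + s)) * deriv G u)"
    proof -
      have "(1 - s) / s * s = 1 - s" using ne by simp
      thus ?thesis unfolding tt by (simp only: distrib_left mult_ac)
    qed
    finally show ?thesis unfolding ww .
  qed
  have tJ: "t * deriv (Kf (\<nu>+1) J) t * s = pk (\<nu>+1) t * ((1 - s) * (\<nu>+1) * J u + 2 * u * deriv J u)"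
  proof -
    have "t * deriv (Kf (\<nu>+1) J) t * s = t / (s * (1 + s)) * s * pk (\<nu>+1) t * ((\<nu>+1) * J u + 2 * wk t / (1 + s) * deriv J u)"
      unfolding dJ by simp
    also have "\<dots> = pk (\<nu>+1) t * ((1 - s) * (\<nu>+1) * J u + (1 - s) * (2 * wk t / (1 + s)) * deriv J u)"
    proof -
      have "(1 - s) / s * s = 1 - s" using ne by simp
      thus ?thesis unfolding tt by (simp only: distrib_left mult_ac)
    qed
    finally show ?thesis unfolding ww .
  qed
  have p1: "pk (\<nu>+1) t * (1 + s)\<^sup>2 = 4 * m"
    using pk_plus1[OF t, of \<nu>] ne by (simp add: s_def m_def power_divide)
  have K: "Kf \<nu> G t = m * G u" "Kf (\<nu>+1) J t = pk (\<nu>+1) t * J u"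
    by (simp_all add: Kf_def m_def u_def)
  have p2: "m * (1 - u) = pk (\<nu>+1) t * s"
  proof -
    have "4 * (m * (1 - u)) = 4 * (pk (\<nu>+1) t * s)" using p1 u1 by algebra
    thus ?thesis by simp
  qed
  have "t * deriv (Kf \<nu> G) t * s = \<nu> * (Kf (\<nu> + 1) J t - Kf \<nu> G t) * s"
    unfolding tG K using I p2 by algebra
  thus "t * deriv (Kf \<nu> G) t = \<nu> * (Kf (\<nu> + 1) J t - Kf \<nu> G t)" using ne by simp
  have "(1 - t) * (t * deriv (Kf (\<nu> + 1) J) t + (\<nu> + 1) * Kf (\<nu> + 1) J t)
      = s * (t * deriv (Kf (\<nu>+1) J) t * s + s * (\<nu>+1) * Kf (\<nu>+1) J t)"
    by (simp add: ts power2_eq_square algebra_simps)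
  also have "\<dots> = (pk (\<nu>+1) t * s) * ((\<nu>+1) * J u + 2 * u * deriv J u)"
    unfolding tJ K by (simp add: algebra_simps)
  also have "\<dots> = (\<nu> + 1) * Kf \<nu> G t"
    unfolding p2[symmetric] K using II by algebra
  finally show "(1 - t) * (t * deriv (Kf (\<nu> + 1) J) t + (\<nu> + 1) * Kf (\<nu> + 1) J t) = (\<nu> + 1) * Kf \<nu> G t" .
qed

lemma Kf_holomorphic:
  assumes "open U" "G holomorphic_on U" "\<And>t. t \<in> S \<Longrightarrow> t \<in> slit" "\<And>t. t \<in> S \<Longrightarrow> (wk t)\<^sup>2 \<in> U" "open S"
  shows "Kf \<nu> G holomorphic_on S"
  using Kf_deriv[OF assms(1,2)] assms(3-5) holomorphic_on_open by blast

lemma fps_eq_of_eventually: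
  fixes F H :: "complex fps"
  assumes "f has_fps_expansion F" "g has_fps_expansion H" "eventually (\<lambda>x. f x = g x) (nhds 0)"
  shows "F = H"
proof (rule fps_expansion_unique_complex)
  show "g has_fps_expansion H" by fact
  show "g has_fps_expansion F" using assms(1) has_fps_expansion_cong[OF assms(3) refl[of F]] by simp
qed

text \<open>Eliminating the coefficients of L from the two relations leaves the two-term recurrence
  of 2F1(\<nu>,\<nu>+1;2\<nu>+2), so the system together with K(0) = 1 determines the expansion of
  K.\<close>

lemma system_fps_unique:
  assumes "open S" "0 \<in> S" and K: "K holomorphic_on S" and L: "L holomorphic_on S"
    and I: "\<And>t. t \<in> S \<Longrightarrow> t * deriv K t = \<nu> * (L t - K t)"
    and II: "\<And>t. t \<in> S \<Longrightarrow> (1 - t) * (t * deriv L t + (\<nu> + 1) * L t) = (\<nu> + 1) * K t"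
    and K0: "K 0 = 1" and c: "2 * \<nu> + 2 \<notin> \<int>\<^sub>\<le>\<^sub>0"
  shows "K has_fps_expansion hyp_fps \<nu> (\<nu> + 1) (2 * \<nu> + 2)"
proof -
  define F where "F = fps_expansion K 0"
  define H where "H = fps_expansion L 0"
  have F: "K has_fps_expansion F" and H: "L has_fps_expansion H"
    unfolding F_def H_def using assms by (auto intro!: analytic_at_imp_has_fps_expansion_0 simp: analytic_at)
  have ev: "eventually (\<lambda>t. t \<in> S) (nhds 0)" using assms(1,2) by (rule eventually_nhds_in_open)
  have "(\<lambda>t. t * deriv K t) has_fps_expansion (fps_X * fps_deriv F)"
    by (intro fps_expansion_intros F)
  moreover have "(\<lambda>t. \<nu> * (L t - K t)) has_fps_expansion (fps_const \<nu> * (H - F))"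
    by (intro fps_expansion_intros F H)
  moreover have "eventually (\<lambda>t. t * deriv K t = \<nu> * (L t - K t)) (nhds 0)"
    using ev by eventually_elim (rule I)
  ultimately have e1: "fps_X * fps_deriv F = fps_const \<nu> * (H - F)"
    by (rule fps_eq_of_eventually)
  have "(\<lambda>t. (1 - t) * (t * deriv L t + (\<nu> + 1) * L t)) has_fps_expansion ((1 - fps_X) * (fps_X * fps_deriv H + fps_const (\<nu> + 1) * H))"
    by (intro fps_expansion_intros H)
  moreover have "(\<lambda>t. (\<nu> + 1) * K t) has_fps_expansion (fps_const (\<nu> + 1) * F)"
    by (intro fps_expansion_intros F)
  moreover have "eventually (\<lambda>t. (1 - t) * (t * deriv L t + (\<nu> + 1) * L t) = (\<nu> + 1) * K t) (nhds 0)"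
    using ev by eventually_elim (rule II)
  ultimately have e2: "(1 - fps_X) * (fps_X * fps_deriv H + fps_const (\<nu> + 1) * H) = fps_const (\<nu> + 1) * F"
    by (rule fps_eq_of_eventually)
  have c1: "of_nat n * fps_nth F n = \<nu> * (fps_nth H n - fps_nth F n)" for n
    using arg_cong[OF e1, of "\<lambda>f. fps_nth f n"] by (cases n) (simp_all add: algebra_simps)
  have c2: "(of_nat (Suc n) + \<nu> + 1) * fps_nth H (Suc n) - (of_nat n + \<nu> + 1) * fps_nth H n = (\<nu> + 1) * fps_nth F (Suc n)" for n
    using arg_cong[OF e2, of "\<lambda>f. fps_nth f (Suc n)"] by (cases n) (simp_all add: algebra_simps)
  have rec: "fps_nth F (Suc n) * ((2 * \<nu> + 2 + of_nat n) * of_nat (Suc n)) = fps_nth F n * ((\<nu> + of_nat n) * (\<nu> + 1 + of_nat n))" for n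
    using c1[of n] c1[of "Suc n"] c2[of n] by simp algebra
  have F0: "fps_nth F 0 = 1"
    using has_fps_expansion_imp_0_eq_fps_nth_0[OF F] K0 by simp
  have "fps_nth F n = hyp_coeff \<nu> (\<nu>+1) (2*\<nu>+2) n" for n
  proof (induction n)
    case 0 thus ?case by (simp add: F0 hyp_coeff_def)
  next
    case (Suc n)
    have "(2 * \<nu> + 2 + of_nat n) * of_nat (Suc n) \<noteq> 0" using nonint_add_nat[OF c, of n] by (simp del: of_nat_Suc)
    thus ?case using rec[of n] Suc unfolding hyp_coeff_Suc by (simp add: field_simps del: of_nat_Suc)
  qed
  hence "F = hyp_fps \<nu> (\<nu> + 1) (2 * \<nu> + 2)" by (simp add: fps_eq_iff)
  thus ?thesis using F by simp
qed

text \<open>By the identity theorem the choice made in \<open>acont\<close> has no influence on D: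
  exhibiting one continuation is enough.\<close>

lemma acont_eq:
  assumes D: "open D" "connected D" and U: "open U" "U \<noteq> {}" "U \<subseteq> D"
    and F: "F holomorphic_on D" "\<And>x. x \<in> U \<Longrightarrow> F x = f x" and x: "x \<in> D"
  shows "acont D U f x = F x"
proof -
  let ?P = "\<lambda>F. F holomorphic_on D \<and> (\<forall>x\<in>U. F x = f x)"
  have "?P (acont D U f)" unfolding acont_def by (rule someI[of ?P F]) (use F in auto)
  thus ?thesis
    using analytic_continuation_open[OF U(1) D(1) U(2) D(2) U(3), of "acont D U f" F] F x by simp
qed

lemma connected_slit: "connected slit"
proof (rule starlike_imp_connected)
  show "starlike slit" unfolding starlike_def
  proof (intro bexI[of _ 0] ballI subsetI)
    fix t y assume t: "t \<in> slit" and "y \<in> closed_segment 0 t"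
    then obtain r where r: "0 \<le> r" "r \<le> 1" "y = of_real r * t" by (auto simp: in_segment scaleR_conv_of_real)
    show "y \<in> slit"
    proof (rule ccontr)
      assume "y \<notin> slit"
      then obtain q where q: "q \<ge> 1" "of_real r * t = of_real q" using r by (auto simp: slit_def)
      hence "r \<noteq> 0" by auto
      hence "t = of_real (q / r)" using q by (simp add: field_simps)
      moreover have "q / r \<ge> 1" using q r \<open>r \<noteq> 0\<close> by (simp add: field_simps)
      ultimately show False using t unfolding slit_def by (metis ComplD atLeast_iff imageI)
    qed
  qed (auto simp: slit_def)
qed

definition Gs :: "complex \<Rightarrow> complex \<Rightarrow> complex" where "Gs \<nu> = HS \<nu> (-1/2) (\<nu> + 3/2)"
definition Js :: "complex \<Rightarrow> complex \<Rightarrow> complex" where "Js \<nu> = HS (\<nu> + 1) (1/2) (\<nu> + 3/2)"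
text \<open>\<open>Gh\<close> and \<open>Jh\<close> are the Pfaff partners of \<open>Gs\<close> and
  \<open>Js\<close>. Only their lower parameter contains \<nu>, so \<open>HS_bound\<close> drives
  them to 1 as |Im \<nu>| grows while Re \<nu> \<ge> -3/2.\<close>

definition Gh :: "complex \<Rightarrow> complex \<Rightarrow> complex" where "Gh \<nu> = HS (-1/2) (3/2) (\<nu> + 3/2)"
definition Jh :: "complex \<Rightarrow> complex \<Rightarrow> complex" where "Jh \<nu> = HS (1/2) (1/2) (\<nu> + 3/2)"

lemma HS_deriv_eq: "norm x < 1 \<Longrightarrow> deriv (HS A B C) x = HD A B C x"
  using HS_deriv[OF DERIV_ident, of x A B C] by (auto intro: DERIV_imp_deriv)

lemma even_system_series:
  assumes "\<nu> + 3/2 \<notin> \<int>\<^sub>\<le>\<^sub>0"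
  shows "even_system \<nu> (Gs \<nu>) (Js \<nu>) (ball 0 1)"
  unfolding even_system_def Gs_def Js_def
  using hyp_u_system[OF assms] by (auto simp: HS_hol HS_deriv_eq)

text \<open>Exactly the half-plane where |u/(u-1)| < 1. It contains u = -1, the point that belongs
  to \<eta> = 1/2.\<close>

definition pfaff_dom :: "complex set" where "pfaff_dom = {u. Re u < 1/2}"

lemma open_pfaff_dom: "open pfaff_dom" and convex_pfaff_dom: "convex pfaff_dom"
  unfolding pfaff_dom_def by (rule open_halfspace_Re_lt convex_halfspace_Re_lt)+

lemma norm_pfaff: "u \<in> pfaff_dom \<Longrightarrow> norm (u / (u - 1)) < 1"
proof -
  assume u: "u \<in> pfaff_dom"
  have "(norm u)\<^sup>2 < (norm (u - 1))\<^sup>2"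
    using u by (simp only: cmod_power2) (simp add: pfaff_dom_def power2_eq_square algebra_simps)
  hence "norm u < norm (u - 1)" by (rule power_less_imp_less_base) simp
  moreover from this have "u - 1 \<noteq> 0" by auto
  ultimately show ?thesis by (simp add: norm_divide)
qed

lemma pfaff_dom_nonpos: "u \<in> pfaff_dom \<Longrightarrow> 1 - u \<notin> \<real>\<^sub>\<le>\<^sub>0" "u \<in> pfaff_dom \<Longrightarrow> u \<noteq> 1"
  by (auto simp: pfaff_dom_def complex_nonpos_Reals_iff)

text \<open>With x = u/(u-1) and 1 - x = 1/(1-u), the chain rule turns \<open>hyp_tau_system\<close>
  into the system of the untransformed pair. Pfaff's transformation then follows by uniqueness, in
  \<open>Gs_pfaff\<close>.\<close>

lemma even_system_pfaff:
  assumes c: "\<nu> + 3/2 \<notin> \<int>\<^sub>\<le>\<^sub>0"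
  shows "even_system \<nu> (\<lambda>u. csqrt (1 - u) * Gh \<nu> (u / (u - 1))) (\<lambda>u. Jh \<nu> (u / (u - 1)) / csqrt (1 - u)) pfaff_dom"
    (is "even_system \<nu> ?G ?J _")
proof -
  define c where "c = \<nu> + 3/2"
  have op: "open pfaff_dom" by (rule open_pfaff_dom)
  have dG: "(?G has_field_derivative - Gh \<nu> (u/(u-1)) / (2 * csqrt (1 - u)) - csqrt (1 - u) * HD (-1/2) (3/2) c (u/(u-1)) / (u-1)\<^sup>2) (at u)"
    and dJ: "(?J has_field_derivative Jh \<nu> (u/(u-1)) / (2 * csqrt (1 - u) * (1 - u)) - HD (1/2) (1/2) c (u/(u-1)) / ((u-1)\<^sup>2 * csqrt (1 - u))) (at u)"
    if u: "u \<in> pfaff_dom" for u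
  proof -
    note n = pfaff_dom_nonpos[OF u]
    have d: "((\<lambda>u. u / (u - 1)) has_field_derivative - 1 / (u - 1)\<^sup>2) (at u)"
      using n by (auto intro!: derivative_eq_intros simp: field_simps power2_eq_square)
    have q: "((\<lambda>u. csqrt (1 - u)) has_field_derivative - 1 / (2 * csqrt (1 - u))) (at u)"
      using n by (auto intro!: derivative_eq_intros)
    have q0: "csqrt (1 - u) \<noteq> 0" using n by simp
    have q2: "1 - u = csqrt (1 - u) * csqrt (1 - u)" by (metis power2_csqrt power2_eq_square)
    show "(?G has_field_derivative - Gh \<nu> (u/(u-1)) / (2 * csqrt (1 - u)) - csqrt (1 - u) * HD (-1/2) (3/2) c (u/(u-1)) / (u-1)\<^sup>2) (at u)"
      unfolding Gh_def c_def
      by (rule DERIV_mult'[OF q HS_deriv[OF d norm_pfaff[OF u]], THEN DERIV_cong]) simp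
    have "Jh \<nu> (u/(u-1)) / (2 * csqrt (1 - u) * (1 - u)) - HD (1/2) (1/2) c (u/(u-1)) / ((u-1)\<^sup>2 * csqrt (1 - u)) =
      (HD (1/2) (1/2) c (u/(u-1)) * (- 1 / (u - 1)\<^sup>2) * csqrt (1 - u) - Jh \<nu> (u/(u-1)) * (- 1 / (2 * csqrt (1 - u)))) / (csqrt (1 - u) * csqrt (1 - u))"
      unfolding q2[symmetric] using q0 n by (simp add: divide_simps q2[symmetric]) (simp add: algebra_simps q2[symmetric])
    thus "(?J has_field_derivative Jh \<nu> (u/(u-1)) / (2 * csqrt (1 - u) * (1 - u)) - HD (1/2) (1/2) c (u/(u-1)) / ((u-1)\<^sup>2 * csqrt (1 - u))) (at u)"
      using DERIV_divide[OF HS_deriv[OF d norm_pfaff[OF u], of "1/2" "1/2" c] q q0]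
      by (simp only: Jh_def c_def)
  qed
  have "\<nu> * ?G u + 2 * u * deriv ?G u = \<nu> * (1 - u) * ?J u \<and>
           (1 - u) * ((\<nu> + 1) * ?J u + 2 * u * deriv ?J u) = (\<nu> + 1) * ?G u" if u: "u \<in> pfaff_dom" for u
  proof -
    note n = pfaff_dom_nonpos[OF u]
    define q where "q = csqrt (1 - u)"
    define x where "x = u / (u - 1)"
    define m where "m = 1 / (1 - u)"
    have q2: "q * q = 1 - u" unfolding q_def by (metis power2_csqrt power2_eq_square)
    have q0: "q \<noteq> 0" unfolding q_def using n by simp
    have m0: "m * (1 - u) = 1" using n by (simp add: m_def)
    have x: "x = - u * m" using n by (simp add: x_def m_def field_simps)
    have x1: "1 - x = m" using n by (simp add: x_def m_def field_simps)
    have mm: "1 / (u - 1)\<^sup>2 = m * m" using n by (simp add: m_def power2_eq_square field_simps)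
    have "q * (q * m) = 1" using q2 m0 by algebra
    hence iq: "1 / q = q * m" using q0 by (simp add: field_simps)
    note T = hyp_tau_system[OF c norm_pfaff[OF u], folded x_def c_def]
    let ?H = "HD (-1/2) (3/2) c x" and ?I = "HD (1/2) (1/2) c x"
    have T1: "(\<nu> + x) * Gh \<nu> x + 2 * x * m * ?H = \<nu> * Jh \<nu> x"
      and T2: "(\<nu> + 1 - x) * Jh \<nu> x + 2 * x * m * ?I = (\<nu> + 1) * Gh \<nu> x"
      using T unfolding x1 Gh_def Jh_def c_def by simp_all
    have "deriv ?G u = - Gh \<nu> x / (2 * q) - q * ?H / (u-1)\<^sup>2"
      using DERIV_imp_deriv[OF dG[OF u]] by (simp add: q_def x_def)
    also have "\<dots> = - Gh \<nu> x * (1 / q) / 2 - q * ?H * (1 / (u-1)\<^sup>2)" by simp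
    finally have dGu: "deriv ?G u = - Gh \<nu> x * q * m / 2 - q * ?H * m * m" unfolding mm iq by simp
    have "deriv ?J u = Jh \<nu> x / (2 * q * (1 - u)) - ?I / ((u-1)\<^sup>2 * q)"
      using DERIV_imp_deriv[OF dJ[OF u]] by (simp add: q_def x_def)
    also have "\<dots> = Jh \<nu> x * (1 / q) * m / 2 - ?I * (1 / (u-1)\<^sup>2) * (1 / q)" by (simp add: m_def)
    finally have dJu: "deriv ?J u = Jh \<nu> x * q * m * m / 2 - ?I * m * m * q * m" unfolding mm iq by simp
    have G: "?G u = q * Gh \<nu> x" by (simp add: q_def x_def)
    have "?J u = Jh \<nu> x * (1 / q)" by (simp add: q_def x_def)
    hence J: "?J u = Jh \<nu> x * q * m" unfolding iq by simp
    have "2 * u * deriv ?G u = q * (- u * m * Gh \<nu> x - 2 * u * m * m * ?H)" unfolding dGu by (simp add: algebra_simps)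
    also have "\<dots> = q * (x * Gh \<nu> x + 2 * x * m * ?H)" unfolding x by (simp add: algebra_simps)
    also have "\<dots> = q * (\<nu> * Jh \<nu> x - \<nu> * Gh \<nu> x)" using T1 by algebra
    finally have e1: "2 * u * deriv ?G u = q * (\<nu> * Jh \<nu> x - \<nu> * Gh \<nu> x)" .
    have "2 * u * deriv ?J u = q * m * (u * m * Jh \<nu> x - 2 * u * m * m * ?I)" unfolding dJu by (simp add: algebra_simps)
    also have "\<dots> = q * m * (- x * Jh \<nu> x + 2 * x * m * ?I)" unfolding x by (simp add: algebra_simps)
    also have "\<dots> = q * m * ((\<nu> + 1) * Gh \<nu> x - (\<nu> + 1) * Jh \<nu> x)" using T2 by algebra
    finally have e2: "2 * u * deriv ?J u = q * m * ((\<nu> + 1) * Gh \<nu> x - (\<nu> + 1) * Jh \<nu> x)" .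
    show ?thesis unfolding e1 e2 G J using m0 by algebra
  qed
  moreover have "?G holomorphic_on pfaff_dom" "?J holomorphic_on pfaff_dom"
    using dG dJ op holomorphic_on_open by blast+
  ultimately show ?thesis unfolding even_system_def using op by blast
qed

text \<open>The expansion depends on \<nu> and on G(0) = 1 only, not on the even system at hand;
  this makes two such systems comparable.\<close>

lemma Kf_expansion:
  assumes S: "even_system \<nu> G J U" and U: "0 \<in> U" and G0: "G 0 = 1" and c: "2 * \<nu> + 2 \<notin> \<int>\<^sub>\<le>\<^sub>0"
  shows "Kf \<nu> G has_fps_expansion hyp_fps \<nu> (\<nu> + 1) (2 * \<nu> + 2)"
proof -
  define S where "S = slit \<inter> (\<lambda>t. (wk t)\<^sup>2) -` U"
  have cw: "continuous_on slit (\<lambda>t. (wk t)\<^sup>2)"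
    by (intro continuous_on_power continuous_at_imp_continuous_on ballI DERIV_isCont[OF wk_deriv])
  have oS: "open S" unfolding S_def
    using continuous_on_open_vimage[OF open_slit] cw S by (auto simp: even_system_def Int_commute)
  have "wk 0 = 0" by (simp add: wk_def sq_def)
  hence S0: "0 \<in> S" using U slit_ball by (auto simp: S_def)
  have t: "t \<in> slit" "(wk t)\<^sup>2 \<in> U" if "t \<in> S" for t using that by (auto simp: S_def)
  show ?thesis
  proof (rule system_fps_unique[OF oS S0])
    show "Kf \<nu> G holomorphic_on S" "Kf (\<nu>+1) J holomorphic_on S"
      using S t oS by (auto intro!: Kf_holomorphic[of U] simp: even_system_def)
    show "Kf \<nu> G 0 = 1" using \<open>wk 0 = 0\<close> G0 by (simp add: Kf_def pk_def sq_def)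
    show "2 * \<nu> + 2 \<notin> \<int>\<^sub>\<le>\<^sub>0" by fact
  qed (use Kf_system[OF S t] in auto)
qed

text \<open>Both sides have the same Taylor series at 0, and \<open>Kf\<close> is holomorphic on all
  of \<open>slit\<close> because \<open>wk\<close> maps it into the unit disc. Hence it is the
  principal branch.\<close>

lemma hyp2F1_eq:
  assumes \<nu>: "Im \<nu> \<noteq> 0" and t: "t \<in> slit"
  shows "hyp2F1 \<nu> (\<nu> + 1) (2 * \<nu> + 2) t = Kf \<nu> (Gs \<nu>) t"
  unfolding hyp2F1_def slit_def[symmetric]
proof (rule acont_eq[OF open_slit connected_slit open_ball _ slit_ball _ _ t])
  have c: "\<nu> + 3/2 \<notin> \<int>\<^sub>\<le>\<^sub>0" "2 * \<nu> + 2 \<notin> \<int>\<^sub>\<le>\<^sub>0" using \<nu> by (auto intro!: nonint_Im)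
  note S = even_system_series[OF c(1)]
  have w: "(wk t)\<^sup>2 \<in> ball 0 1" if "t \<in> slit" for t
    using norm_wk[OF that] by (simp add: norm_power power_less_one_iff abs_square_less_1)
  show hol: "Kf \<nu> (Gs \<nu>) holomorphic_on slit"
    using S w open_slit by (intro Kf_holomorphic[of "ball 0 1"]) (auto simp: even_system_def)
  fix x :: complex assume x: "x \<in> ball 0 1"
  have "Kf \<nu> (Gs \<nu>) has_fps_expansion hyp_fps \<nu> (\<nu> + 1) (2 * \<nu> + 2)"
    by (rule Kf_expansion[OF S _ _ c(2)]) (auto simp: Gs_def)
  hence "eventually (\<lambda>t. HS \<nu> (\<nu> + 1) (2 * \<nu> + 2) t = Kf \<nu> (Gs \<nu>) t) (nhds 0)"
    by (simp add: has_fps_expansion_def HS_def)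
  then obtain V where V: "open V" "0 \<in> V" "\<And>t. t \<in> V \<Longrightarrow> HS \<nu> (\<nu> + 1) (2 * \<nu> + 2) t = Kf \<nu> (Gs \<nu>) t"
    unfolding eventually_nhds by blast
  have "Kf \<nu> (Gs \<nu>) x = HS \<nu> (\<nu> + 1) (2 * \<nu> + 2) x"
    by (rule analytic_continuation_open[of "V \<inter> ball 0 1" "ball 0 1"])
       (use V x hol slit_ball HS_hol in \<open>auto intro: holomorphic_on_subset\<close>)
  also have "\<dots> = (\<Sum>n. hyp_coeff \<nu> (\<nu> + 1) (2 * \<nu> + 2) n * x ^ n)"
    using x by (intro sums_unique HS_sums) auto
  finally show "Kf \<nu> (Gs \<nu>) x = (\<Sum>n. pochhammer \<nu> n * pochhammer (\<nu> + 1) n / (pochhammer (2 * \<nu> + 2) n * fact n) * x ^ n)"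
    by (simp add: hyp_coeff_def)
qed auto

text \<open>The even systems on both sides have the same expansion under \<open>Kf\<close>.
  Substituting the Koebe map for t makes the common factor \<open>pk\<close> cancel and leaves an
  identity between functions of w^2 near 0, which extends by the identity theorem.\<close>

lemma Gs_pfaff:
  assumes \<nu>: "Im \<nu> \<noteq> 0" and u: "norm u < 1" "Re u < 1/2"
  shows "Gs \<nu> u = csqrt (1 - u) * Gh \<nu> (u / (u - 1))" (is "_ = ?G u")
    and "Js \<nu> u = Jh \<nu> (u / (u - 1)) / csqrt (1 - u)" (is "_ = ?J u")
proof -
  have c: "\<nu> + 3/2 \<notin> \<int>\<^sub>\<le>\<^sub>0" "2 * \<nu> + 2 \<notin> \<int>\<^sub>\<le>\<^sub>0" using \<nu> by (auto intro!: nonint_Im)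
  note S1 = even_system_series[OF c(1)]
  note S2 = even_system_pfaff[OF c(1)]
  define D where "D = ball 0 1 \<inter> pfaff_dom"
  have D: "open D" "connected D" "0 \<in> D" 
    using open_Int[OF open_ball open_pfaff_dom] convex_connected[OF convex_Int[OF convex_ball convex_pfaff_dom]]
    by (auto simp: D_def pfaff_dom_def)
  have "Kf \<nu> (Gs \<nu>) has_fps_expansion hyp_fps \<nu> (\<nu> + 1) (2 * \<nu> + 2)"
    by (rule Kf_expansion[OF S1 _ _ c(2)]) (auto simp: Gs_def)
  moreover have "Kf \<nu> ?G has_fps_expansion hyp_fps \<nu> (\<nu> + 1) (2 * \<nu> + 2)"
    by (rule Kf_expansion[OF S2 _ _ c(2)]) (auto simp: Gh_def pfaff_dom_def)
  ultimately have ev: "eventually (\<lambda>t. Kf \<nu> (Gs \<nu>) t = Kf \<nu> ?G t) (nhds 0)"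
    unfolding has_fps_expansion_def by (auto elim: eventually_elim2)
  have "((\<lambda>w. 4 * w / (1 + w)\<^sup>2) \<longlongrightarrow> 4 * 0 / (1 + 0)\<^sup>2) (nhds (0::complex))"
    by (intro tendsto_intros filterlim_ident) auto
  hence "filterlim (\<lambda>w. 4 * w / (1 + w)\<^sup>2) (nhds 0) (nhds (0::complex))" by simp
  from filterlim_iff[THEN iffD1, OF this, rule_format, OF ev]
  have "eventually (\<lambda>w. Kf \<nu> (Gs \<nu>) (4 * w / (1 + w)\<^sup>2) = Kf \<nu> ?G (4 * w / (1 + w)\<^sup>2)) (nhds 0)" .
  moreover have "eventually (\<lambda>w::complex. w \<in> ball 0 1) (nhds 0)" by (intro eventually_nhds_in_open) auto
  ultimately have "eventually (\<lambda>w. Gs \<nu> (w\<^sup>2) = ?G (w\<^sup>2)) (nhds 0)"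
    by eventually_elim (simp add: Kf_def koebe_wk pk_def)
  then obtain e where e: "e > 0" "\<And>w. w \<in> ball 0 e \<Longrightarrow> Gs \<nu> (w\<^sup>2) = ?G (w\<^sup>2)"
    unfolding eventually_nhds_metric by (auto simp: dist_commute)
  \<comment> \<open>Every small x is the square of a small w.\<close>
  have near: "Gs \<nu> x = ?G x" if "x \<in> ball 0 (e\<^sup>2)" for x
  proof -
    have "(norm (csqrt x))\<^sup>2 < e\<^sup>2" using that by (simp flip: norm_power)
    hence "norm (csqrt x) < e" using e(1) power_less_imp_less_base by fastforce
    thus ?thesis using e(2)[of "csqrt x"] by simp
  qed
  have hol: "Gs \<nu> holomorphic_on D" "?G holomorphic_on D"
    using S1 S2 by (auto simp: even_system_def D_def intro: holomorphic_on_subset)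
  have eq: "Gs \<nu> x = ?G x" if "x \<in> D" for x
    by (rule analytic_continuation_open[of "D \<inter> ball 0 (e\<^sup>2)" D])
       (use D e near hol that in auto)
  have uD: "u \<in> D" using u by (auto simp: D_def pfaff_dom_def)
  show "Gs \<nu> u = ?G u" by (rule eq[OF uD])
  \<comment> \<open>The first equation of the system recovers J from G and its derivative, since
    \<nu>(1-u) does not vanish.\<close>
  have "deriv (Gs \<nu>) u = deriv ?G u"
    by (rule deriv_cong_ev) (use eventually_nhds_in_open[OF D(1) uD] eq in \<open>auto elim: eventually_mono\<close>)
  hence "\<nu> * (1 - u) * Js \<nu> u = \<nu> * (1 - u) * ?J u"
    using S1 S2 uD eq[OF uD] unfolding even_system_def D_def by (metis (no_types, lifting) IntD1 IntD2)
  moreover have "\<nu> * (1 - u) \<noteq> 0" using \<nu> u by auto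
  ultimately show "Js \<nu> u = ?J u" by (rule mult_left_cancel[THEN iffD1, rotated])
qed

section \<open>The two solutions in the upper half-plane\<close>

text \<open>One formula for both solutions: \<nu> = a gives h and \<nu> = -a-1 gives s, whose minus
  sign is the factor exp(-\<i> pi).\<close>

definition fsol :: "complex \<Rightarrow> complex \<Rightarrow> complex" where
  "fsol \<nu> \<eta> = exp (\<nu> * pi * \<i>) * exp (- \<nu> * Ln \<eta>) * Kf \<nu> (Gs \<nu>) (1 / \<eta>)"

definition fsol' :: "complex \<Rightarrow> complex \<Rightarrow> complex" where
  "fsol' \<nu> \<eta> = - \<nu> * exp (\<nu> * pi * \<i>) * exp (- (\<nu> + 1) * Ln \<eta>) * Kf (\<nu> + 1) (Js \<nu>) (1 / \<eta>)"

abbreviation UHP :: "complex set" where "UHP \<equiv> {u. 0 < Im u}"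

lemma UHP_slit: "\<eta> \<in> UHP \<Longrightarrow> 1 / \<eta> \<in> slit"
proof -
  assume e: "\<eta> \<in> UHP"
  hence "\<eta> \<noteq> 0" by auto
  hence "Im (1 / \<eta>) < 0" using e by (simp add: Im_divide divide_neg_pos sum_power2_gt_zero_iff complex_eq_iff)
  thus ?thesis by (auto simp: slit_iff complex_nonpos_Reals_iff)
qed

lemma wk_ball: "t \<in> slit \<Longrightarrow> (wk t)\<^sup>2 \<in> ball 0 1"
  using norm_wk by (simp add: norm_power abs_square_less_1)

text \<open>Each equation of \<open>Kf_system\<close> accounts for one differentiation. The factor
  \<nu>(\<nu>+1) is invariant under \<nu> -> -\<nu>-1, so both solutions satisfy the same
  equation.\<close>

lemma fsol_deriv:
  assumes \<nu>: "Im \<nu> \<noteq> 0" and e: "\<eta> \<in> UHP"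
  shows "(fsol \<nu> has_field_derivative fsol' \<nu> \<eta>) (at \<eta>)"
    and "(fsol' \<nu> has_field_derivative \<nu> * (\<nu> + 1) * fsol \<nu> \<eta> / (\<eta> * (\<eta> - 1))) (at \<eta>)"
proof -
  have c: "\<nu> + 3/2 \<notin> \<int>\<^sub>\<le>\<^sub>0" using \<nu> by (auto intro!: nonint_Im)
  note S = even_system_series[OF c]
  have ne: "\<eta> \<noteq> 0" "\<eta> - 1 \<noteq> 0" "\<eta> \<notin> \<real>\<^sub>\<le>\<^sub>0" using e by (auto simp: complex_nonpos_Reals_iff complex_eq_iff)
  define t where "t = 1 / \<eta>"
  have t: "t \<in> slit" using UHP_slit[OF e] by (simp add: t_def)
  note w = wk_ball[OF t]
  have hol: "Kf \<nu> (Gs \<nu>) holomorphic_on slit" "Kf (\<nu> + 1) (Js \<nu>) holomorphic_on slit"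
    using S open_slit wk_ball by (auto intro!: Kf_holomorphic[of "ball 0 1"] simp: even_system_def)
  have dt: "((\<lambda>x. 1 / x) has_field_derivative - t / \<eta>) (at \<eta>)"
    using ne by (auto intro!: derivative_eq_intros simp: t_def power2_eq_square)
  have dK: "((\<lambda>x. Kf \<nu> (Gs \<nu>) (1 / x)) has_field_derivative deriv (Kf \<nu> (Gs \<nu>)) t * (- t / \<eta>)) (at \<eta>)"
    using DERIV_chain2[OF holomorphic_derivI[OF hol(1) open_slit t, unfolded t_def] dt] by (simp add: t_def)
  have dL: "((\<lambda>x. Kf (\<nu>+1) (Js \<nu>) (1 / x)) has_field_derivative deriv (Kf (\<nu>+1) (Js \<nu>)) t * (- t / \<eta>)) (at \<eta>)"
    using DERIV_chain2[OF holomorphic_derivI[OF hol(2) open_slit t, unfolded t_def] dt] by (simp add: t_def)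
  have de: "((\<lambda>x. exp (- m * Ln x)) has_field_derivative exp (- m * Ln \<eta>) * (- m / \<eta>)) (at \<eta>)" for m
    using ne by (auto intro!: derivative_eq_intros simp: divide_inverse mult_ac)
  have ex: "exp (- (\<nu> + 1) * Ln \<eta>) = exp (- \<nu> * Ln \<eta>) / \<eta>"
    using ne by (simp add: algebra_simps exp_diff exp_minus divide_inverse)
  note Sys = Kf_system[OF S t w]
  let ?K = "Kf \<nu> (Gs \<nu>) t" and ?L = "Kf (\<nu>+1) (Js \<nu>) t" and ?E = "exp (\<nu> * pi * \<i>)" and ?e = "exp (- \<nu> * Ln \<eta>)"
  have "(fsol \<nu> has_field_derivative ?E * (?e * (- \<nu> / \<eta>) * ?K + ?e * (deriv (Kf \<nu> (Gs \<nu>)) t * (- t / \<eta>)))) (at \<eta>)"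
    unfolding fsol_def[abs_def]
    by (rule DERIV_mult'[OF DERIV_cmult[OF de] dK, THEN DERIV_cong]) (simp add: t_def algebra_simps)
  moreover have "?E * (?e * (- \<nu> / \<eta>) * ?K + ?e * (deriv (Kf \<nu> (Gs \<nu>)) t * (- t / \<eta>))) = fsol' \<nu> \<eta>"
  proof -
    have "?E * (?e * (- \<nu> / \<eta>) * ?K + ?e * (deriv (Kf \<nu> (Gs \<nu>)) t * (- t / \<eta>)))
        = - ?E * ?e / \<eta> * (\<nu> * ?K + t * deriv (Kf \<nu> (Gs \<nu>)) t)"
      by (simp add: add_divide_distrib distrib_left right_diff_distrib mult_ac)
    also have "\<dots> = fsol' \<nu> \<eta>"
      unfolding Sys(1) fsol'_def ex by (simp add: t_def algebra_simps)
    finally show ?thesis .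
  qed
  ultimately show "(fsol \<nu> has_field_derivative fsol' \<nu> \<eta>) (at \<eta>)" by simp
  let ?e1 = "exp (- (\<nu> + 1) * Ln \<eta>)"
  have "(fsol' \<nu> has_field_derivative - \<nu> * ?E * (?e1 * (- (\<nu> + 1) / \<eta>) * ?L + ?e1 * (deriv (Kf (\<nu>+1) (Js \<nu>)) t * (- t / \<eta>)))) (at \<eta>)"
    unfolding fsol'_def[abs_def]
    by (rule DERIV_mult'[OF DERIV_cmult[OF de] dL, THEN DERIV_cong]) (simp add: t_def algebra_simps)
  moreover have "- \<nu> * ?E * (?e1 * (- (\<nu> + 1) / \<eta>) * ?L + ?e1 * (deriv (Kf (\<nu>+1) (Js \<nu>)) t * (- t / \<eta>))) = \<nu> * (\<nu> + 1) * fsol \<nu> \<eta> / (\<eta> * (\<eta> - 1))"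
  proof -
    have t1: "(1 - t) * \<eta> = \<eta> - 1" using ne by (simp add: t_def field_simps)
    have t0: "1 - t \<noteq> 0" using t1 ne by auto
    have "- \<nu> * ?E * (?e1 * (- (\<nu> + 1) / \<eta>) * ?L + ?e1 * (deriv (Kf (\<nu>+1) (Js \<nu>)) t * (- t / \<eta>)))
        = \<nu> * ?E * ?e1 / \<eta> * (t * deriv (Kf (\<nu>+1) (Js \<nu>)) t + (\<nu> + 1) * ?L)"
    proof -
      have "- \<nu> * E * (e * (- (\<nu> + 1) / \<eta>) * L + e * (D * (- t / \<eta>))) = \<nu> * E * e / \<eta> * (t * D + (\<nu> + 1) * L)"
        for E e L D :: complex using ne by (simp add: field_simps)
      thus ?thesis .
    qed
    also have "t * deriv (Kf (\<nu>+1) (Js \<nu>)) t + (\<nu> + 1) * ?L = (\<nu> + 1) * ?K / (1 - t)"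
      using Sys(2) t0 by (simp only: eq_divide_eq) (simp add: mult.commute)
    also have "\<nu> * ?E * ?e1 / \<eta> * ((\<nu> + 1) * ?K / (1 - t)) = \<nu> * (\<nu> + 1) * (?E * ?e * ?K) / (\<eta> * ((1 - t) * \<eta>))"
      unfolding ex by (simp add: mult_ac)
    finally show ?thesis unfolding t1 unfolding fsol_def t_def .
  qed
  ultimately show "(fsol' \<nu> has_field_derivative \<nu> * (\<nu> + 1) * fsol \<nu> \<eta> / (\<eta> * (\<eta> - 1))) (at \<eta>)" by simp
qed

text \<open>\<open>v = \<i>w\<close> with \<open>\<eta> = (1+w)\<^sup>2/(4w)\<close>: the right half of the unit disc corresponds to the upper half-plane.\<close>
definition eta_of :: "complex \<Rightarrow> complex" where
  "eta_of v = 1/2 + \<i> * (1 / v - v) / 4"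

text \<open>The branch of \<open>(4 \<i> v)^\<nu>\<close> to which the prefactors
  \<open>exp(\<nu> pi \<i>) \<eta>^(-\<nu>) (1+w)^(2\<nu>)\<close> combine when
  \<open>\<eta> = (1+w)^2/(4w)\<close> and \<open>w = - \<i> v\<close>.\<close>

definition EE :: "complex \<Rightarrow> complex \<Rightarrow> complex" where
  "EE \<nu> v = exp (\<nu> * (\<i> * pi / 2 + of_real (ln 4) + Ln v))"

lemma EE_plus1: "v \<noteq> 0 \<Longrightarrow> EE (\<nu> + 1) v = 4 * \<i> * v * EE \<nu> v"
proof -
  assume v: "v \<noteq> 0"
  have "EE (\<nu> + 1) v = EE \<nu> v * exp (\<i> * pi / 2 + of_real (ln 4) + Ln v)"
  proof -
    have "exp ((\<nu> + 1) * X) = exp (\<nu> * X) * exp X" for X :: complex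
      by (simp add: distrib_right exp_add)
    thus ?thesis unfolding EE_def .
  qed
  also have "exp (\<i> * pi / 2 + of_real (ln 4) + Ln v) = exp (\<i> * complex_of_real (pi / 2)) * exp (of_real (ln 4)) * exp (Ln v)"
    by (simp add: exp_add)
  also have "\<dots> = \<i> * 4 * v"
  proof -
    have "exp (complex_of_real (ln 4)) = of_real (exp (ln 4))" by (rule exp_of_real)
    hence "exp (complex_of_real (ln 4)) = 4" by simp
    moreover have "exp (\<i> * complex_of_real (pi / 2)) = \<i>"
      by (simp add: exp_Euler cos_of_real sin_of_real del: of_real_divide)
    ultimately show ?thesis using v by simp
  qed
  finally show ?thesis by simp
qed

lemma eta_of_koebe:
  assumes "v \<noteq> 0" defines "w \<equiv> - \<i> * v"
  shows "4 * w * eta_of v = (1 + w)\<^sup>2"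
  using assms(1) unfolding w_def eta_of_def by (simp add: field_simps power2_eq_square)

lemma Im_eta_of: "Re v > 0 \<Longrightarrow> norm v < 1 \<Longrightarrow> 0 < Im (eta_of v)"
proof -
  assume v: "Re v > 0" "norm v < 1"
  hence v0: "v \<noteq> 0" by auto
  have "Im (eta_of v) = (Re (1 / v) - Re v) / 4" by (simp add: eta_of_def)
  also have "Re (1 / v) = Re v / (norm v)\<^sup>2" by (simp add: Re_divide cmod_power2)
  also have "Re v / (norm v)\<^sup>2 > Re v"
  proof -
    have "(norm v)\<^sup>2 < 1" using v by (simp add: abs_square_less_1)
    thus ?thesis using v v0 by (simp add: field_simps)
  qed
  ultimately show ?thesis by simp
qed

lemma Ln_eta_of:
  assumes v: "Re v > 0" "norm v < 1"
  shows "Ln (eta_of v) = 2 * Ln (1 - \<i> * v) - of_real (ln 4) - Ln v + \<i> * pi / 2"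
proof (rule Ln_unique)
  have v0: "v \<noteq> 0" using v by auto
  have n: "1 - \<i> * v \<noteq> 0" using v(2) by (metis eq_iff_diff_eq_0 norm_ii norm_mult norm_one mult_1 order_less_irrefl)
  have l4: "exp (complex_of_real (ln 4)) = 4" by (metis exp_ln exp_of_real of_real_numeral zero_less_numeral)
  have "exp (2 * Ln (1 - \<i> * v) - of_real (ln 4) - Ln v + \<i> * pi / 2) = (exp (Ln (1 - \<i> * v)))\<^sup>2 / exp (of_real (ln 4)) / exp (Ln v) * exp (\<i> * of_real (pi / 2))"
    by (simp add: exp_add exp_diff exp_double[symmetric])
  also have "\<dots> = (1 - \<i> * v)\<^sup>2 / 4 / v * \<i>"
    using v0 n l4 by (simp add: exp_Euler cos_of_real sin_of_real del: of_real_divide)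
  also have "\<dots> = eta_of v"
    using eta_of_koebe[OF v0] v0 by (simp add: field_simps power2_eq_square)
  finally show "exp (2 * Ln (1 - \<i> * v) - of_real (ln 4) - Ln v + \<i> * pi / 2) = eta_of v" .
  have r: "Re (1 - \<i> * v) > 0" using complex_Re_le_cmod[of "\<i> * v"] v(2) by (simp add: norm_mult)
  have i: "\<bar>Im (Ln v)\<bar> < pi / 2" using v(1) Re_Ln_pos_lt[OF v0] by blast
  have b: "\<bar>Im (Ln (1 - \<i> * v))\<bar> < pi / 2" using r Re_Ln_pos_lt[OF n] by blast
  \<comment> \<open>The bound pi from above needs this sign: twice the argument of 1 - \<i>v must
    not contribute a positive amount to pi/2 - arg v, which is already less than pi.\<close>
  have neg: "Im (Ln (1 - \<i> * v)) \<le> 0"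
  proof -
    have "\<not> (0 < Im (Ln (1 - \<i> * v)) \<and> Im (Ln (1 - \<i> * v)) < pi)"
      unfolding Im_Ln_pos_lt[OF n] using v(1) by simp
    thus ?thesis using b pi_gt_zero by linarith
  qed
  show "- pi < Im (2 * Ln (1 - \<i> * v) - of_real (ln 4) - Ln v + \<i> * pi / 2)"
    using i b by simp
  show "Im (2 * Ln (1 - \<i> * v) - of_real (ln 4) - Ln v + \<i> * pi / 2) \<le> pi"
    using i neg by simp
qed

text \<open>The condition on Re(v^2) is the Pfaff condition Re u < 1/2 for u = -v^2. It holds for
  all |v| \<le> 1/2, where the asymptotics take place, and for real v < 1, along which the base
  point v = 1 is approached.\<close>

lemma fsol_eta_of:
  assumes \<nu>: "Im \<nu> \<noteq> 0" and v: "Re v > 0" "norm v < 1" "Re (v\<^sup>2) > - 1/2"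
  shows "fsol \<nu> (eta_of v) = EE \<nu> v * (csqrt (1 + v\<^sup>2) * Gh \<nu> (v\<^sup>2 / (1 + v\<^sup>2)))" (is ?A)
    and "fsol' \<nu> (eta_of v) = \<nu> * EE (\<nu> + 1) v * (Jh \<nu> (v\<^sup>2 / (1 + v\<^sup>2)) / csqrt (1 + v\<^sup>2))" (is ?B)
proof -
  define w where "w = - \<i> * v"
  define \<eta> where "\<eta> = eta_of v"
  have v0: "v \<noteq> 0" using v by auto
  have nw: "norm w < 1" using v by (simp add: w_def norm_mult)
  have w1: "1 + w \<noteq> 0" using nw by (metis add_eq_0_iff norm_minus_cancel norm_one order_less_irrefl)
  have e0: "\<eta> \<noteq> 0" using Im_eta_of[OF v(1,2)] by (auto simp: \<eta>_def)
  have t: "1 / \<eta> = 4 * w / (1 + w)\<^sup>2"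
    using eta_of_koebe[OF v0] e0 w1 unfolding w_def \<eta>_def by (simp add: field_simps)
  have wk: "wk (1 / \<eta>) = w" and sqt: "sq (1 / \<eta>) = (1 - w) / (1 + w)"
    unfolding t using koebe_wk[OF nw] koebe_sq[OF nw] by auto
  have s1: "2 / (1 + sq (1 / \<eta>)) = 1 - \<i> * v"
  proof -
    have "1 + sq (1 / \<eta>) = 2 / (1 + w)" unfolding sqt using w1 by (simp add: field_simps)
    thus ?thesis using w1 by (simp add: w_def)
  qed
  have w2: "w\<^sup>2 = - v\<^sup>2" by (simp add: w_def power_mult_distrib)
  have "Re (- v\<^sup>2) \<noteq> Re 1" using v(3) by simp
  hence "- v\<^sup>2 \<noteq> 1" by metis
  hence "1 + v\<^sup>2 \<noteq> 0" by (metis add_eq_0_iff add.commute)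
  hence x: "- v\<^sup>2 / (- v\<^sup>2 - 1) = v\<^sup>2 / (1 + v\<^sup>2)"
    by (metis add.commute minus_add_distrib minus_divide_left minus_divide_right minus_minus uminus_add_conv_diff diff_conv_add_uminus)
  have u: "norm (- v\<^sup>2) < 1" "Re (- v\<^sup>2) < 1/2" using v by (simp_all add: norm_power abs_square_less_1)
  note P = Gs_pfaff[OF \<nu> u, unfolded x]
  have E: "exp (\<mu> * pi * \<i>) * exp (- \<mu> * Ln \<eta>) * pk \<mu> (1 / \<eta>) = EE \<mu> v" for \<mu> :: complex
    unfolding \<eta>_def Ln_eta_of[OF v(1,2)] pk_def s1[unfolded \<eta>_def] EE_def
    by (simp add: algebra_simps flip: exp_add)
  have "fsol \<nu> \<eta> = exp (\<nu> * pi * \<i>) * exp (- \<nu> * Ln \<eta>) * pk \<nu> (1 / \<eta>) * Gs \<nu> (- v\<^sup>2)"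
    by (simp add: fsol_def Kf_def wk w2)
  thus ?A using E[of \<nu>] P(1) by (simp only: \<eta>_def diff_minus_eq_add)
  have "fsol' \<nu> \<eta> = \<nu> * (exp ((\<nu>+1) * pi * \<i>) * exp (- (\<nu>+1) * Ln \<eta>) * pk (\<nu>+1) (1 / \<eta>)) * Js \<nu> (- v\<^sup>2)"
    by (simp add: fsol'_def Kf_def wk w2 distrib_right exp_add)
  thus ?B using E[of "\<nu> + 1"] P(2) by (simp only: \<eta>_def diff_minus_eq_add)
qed

section \<open>Gamma identities at the base point\<close>

lemma sin_cos_nz:
  assumes "Im z \<noteq> 0" shows "sin z \<noteq> 0" "cos z \<noteq> 0"
proof -
  show "sin z \<noteq> 0"
  proof
    assume "sin z = 0"
    then obtain n :: int where "z = of_real (of_int n * pi)" unfolding sin_eq_0 by blast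
    thus False using assms by simp
  qed
  show "cos z \<noteq> 0"
  proof
    assume "cos z = 0"
    then obtain n :: int where "z = of_real (of_int n * pi) + of_real pi / 2" unfolding cos_eq_0 by blast
    thus False using assms by simp
  qed
qed

lemma sin_shift_half: "sin ((z + 1/2) * complex_of_real pi) = cos (z * pi)"
  and sin_shift_one: "sin ((z + 1) * complex_of_real pi) = - sin (z * pi)"
proof -
  have "(z + 1/2) * complex_of_real pi = z * pi + of_real (pi / 2)" by (simp add: distrib_right)
  thus "sin ((z + 1/2) * complex_of_real pi) = cos (z * pi)"
    by (simp only: sin_add sin_of_real cos_of_real sin_pi_half cos_pi_half) simp
  have "(z + 1) * complex_of_real pi = z * pi + of_real pi" by (simp add: distrib_right)
  thus "sin ((z + 1) * complex_of_real pi) = - sin (z * pi)"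
    by (simp only: sin_add sin_of_real cos_of_real sin_pi cos_pi) simp
qed

text \<open>\<open>HS_half\<close> for \<alpha> = -1/2 and \<alpha> = 1/2. The base point v = 1
  corresponds to x = v^2/(1+v^2) = 1/2.\<close>

lemma Gh_half:
  assumes "Im \<nu> \<noteq> 0"
  shows "Gh \<nu> (1/2) * (Gamma (\<nu>/2 + 3/2) * Gamma (\<nu>/2 + 1/2)) = Gamma (\<nu>/2 + 3/4) * Gamma (\<nu>/2 + 5/4)"
    and "Jh \<nu> (1/2) * (Gamma (\<nu>/2 + 1))\<^sup>2 = Gamma (\<nu>/2 + 3/4) * Gamma (\<nu>/2 + 5/4)"
proof -
  have nz: "Gamma (\<nu>/2 + of_real r) \<noteq> 0" for r
    using assms by (intro Gamma_nonzero nonint_Im) simp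
  note nz' = nz[of "3/4"] nz[of "5/4"] nz[of "3/2"] nz[of "1/2"] nz[of 1]
  have "HS (-1/2) (1 - (-1/2)) (\<nu>+3/2) (1/2) * rGamma ((\<nu>+3/2)/2) * rGamma ((\<nu>+3/2)/2 + 1/2) =
      rGamma ((\<nu>+3/2)/2 + (1 - (-1/2))/2) * rGamma ((\<nu>+3/2)/2 + (-1/2)/2)"
    by (rule HS_half) (use assms in simp_all)
  moreover have "(\<nu>+3/2)/2 = \<nu>/2 + 3/4" by (simp add: field_simps)
  moreover have "\<nu>/2 + 3/4 + 1/2 = \<nu>/2 + 5/4" "\<nu>/2 + 3/4 + (1 - (-1/2))/2 = \<nu>/2 + 3/2" "\<nu>/2 + 3/4 + (-1/2)/2 = \<nu>/2 + 1/2"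
    by simp_all
  moreover have "1 - (-1/2) = (3/2::complex)" by simp
  ultimately have "Gh \<nu> (1/2) * rGamma (\<nu>/2 + 3/4) * rGamma (\<nu>/2 + 5/4) = rGamma (\<nu>/2 + 3/2) * rGamma (\<nu>/2 + 1/2)"
    unfolding Gh_def by metis
  thus "Gh \<nu> (1/2) * (Gamma (\<nu>/2 + 3/2) * Gamma (\<nu>/2 + 1/2)) = Gamma (\<nu>/2 + 3/4) * Gamma (\<nu>/2 + 5/4)"
    using nz' unfolding rGamma_inverse_Gamma by (simp add: field_simps)
  have "HS (1/2) (1 - 1/2) (\<nu>+3/2) (1/2) * rGamma ((\<nu>+3/2)/2) * rGamma ((\<nu>+3/2)/2 + 1/2) =
      rGamma ((\<nu>+3/2)/2 + (1 - 1/2)/2) * rGamma ((\<nu>+3/2)/2 + (1/2)/2)"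
    by (rule HS_half) (use assms in simp_all)
  moreover have "(\<nu>+3/2)/2 = \<nu>/2 + 3/4" by (simp add: field_simps)
  moreover have "\<nu>/2 + 3/4 + 1/2 = \<nu>/2 + 5/4" "\<nu>/2 + 3/4 + (1 - 1/2)/2 = \<nu>/2 + 1" "\<nu>/2 + 3/4 + (1/2)/2 = \<nu>/2 + 1"
    by simp_all
  moreover have "1 - 1/2 = (1/2::complex)" by simp
  ultimately have "Jh \<nu> (1/2) * rGamma (\<nu>/2 + 3/4) * rGamma (\<nu>/2 + 5/4) = rGamma (\<nu>/2 + 1) * rGamma (\<nu>/2 + 1)"
    unfolding Jh_def by metis
  thus "Jh \<nu> (1/2) * (Gamma (\<nu>/2 + 1))\<^sup>2 = Gamma (\<nu>/2 + 3/4) * Gamma (\<nu>/2 + 5/4)"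
    using nz' unfolding rGamma_inverse_Gamma by (simp add: field_simps power2_eq_square)
qed

definition BQ :: "complex \<Rightarrow> complex" where
  "BQ a = Gamma (a + 3/2) * Gamma (a + 1/2) / (Gamma a * Gamma (a + 2))"

text \<open>\<open>Gh_half\<close> expresses both sides by Gamma values at shifts of b = a/2 and -b.
  The duplication formula (\<open>D1\<close> to \<open>D4\<close>) pairs them into values at shifts
  of a and -a, and the reflection formula (\<open>R1\<close> to \<open>R4\<close>) removes the
  negative arguments, leaving trigonometric functions.\<close>

lemma BQ_identities:
  assumes a: "Im a \<noteq> 0"
  shows "BQ a * Gh (- a - 1) (1/2) * cos (a * pi) = - 2 * (sin (a / 2 * pi))\<^sup>2 * Gh a (1/2)" (is ?A)
    and "BQ a * (a + 1) * Jh (- a - 1) (1/2) * cos (a * pi) = 2 * a * (cos (a / 2 * pi))\<^sup>2 * Jh a (1/2)" (is ?B)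
proof -
  define b where "b = a / 2"
  have ab: "a = 2 * b" by (simp add: b_def)
  have ib: "Im b \<noteq> 0" using a by (simp add: b_def)
  have ni: "z \<notin> \<int>\<^sub>\<le>\<^sub>0" if "Im z \<noteq> 0" for z using that by (rule nonint_Im)
  have gz: "Gamma z \<noteq> 0" if "Im z \<noteq> 0" for z :: complex using that by (intro Gamma_nonzero nonint_Im)
  have rpi: "of_real (sqrt pi) * of_real (sqrt pi) = complex_of_real pi" by (simp flip: of_real_mult)
  have dup: "Gamma z * Gamma (z + 1/2) = exp ((1 - 2 * z) * of_real (ln 2)) * of_real (sqrt pi) * Gamma (2 * z)" if "Im z \<noteq> 0" for z :: complex
    using that by (intro Gamma_legendre_duplication nonint_Im) auto
  define p where "p = complex_of_real (sqrt pi)"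
  \<comment> \<open>The powers of 2 from the four duplications. By \<open>E12\<close> and
    \<open>E34\<close> they cancel up to a factor 2.\<close>
  define E1 E2 E3 E4 where "E1 = exp ((- a - 1/2) * complex_of_real (ln 2))" and "E2 = exp ((a + 1/2) * complex_of_real (ln 2))"
    and "E3 = exp ((1 - a) * complex_of_real (ln 2))" and "E4 = exp ((- a - 1) * complex_of_real (ln 2))"
  define C S Cb where "C = cos (a * pi)" and "S = sin (b * pi)" and "Cb = cos (b * pi)"
  have l2: "exp (complex_of_real (ln 2)) = 2" by (simp add: exp_of_real)
  have E12: "E1 * E2 = 1" unfolding E1_def E2_def by (simp flip: exp_add distrib_right)
  have E34: "E3 * E4 = 2 * E1 * E1"
  proof -
    have "E3 * E4 = exp (- 2 * a * complex_of_real (ln 2))" unfolding E3_def E4_def by (simp add: algebra_simps flip: exp_add)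
    also have "\<dots> = exp (complex_of_real (ln 2)) * (E1 * E1)" unfolding E1_def by (simp add: algebra_simps flip: exp_add)
    finally show ?thesis by (simp add: l2)
  qed
  have pp: "p * p = of_real pi" by (simp add: p_def rpi)
  have p0: "p \<noteq> 0" by (simp add: p_def)
  have nzE: "E1 \<noteq> 0" "E2 \<noteq> 0" "E3 \<noteq> 0" "E4 \<noteq> 0" by (simp_all add: E1_def E2_def E3_def E4_def)
  have D1: "Gamma (b + 3/4) * Gamma (b + 5/4) = E1 * p * Gamma (a + 3/2)"
    using dup[of "b + 3/4"] ib by (simp add: E1_def p_def ab algebra_simps)
  have D2: "Gamma (1/4 - b) * Gamma (3/4 - b) = E2 * p * Gamma (1/2 - a)"
    using dup[of "1/4 - b"] ib by (simp add: E2_def p_def ab algebra_simps)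
  have D3: "Gamma b * Gamma (b + 1/2) = E3 * p * Gamma a"
    using dup[of "b"] ib by (simp add: E3_def p_def ab algebra_simps)
  have D4: "Gamma (b + 1) * Gamma (b + 3/2) = E4 * p * Gamma (a + 2)"
  proof -
    have e: "1 - (a + 2) = - a - 1" "2 * (b + 1) = a + 2" "b + 1 + 1/2 = b + 3/2" by (simp_all add: ab)
    show ?thesis by (rule dup[of "b + 1", unfolded e, folded E4_def p_def]) (use ib in simp)
  qed
  have refl: "Gamma z * Gamma (1 - z) * sin (z * pi) = p * p" if "Im z \<noteq> 0" for z :: complex
  proof -
    have "sin (z * pi) \<noteq> 0" using that by (intro sin_cos_nz) simp
    moreover have "Gamma z * Gamma (1 - z) = of_real pi / sin (z * pi)"
      using Gamma_reflection_complex[of z] by (simp only: mult.commute[of "complex_of_real pi" z])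
    ultimately show ?thesis by (simp add: pp)
  qed
  have R1: "Gamma (a + 1/2) * Gamma (1/2 - a) * C = p * p"
    using refl[of "a + 1/2"] a by (simp add: C_def sin_shift_half)
  have R2: "Gamma b * Gamma (1 - b) * S = p * p"
    using refl[OF ib] by (simp add: S_def)
  have R3: "Gamma (b + 1) * Gamma (- b) * S = - (p * p)"
  proof -
    have "Gamma (b + 1) * Gamma (- b) * (- S) = p * p"
      using refl[of "b + 1"] ib by (simp add: S_def sin_shift_one)
    thus ?thesis by algebra
  qed
  have R4: "Gamma (b + 1/2) * Gamma (1/2 - b) * Cb = p * p"
    using refl[of "b + 1/2"] ib by (simp add: Cb_def sin_shift_half)
  have P1: "Gamma (b + 1) = b * Gamma b" using Gamma_plus1[OF ni[OF ib]] by (simp add: mult.commute)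
  have P2: "Gamma (b + 3/2) = (b + 1/2) * Gamma (b + 1/2)" using Gamma_plus1[of "b + 1/2"] ib by (simp add: ni add.commute)
  have nz: "Gamma (b + 3/4) \<noteq> 0" "Gamma (b + 5/4) \<noteq> 0" "Gamma (b + 1/2) \<noteq> 0" "Gamma (b + 3/2) \<noteq> 0"
    "Gamma (b + 1) \<noteq> 0" "Gamma b \<noteq> 0" "Gamma (- b) \<noteq> 0" "Gamma (1 - b) \<noteq> 0" "Gamma (1/2 - b) \<noteq> 0"
    "Gamma a \<noteq> 0" "Gamma (a + 2) \<noteq> 0" "Gamma (a + 3/2) \<noteq> 0"
    using a ib by (simp_all add: gz)
  note H1 = Gh_half[OF a, folded b_def] 
  have in1: "Im (- a - 1) \<noteq> 0" using a by simp
  have eqs: "(- a - 1) / 2 + 3/2 = 1 - b" "(- a - 1) / 2 + 1/2 = - b" "(- a - 1) / 2 + 3/4 = 1/4 - b"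
    "(- a - 1) / 2 + 5/4 = 3/4 - b" "(- a - 1) / 2 + 1 = 1/2 - b"
    by (simp_all add: ab field_simps)
  note H2 = Gh_half[OF in1, unfolded eqs]
  define X1 X2 where "X1 = Gh a (1/2)" and "X2 = Gh (- a - 1) (1/2)"
  define Y1 Y2 where "Y1 = Jh a (1/2)" and "Y2 = Jh (- a - 1) (1/2)"
  have B: "BQ a * (Gamma a * Gamma (a + 2)) = Gamma (a + 3/2) * Gamma (a + 1/2)"
    using nz by (simp add: BQ_def)
  have AA: "Gamma b * Gamma (b + 1/2) * Gamma (b + 1) * Gamma (b + 3/2) = 2 * E1 * E1 * (p * p) * (Gamma a * Gamma (a + 2))"
  proof -
    have "Gamma b * Gamma (b + 1/2) * (Gamma (b + 1) * Gamma (b + 3/2)) = (E3 * E4) * (p * p) * (Gamma a * Gamma (a + 2))"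
      unfolding D3 D4 by (simp add: mult_ac)
    thus ?thesis unfolding E34 by (simp add: mult_ac)
  qed
  have BE: "BQ a * (Gamma b * Gamma (b + 1/2) * Gamma (b + 1) * Gamma (b + 3/2)) = 2 * E1 * E1 * (p * p) * (Gamma (a + 3/2) * Gamma (a + 1/2))"
    unfolding AA using B by algebra
  text \<open>multiply by the Gamma factors that turn every product into one of the known ones\<close>
  have "BQ a * X2 * C * (Gamma (1 - b) * Gamma (- b) * (Gamma b * Gamma (b + 1/2) * Gamma (b + 1) * Gamma (b + 3/2)))
      = (X2 * (Gamma (1 - b) * Gamma (- b))) * C * (BQ a * (Gamma b * Gamma (b + 1/2) * Gamma (b + 1) * Gamma (b + 3/2)))"
    by (simp add: mult_ac)
  also have "\<dots> = E2 * p * Gamma (1/2 - a) * C * (2 * E1 * E1 * (p * p) * (Gamma (a + 3/2) * Gamma (a + 1/2)))"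
    unfolding BE using H2(1) by (simp add: X2_def D2)
  also have "\<dots> = (Gamma (a + 1/2) * Gamma (1/2 - a) * C) * (E1 * E2) * (2 * E1 * (p * p) * p * Gamma (a + 3/2))"
    by (simp add: mult_ac)
  also have "\<dots> = 2 * (p * p) * (p * p) * (E1 * p * Gamma (a + 3/2))"
    unfolding R1 E12 by (simp add: mult_ac)
  also have "\<dots> = - 2 * (Gamma b * Gamma (1 - b) * S) * (Gamma (b + 1) * Gamma (- b) * S) * (X1 * (Gamma (b + 3/2) * Gamma (b + 1/2)))"
    unfolding R2 R3 using H1(1) by (simp add: X1_def D1)
  also have "\<dots> = (- 2 * S\<^sup>2 * X1) * (Gamma (1 - b) * Gamma (- b) * (Gamma b * Gamma (b + 1/2) * Gamma (b + 1) * Gamma (b + 3/2)))"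
    by (simp add: power2_eq_square mult_ac)
  finally have "BQ a * X2 * C = - 2 * S\<^sup>2 * X1"
    using nz by (simp only: mult_cancel_right) auto
  thus ?A by (simp add: X1_def X2_def C_def S_def b_def)
  have "BQ a * (a + 1) * Y2 * C * ((Gamma (1/2 - b))\<^sup>2 * (Gamma b * Gamma (b + 1/2) * Gamma (b + 1) * Gamma (b + 3/2)))
      = (Y2 * (Gamma (1/2 - b))\<^sup>2) * C * (a + 1) * (BQ a * (Gamma b * Gamma (b + 1/2) * Gamma (b + 1) * Gamma (b + 3/2)))"
    by (simp add: mult_ac)
  also have "\<dots> = E2 * p * Gamma (1/2 - a) * C * (a + 1) * (2 * E1 * E1 * (p * p) * (Gamma (a + 3/2) * Gamma (a + 1/2)))"
    unfolding BE using H2(2) by (simp add: Y2_def D2)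
  also have "\<dots> = (Gamma (a + 1/2) * Gamma (1/2 - a) * C) * (E1 * E2) * (2 * E1 * (p * p) * p * Gamma (a + 3/2)) * (a + 1)"
    by (simp add: mult_ac)
  also have "\<dots> = 2 * (p * p) * (p * p) * (E1 * p * Gamma (a + 3/2)) * (a + 1)"
    unfolding R1 E12 by (simp add: mult_ac)
  also have "\<dots> = 2 * (Gamma (b + 1/2) * Gamma (1/2 - b) * Cb) * (Gamma (b + 1/2) * Gamma (1/2 - b) * Cb) * (Y1 * (Gamma (b + 1))\<^sup>2) * (a + 1)"
    unfolding R4 using H1(2) by (simp add: Y1_def D1)
  also have "\<dots> = (2 * Cb\<^sup>2 * Y1) * (Gamma (1/2 - b))\<^sup>2 * (Gamma (b + 1/2) * Gamma (b + 1) * ((2 * b + 1) * Gamma (b + 1/2) * Gamma (b + 1)))"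
    by (simp add: power2_eq_square ab mult_ac)
  also have "(2 * b + 1) * Gamma (b + 1/2) * Gamma (b + 1) = a * Gamma b * Gamma (b + 3/2)"
    unfolding P1 P2 ab by (simp add: algebra_simps)
  also have "(2 * Cb\<^sup>2 * Y1) * (Gamma (1/2 - b))\<^sup>2 * (Gamma (b + 1/2) * Gamma (b + 1) * (a * Gamma b * Gamma (b + 3/2)))
    = (2 * a * Cb\<^sup>2 * Y1) * ((Gamma (1/2 - b))\<^sup>2 * (Gamma b * Gamma (b + 1/2) * Gamma (b + 1) * Gamma (b + 3/2)))"
    by (simp add: mult_ac)
  finally have "BQ a * (a + 1) * Y2 * C = 2 * a * Cb\<^sup>2 * Y1"
    using nz by (simp only: mult_cancel_right) auto
  thus ?B by (simp add: Y1_def Y2_def C_def Cb_def b_def)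
qed

section \<open>Solutions around the base point\<close>

text \<open>The solution of \<eta>(\<eta>-1)y'' = a(a+1)y with y(1/2) = \<alpha> and y'(1/2) =
  \<beta>, split into its even and odd part in 2\<eta>-1.\<close>

definition Ya :: "complex \<Rightarrow> complex \<Rightarrow> complex \<Rightarrow> complex \<Rightarrow> complex" where
  "Ya a \<alpha> \<beta> \<eta> = \<alpha> * HS (a/2) (-(a+1)/2) (1/2) ((2*\<eta>-1)\<^sup>2) + \<beta> / 2 * (2*\<eta>-1) * HS ((a+1)/2) (-a/2) (3/2) ((2*\<eta>-1)\<^sup>2)"

definition Ya' :: "complex \<Rightarrow> complex \<Rightarrow> complex \<Rightarrow> complex \<Rightarrow> complex" where
  "Ya' a \<alpha> \<beta> \<eta> = \<alpha> * (HD (a/2) (-(a+1)/2) (1/2) ((2*\<eta>-1)\<^sup>2) * (4 * (2*\<eta>-1)))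
     + \<beta> * (HS ((a+1)/2) (-a/2) (3/2) ((2*\<eta>-1)\<^sup>2) + 2 * (2*\<eta>-1)\<^sup>2 * HD ((a+1)/2) (-a/2) (3/2) ((2*\<eta>-1)\<^sup>2))"

abbreviation hdisc :: "complex set" where "hdisc \<equiv> ball (1/2) (1/2)"

lemma hdisc_norm: "\<eta> \<in> hdisc \<Longrightarrow> norm ((2*\<eta>-1)\<^sup>2) < 1"
proof -
  assume "\<eta> \<in> hdisc"
  hence "norm (\<eta> - 1/2) < 1/2" by (simp add: dist_norm norm_minus_commute)
  moreover have "2 * \<eta> - 1 = 2 * (\<eta> - 1/2)" by (simp add: algebra_simps)
  hence "norm (2 * \<eta> - 1) = 2 * norm (\<eta> - 1/2)" by (simp only: norm_mult) simp
  ultimately have "norm (2 * \<eta> - 1) < 1" by simp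
  thus ?thesis by (simp add: norm_power abs_square_less_1)
qed

lemma half_nonint: "(1/2::complex) \<notin> \<int>\<^sub>\<le>\<^sub>0" "(3/2::complex) \<notin> \<int>\<^sub>\<le>\<^sub>0"
  by (auto elim!: nonpos_Ints_cases simp: complex_eq_iff)

lemma Ya_deriv:
  assumes e: "\<eta> \<in> hdisc"
  shows "(Ya a \<alpha> \<beta> has_field_derivative Ya' a \<alpha> \<beta> \<eta>) (at \<eta>)"
    and "(Ya' a \<alpha> \<beta> has_field_derivative a * (a + 1) * Ya a \<alpha> \<beta> \<eta> / (\<eta> * (\<eta> - 1))) (at \<eta>)"
proof -
  note n = hdisc_norm[OF e]
  have ne: "\<eta> \<noteq> 0" "\<eta> \<noteq> 1" using e by (auto simp: dist_norm)
  define x where "x = 2 * \<eta> - 1"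
  have d: "((\<lambda>\<eta>. (2*\<eta>-1)\<^sup>2) has_field_derivative 4 * x) (at \<eta>)"
    unfolding x_def by (auto intro!: derivative_eq_intros)
  have dx: "((\<lambda>\<eta>. 2*\<eta>-1) has_field_derivative 2) (at \<eta>)"
    by (auto intro!: derivative_eq_intros)
  note S1 = HS_deriv[OF d n] and S2 = HD_deriv[OF d n]
  let ?E = "HS (a/2) (-(a+1)/2) (1/2) (x\<^sup>2)" and ?E' = "HD (a/2) (-(a+1)/2) (1/2) (x\<^sup>2)" and ?E'' = "HDD (a/2) (-(a+1)/2) (1/2) (x\<^sup>2)"
  let ?O = "HS ((a+1)/2) (-a/2) (3/2) (x\<^sup>2)" and ?O' = "HD ((a+1)/2) (-a/2) (3/2) (x\<^sup>2)" and ?O'' = "HDD ((a+1)/2) (-a/2) (3/2) (x\<^sup>2)"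
  show "(Ya a \<alpha> \<beta> has_field_derivative Ya' a \<alpha> \<beta> \<eta>) (at \<eta>)"
    unfolding Ya_def[abs_def] Ya'_def
    by (rule DERIV_add[OF DERIV_cmult[OF S1] DERIV_mult'[OF DERIV_cmult[OF dx] S1], THEN DERIV_cong])
       (simp add: x_def power2_eq_square algebra_simps)
  have E: "x\<^sup>2 * (1 - x\<^sup>2) * ?E'' + (1/2 - (a/2 + (-(a+1)/2) + 1) * x\<^sup>2) * ?E' = a/2 * (-(a+1)/2) * ?E"
    by (rule hypergeometric_ODE[OF half_nonint(1) n[folded x_def]])
  have O: "x\<^sup>2 * (1 - x\<^sup>2) * ?O'' + (3/2 - ((a+1)/2 + (-a/2) + 1) * x\<^sup>2) * ?O' = (a+1)/2 * (-a/2) * ?O"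
    by (rule hypergeometric_ODE[OF half_nonint(2) n[folded x_def]])
  have co: "a/2 + (-(a+1)/2) + 1 = 1/2" "(a+1)/2 + (-a/2) + 1 = 3/2" by (simp_all add: field_simps)
  have E1: "(1 - x\<^sup>2) * (4 * x\<^sup>2 * ?E'' + 2 * ?E') = - a * (a + 1) * ?E"
  proof -
    have "2 * ((1 - x\<^sup>2) * (4 * x\<^sup>2 * ?E'' + 2 * ?E')) = 2 * (- a * (a + 1) * ?E)"
      using E unfolding co by (simp add: field_simps)
    thus ?thesis by (simp only: mult_cancel_left) simp
  qed
  have O1: "(1 - x\<^sup>2) * (4 * x\<^sup>2 * ?O'' + 6 * ?O') = - a * (a + 1) * ?O"
  proof -
    have "2 * ((1 - x\<^sup>2) * (4 * x\<^sup>2 * ?O'' + 6 * ?O')) = 2 * (- a * (a + 1) * ?O)"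
      using O unfolding co by (simp add: field_simps)
    thus ?thesis by (simp only: mult_cancel_left) simp
  qed
  have D: "(Ya' a \<alpha> \<beta> has_field_derivative \<alpha> * (?E'' * (4*x) * (4*x) + ?E' * 8)
     + \<beta> * (?O' * (4*x) + (8 * x * ?O' + 2 * x\<^sup>2 * (?O'' * (4*x))))) (at \<eta>)"
    unfolding Ya'_def[abs_def]
    apply (rule DERIV_add[OF DERIV_cmult[OF DERIV_mult'[OF S2 DERIV_cmult[OF dx]]]
             DERIV_cmult[OF DERIV_add[OF S1 DERIV_mult'[OF DERIV_cmult[OF d] S2]]], THEN DERIV_cong])
    by (simp add: x_def algebra_simps)
  have x2: "1 - x\<^sup>2 = - 4 * (\<eta> * (\<eta> - 1))" by (simp add: x_def power2_eq_square algebra_simps)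
  have nz: "\<eta> * (\<eta> - 1) \<noteq> 0" using ne by simp
  have "(\<eta> * (\<eta> - 1)) * (\<alpha> * (?E'' * (4*x) * (4*x) + ?E' * 8) + \<beta> * (?O' * (4*x) + (8 * x * ?O' + 2 * x\<^sup>2 * (?O'' * (4*x)))))
     = - \<alpha> * ((1 - x\<^sup>2) * (4 * x\<^sup>2 * ?E'' + 2 * ?E')) - \<beta> / 2 * x * ((1 - x\<^sup>2) * (4 * x\<^sup>2 * ?O'' + 6 * ?O'))"
    unfolding x2 by (simp add: power2_eq_square algebra_simps)
  also have "\<dots> = a * (a + 1) * Ya a \<alpha> \<beta> \<eta>"
    unfolding E1 O1 Ya_def by (simp add: x_def algebra_simps)
  finally have "\<alpha> * (?E'' * (4*x) * (4*x) + ?E' * 8) + \<beta> * (?O' * (4*x) + (8 * x * ?O' + 2 * x\<^sup>2 * (?O'' * (4*x)))) = a * (a + 1) * Ya a \<alpha> \<beta> \<eta> / (\<eta> * (\<eta> - 1))"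
    using nz by (simp add: eq_divide_eq mult.commute)
  with D show "(Ya' a \<alpha> \<beta> has_field_derivative a * (a + 1) * Ya a \<alpha> \<beta> \<eta> / (\<eta> * (\<eta> - 1))) (at \<eta>)" by simp
qed

lemma Ya_half: "Ya a \<alpha> \<beta> (1/2) = \<alpha>" "Ya' a \<alpha> \<beta> (1/2) = \<beta>"
  by (simp_all add: Ya_def Ya'_def)

text \<open>The odd part changes sign and the even part does not. \<open>Fc_pieces\<close> uses this
  to continue into the lower half-plane.\<close>

lemma Ya_reflect: "Ya a \<alpha> \<beta> (1 - \<eta>) = Ya a \<alpha> (- \<beta>) \<eta>"
proof -
  define x where "x = 2 * \<eta> - 1"
  have e: "2 * (1 - \<eta>) - 1 = - x" by (simp add: x_def algebra_simps)
  show ?thesis unfolding Ya_def e x_def[symmetric] power2_minus by simp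
qed

text \<open>The equation has no first-order term, so Wronskians are constant.\<close>

lemma wronskian_deriv:
  assumes "(f has_field_derivative f' \<eta>) (at \<eta>)" "(f' has_field_derivative q * f \<eta>) (at \<eta>)"
    and "(g has_field_derivative g' \<eta>) (at \<eta>)" "(g' has_field_derivative q * g \<eta>) (at \<eta>)"
  shows "((\<lambda>\<eta>. f \<eta> * g' \<eta> - f' \<eta> * g \<eta>) has_field_derivative 0) (at (\<eta>::complex))"
  by (rule DERIV_diff[OF DERIV_mult'[OF assms(1,4)] DERIV_mult'[OF assms(2,3)], THEN DERIV_cong]) (simp add: algebra_simps)

lemma tendsto_eta_of: "((\<lambda>r. eta_of (complex_of_real r)) \<longlongrightarrow> 1/2) (at_left 1)"
proof -
  have "((\<lambda>r. 1/2 + \<i> * (1 / complex_of_real r - complex_of_real r) / 4) \<longlongrightarrow> 1/2 + \<i> * (1 / complex_of_real 1 - complex_of_real 1) / 4) (at_left 1)"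
    by (intro tendsto_intros) auto
  thus ?thesis by (simp add: eta_of_def)
qed

lemma eventually_eta_of: "eventually (\<lambda>r. eta_of (complex_of_real r) \<in> UHP \<inter> hdisc) (at_left 1)"
proof -
  have "eventually (\<lambda>r. eta_of (complex_of_real r) \<in> hdisc) (at_left 1)"
    using tendsto_eta_of by (rule topological_tendstoD) auto
  moreover have "eventually (\<lambda>r::real. r \<in> {0<..<1}) (at_left 1)"
    by (rule eventually_at_left_real) simp
  ultimately show ?thesis
    by eventually_elim (auto intro!: Im_eta_of)
qed

text \<open>The Wronskians of f with the solutions \<open>Ya\<close> are constant on the convex half
  disc. The limits of f and f' at its boundary point 1/2, taken along the vertical path \<eta> =
  \<open>eta_of r\<close> with r -> 1, evaluate these constants, and they determine f.\<close>

lemma half_disc_match: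
  assumes f: "\<And>\<eta>. \<eta> \<in> UHP \<Longrightarrow> (f has_field_derivative f' \<eta>) (at \<eta>)"
    and f': "\<And>\<eta>. \<eta> \<in> UHP \<Longrightarrow> (f' has_field_derivative a * (a + 1) * f \<eta> / (\<eta> * (\<eta> - 1))) (at \<eta>)"
    and lim: "((\<lambda>r. f (eta_of (complex_of_real r))) \<longlongrightarrow> \<alpha>) (at_left 1)" "((\<lambda>r. f' (eta_of (complex_of_real r))) \<longlongrightarrow> \<beta>) (at_left 1)"
    and e: "\<eta> \<in> UHP \<inter> hdisc"
  shows "f \<eta> = Ya a \<alpha> \<beta> \<eta>"
proof -
  have cv: "convex (UHP \<inter> hdisc)" by (intro convex_Int convex_halfspace_Im_gt convex_ball)
  have W: "f x * Ya' a \<gamma> \<delta> x - f' x * Ya a \<gamma> \<delta> x = \<alpha> * \<delta> - \<beta> * \<gamma>" if x: "x \<in> UHP \<inter> hdisc" for x \<gamma> \<delta>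
  proof -
    define w where "w x = f x * Ya' a \<gamma> \<delta> x - f' x * Ya a \<gamma> \<delta> x" for x
    have "(w has_field_derivative 0) (at x within UHP \<inter> hdisc)" if "x \<in> UHP \<inter> hdisc" for x
      unfolding w_def[abs_def]
      using wronskian_deriv[of f f' x "a * (a + 1) / (x * (x - 1))" "Ya a \<gamma> \<delta>" "Ya' a \<gamma> \<delta>"] f[of x] f'[of x] Ya_deriv[of x a \<gamma> \<delta>] that
      by (simp add: has_field_derivative_at_within)
    then obtain k where k: "\<And>x. x \<in> UHP \<inter> hdisc \<Longrightarrow> w x = k"
      using has_field_derivative_zero_constant[OF cv] by blast
    have "isCont (Ya a \<gamma> \<delta>) (1/2)" "isCont (Ya' a \<gamma> \<delta>) (1/2)"
      using Ya_deriv[of "1/2" a \<gamma> \<delta>] by (auto intro: DERIV_isCont)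
    hence "((\<lambda>r. w (eta_of (complex_of_real r))) \<longlongrightarrow> \<alpha> * Ya' a \<gamma> \<delta> (1/2) - \<beta> * Ya a \<gamma> \<delta> (1/2)) (at_left 1)"
      unfolding w_def by (intro tendsto_diff tendsto_mult lim isCont_tendsto_compose[OF _ tendsto_eta_of])
    moreover have "((\<lambda>r. w (eta_of (complex_of_real r))) \<longlongrightarrow> k) (at_left 1)"
      by (rule tendsto_eventually) (use eventually_eta_of k in \<open>auto elim: eventually_mono\<close>)
    ultimately have "k = \<alpha> * Ya' a \<gamma> \<delta> (1/2) - \<beta> * Ya a \<gamma> \<delta> (1/2)"
      using tendsto_unique[OF trivial_limit_at_left_real] by blast
    thus ?thesis using k[OF x] by (simp add: w_def Ya_half)
  qed
  have WY: "Ya a 1 0 \<eta> * Ya' a 0 1 \<eta> - Ya' a 1 0 \<eta> * Ya a 0 1 \<eta> = 1"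
  proof -
    define w where "w x = Ya a 1 0 x * Ya' a 0 1 x - Ya' a 1 0 x * Ya a 0 1 x" for x
    have "(w has_field_derivative 0) (at x within hdisc)" if "x \<in> hdisc" for x
      unfolding w_def[abs_def]
      using wronskian_deriv[of "Ya a 1 0" "Ya' a 1 0" x "a * (a + 1) / (x * (x - 1))" "Ya a 0 1" "Ya' a 0 1"] Ya_deriv[of x a] that
      by (simp add: has_field_derivative_at_within)
    then obtain k where k: "\<And>x. x \<in> hdisc \<Longrightarrow> w x = k"
      using has_field_derivative_zero_constant[OF convex_ball] by blast
    have "w \<eta> = w (1/2)" using k[of \<eta>] k[of "1/2"] e by simp
    thus ?thesis by (simp add: w_def Ya_half)
  qed
  \<comment> \<open>Cramer's rule: the two basis solutions have Wronskian 1.\<close>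
  have "f \<eta> = f \<eta> * (Ya a 1 0 \<eta> * Ya' a 0 1 \<eta> - Ya' a 1 0 \<eta> * Ya a 0 1 \<eta>)" by (simp add: WY)
  also have "\<dots> = (f \<eta> * Ya' a 0 1 \<eta> - f' \<eta> * Ya a 0 1 \<eta>) * Ya a 1 0 \<eta> - (f \<eta> * Ya' a 1 0 \<eta> - f' \<eta> * Ya a 1 0 \<eta>) * Ya a 0 1 \<eta>"
    by (simp add: algebra_simps)
  also have "\<dots> = \<alpha> * Ya a 1 0 \<eta> + \<beta> * Ya a 0 1 \<eta>" unfolding W[OF e] by simp
  also have "\<dots> = Ya a \<alpha> \<beta> \<eta>" by (simp add: Ya_def)
  finally show ?thesis .
qed

lemma fsol_limit:
  assumes \<nu>: "Im \<nu> \<noteq> 0"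
  shows "((\<lambda>r. fsol \<nu> (eta_of (complex_of_real r))) \<longlongrightarrow> EE \<nu> 1 * (csqrt 2 * Gh \<nu> (1/2))) (at_left 1)"
    and "((\<lambda>r. fsol' \<nu> (eta_of (complex_of_real r))) \<longlongrightarrow> \<nu> * EE (\<nu>+1) 1 * (Jh \<nu> (1/2) / csqrt 2)) (at_left 1)"
proof -
  have ev: "eventually (\<lambda>r::real. 0 < r \<and> r < 1) (at_left 1)"
    using eventually_at_left_real[of 0 "1::real"] by (auto elim: eventually_mono)
  have cE: "((\<lambda>r. EE \<mu> (complex_of_real r)) \<longlongrightarrow> EE \<mu> (complex_of_real 1)) (at_left 1)" for \<mu>
    unfolding EE_def by (intro tendsto_intros) (auto simp: complex_nonpos_Reals_iff)
  have cq: "((\<lambda>r. csqrt (1 + (complex_of_real r)\<^sup>2)) \<longlongrightarrow> csqrt (1 + (complex_of_real 1)\<^sup>2)) (at_left 1)"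
    by (intro isCont_tendsto_compose[OF continuous_at_csqrt] tendsto_intros) (auto simp: complex_nonpos_Reals_iff)
  have cx: "((\<lambda>r. (complex_of_real r)\<^sup>2 / (1 + (complex_of_real r)\<^sup>2)) \<longlongrightarrow> (complex_of_real 1)\<^sup>2 / (1 + (complex_of_real 1)\<^sup>2)) (at_left 1)"
    by (intro tendsto_intros) (auto simp: complex_eq_iff)
  have cH: "isCont (HS A B C) ((complex_of_real 1)\<^sup>2 / (1 + (complex_of_real 1)\<^sup>2))" for A B C
    using HS_deriv[OF DERIV_ident, of "(complex_of_real 1)\<^sup>2 / (1 + (complex_of_real 1)\<^sup>2)" A B C] by (auto intro: DERIV_isCont)
  have v: "Re (complex_of_real r) > 0" "norm (complex_of_real r) < 1" "Re ((complex_of_real r)\<^sup>2) > - 1/2" if "0 < r \<and> r < 1" for r :: real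
    using that by (auto simp: power2_eq_square intro: order_less_le_trans[of _ 0])
  have "((\<lambda>r. EE \<nu> (complex_of_real r) * (csqrt (1 + (complex_of_real r)\<^sup>2) * Gh \<nu> ((complex_of_real r)\<^sup>2 / (1 + (complex_of_real r)\<^sup>2))))
     \<longlongrightarrow> EE \<nu> (complex_of_real 1) * (csqrt (1 + (complex_of_real 1)\<^sup>2) * Gh \<nu> ((complex_of_real 1)\<^sup>2 / (1 + (complex_of_real 1)\<^sup>2)))) (at_left 1)"
    unfolding Gh_def by (intro tendsto_mult cE cq isCont_tendsto_compose[OF cH cx])
  moreover have "eventually (\<lambda>r. fsol \<nu> (eta_of (complex_of_real r)) = EE \<nu> (complex_of_real r) * (csqrt (1 + (complex_of_real r)\<^sup>2) * Gh \<nu> ((complex_of_real r)\<^sup>2 / (1 + (complex_of_real r)\<^sup>2)))) (at_left 1)"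
    using ev by eventually_elim (rule fsol_eta_of(1)[OF \<nu> v])
  ultimately show "((\<lambda>r. fsol \<nu> (eta_of (complex_of_real r))) \<longlongrightarrow> EE \<nu> 1 * (csqrt 2 * Gh \<nu> (1/2))) (at_left 1)"
    by (simp add: tendsto_cong)
  have "((\<lambda>r. \<nu> * EE (\<nu>+1) (complex_of_real r) * (Jh \<nu> ((complex_of_real r)\<^sup>2 / (1 + (complex_of_real r)\<^sup>2)) / csqrt (1 + (complex_of_real r)\<^sup>2)))
     \<longlongrightarrow> \<nu> * EE (\<nu>+1) (complex_of_real 1) * (Jh \<nu> ((complex_of_real 1)\<^sup>2 / (1 + (complex_of_real 1)\<^sup>2)) / csqrt (1 + (complex_of_real 1)\<^sup>2))) (at_left 1)"
    unfolding Jh_def by (intro tendsto_mult tendsto_divide tendsto_const cE cq isCont_tendsto_compose[OF cH cx]) simp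
  moreover have "eventually (\<lambda>r. fsol' \<nu> (eta_of (complex_of_real r)) = \<nu> * EE (\<nu>+1) (complex_of_real r) * (Jh \<nu> ((complex_of_real r)\<^sup>2 / (1 + (complex_of_real r)\<^sup>2)) / csqrt (1 + (complex_of_real r)\<^sup>2))) (at_left 1)"
    using ev by eventually_elim (rule fsol_eta_of(2)[OF \<nu> v])
  ultimately show "((\<lambda>r. fsol' \<nu> (eta_of (complex_of_real r))) \<longlongrightarrow> \<nu> * EE (\<nu>+1) 1 * (Jh \<nu> (1/2) / csqrt 2)) (at_left 1)"
    by (simp add: tendsto_cong)
qed

section \<open>Two-by-two matrices and the constants of Q\<close>

lemma mat2_mult: "mat2 a b c d ** mat2 a' b' c' d' = mat2 (a*a'+b*c') (a*b'+b*d') (c*a'+d*c') (c*b'+d*d')"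
  by (simp add: mat2_def matrix_matrix_mult_def vec_eq_iff forall_2 sum_2 vector_2)

lemma mat2_add: "mat2 a b c d + mat2 a' b' c' d' = mat2 (a+a') (b+b') (c+c') (d+d')"
  by (simp add: mat2_def vec_eq_iff forall_2 vector_2)

lemma mat2_one: "mat 1 = mat2 1 0 0 1"
  by (simp add: mat2_def mat_def vec_eq_iff forall_2 vector_2)

lemma mat2_eq: "mat2 a b c d = mat2 a' b' c' d' \<longleftrightarrow> a = a' \<and> b = b' \<and> c = c' \<and> d = d'"
  by (auto simp: mat2_def vec_eq_iff forall_2 vector_2)

lemma sigma2_conj: "sigma2 ** mat2 a b c d ** sigma2 = mat2 d (-c) (-b) a"
  by (simp add: sigma2_def mat2_mult mat2_eq complex_eq_iff)

lemma sigma1_conj: "sigma1 ** mat2 a b c d ** sigma1 = mat2 d c b a"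
  by (simp add: sigma1_def mat2_mult)

lemma matrix_inv_eq:
  fixes A B :: "complex^2^2"
  assumes "A ** B = mat 1" shows "matrix_inv A = B"
proof -
  have "B ** A = mat 1" using assms matrix_left_right_inverse by blast
  hence "A ** B = mat 1 \<and> B ** A = mat 1" using assms by simp
  hence "A ** matrix_inv A = mat 1 \<and> matrix_inv A ** A = mat 1"
    unfolding matrix_inv_def by (rule someI)
  hence "matrix_inv A ** (A ** B) = B" by (simp add: matrix_mul_assoc)
  thus ?thesis by (simp add: assms)
qed

text \<open>For square matrices a right inverse of the product makes both factors invertible, so
  neither has to be inverted by itself. Applied to \<open>Gamma_hat a (1/2)\<close> and
  \<open>Q_mat a\<close>.\<close>

lemma matrix_inv_product:
  fixes A B F :: "complex^2^2"
  assumes "A ** B ** F = mat 1"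
  shows "matrix_inv B ** matrix_inv A = F"
proof -
  have 1: "F ** (A ** B) = mat 1" using assms matrix_left_right_inverse by blast
  have "(F ** A) ** B = mat 1" using 1 by (simp add: matrix_mul_assoc)
  hence "B ** (F ** A) = mat 1" using matrix_left_right_inverse by blast
  hence B: "matrix_inv B = F ** A" by (rule matrix_inv_eq)
  have A: "matrix_inv A = B ** F" using assms by (intro matrix_inv_eq) (simp add: matrix_mul_assoc)
  have "matrix_inv B ** matrix_inv A = (F ** (A ** B)) ** F" unfolding A B by (simp add: matrix_mul_assoc)
  thus ?thesis by (simp add: 1)
qed

definition ee :: "complex \<Rightarrow> complex" where "ee a = exp (a * pi * \<i>)"
text \<open>\<open>- TT a\<close> and \<open>KQ a\<close> are the diagonal entries of the left
  factor of \<open>Q_mat a\<close>.\<close>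

definition KQ :: "complex \<Rightarrow> complex" where "KQ a = 4 powr (2 * a + 1) * ee a * BQ a"
definition TT :: "complex \<Rightarrow> complex" where "TT a = tan (a * pi)"

lemma norm_ee: "norm (ee a) = exp (- pi * Im a)" by (simp add: ee_def mult.commute)

lemma ee_ne:
  assumes a: "Im a \<noteq> 0"
  shows "ee a \<noteq> 0" "1 + ee a \<noteq> 0" "ee a - 1 \<noteq> 0" "1 + (ee a)\<^sup>2 \<noteq> 0"
proof -
  have n: "norm (ee a) \<noteq> 1" using a by (simp add: norm_ee)
  show "ee a \<noteq> 0" by (simp add: ee_def)
  show "1 + ee a \<noteq> 0" using n by (metis add_eq_0_iff norm_minus_cancel norm_one)
  show "ee a - 1 \<noteq> 0" using n by auto
  have "norm ((ee a)\<^sup>2) \<noteq> 1" using n by (metis norm_ge_zero norm_power power2_eq_1_iff zero_le_one le_minus_one_simps(3))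
  thus "1 + (ee a)\<^sup>2 \<noteq> 0" by (metis add_eq_0_iff norm_minus_cancel norm_one)
qed

lemma EE_split: "EE \<nu> v = EE \<nu> 1 * exp (\<nu> * Ln v)"
  by (simp add: EE_def distrib_left exp_add)

text \<open>The factor \<open>4^(2a+1) exp(a pi \<i>)\<close> of Q is what turns the prefactor
  \<open>(4\<i>)^(-a-1)\<close> of the second solution into \<open>-\<i>\<close> times the prefactor
  \<open>(4\<i>)^a\<close> of the first.\<close>

lemma KQ_EE: "KQ a * EE (- a - 1) 1 = - \<i> * BQ a * EE a 1"
proof -
  define l where "l = complex_of_real (ln 4)"
  have ln4: "Ln 4 = l" unfolding l_def using Ln_of_real[of 4] by simp
  have p: "4 powr (2 * a + 1) = exp ((2 * a + 1) * l)" by (simp add: powr_def ln4)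
  have i: "exp (- \<i> * complex_of_real (pi / 2)) = - \<i>"
    by (simp add: exp_minus_Euler cos_of_real sin_of_real del: of_real_divide)
  have "(2 * a + 1) * l + a * pi * \<i> + (- a - 1) * (\<i> * pi / 2 + l) = a * (\<i> * pi / 2 + l) + (- \<i> * complex_of_real (pi / 2))"
    by (simp add: field_simps)
  hence "exp ((2 * a + 1) * l) * exp (a * pi * \<i>) * exp ((- a - 1) * (\<i> * pi / 2 + l)) = exp (a * (\<i> * pi / 2 + l)) * (- \<i>)"
    by (metis exp_add i)
  thus ?thesis unfolding KQ_def ee_def p EE_def l_def[symmetric] by (simp add: mult_ac)
qed

lemma half_angle:
  fixes a :: complex
  defines "S \<equiv> sin (a / 2 * pi)" and "Cb \<equiv> cos (a / 2 * pi)" and "C \<equiv> cos (a * pi)"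
  shows "1 + ee a = 2 * Cb * (Cb + \<i> * S)" "ee a - 1 = 2 * \<i> * S * (Cb + \<i> * S)" "sin (a * pi) = 2 * S * Cb"
proof -
  have "a * pi * \<i> = 2 * (\<i> * (a / 2 * pi))" by simp
  hence "ee a = (exp (\<i> * (a / 2 * pi)))\<^sup>2" unfolding ee_def by (simp only: exp_double)
  hence e: "ee a = (Cb + \<i> * S)\<^sup>2" by (simp only: exp_Euler S_def Cb_def)
  have one: "S\<^sup>2 + Cb\<^sup>2 = 1" by (simp add: S_def Cb_def)
  have ii: "\<i> * \<i> = -1" by simp
  show "1 + ee a = 2 * Cb * (Cb + \<i> * S)" using e one ii by algebra
  show "ee a - 1 = 2 * \<i> * S * (Cb + \<i> * S)" using e one ii by algebra
  have "a * pi = 2 * (a / 2 * pi)" by simp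
  hence "sin (a * pi) = sin (2 * (a / 2 * pi))" by simp
  thus "sin (a * pi) = 2 * S * Cb" unfolding S_def Cb_def by (simp only: sin_double)
qed

lemma half_nonzero:
  assumes "Im \<nu> \<noteq> 0" shows "Gh \<nu> (1/2) \<noteq> 0" "Jh \<nu> (1/2) \<noteq> 0"
proof -
  have "Gamma (\<nu>/2 + of_real r) \<noteq> 0" for r using assms by (intro Gamma_nonzero nonint_Im) simp
  from this[of "3/4"] this[of "5/4"] have "Gamma (\<nu>/2 + 3/4) * Gamma (\<nu>/2 + 5/4) \<noteq> 0" by simp
  thus "Gh \<nu> (1/2) \<noteq> 0" "Jh \<nu> (1/2) \<noteq> 0" using Gh_half[OF assms] by auto
qed

lemma TT_ne: "Im a \<noteq> 0 \<Longrightarrow> TT a \<noteq> 0"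
  using sin_cos_nz[of "a * pi"] by (simp add: TT_def tan_def)

text \<open>\<open>BQ_identities\<close> in terms of \<open>ee a\<close>: the squares of half-angle
  functions are traded for 1 + \<open>ee a\<close> and \<open>ee a\<close> - 1, which contain the
  cosine and the sine of a pi/2, and for the double angle in \<open>TT\<close>.\<close>

lemma BQ_half:
  assumes a: "Im a \<noteq> 0"
  shows "\<i> * BQ a * Gh (- a - 1) (1/2) * (1 + ee a) = TT a * (1 - ee a) * Gh a (1/2)"
    and "BQ a * (a + 1) * Jh (- a - 1) (1/2) * (ee a - 1) = \<i> * a * TT a * (1 + ee a) * Jh a (1/2)"
proof -
  define S Cb C where "S = sin (a / 2 * pi)" and "Cb = cos (a / 2 * pi)" and "C = cos (a * pi)"
  note h = half_angle[of a, folded S_def Cb_def C_def]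
  note b = BQ_identities[OF a, folded S_def Cb_def C_def]
  have C0: "C \<noteq> 0" using sin_cos_nz[of "a * pi"] a by (simp add: C_def)
  have T: "TT a * C = 2 * S * Cb" using h(3) C0 by (simp add: TT_def tan_def C_def)
  have e1: "1 - ee a = - (2 * \<i> * S * (Cb + \<i> * S))" using h(2) by algebra
  have ii: "\<i> * \<i> = -1" by simp
  define W where "W = Cb + \<i> * S"
  define BG where "BG = BQ a * Gh (- a - 1) (1/2)"
  define BJ where "BJ = BQ a * (a + 1) * Jh (- a - 1) (1/2)"
  have "C * (\<i> * BG * (2 * Cb * W)) = \<i> * (2 * Cb * W) * (BG * C)" by (simp add: mult_ac)
  also have "\<dots> = - ((TT a * C) * (2 * \<i> * S * W) * Gh a (1/2))"
    unfolding BG_def b(1) T by (simp add: power2_eq_square mult_ac)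
  finally have "C * (\<i> * BG * (2 * Cb * W)) = C * (TT a * (- (2 * \<i> * S * W)) * Gh a (1/2))" by algebra
  hence "\<i> * BG * (2 * Cb * W) = TT a * (- (2 * \<i> * S * W)) * Gh a (1/2)" by (rule mult_left_cancel[THEN iffD1, OF C0])
  thus "\<i> * BQ a * Gh (- a - 1) (1/2) * (1 + ee a) = TT a * (1 - ee a) * Gh a (1/2)"
    unfolding h(1) e1 W_def BG_def by (simp only: mult_ac)
  have "C * (BJ * (2 * \<i> * S * W)) = (2 * \<i> * S * W) * (BJ * C)" by (simp add: mult_ac)
  also have "\<dots> = \<i> * a * (TT a * C) * (2 * Cb * W) * Jh a (1/2)"
    unfolding BJ_def b(2) T by (simp add: power2_eq_square mult_ac)
  finally have "C * (BJ * (2 * \<i> * S * W)) = C * (\<i> * a * TT a * (2 * Cb * W) * Jh a (1/2))" by algebra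
  hence "BJ * (2 * \<i> * S * W) = \<i> * a * TT a * (2 * Cb * W) * Jh a (1/2)" by (rule mult_left_cancel[THEN iffD1, OF C0])
  thus "BQ a * (a + 1) * Jh (- a - 1) (1/2) * (ee a - 1) = \<i> * a * TT a * (1 + ee a) * Jh a (1/2)"
    unfolding h(1,2) W_def BJ_def by (simp only: mult_ac)
qed

lemma KQ_ne: "Im a \<noteq> 0 \<Longrightarrow> KQ a \<noteq> 0"
proof
  assume a: "Im a \<noteq> 0" and "KQ a = 0"
  hence "BQ a = 0" by (simp add: KQ_def ee_def)
  hence "TT a * (1 - ee a) * Gh a (1/2) = 0" using BQ_half(1)[OF a] by simp
  thus False using TT_ne[OF a] half_nonzero[OF a] ee_ne(3)[OF a] by auto
qed

section \<open>The columns and their continuation across (0,1)\<close>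

text \<open>\<open>col1\<close> and \<open>col1'\<close> form the first column of
  \<open>Gamma_hat a \<eta> ** Q_mat a\<close> in the upper half-plane, \<open>col2\<close> and
  \<open>col2'\<close> the second.\<close>

definition col1 :: "complex \<Rightarrow> complex \<Rightarrow> complex" where
  "col1 a \<eta> = - TT a * fsol a \<eta> - ee a * KQ a * fsol (- a - 1) \<eta>"
definition col1' :: "complex \<Rightarrow> complex \<Rightarrow> complex" where
  "col1' a \<eta> = - TT a * fsol' a \<eta> - ee a * KQ a * fsol' (- a - 1) \<eta>"
definition col2 :: "complex \<Rightarrow> complex \<Rightarrow> complex" where
  "col2 a \<eta> = - ee a * TT a * fsol a \<eta> + KQ a * fsol (- a - 1) \<eta>"
definition col2' :: "complex \<Rightarrow> complex \<Rightarrow> complex" where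
  "col2' a \<eta> = - ee a * TT a * fsol' a \<eta> + KQ a * fsol' (- a - 1) \<eta>"

text \<open>\<open>c\<alpha>\<close> and \<open>c\<beta>\<close> are the value and the derivative of
  the first column at \<eta> = 1/2, with the second solution already eliminated.\<close>

definition c\<alpha> :: "complex \<Rightarrow> complex" where
  "c\<alpha> a = - TT a * (1 + (ee a)\<^sup>2) / (1 + ee a) * (EE a 1 * (csqrt 2 * Gh a (1/2)))"
definition c\<beta> :: "complex \<Rightarrow> complex" where
  "c\<beta> a = TT a * (1 + (ee a)\<^sup>2) / (ee a - 1) * (a * EE (a+1) 1 * (Jh a (1/2) / csqrt 2))"

lemma c\<alpha>_ne: "Im a \<noteq> 0 \<Longrightarrow> c\<alpha> a \<noteq> 0" and c\<beta>_ne: "Im a \<noteq> 0 \<Longrightarrow> c\<beta> a \<noteq> 0"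
  using TT_ne[of a] ee_ne[of a] half_nonzero[of a] by (auto simp: c\<alpha>_def c\<beta>_def EE_def)

lemma col_deriv:
  assumes a: "Im a \<noteq> 0" and e: "\<eta> \<in> UHP"
  shows "(col1 a has_field_derivative col1' a \<eta>) (at \<eta>)" "(col1' a has_field_derivative a * (a + 1) * col1 a \<eta> / (\<eta> * (\<eta> - 1))) (at \<eta>)"
    "(col2 a has_field_derivative col2' a \<eta>) (at \<eta>)" "(col2' a has_field_derivative a * (a + 1) * col2 a \<eta> / (\<eta> * (\<eta> - 1))) (at \<eta>)"
proof -
  have n: "Im (- a - 1) \<noteq> 0" using a by simp
  note d = fsol_deriv[OF a e] fsol_deriv[OF n e]
  have s: "(- a - 1) * (- a - 1 + 1) = a * (a + 1)" by (simp add: algebra_simps)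
  show "(col1 a has_field_derivative col1' a \<eta>) (at \<eta>)" unfolding col1_def[abs_def] col1'_def
    by (rule DERIV_diff[OF DERIV_cmult[OF d(1)] DERIV_cmult[OF d(3)]])
  show "(col2 a has_field_derivative col2' a \<eta>) (at \<eta>)" unfolding col2_def[abs_def] col2'_def
    by (rule DERIV_add[OF DERIV_cmult[OF d(1)] DERIV_cmult[OF d(3)]])
  show "(col1' a has_field_derivative a * (a + 1) * col1 a \<eta> / (\<eta> * (\<eta> - 1))) (at \<eta>)"
    unfolding col1_def col1'_def[abs_def]
    by (rule DERIV_diff[OF DERIV_cmult[OF d(2)] DERIV_cmult[OF d(4)[unfolded s]], THEN DERIV_cong])
       (simp add: diff_divide_distrib right_diff_distrib mult_ac)
  show "(col2' a has_field_derivative a * (a + 1) * col2 a \<eta> / (\<eta> * (\<eta> - 1))) (at \<eta>)"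
    unfolding col2_def col2'_def[abs_def]
    by (rule DERIV_add[OF DERIV_cmult[OF d(2)] DERIV_cmult[OF d(4)[unfolded s]], THEN DERIV_cong])
       (simp add: add_divide_distrib diff_divide_distrib right_diff_distrib distrib_left mult_ac)
qed

text \<open>The effect of Q: at \<eta> = 1/2 the two columns have equal values and opposite
  derivatives, which makes them reflections of each other under \<eta> -> 1-\<eta>.\<close>

lemma col_limits:
  assumes a: "Im a \<noteq> 0"
  shows "((\<lambda>r. col1 a (eta_of (complex_of_real r))) \<longlongrightarrow> c\<alpha> a) (at_left 1)"
    "((\<lambda>r. col1' a (eta_of (complex_of_real r))) \<longlongrightarrow> c\<beta> a) (at_left 1)"
    "((\<lambda>r. col2 a (eta_of (complex_of_real r))) \<longlongrightarrow> c\<alpha> a) (at_left 1)"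
    "((\<lambda>r. col2' a (eta_of (complex_of_real r))) \<longlongrightarrow> - c\<beta> a) (at_left 1)"
proof -
  define e where "e = ee a"
  define m where "m = 1 + e"
  define n where "n = e - 1"
  have in1: "Im (- a - 1) \<noteq> 0" using a by simp
  have ne: "m \<noteq> 0" "n \<noteq> 0" using ee_ne[OF a] by (auto simp: e_def m_def n_def)
  define h0 h1 s0 s1 where "h0 = EE a 1 * (csqrt 2 * Gh a (1/2))" and "h1 = a * EE (a+1) 1 * (Jh a (1/2) / csqrt 2)"
    and "s0 = EE (- a - 1) 1 * (csqrt 2 * Gh (- a - 1) (1/2))" and "s1 = (- a - 1) * EE (- a - 1 + 1) 1 * (Jh (- a - 1) (1/2) / csqrt 2)"
  note L = fsol_limit[OF a, folded h0_def h1_def] fsol_limit[OF in1, folded s0_def s1_def]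
  \<comment> \<open>\<open>BQ_half\<close> expresses the limits of the second solution by those of
    the first; keeping m and n as factors postpones the division.\<close>
  have k0: "KQ a * s0 * m = TT a * h0 * n"
  proof -
    have "KQ a * s0 * m = (KQ a * EE (- a - 1) 1) * (csqrt 2 * Gh (- a - 1) (1/2)) * m" by (simp add: s0_def)
    also have "\<dots> = - (\<i> * BQ a * Gh (- a - 1) (1/2) * (1 + ee a)) * EE a 1 * csqrt 2"
      unfolding KQ_EE by (simp add: m_def e_def)
    also have "\<dots> = TT a * h0 * n" unfolding BQ_half(1)[OF a] by (simp add: h0_def n_def e_def algebra_simps)
    finally show ?thesis .
  qed
  have k1: "KQ a * s1 * n = - TT a * h1 * m"
  proof -
    have "KQ a * s1 * n = (KQ a * EE (- a - 1) 1) * 4 * \<i> * (- (a + 1)) * (Jh (- a - 1) (1/2) / csqrt 2) * n"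
      unfolding s1_def EE_plus1[OF one_neq_zero] by simp
    also have "\<dots> = - 4 * (BQ a * (a + 1) * Jh (- a - 1) (1/2) * (ee a - 1)) * EE a 1 / csqrt 2"
      unfolding KQ_EE by (simp add: n_def e_def algebra_simps add_divide_distrib diff_divide_distrib)
    also have "\<dots> = - TT a * h1 * m" unfolding BQ_half(2)[OF a] h1_def EE_plus1[OF one_neq_zero] by (simp add: m_def e_def mult_ac)
    finally show ?thesis .
  qed
  have ca: "c\<alpha> a * m = - TT a * (1 + e\<^sup>2) * h0" using ne by (simp add: c\<alpha>_def h0_def e_def m_def)
  have cb: "c\<beta> a * n = TT a * (1 + e\<^sup>2) * h1" using ne by (simp add: c\<beta>_def h1_def e_def n_def)
  have 1: "- TT a * h0 - e * KQ a * s0 = c\<alpha> a"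
  proof -
    have "(- TT a * h0 - e * KQ a * s0) * m = c\<alpha> a * m" unfolding ca using k0 unfolding m_def n_def by algebra
    thus ?thesis using ne by simp
  qed
  have 2: "- TT a * h1 - e * KQ a * s1 = c\<beta> a"
  proof -
    have "(- TT a * h1 - e * KQ a * s1) * n = c\<beta> a * n" unfolding cb using k1 unfolding m_def n_def by algebra
    thus ?thesis using ne by simp
  qed
  have 3: "- e * TT a * h0 + KQ a * s0 = c\<alpha> a"
  proof -
    have "(- e * TT a * h0 + KQ a * s0) * m = c\<alpha> a * m" unfolding ca using k0 unfolding m_def n_def by algebra
    thus ?thesis using ne by simp
  qed
  have 4: "- e * TT a * h1 + KQ a * s1 = - c\<beta> a"
  proof -
    have "(- e * TT a * h1 + KQ a * s1) * n = - (c\<beta> a * n)" unfolding cb using k1 unfolding m_def n_def by algebra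
    hence "(- e * TT a * h1 + KQ a * s1) * n = (- c\<beta> a) * n" by simp
    thus ?thesis using ne by (simp only: mult_cancel_right) simp
  qed
  show "((\<lambda>r. col1 a (eta_of (complex_of_real r))) \<longlongrightarrow> c\<alpha> a) (at_left 1)"
    unfolding col1_def 1[symmetric] e_def by (intro tendsto_intros L)
  show "((\<lambda>r. col1' a (eta_of (complex_of_real r))) \<longlongrightarrow> c\<beta> a) (at_left 1)"
    unfolding col1'_def 2[symmetric] e_def by (intro tendsto_intros L)
  show "((\<lambda>r. col2 a (eta_of (complex_of_real r))) \<longlongrightarrow> c\<alpha> a) (at_left 1)"
    unfolding col2_def 3[symmetric] e_def by (intro tendsto_intros L)
  show "((\<lambda>r. col2' a (eta_of (complex_of_real r))) \<longlongrightarrow> - c\<beta> a) (at_left 1)"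
    unfolding col2'_def 4[symmetric] e_def by (intro tendsto_intros L)
qed

text \<open>The continuation of the first column to \<open>eta_dom\<close>: through the disc around
  1/2 into the lower half-plane, where it is the reflected second column.\<close>

definition Fc :: "complex \<Rightarrow> complex \<Rightarrow> complex" where
  "Fc a \<eta> = (if 0 < Im \<eta> then col1 a \<eta> else if \<eta> \<in> hdisc then Ya a (c\<alpha> a) (c\<beta> a) \<eta> else col2 a (1 - \<eta>))"

text \<open>\<open>half_disc_match\<close> identifies each column with a solution \<open>Ya\<close>.
  The initial data differ in the sign of the derivative only, so by \<open>Ya_reflect\<close> the
  three pieces agree where they overlap.\<close>

lemma Fc_pieces:
  assumes a: "Im a \<noteq> 0"
  shows "\<eta> \<in> UHP \<Longrightarrow> Fc a \<eta> = col1 a \<eta>" "\<eta> \<in> hdisc \<Longrightarrow> Fc a \<eta> = Ya a (c\<alpha> a) (c\<beta> a) \<eta>"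
    "Im \<eta> < 0 \<Longrightarrow> Fc a \<eta> = col2 a (1 - \<eta>)"
proof -
  have m1: "col1 a x = Ya a (c\<alpha> a) (c\<beta> a) x" if "x \<in> UHP \<inter> hdisc" for x
    by (rule half_disc_match[of "col1 a" "col1' a" a "c\<alpha> a" "c\<beta> a"])
       (use col_deriv(1,2)[OF a] col_limits(1,2)[OF a] that in blast)+
  have m2: "col2 a x = Ya a (c\<alpha> a) (- c\<beta> a) x" if "x \<in> UHP \<inter> hdisc" for x
    by (rule half_disc_match[of "col2 a" "col2' a" a "c\<alpha> a" "- c\<beta> a"])
       (use col_deriv(3,4)[OF a] col_limits(3,4)[OF a] that in blast)+
  show "\<eta> \<in> UHP \<Longrightarrow> Fc a \<eta> = col1 a \<eta>" by (simp add: Fc_def)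
  show "\<eta> \<in> hdisc \<Longrightarrow> Fc a \<eta> = Ya a (c\<alpha> a) (c\<beta> a) \<eta>" using m1[of \<eta>] by (auto simp: Fc_def)
  assume i: "Im \<eta> < 0"
  show "Fc a \<eta> = col2 a (1 - \<eta>)"
  proof (cases "\<eta> \<in> hdisc")
    case True
    have "dist (1/2) (1 - \<eta>) = dist (1/2) \<eta>"
      by (simp add: dist_norm norm_minus_commute)
    hence "1 - \<eta> \<in> UHP \<inter> hdisc" using True i by simp
    hence "col2 a (1 - \<eta>) = Ya a (c\<alpha> a) (- c\<beta> a) (1 - \<eta>)" by (rule m2)
    also have "\<dots> = Ya a (c\<alpha> a) (c\<beta> a) \<eta>" by (simp add: Ya_reflect)
    finally show ?thesis using True i by (simp add: Fc_def)
  qed (use i in \<open>simp add: Fc_def\<close>)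
qed

lemma eta_dom_cases: "\<eta> \<in> eta_dom \<longleftrightarrow> \<eta> \<in> UHP \<or> \<eta> \<in> hdisc \<or> Im \<eta> < 0"
proof
  assume "\<eta> \<in> eta_dom"
  hence "Im \<eta> \<noteq> 0 \<or> (0 < Re \<eta> \<and> Re \<eta> < 1)"
  proof -
    have "\<not> (0 < Re \<eta> \<and> Re \<eta> < 1) \<Longrightarrow> Im \<eta> = 0 \<Longrightarrow> \<eta> \<in> of_real ` ({..0} \<union> {1..})"
      by (rule image_eqI[of _ _ "Re \<eta>"]) (auto simp: complex_eq_iff)
    thus ?thesis using \<open>\<eta> \<in> eta_dom\<close> by (auto simp: eta_dom_def)
  qed
  thus "\<eta> \<in> UHP \<or> \<eta> \<in> hdisc \<or> Im \<eta> < 0"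
  proof (cases "Im \<eta> = 0")
    case True
    hence "0 < Re \<eta>" "Re \<eta> < 1" "\<eta> = of_real (Re \<eta>)" using \<open>Im \<eta> \<noteq> 0 \<or> _\<close> by (auto simp: complex_eq_iff)
    moreover have "dist (1/2) (complex_of_real (Re \<eta>)) = dist (1/2) (Re \<eta>)"
      using dist_of_real[of "1/2" "Re \<eta>", where ?'a = complex] by simp
    moreover have "\<bar>1/2 - Re \<eta>\<bar> < 1/2" using \<open>0 < Re \<eta>\<close> \<open>Re \<eta> < 1\<close> by linarith
    ultimately have "dist (1/2) \<eta> < 1/2" by (simp add: dist_real_def)
    thus ?thesis by simp
  qed auto
next
  assume h: "\<eta> \<in> UHP \<or> \<eta> \<in> hdisc \<or> Im \<eta> < 0"
  show "\<eta> \<in> eta_dom"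
  proof (rule ccontr)
    assume "\<eta> \<notin> eta_dom"
    then obtain r where r: "\<eta> = of_real r" "r \<le> 0 \<or> r \<ge> 1" by (auto simp: eta_dom_def)
    hence "\<eta> \<in> hdisc" using h by auto
    hence "dist (1/2) r < 1/2" using r dist_of_real[of "1/2" r, where ?'a = complex] by simp
    thus False using r by (auto simp: dist_real_def)
  qed
qed

lemma eta_dom_Un: "eta_dom = UHP \<union> hdisc \<union> {\<eta>. Im \<eta> < 0}"
  by (rule set_eqI) (simp only: eta_dom_cases Un_iff mem_Collect_eq disj_assoc)

lemma open_eta_dom: "open eta_dom"
  unfolding eta_dom_Un by (intro open_Un open_halfspace_Im_gt open_halfspace_Im_lt open_ball)

lemma connected_eta_dom: "connected eta_dom"
proof -
  have 1: "UHP \<inter> hdisc \<noteq> {}" "hdisc \<inter> {\<eta>. Im \<eta> < 0} \<noteq> {}"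
  proof -
    have "1/2 + \<i>/4 \<in> UHP \<inter> hdisc" "1/2 - \<i>/4 \<in> hdisc \<inter> {\<eta>. Im \<eta> < 0}" by (simp_all add: dist_norm norm_divide)
    thus "UHP \<inter> hdisc \<noteq> {}" "hdisc \<inter> {\<eta>. Im \<eta> < 0} \<noteq> {}" by blast+
  qed
  have "connected (UHP \<union> hdisc)"
    by (intro connected_Un convex_connected convex_halfspace_Im_gt convex_ball 1)
  thus ?thesis unfolding eta_dom_Un
    by (rule connected_Un) (use 1 in \<open>auto intro: convex_connected convex_halfspace_Im_lt\<close>)
qed

lemma Fc_holomorphic:
  assumes a: "Im a \<noteq> 0" shows "Fc a holomorphic_on eta_dom"
proof -
  have r: "((\<lambda>\<eta>. col2 a (1 - \<eta>)) has_field_derivative - col2' a (1 - \<eta>)) (at \<eta>)" if "Im \<eta> < 0" for \<eta>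
  proof -
    have "((\<lambda>\<eta>. 1 - \<eta>) has_field_derivative (-1::complex)) (at \<eta>)" by (auto intro!: derivative_eq_intros)
    from DERIV_chain2[OF col_deriv(3)[OF a] this] that show ?thesis by simp
  qed
  have "Fc a holomorphic_on UHP"
    by (rule holomorphic_transform[of "col1 a"])
       (use col_deriv(1)[OF a] Fc_pieces(1)[OF a] open_halfspace_Im_gt[of 0] in \<open>auto simp: holomorphic_on_open\<close>)
  moreover have "Ya a (c\<alpha> a) (c\<beta> a) holomorphic_on hdisc"
    unfolding holomorphic_on_open[OF open_ball] using Ya_deriv(1) by blast
  hence "Fc a holomorphic_on hdisc"
    by (rule holomorphic_transform) (simp add: Fc_pieces(2)[OF a])
  moreover have "Fc a holomorphic_on {\<eta>. Im \<eta> < 0}"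
    by (rule holomorphic_transform[of "\<lambda>\<eta>. col2 a (1 - \<eta>)"])
       (use r Fc_pieces(3)[OF a] open_halfspace_Im_lt[of 0] in \<open>auto simp: holomorphic_on_open\<close>)
  ultimately show ?thesis unfolding eta_dom_Un
    by (intro holomorphic_on_Un open_Un open_halfspace_Im_gt open_halfspace_Im_lt open_ball)
qed

lemma eta_dom_reflect: "u \<in> eta_dom \<Longrightarrow> 1 - u \<in> eta_dom"
proof -
  assume u: "u \<in> eta_dom"
  have "1 - u \<in> hdisc" if "u \<in> hdisc" using that by (simp add: dist_norm norm_minus_commute)
  thus ?thesis using u unfolding eta_dom_cases[of u] eta_dom_cases[of "1 - u"] by auto
qed

lemma Fc_deriv:
  assumes a: "Im a \<noteq> 0" and u: "u \<in> eta_dom"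
  shows "(Fc a has_field_derivative deriv (Fc a) u) (at u)"
    and "((\<lambda>u. Fc a (1 - u)) has_field_derivative - deriv (Fc a) (1 - u)) (at u)"
proof -
  have d: "(Fc a has_field_derivative deriv (Fc a) u) (at u)" if "u \<in> eta_dom" for u
    by (rule holomorphic_derivI[OF Fc_holomorphic[OF a] open_eta_dom that])
  show "(Fc a has_field_derivative deriv (Fc a) u) (at u)" by (rule d[OF u])
  have "((\<lambda>u. 1 - u) has_field_derivative (-1::complex)) (at u)" by (auto intro!: derivative_eq_intros)
  from DERIV_chain2[OF d[OF eta_dom_reflect[OF u]] this]
  show "((\<lambda>u. Fc a (1 - u)) has_field_derivative - deriv (Fc a) (1 - u)) (at u)" by simp
qed

lemma Fc_reflect_UHP: "Im a \<noteq> 0 \<Longrightarrow> u \<in> UHP \<Longrightarrow> Fc a (1 - u) = col2 a u"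
  using Fc_pieces(3)[of a "1 - u"] by simp

lemma UHP_eta_dom: "UHP \<subseteq> eta_dom" "open UHP" "UHP \<noteq> {}"
proof -
  show "UHP \<subseteq> eta_dom" using eta_dom_cases by blast
  show "open UHP" by (rule open_halfspace_Im_gt)
  have "\<i> \<in> UHP" by simp
  thus "UHP \<noteq> {}" by blast
qed

text \<open>The definitions of the columns are solved for the first solution, which brings in the
  determinant \<open>1 + (ee a)^2\<close>. As \<open>Fc\<close> lives on all of
  \<open>eta_dom\<close>, the result is the continuation across (0,1).\<close>

lemma h_inf_eq:
  assumes a: "Im a \<noteq> 0" and u: "u \<in> eta_dom"
  shows "h_inf a u = - (Fc a u + ee a * Fc a (1 - u)) / (TT a * (1 + (ee a)\<^sup>2))"
  unfolding h_inf_def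
proof (rule acont_eq[OF open_eta_dom connected_eta_dom UHP_eta_dom(2,3,1) _ _ u])
  have "(\<lambda>u. Fc a (1 - u)) holomorphic_on eta_dom"
    using Fc_deriv(2)[OF a] holomorphic_on_open[OF open_eta_dom] by blast
  thus "(\<lambda>u. - (Fc a u + ee a * Fc a (1 - u)) / (TT a * (1 + (ee a)\<^sup>2))) holomorphic_on eta_dom"
    using Fc_holomorphic[OF a] ee_ne[OF a] TT_ne[OF a] by (auto intro!: holomorphic_intros)
  fix x assume x: "x \<in> UHP"
  hence x0: "x \<noteq> 0" by auto
  have "Fc a x + ee a * Fc a (1 - x) = - (TT a * (1 + (ee a)\<^sup>2)) * fsol a x"
    unfolding Fc_pieces(1)[OF a x] Fc_reflect_UHP[OF a x] col1_def col2_def by (simp add: algebra_simps power2_eq_square)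
  hence "- (Fc a x + ee a * Fc a (1 - x)) / (TT a * (1 + (ee a)\<^sup>2)) = fsol a x"
    using ee_ne[OF a] TT_ne[OF a] by simp
  also have "\<dots> = exp (a * pi * \<i>) * x powr (- a) * hyp2F1 a (a + 1) (2 * a + 2) (1 / x)"
    using x0 by (simp add: fsol_def hyp2F1_eq[OF a UHP_slit[OF x]] powr_def)
  finally show "- (Fc a x + ee a * Fc a (1 - x)) / (TT a * (1 + (ee a)\<^sup>2)) = exp (a * pi * \<i>) * x powr (- a) * hyp2F1 a (a + 1) (2 * a + 2) (1 / x)" .
qed

lemma s_inf_eq:
  assumes a: "Im a \<noteq> 0" and u: "u \<in> eta_dom"
  shows "s_inf a u = (Fc a (1 - u) - ee a * Fc a u) / (KQ a * (1 + (ee a)\<^sup>2))"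
  unfolding s_inf_def
proof (rule acont_eq[OF open_eta_dom connected_eta_dom UHP_eta_dom(2,3,1) _ _ u])
  have "(\<lambda>u. Fc a (1 - u)) holomorphic_on eta_dom"
    using Fc_deriv(2)[OF a] holomorphic_on_open[OF open_eta_dom] by blast
  thus "(\<lambda>u. (Fc a (1 - u) - ee a * Fc a u) / (KQ a * (1 + (ee a)\<^sup>2))) holomorphic_on eta_dom"
    using Fc_holomorphic[OF a] ee_ne[OF a] KQ_ne[OF a] by (auto intro!: holomorphic_intros)
  fix x assume x: "x \<in> UHP"
  hence x0: "x \<noteq> 0" by auto
  have n: "Im (- a - 1) \<noteq> 0" using a by simp
  have e: "2 * (- a - 1) + 2 = - 2 * a" "- a - 1 + 1 = - a" by simp_all
  \<comment> \<open>Source of the minus sign in the definition of s.\<close>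
  have p: "exp ((- a - 1) * pi * \<i>) = - exp (- a * pi * \<i>)"
  proof -
    have "(- a - 1) * pi * \<i> = - a * pi * \<i> - of_real pi * \<i>" by (simp add: algebra_simps)
    hence "exp ((- a - 1) * pi * \<i>) = exp (- a * pi * \<i>) / exp (of_real pi * \<i>)" by (simp only: exp_diff)
    thus ?thesis by (simp add: exp_pi_i)
  qed
  have "Fc a (1 - x) - ee a * Fc a x = (KQ a * (1 + (ee a)\<^sup>2)) * fsol (- a - 1) x"
    unfolding Fc_pieces(1)[OF a x] Fc_reflect_UHP[OF a x] col1_def col2_def by (simp add: algebra_simps power2_eq_square)
  hence "(Fc a (1 - x) - ee a * Fc a x) / (KQ a * (1 + (ee a)\<^sup>2)) = fsol (- a - 1) x"
    using ee_ne[OF a] KQ_ne[OF a] by simp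
  also have "\<dots> = exp ((- a - 1) * pi * \<i>) * x powr (- (- a - 1)) * hyp2F1 (- a - 1) (- a - 1 + 1) (2 * (- a - 1) + 2) (1 / x)"
    using x0 unfolding hyp2F1_eq[OF n UHP_slit[OF x]] by (simp add: fsol_def powr_def)
  also have "\<dots> = - exp (- a * pi * \<i>) * x powr (a + 1) * hyp2F1 (- a - 1) (- a) (- 2 * a) (1 / x)"
    unfolding e p by (simp add: add.commute)
  finally show "(Fc a (1 - x) - ee a * Fc a x) / (KQ a * (1 + (ee a)\<^sup>2)) = - exp (- a * pi * \<i>) * x powr (a + 1) * hyp2F1 (- a - 1) (- a) (- 2 * a) (1 / x)" .
qed

text \<open>Multiplication by \<open>Q_mat\<close> undoes the linear solving in
  \<open>h_inf_eq\<close> and \<open>s_inf_eq\<close>.\<close>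

lemma Gamma_hat_Q:
  assumes a: "Im a \<noteq> 0" and u: "u \<in> eta_dom"
  shows "Gamma_hat a u ** Q_mat a = mat2 (Fc a u) (Fc a (1 - u)) (deriv (Fc a) u) (- deriv (Fc a) (1 - u))"
proof -
  define e T K where "e = ee a" and "T = TT a" and "K = KQ a"
  have ne: "1 + e\<^sup>2 \<noteq> 0" "T \<noteq> 0" "K \<noteq> 0" using ee_ne[OF a] TT_ne[OF a] KQ_ne[OF a] by (simp_all add: e_def T_def K_def)
  have Q: "Q_mat a = mat2 (- T) (- T * e) (- K * e) K"
    by (simp add: Q_mat_def mat2_mult T_def TT_def e_def ee_def K_def KQ_def BQ_def mult.commute mult.left_commute)
  have ev: "eventually (\<lambda>x. x \<in> eta_dom) (nhds u)" by (rule eventually_nhds_in_open[OF open_eta_dom u])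
  have "deriv (h_inf a) u = deriv (\<lambda>u. - (Fc a u + e * Fc a (1 - u)) / (T * (1 + e\<^sup>2))) u"
    by (rule deriv_cong_ev) (use ev h_inf_eq[OF a] in \<open>auto elim!: eventually_mono simp: e_def T_def\<close>)
  also have "((\<lambda>u. - (Fc a u + e * Fc a (1 - u)) / (T * (1 + e\<^sup>2))) has_field_derivative - (deriv (Fc a) u + e * (- deriv (Fc a) (1 - u))) / (T * (1 + e\<^sup>2))) (at u)"
    by (intro DERIV_cdivide DERIV_minus DERIV_add DERIV_cmult Fc_deriv[OF a u])
  hence "deriv (\<lambda>u. - (Fc a u + e * Fc a (1 - u)) / (T * (1 + e\<^sup>2))) u = - (deriv (Fc a) u - e * deriv (Fc a) (1 - u)) / (T * (1 + e\<^sup>2))"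
    by (simp add: DERIV_imp_deriv)
  finally have dh: "deriv (h_inf a) u = - (deriv (Fc a) u - e * deriv (Fc a) (1 - u)) / (T * (1 + e\<^sup>2))" .
  have "deriv (s_inf a) u = deriv (\<lambda>u. (Fc a (1 - u) - e * Fc a u) / (K * (1 + e\<^sup>2))) u"
    by (rule deriv_cong_ev) (use ev s_inf_eq[OF a] in \<open>auto elim!: eventually_mono simp: e_def K_def\<close>)
  also have "((\<lambda>u. (Fc a (1 - u) - e * Fc a u) / (K * (1 + e\<^sup>2))) has_field_derivative (- deriv (Fc a) (1 - u) - e * deriv (Fc a) u) / (K * (1 + e\<^sup>2))) (at u)"
    by (intro DERIV_cdivide DERIV_diff DERIV_cmult Fc_deriv[OF a u])
  hence "deriv (\<lambda>u. (Fc a (1 - u) - e * Fc a u) / (K * (1 + e\<^sup>2))) u = (- deriv (Fc a) (1 - u) - e * deriv (Fc a) u) / (K * (1 + e\<^sup>2))"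
    by (rule DERIV_imp_deriv)
  finally have ds: "deriv (s_inf a) u = (- deriv (Fc a) (1 - u) - e * deriv (Fc a) u) / (K * (1 + e\<^sup>2))" .
  have c: "- (x + e * y) / (T * (1 + e\<^sup>2)) * - T + (y - e * x) / (K * (1 + e\<^sup>2)) * (- K * e) = x"
    "- (x + e * y) / (T * (1 + e\<^sup>2)) * (- T * e) + (y - e * x) / (K * (1 + e\<^sup>2)) * K = y" for x y
  proof -
    have g: "- X / (T * D) * - T = X / D" "Y / (K * D) * (- K * e) = - e * Y / D"
      "- X / (T * D) * (- T * e) = e * X / D" "Y / (K * D) * K = Y / D" if "D \<noteq> 0" for X Y D
      using ne that by (simp_all add: field_simps)
    have s: "(x + e * y) + - e * (y - e * x) = x * (1 + e\<^sup>2)" "e * (x + e * y) + (y - e * x) = y * (1 + e\<^sup>2)"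
      by (simp_all add: algebra_simps power2_eq_square)
    show "- (x + e * y) / (T * (1 + e\<^sup>2)) * - T + (y - e * x) / (K * (1 + e\<^sup>2)) * (- K * e) = x"
      unfolding g[OF ne(1)] add_divide_distrib[symmetric] s using ne by simp
    show "- (x + e * y) / (T * (1 + e\<^sup>2)) * (- T * e) + (y - e * x) / (K * (1 + e\<^sup>2)) * K = y"
      unfolding g[OF ne(1)] add_divide_distrib[symmetric] s using ne by simp
  qed
  show ?thesis
    unfolding Gamma_hat_def Q h_inf_eq[OF a u] s_inf_eq[OF a u] dh ds mat2_mult mat2_eq e_def[symmetric] T_def[symmetric] K_def[symmetric]
    using c[of "Fc a u" "Fc a (1 - u)"] c[of "deriv (Fc a) u" "- deriv (Fc a) (1 - u)"] by simp
qed

lemma Fc_half: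
  assumes a: "Im a \<noteq> 0"
  shows "Fc a (1/2) = c\<alpha> a" "deriv (Fc a) (1/2) = c\<beta> a"
proof -
  show "Fc a (1/2) = c\<alpha> a" using Fc_pieces(2)[OF a, of "1/2"] by (simp add: Ya_half)
  have "deriv (Fc a) (1/2) = deriv (Ya a (c\<alpha> a) (c\<beta> a)) (1/2)"
    by (rule deriv_cong_ev)
       (use eventually_nhds_in_open[OF open_ball, of "1/2" "1/2" "1/2"] Fc_pieces(2)[OF a] in \<open>auto elim!: eventually_mono\<close>)
  thus "deriv (Fc a) (1/2) = c\<beta> a"
    using Ya_deriv(1)[of "1/2" a "c\<alpha> a" "c\<beta> a"] by (simp add: DERIV_imp_deriv Ya_half)
qed

section \<open>Explicit form of the matrix\<close>

lemma Gamma_off_entries: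
  assumes a: "Im a \<noteq> 0" and u: "(z + 1) / (2 * z) \<in> eta_dom"
    and F: "Fc a ((z + 1) / (2 * z)) = F1" "Fc a (1 - (z + 1) / (2 * z)) = F2"
      "deriv (Fc a) ((z + 1) / (2 * z)) = R1" "- deriv (Fc a) (1 - (z + 1) / (2 * z)) = R2"
  defines "b \<equiv> - 1 / (2 * z * (a + 1))"
  defines "P1 \<equiv> (F1 + b * R1) / c\<alpha> a" and "P2 \<equiv> (F2 + b * R2) / c\<alpha> a"
  shows "Gamma_off a z = mat2 ((P2 - R2 / c\<beta> a) / 2) ((- P1 + R1 / c\<beta> a) / 2) ((- P2 - R2 / c\<beta> a) / 2) ((P1 + R1 / c\<beta> a) / 2)"
proof -
  define \<alpha> \<beta> where "\<alpha> = c\<alpha> a" and "\<beta> = c\<beta> a"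
  have ne: "\<alpha> \<noteq> 0" "\<beta> \<noteq> 0" using c\<alpha>_ne[OF a] c\<beta>_ne[OF a] by (simp_all add: \<alpha>_def \<beta>_def)
  have half: "(1/2::complex) \<in> eta_dom" unfolding eta_dom_cases by simp
  \<comment> \<open>Inverse of \<open>Gamma_hat a (1/2) ** Q_mat a\<close>, whose rows are
    (\<alpha>, \<alpha>) and (\<beta>, -\<beta>) by \<open>Fc_half\<close>.\<close>
  define Fi where "Fi = mat2 (1/(2*\<alpha>)) (1/(2*\<beta>)) (1/(2*\<alpha>)) (- 1/(2*\<beta>))"
  have "Gamma_hat a (1/2) ** Q_mat a ** Fi = mat 1"
    using Gamma_hat_Q[OF a half] ne by (simp add: Fc_half[OF a] Fi_def mat2_mult mat2_one mat2_eq \<alpha>_def[symmetric] \<beta>_def[symmetric])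
  hence inv: "matrix_inv (Q_mat a) ** matrix_inv (Gamma_hat a (1/2)) = Fi" by (rule matrix_inv_product)
  have "Gamma_off a z = sigma2 ** (matrix_inv (Q_mat a) ** matrix_inv (Gamma_hat a (1/2)) ** mat2 1 (- 1 / (2 * z * (a + 1))) 0 1
       ** (Gamma_hat a ((z + 1) / (2 * z)) ** Q_mat a)) ** sigma2"
    unfolding Gamma_off_def by (simp only: matrix_mul_assoc)
  also have "\<dots> = sigma2 ** (Fi ** mat2 1 b 0 1 ** mat2 F1 F2 R1 R2) ** sigma2"
    unfolding inv Gamma_hat_Q[OF a u] F b_def ..
  also have "\<dots> = mat2 ((P2 - R2 / \<beta>) / 2) ((- P1 + R1 / \<beta>) / 2) ((- P2 - R2 / \<beta>) / 2) ((P1 + R1 / \<beta>) / 2)"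
    unfolding Fi_def mat2_mult sigma2_conj mat2_eq P1_def P2_def \<alpha>_def[symmetric]
    using ne by (simp add: field_simps)
  finally show ?thesis by (simp only: \<beta>_def)
qed

definition xx :: "complex \<Rightarrow> complex" where "xx v = v\<^sup>2 / (1 + v\<^sup>2)"
text \<open>The functions \<open>n1\<close> to \<open>n4\<close> are normalized so as to tend to 1.
  \<open>n2\<close> and \<open>n4\<close> come from the derivatives; \<open>n1\<close> and
  \<open>n3\<close> come from the first row after the shear with entry -1/(2z(a+1)), where the
  leading terms (1+v^2) \<plusminus> (1-v^2) combine to 2 and to 2v^2.\<close>

definition n1 :: "complex \<Rightarrow> complex \<Rightarrow> complex" where
  "n1 a v = ((1 + v\<^sup>2) * Gh a (xx v) + a / (a + 1) * (1 - v\<^sup>2) * Jh a (xx v)) / (2 * Gh a (1/2))"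
definition n2 :: "complex \<Rightarrow> complex \<Rightarrow> complex" where
  "n2 a v = Jh a (xx v) / Jh a (1/2)"
definition n3 :: "complex \<Rightarrow> complex \<Rightarrow> complex" where
  "n3 a v = ((1 + v\<^sup>2) * Gh (- a - 1) (xx v) - (1 - v\<^sup>2) * Jh (- a - 1) (xx v)) / (2 * v\<^sup>2 * Gh (- a - 1) (1/2))"
definition n4 :: "complex \<Rightarrow> complex \<Rightarrow> complex" where
  "n4 a v = Jh (- a - 1) (xx v) / Jh (- a - 1) (1/2)"

definition kk :: "complex \<Rightarrow> complex \<Rightarrow> complex" where
  "kk a v = 1 / (csqrt 2 * csqrt (1 + v\<^sup>2) * (1 + (ee a)\<^sup>2))"
definition Aa :: "complex \<Rightarrow> complex \<Rightarrow> complex" where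
  "Aa a v = exp (a * Ln v) * ((1 + ee a) * n1 a v + (ee a - 1) * n2 a v * v)"
definition Cc :: "complex \<Rightarrow> complex \<Rightarrow> complex" where
  "Cc a v = exp (a * Ln v) * (- (1 + ee a) * n1 a v + (ee a - 1) * n2 a v * v)"
definition Bb :: "complex \<Rightarrow> complex \<Rightarrow> complex" where
  "Bb a v = exp (- (a * Ln v)) * ((1 + ee a) * n4 a v - (ee a - 1) * n3 a v * v)"
definition Dd :: "complex \<Rightarrow> complex \<Rightarrow> complex" where
  "Dd a v = exp (- (a * Ln v)) * ((1 + ee a) * n4 a v + (ee a - 1) * n3 a v * v)"

text \<open>The matrix \<Gamma> in the variable v (\<open>Gamma_off_Gx\<close>). The Gamma functions
  are gone, and each of \<open>Aa\<close> to \<open>Dd\<close> carries one of the powers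
  \<open>v^a\<close>, \<open>v^(-a)\<close>.\<close>

definition Gx :: "complex \<Rightarrow> complex \<Rightarrow> complex^2^2" where
  "Gx a v = mat2 (kk a v * (ee a * Aa a v + Bb a v)) (kk a v * (ee a * Bb a v - Aa a v))
                 (kk a v * (ee a * Cc a v + Dd a v)) (kk a v * (ee a * Dd a v - Cc a v))"

text \<open>These are the quotients that \<open>Gamma_off_entries\<close> asks for; \<open>b\<close>
  is its shear entry after the substitution for 1/z. The Gamma quotient \<open>BQ a\<close> drops
  out through \<open>BQ_half\<close>, which replaces it by factors that are also in
  \<open>c\<alpha>\<close> and \<open>c\<beta>\<close>.\<close>

lemma columns_explicit:
  assumes a: "Im a \<noteq> 0" and v: "Re v > 0" "norm v < 1" "Re (v\<^sup>2) > - 1/2"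
  defines "U \<equiv> exp (a * Ln v)" and "b \<equiv> - \<i> * (1 - v\<^sup>2) / (4 * v * (a + 1))" and "e \<equiv> ee a"
  shows "(col1 a (eta_of v) + b * col1' a (eta_of v)) / c\<alpha> a = 2 * kk a v * ((1 + e) * n1 a v * U + e * (e - 1) * n3 a v * v / U)"
    and "(col2 a (eta_of v) + b * col2' a (eta_of v)) / c\<alpha> a = 2 * kk a v * (e * (1 + e) * n1 a v * U - (e - 1) * n3 a v * v / U)"
    and "col1' a (eta_of v) / c\<beta> a = 2 * kk a v * (e * (1 + e) * n4 a v / U - (e - 1) * n2 a v * v * U)"
    and "col2' a (eta_of v) / c\<beta> a = - 2 * kk a v * (e * (e - 1) * n2 a v * v * U + (1 + e) * n4 a v / U)"
proof -
  define q where "q = csqrt (1 + v\<^sup>2)"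
  define B where "B = BQ a"
  define E where "E = EE a 1"
  define T where "T = TT a"
  define Ga Ja Gn Jn where "Ga = Gh a (xx v)" and "Ja = Jh a (xx v)" and "Gn = Gh (- a - 1) (xx v)" and "Jn = Jh (- a - 1) (xx v)"
  define ga ja gn jn where "ga = Gh a (1/2)" and "ja = Jh a (1/2)" and "gn = Gh (- a - 1) (1/2)" and "jn = Jh (- a - 1) (1/2)"
  define r where "r = csqrt 2"
  have rr: "r * r = 2" unfolding r_def by (metis power2_csqrt power2_eq_square)
  have in1: "Im (- a - 1) \<noteq> 0" using a by simp
  have v0: "v \<noteq> 0" using v by auto
  have a1: "a + 1 \<noteq> 0" using a by (auto simp: complex_eq_iff)
  have a0: "a \<noteq> 0" using a by auto
  have vv: "1 + v\<^sup>2 \<noteq> 0"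
  proof
    assume "1 + v\<^sup>2 = 0"
    hence "Re (1 + v\<^sup>2) = 0" by simp
    thus False using v(3) by simp
  qed
  have qq: "q * q = 1 + v\<^sup>2" unfolding q_def by (metis power2_csqrt power2_eq_square)
  have ne: "q \<noteq> 0" "r \<noteq> 0" "U \<noteq> 0" "E \<noteq> 0" "T \<noteq> 0" "1 + e \<noteq> 0" "e - 1 \<noteq> 0" "1 + e\<^sup>2 \<noteq> 0" "ga \<noteq> 0" "ja \<noteq> 0" "gn \<noteq> 0" "jn \<noteq> 0"
    using vv rr ee_ne[OF a] TT_ne[OF a] half_nonzero[OF a] half_nonzero[OF in1]
    by (auto simp: q_def U_def E_def EE_def T_def e_def ga_def ja_def gn_def jn_def)
  have U': "exp ((- a - 1) * Ln v) = 1 / (U * v)"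
  proof -
    have "(- a - 1) * Ln v = - (a * Ln v) - Ln v" by (simp add: algebra_simps)
    thus ?thesis using v0 by (simp add: U_def exp_diff exp_minus divide_inverse)
  qed
  note f1 = fsol_eta_of[OF a v, folded xx_def, folded Ga_def Ja_def q_def]
  note f2 = fsol_eta_of[OF in1 v, folded xx_def, folded Gn_def Jn_def q_def]
  have Ea: "EE a v = E * U" using EE_split[of a v] by (simp add: E_def U_def)
  have En: "KQ a * EE (- a - 1) v = - \<i> * B * E / (U * v)"
    using EE_split[of "- a - 1" v] KQ_EE[of a] by (simp add: U' E_def B_def)
  define H where "H = fsol a (eta_of v)"
  define H' where "H' = fsol' a (eta_of v)"
  define S where "S = KQ a * fsol (- a - 1) (eta_of v)"
  define S' where "S' = KQ a * fsol' (- a - 1) (eta_of v)"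
  have H: "H = E * U * (1 + v\<^sup>2) * Ga / q"
    unfolding H_def f1 Ea qq[symmetric] using ne by simp
  have H': "H' = 4 * \<i> * a * v * E * U * Ja / q"
    unfolding H'_def f1 EE_plus1[OF v0] Ea using ne by simp
  have "S = (KQ a * EE (- a - 1) v) * (q * Gn)" unfolding S_def f2 by simp
  hence S: "S = - \<i> * B * E * (1 + v\<^sup>2) * Gn / (U * v * q)" unfolding En qq[symmetric] using ne by simp
  have S'0: "S' = (- a - 1) * (4 * \<i> * v) * (KQ a * EE (- a - 1) v) * (Jn / q)" unfolding S'_def f2 EE_plus1[OF v0] by simp
  have S': "S' = - 4 * (a + 1) * B * E * Jn / (U * q)"
  proof -
    have "(- a - 1) * (4 * \<i> * v) * (- \<i> * B * E / (U * v)) = - 4 * (a + 1) * B * E / U"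
      using v0 ne by (simp add: field_simps)
    thus ?thesis using S'0 unfolding En by simp
  qed
  have n1: "2 * ga * n1 a v = (1 + v\<^sup>2) * Ga + a / (a + 1) * (1 - v\<^sup>2) * Ja" using ne by (simp add: n1_def ga_def Ga_def Ja_def)
  have n2: "ja * n2 a v = Ja" using ne by (simp add: n2_def ja_def Ja_def)
  have n3: "2 * v\<^sup>2 * gn * n3 a v = (1 + v\<^sup>2) * Gn - (1 - v\<^sup>2) * Jn" using ne v0 by (simp add: n3_def gn_def Gn_def Jn_def)
  have n4: "jn * n4 a v = Jn" using ne by (simp add: n4_def jn_def Jn_def)
  have HH: "H + b * H' = E * U / q * (2 * ga * n1 a v)"
  proof -
    have "b * H' = E * U / q * (a / (a + 1) * (1 - v\<^sup>2) * Ja)"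
    proof -
      have "- \<i> * m / (4 * v * A) * (4 * \<i> * a * v * X / q) = X / q * (a / A * m)" if "A \<noteq> 0" for m A X
        using v0 ne that by (simp add: divide_simps) (simp add: mult_ac)?
      from this[OF a1, of "1 - v\<^sup>2" "E * U * Ja"] show ?thesis unfolding b_def H' by (simp add: mult_ac)
    qed
    moreover have "H = E * U / q * ((1 + v\<^sup>2) * Ga)" unfolding H by (simp add: mult_ac)
    ultimately show ?thesis unfolding n1 by (simp only: distrib_left[symmetric])
  qed
  have "S + b * S' = - \<i> * B * E / (U * v * q) * (2 * v\<^sup>2 * gn * n3 a v)"
  proof -
    have "b * S' = - \<i> * B * E / (U * v * q) * (- ((1 - v\<^sup>2) * Jn))"
    proof -
      have "- \<i> * m / (4 * v * A) * (- 4 * A * X * Y * Z / (U * q)) = - \<i> * X * Y / (U * v * q) * (- (m * Z))"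
        if "A \<noteq> 0" for m A X Y Z
        using v0 ne that by (simp add: divide_simps) (simp add: mult_ac)?
      from this[OF a1] show ?thesis unfolding b_def S' .
    qed
    moreover have "S = - \<i> * B * E / (U * v * q) * ((1 + v\<^sup>2) * Gn)" unfolding S by (simp add: mult_ac)
    ultimately show ?thesis unfolding n3 by (simp only: distrib_left[symmetric] diff_conv_add_uminus)
  qed
  hence SS: "S + b * S' = - (\<i> * B * gn) * (2 * E * v * n3 a v / (U * q))"
    using v0 by (simp add: power2_eq_square)
  have k1: "\<i> * B * gn * (1 + e) = T * (1 - e) * ga" using BQ_half(1)[OF a] by (simp only: B_def gn_def e_def T_def ga_def)
  have k2: "B * (a + 1) * jn * (e - 1) = \<i> * a * T * (1 + e) * ja" using BQ_half(2)[OF a] by (simp only: B_def jn_def e_def T_def ja_def)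
  \<comment> \<open>\<open>BQ_half\<close> comes with the factors 1 + e and e - 1. Therefore the
    first row is handled after multiplication by the former and the second row after multiplication
    by the latter.\<close>
  have SS1: "(S + b * S') * (1 + e) = - (T * (1 - e) * ga) * (2 * E * v * n3 a v / (U * q))"
    unfolding SS using k1 by algebra
  have SS2: "S' * (e - 1) = - (\<i> * a * T * (1 + e) * ja) * (4 * E * n4 a v / (U * q))"
  proof -
    have "S' * (e - 1) = - (B * (a + 1) * jn * (e - 1)) * (4 * E * n4 a v / (U * q))"
    proof -
      have "- 4 * A * B * E * (jn * N) / D * m = - (B * A * jn * m) * (4 * E * N / D)" for A N D m
        by simp
      thus ?thesis unfolding S' n4[symmetric] .
    qed
    thus ?thesis unfolding k2 .
  qed
  have HJ: "H' = \<i> * a * ja * (4 * v * E * U * n2 a v / q)" unfolding H' n2[symmetric] by (simp add: mult_ac)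
  have ca: "c\<alpha> a * (1 + e) = - T * (1 + e\<^sup>2) * (E * r * ga)" using ne by (simp add: c\<alpha>_def e_def T_def E_def r_def ga_def)
  have cb: "c\<beta> a * (e - 1) = T * (1 + e\<^sup>2) * (4 * \<i> * a * E * ja / r)"
    using ne unfolding c\<beta>_def EE_plus1[OF one_neq_zero] by (simp add: e_def T_def E_def r_def ja_def)
  \<comment> \<open>Common factors of the two rows; division by \<open>c\<alpha> a\<close> and
    \<open>c\<beta> a\<close> turns them into the prefactor \<open>2 * kk a v\<close>.\<close>
  define W where "W = 2 * ga * T * E / q"
  define V where "V = 4 * \<i> * a * T * E * ja / q"
  have k: "kk a v = 1 / (r * q * (1 + e\<^sup>2))" by (simp add: kk_def r_def q_def e_def)
  have W: "c\<alpha> a * (1 + e) * (2 * kk a v) = - W"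
  proof -
    have "c\<alpha> a * (1 + e) * (2 * kk a v) = - (T * E * ga * (1 + e\<^sup>2) * (r * 2)) / (r * q * (1 + e\<^sup>2))" unfolding ca k by simp
    also have "\<dots> = - W" using ne by (simp add: W_def)
    finally show ?thesis .
  qed
  have V: "c\<beta> a * (e - 1) * (2 * kk a v) = V"
  proof -
    have "c\<beta> a * (e - 1) * (2 * kk a v) = (T * (4 * \<i> * a * E * ja) * (1 + e\<^sup>2) * (r * r)) / (r * r * q * (1 + e\<^sup>2))" unfolding cb k rr[symmetric] by simp
    also have "\<dots> = V" using ne by (simp add: V_def)
    finally show ?thesis .
  qed
  have c0: "c\<alpha> a * (1 + e) \<noteq> 0" "c\<beta> a * (e - 1) \<noteq> 0" using c\<alpha>_ne[OF a] c\<beta>_ne[OF a] ne by auto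
  have divA: "X / c\<alpha> a = 2 * kk a v * Y" if "X * (1 + e) = - W * Y" for X Y
  proof -
    have "X * (1 + e) = (c\<alpha> a * (2 * kk a v * Y)) * (1 + e)" unfolding that W[symmetric] by simp
    hence "X = c\<alpha> a * (2 * kk a v * Y)" using ne by simp
    thus ?thesis using c0 by simp
  qed
  have divB: "X / c\<beta> a = 2 * kk a v * Y" if "X * (e - 1) = V * Y" for X Y
  proof -
    have "X * (e - 1) = (c\<beta> a * (2 * kk a v * Y)) * (e - 1)" unfolding that V[symmetric] by simp
    hence "X = c\<beta> a * (2 * kk a v * Y)" using ne by (simp only: mult_cancel_right) simp
    thus ?thesis using c0 by simp
  qed
  have 1: "col1 a (eta_of v) + b * col1' a (eta_of v) = - T * (H + b * H') - e * (S + b * S')"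
    "col2 a (eta_of v) + b * col2' a (eta_of v) = - e * T * (H + b * H') + (S + b * S')"
    by (simp_all add: col1_def col1'_def col2_def col2'_def H_def H'_def S_def S'_def T_def e_def algebra_simps)
  have 2: "col1' a (eta_of v) = - T * H' - e * S'" "col2' a (eta_of v) = - e * T * H' + S'"
    by (simp_all add: col1'_def col2'_def H'_def S'_def T_def e_def)
  show "(col1 a (eta_of v) + b * col1' a (eta_of v)) / c\<alpha> a = 2 * kk a v * ((1 + e) * n1 a v * U + e * (e - 1) * n3 a v * v / U)"
  proof (rule divA)
    have "(- T * (H + b * H') - e * (S + b * S')) * (1 + e) = - T * (1 + e) * (H + b * H') - e * ((S + b * S') * (1 + e))"
      by (simp add: algebra_simps)
    also have "\<dots> = - W * ((1 + e) * n1 a v * U + e * (e - 1) * n3 a v * v / U)"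
      unfolding HH SS1 W_def using ne by (simp add: field_simps)
    finally show "(col1 a (eta_of v) + b * col1' a (eta_of v)) * (1 + e) = - W * ((1 + e) * n1 a v * U + e * (e - 1) * n3 a v * v / U)"
      unfolding 1 .
  qed
  show "(col2 a (eta_of v) + b * col2' a (eta_of v)) / c\<alpha> a = 2 * kk a v * (e * (1 + e) * n1 a v * U - (e - 1) * n3 a v * v / U)"
  proof (rule divA)
    have "(- e * T * (H + b * H') + (S + b * S')) * (1 + e) = - e * T * (1 + e) * (H + b * H') + (S + b * S') * (1 + e)"
      by (simp add: algebra_simps)
    also have "\<dots> = - W * (e * (1 + e) * n1 a v * U - (e - 1) * n3 a v * v / U)"
      unfolding HH SS1 W_def using ne by (simp add: field_simps)
    finally show "(col2 a (eta_of v) + b * col2' a (eta_of v)) * (1 + e) = - W * (e * (1 + e) * n1 a v * U - (e - 1) * n3 a v * v / U)"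
      unfolding 1 .
  qed
  show "col1' a (eta_of v) / c\<beta> a = 2 * kk a v * (e * (1 + e) * n4 a v / U - (e - 1) * n2 a v * v * U)"
  proof (rule divB)
    have "(- T * H' - e * S') * (e - 1) = - T * (e - 1) * H' - e * (S' * (e - 1))"
      by (simp add: algebra_simps)
    also have "\<dots> = V * (e * (1 + e) * n4 a v / U - (e - 1) * n2 a v * v * U)"
      unfolding HJ SS2 V_def using ne by (simp add: field_simps)
    finally show "col1' a (eta_of v) * (e - 1) = V * (e * (1 + e) * n4 a v / U - (e - 1) * n2 a v * v * U)"
      unfolding 2 .
  qed
  have "col2' a (eta_of v) / c\<beta> a = 2 * kk a v * (- (e * (e - 1) * n2 a v * v * U) - (1 + e) * n4 a v / U)"
  proof (rule divB)
    have "(- e * T * H' + S') * (e - 1) = - e * T * (e - 1) * H' + S' * (e - 1)"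
      by (simp add: algebra_simps)
    also have "\<dots> = V * (- (e * (e - 1) * n2 a v * v * U) - (1 + e) * n4 a v / U)"
      unfolding HJ SS2 V_def using ne by (simp add: field_simps)
    finally show "col2' a (eta_of v) * (e - 1) = V * (- (e * (e - 1) * n2 a v * v * U) - (1 + e) * n4 a v / U)"
      unfolding 2 .
  qed
  moreover have "2 * x * (- y - y') = - 2 * x * (y + y')" for x y y' :: complex
    by (simp add: algebra_simps)
  ultimately show "col2' a (eta_of v) / c\<beta> a = - 2 * kk a v * (e * (e - 1) * n2 a v * v * U + (1 + e) * n4 a v / U)"
    by (simp only:)
qed

text \<open>Replacing z by -z replaces \<eta> by 1-\<eta> and b by -b. This exchanges the roles of
  the two columns, up to the sign of the derivatives, and amounts to conjugation by
  \<open>sigma1\<close>. Thus the right half of the disc of v serves both sides of z.\<close>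

lemma Gamma_off_Gx:
  assumes a: "Im a \<noteq> 0" and v: "Re v > 0" "norm v < 1" "Re (v\<^sup>2) > - 1/2"
    and z: "1 / z = \<i> * (1 / v - v) / 2"
  shows "Gamma_off a z = Gx a v" and "Gamma_off a (- z) = sigma1 ** Gx a v ** sigma1"
proof -
  have v0: "v \<noteq> 0" using v by auto
  have "1 / v - v \<noteq> 0"
  proof
    assume "1 / v - v = 0"
    hence "v * v = 1" using v0 by (simp add: field_simps)
    hence "norm v * norm v = 1" by (metis norm_mult norm_one)
    thus False using v by (metis abs_norm_cancel mult.right_neutral norm_ge_zero order_less_irrefl power2_eq_1_iff power2_eq_square  le_minus_one_simps(3))
  qed
  hence z0: "z \<noteq> 0" using z by auto
  have e1: "(z + 1) / (2 * z) = eta_of v"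
  proof -
    have "(z + 1) / (2 * z) = 1/2 + (1 / z) / 2" using z0 by (simp add: field_simps)
    thus ?thesis unfolding z eta_of_def by simp
  qed
  have e2: "(- z + 1) / (2 * - z) = 1 - eta_of v"
    unfolding e1[symmetric] using z0 by (simp add: field_simps)
  have U: "eta_of v \<in> UHP" using Im_eta_of[OF v(1,2)] by simp
  have dom: "eta_of v \<in> eta_dom" "1 - eta_of v \<in> eta_dom" using U UHP_eta_dom(1) eta_dom_reflect by blast+
  have ev: "eventually (\<lambda>x. x \<in> UHP) (nhds (eta_of v))" by (rule eventually_nhds_in_open[OF UHP_eta_dom(2) U])
  have d1: "deriv (Fc a) (eta_of v) = col1' a (eta_of v)"
  proof -
    have "deriv (Fc a) (eta_of v) = deriv (col1 a) (eta_of v)"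
      by (rule deriv_cong_ev) (use ev Fc_pieces(1)[OF a] in \<open>auto elim!: eventually_mono\<close>)
    thus ?thesis using DERIV_imp_deriv[OF col_deriv(1)[OF a U]] by simp
  qed
  have d2: "deriv (Fc a) (1 - eta_of v) = - col2' a (eta_of v)"
  proof -
    have "deriv (\<lambda>u. Fc a (1 - u)) (eta_of v) = deriv (col2 a) (eta_of v)"
      by (rule deriv_cong_ev) (use ev Fc_reflect_UHP[OF a] in \<open>auto elim!: eventually_mono\<close>)
    thus ?thesis using DERIV_imp_deriv[OF col_deriv(3)[OF a U]] DERIV_imp_deriv[OF Fc_deriv(2)[OF a dom(1)]] by (metis minus_minus)
  qed
  define b where "b = - \<i> * (1 - v\<^sup>2) / (4 * v * (a + 1))"
  have b1: "- 1 / (2 * z * (a + 1)) = b" "- 1 / (2 * - z * (a + 1)) = - b"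
  proof -
    have "- 1 / (2 * z * (a + 1)) = - (1 / z) / (2 * (a + 1))" by simp
    also have "1 / v - v = (1 - v\<^sup>2) / v" using v0 by (simp add: field_simps power2_eq_square)
    hence "- (1 / z) / (2 * (a + 1)) = b" unfolding z b_def by simp
    finally show "- 1 / (2 * z * (a + 1)) = b" .
    thus "- 1 / (2 * - z * (a + 1)) = - b" by simp
  qed
  note C = columns_explicit[OF a v, folded b_def]
  have Um: "exp (- (a * Ln v)) = 1 / exp (a * Ln v)" by (simp add: exp_minus divide_inverse)
  let ?P1 = "(col1 a (eta_of v) + b * col1' a (eta_of v)) / c\<alpha> a" and ?P2 = "(col2 a (eta_of v) + b * col2' a (eta_of v)) / c\<alpha> a"
  let ?R1 = "col1' a (eta_of v) / c\<beta> a" and ?R2 = "col2' a (eta_of v) / c\<beta> a"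
  have G: "Gx a v = mat2 ((?P2 - ?R2) / 2) ((- ?P1 + ?R1) / 2) ((- ?P2 - ?R2) / 2) ((?P1 + ?R1) / 2)"
    unfolding C Gx_def Aa_def Bb_def Cc_def Dd_def Um mat2_eq by (simp add: algebra_simps add_divide_distrib diff_divide_distrib)
  show "Gamma_off a z = Gx a v"
    using Gamma_off_entries[OF a, of z, unfolded e1 b1, OF dom(1)] Fc_pieces(1)[OF a U] Fc_reflect_UHP[OF a U] d1 d2
    unfolding G by simp
  have G': "sigma1 ** Gx a v ** sigma1 = mat2 ((?P1 + ?R1) / 2) ((- ?P2 - ?R2) / 2) ((- ?P1 + ?R1) / 2) ((?P2 - ?R2) / 2)"
    unfolding G sigma1_conj ..
  have "Fc a (1 - (1 - eta_of v)) = col1 a (eta_of v)" "deriv (Fc a) (1 - (1 - eta_of v)) = col1' a (eta_of v)"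
    using Fc_pieces(1)[OF a U] d1 by simp_all
  thus "Gamma_off a (- z) = sigma1 ** Gx a v ** sigma1"
    using Gamma_off_entries[OF a, of "- z", unfolded e2 b1, OF dom(2)] Fc_reflect_UHP[OF a U] d2
    unfolding G' by (simp add: mat2_eq)
qed

section \<open>Factorization and estimates for large |Im a|\<close>

lemma hyp_bound_nonneg: "hyp_bound \<ge> 0"
  unfolding hyp_bound_def by (rule suminf_nonneg[OF summable_hyp_bound]) simp

lemma norm_one_plus_sq:
  assumes "norm v \<le> 1/2"
  shows "norm (1 + v\<^sup>2) \<le> 2" "norm (1 - v\<^sup>2) \<le> 2" "norm (1 + v\<^sup>2) \<ge> 3/4" "1 + v\<^sup>2 \<noteq> (0::complex)" "norm (v\<^sup>2) \<le> 1/4"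
proof -
  have "norm (v\<^sup>2) \<le> (1/2)\<^sup>2" unfolding norm_power using assms by (intro power_mono) auto
  thus q: "norm (v\<^sup>2) \<le> 1/4" by (simp add: power2_eq_square)
  show "norm (1 + v\<^sup>2) \<le> 2" using norm_triangle_ineq[of 1 "v\<^sup>2"] q by simp
  show "norm (1 - v\<^sup>2) \<le> 2" using norm_triangle_ineq4[of 1 "v\<^sup>2"] q by simp
  show l: "norm (1 + v\<^sup>2) \<ge> 3/4" using norm_diff_ineq[of 1 "v\<^sup>2"] q by simp
  show "1 + v\<^sup>2 \<noteq> 0" using l by auto
qed

lemma norm_xx: "norm v \<le> 1/2 \<Longrightarrow> norm (xx v) \<le> 1/2"
proof -
  assume v: "norm v \<le> 1/2"
  note n = norm_one_plus_sq[OF v]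
  have "norm (xx v) = norm (v\<^sup>2) / norm (1 + v\<^sup>2)" by (simp add: xx_def norm_divide)
  also have "\<dots> \<le> (1/4) / (3/4)" by (rule frac_le) (use n in auto)
  finally show ?thesis by simp
qed

lemma norm_quotient_minus_one:
  fixes X Y :: complex
  assumes "norm (X - Y) \<le> d" "norm (Y - 1) \<le> 1/2"
  shows "norm (X / Y - 1) \<le> 2 * d"
proof -
  have y: "norm Y \<ge> 1/2" using norm_triangle_ineq2[of 1 "1 - Y"] assms(2) by (simp add: norm_minus_commute)
  hence "Y \<noteq> 0" by auto
  hence "X / Y - 1 = (X - Y) / Y" by (simp add: field_simps)
  hence "norm (X / Y - 1) = norm (X - Y) / norm Y" by (simp add: norm_divide)
  also have "\<dots> \<le> d / (1/2)" by (rule frac_le) (use assms y order_trans[OF norm_ge_zero assms(1)] in auto)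
  finally show ?thesis by simp
qed

text \<open>The bounds on Re a make the lower parameters a + 3/2 and 1/2 - a have nonnegative real
  part, so \<open>HS_bound\<close> serves both solutions. The \<open>+ 1\<close> in h absorbs the
  distance of a/(a+1) from 1. The constant 12 covers the values 4, 6 and 9 obtained below.\<close>

lemma n_bounds:
  assumes a: "- 1/2 \<le> Re a" "Re a \<le> 1/2" and Y: "2 * (hyp_bound + 1) \<le> \<bar>Im a\<bar>"
    and v: "v \<noteq> 0" "norm v \<le> 1/2"
  defines "h \<equiv> (hyp_bound + 1) / \<bar>Im a\<bar>"
  shows "norm (n1 a v - 1) \<le> 12 * h / (norm v)\<^sup>2" "norm (n2 a v - 1) \<le> 12 * h / (norm v)\<^sup>2"
    "norm (n3 a v - 1) \<le> 12 * h / (norm v)\<^sup>2" "norm (n4 a v - 1) \<le> 12 * h / (norm v)\<^sup>2"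
proof -
  have "2 * (hyp_bound + 1) \<ge> 2" using hyp_bound_nonneg by simp
  hence Yp: "\<bar>Im a\<bar> > 0" using Y by (metis less_le_trans zero_less_numeral order_trans)
  have h2: "h \<le> 1/2" using Y Yp by (simp add: h_def field_simps)
  have h0: "h \<ge> 0" using hyp_bound_nonneg by (simp add: h_def)
  have vp: "norm v > 0" using v by simp
  have v1: "(norm v)\<^sup>2 \<le> 1" using v power_mono[of "norm v" 1 2] by simp
  note n = norm_one_plus_sq[OF v(2)]
  have HB: "norm (HS A B c x - 1) \<le> h" if "Re c \<ge> 0" "\<bar>Im c\<bar> = \<bar>Im a\<bar>" "norm A \<le> 1" "norm B \<le> 2" "norm x \<le> 1/2" for A B c x
  proof -
    have c0: "c \<noteq> 0" using that(2) Yp by auto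
    have "norm (HS A B c x - 1) \<le> hyp_bound / norm c" by (rule HS_bound) (use that c0 in auto)
    also have "\<dots> \<le> h" unfolding h_def
      by (rule frac_le) (use hyp_bound_nonneg Yp that(2) abs_Im_le_cmod[of c] in auto)
    finally show ?thesis .
  qed
  have G: "norm (Gh a x - 1) \<le> h" "norm (Jh a x - 1) \<le> h" "norm (Gh (- a - 1) x - 1) \<le> h" "norm (Jh (- a - 1) x - 1) \<le> h"
    if "norm x \<le> 1/2" for x
    using a that unfolding Gh_def Jh_def by (auto intro!: HB)
  note Gx = G[OF norm_xx[OF v(2)]] and Gd = G[of "1/2"]
  have up: "c * h \<le> 12 * h / (norm v)\<^sup>2" if "c \<le> 12" for c
  proof -
    have "c * h \<le> 12 * h" using that h0 by (rule mult_right_mono)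
    also have "\<dots> = 12 * h / 1" by simp
    also have "\<dots> \<le> 12 * h / (norm v)\<^sup>2" by (rule frac_le) (use h0 vp v1 in auto)
    finally show ?thesis .
  qed
  have half: "norm (Gh a (1/2) - 1) \<le> 1/2" "norm (Jh a (1/2) - 1) \<le> 1/2" "norm (Gh (- a - 1) (1/2) - 1) \<le> 1/2" "norm (Jh (- a - 1) (1/2) - 1) \<le> 1/2"
    using Gd h2 by auto
  have tri: "norm (X - Y) \<le> 2 * h" if "norm (X - 1) \<le> h" "norm (Y - 1) \<le> h" for X Y :: complex
    using norm_triangle_ineq4[of "X - 1" "Y - 1"] that by simp
  have "norm (n2 a v - 1) \<le> 2 * (2 * h)" unfolding n2_def
    by (rule norm_quotient_minus_one) (use Gx Gd half tri in auto)
  thus "norm (n2 a v - 1) \<le> 12 * h / (norm v)\<^sup>2" using up[of 4] by simp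
  have "norm (n4 a v - 1) \<le> 2 * (2 * h)" unfolding n4_def
    by (rule norm_quotient_minus_one) (use Gx Gd half tri in auto)
  thus "norm (n4 a v - 1) \<le> 12 * h / (norm v)\<^sup>2" using up[of 4] by simp
  have mm: "norm (c * d) \<le> 2 * h" if "norm c \<le> 2" "norm d \<le> h" for c d :: complex
    unfolding norm_mult using that by (intro mult_mono) auto
  have aa: "norm (a / (a + 1) - 1) \<le> h"
  proof -
    have "a + 1 \<noteq> 0" using Yp by (auto simp: complex_eq_iff)
    hence "a / (a + 1) - 1 = - 1 / (a + 1)" by (simp add: field_simps)
    hence "norm (a / (a + 1) - 1) = 1 / norm (a + 1)" by (simp add: norm_divide)
    also have "\<dots> \<le> h" unfolding h_def by (rule frac_le) (use hyp_bound_nonneg Yp abs_Im_le_cmod[of "a + 1"] in auto)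
    finally show ?thesis .
  qed
  have Jb: "norm (Jh a (xx v)) \<le> 3/2" using norm_triangle_ineq[of 1 "Jh a (xx v) - 1"] Gx(2) h2 by simp
  have t3: "norm ((1 - v\<^sup>2) * (a / (a + 1) - 1) * Jh a (xx v)) \<le> 2 * h * (3/2)"
    unfolding norm_mult[of "(1 - v\<^sup>2) * (a / (a + 1) - 1)"] using mm[OF n(2) aa] Jb h0 by (intro mult_mono) auto
  let ?N = "((1 + v\<^sup>2) * Gh a (xx v) + a / (a + 1) * (1 - v\<^sup>2) * Jh a (xx v)) / 2"
  have "2 * (?N - Gh a (1/2)) = (1 + v\<^sup>2) * (Gh a (xx v) - 1) + (1 - v\<^sup>2) * (Jh a (xx v) - 1)
      + (1 - v\<^sup>2) * (a / (a + 1) - 1) * Jh a (xx v) - 2 * (Gh a (1/2) - 1)"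
  proof -
    have "2 * (((1 + v\<^sup>2) * G + t * (1 - v\<^sup>2) * J) / 2 - g) = (1 + v\<^sup>2) * (G - 1) + (1 - v\<^sup>2) * (J - 1) + (1 - v\<^sup>2) * (t - 1) * J - 2 * (g - 1)"
      for t G J g
    proof -
      have "2 * (X / 2 - g) = X - 2 * g" for X :: complex by (simp add: right_diff_distrib)
      thus ?thesis by (simp only:) (simp add: algebra_simps)
    qed
    thus ?thesis .
  qed
  also have "norm \<dots> \<le> 2 * h + 2 * h + 2 * h * (3/2) + 2 * h"
    using t3 mm[OF n(1) Gx(1)] mm[OF n(2) Gx(2)] mm[of 2, OF _ Gd(1)] by (intro norm_triangle_le_diff norm_triangle_le add_mono) simp_all
  finally have "norm (?N - Gh a (1/2)) \<le> 9/2 * h" unfolding norm_mult by simp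
  hence "norm (?N / Gh a (1/2) - 1) \<le> 2 * (9/2 * h)" by (rule norm_quotient_minus_one[OF _ half(1)])
  moreover have "?N / Gh a (1/2) = n1 a v" by (simp add: n1_def)
  ultimately show "norm (n1 a v - 1) \<le> 12 * h / (norm v)\<^sup>2" using up[of 9] by simp
  let ?M = "((1 + v\<^sup>2) * Gh (- a - 1) (xx v) - (1 - v\<^sup>2) * Jh (- a - 1) (xx v)) / (2 * v\<^sup>2)"
  \<comment> \<open>Here the limits combine to 2v^2, and dividing by it costs the factor |v|^-2.
    This is one of the sources of M^2 in the final error.\<close>
  have "2 * v\<^sup>2 * (?M - Gh (- a - 1) (1/2)) = (1 + v\<^sup>2) * (Gh (- a - 1) (xx v) - 1) - (1 - v\<^sup>2) * (Jh (- a - 1) (xx v) - 1) - 2 * v\<^sup>2 * (Gh (- a - 1) (1/2) - 1)"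
    using v by (simp add: field_simps)
  also have "norm \<dots> \<le> 2 * h + 2 * h + 2 * h"
    using mm[OF n(1) Gx(3)] mm[OF n(2) Gx(4)] mm[of "2 * v\<^sup>2", OF _ Gd(3)] n(5) by (intro norm_triangle_le_diff add_mono) (auto simp: norm_mult)
  finally have "norm v ^ 2 * norm (?M - Gh (- a - 1) (1/2)) \<le> 3 * h" by (simp add: norm_mult norm_power)
  hence "norm (?M - Gh (- a - 1) (1/2)) \<le> 3 * h / (norm v)\<^sup>2" using vp by (simp add: field_simps)
  hence "norm (?M / Gh (- a - 1) (1/2) - 1) \<le> 2 * (3 * h / (norm v)\<^sup>2)" by (rule norm_quotient_minus_one[OF _ half(3)])
  moreover have "?M / Gh (- a - 1) (1/2) = n3 a v" by (simp add: n3_def)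
  moreover have "2 * (3 * h / (norm v)\<^sup>2) \<le> 12 * h / (norm v)\<^sup>2" using h0 by (simp add: divide_right_mono)
  ultimately show "norm (n3 a v - 1) \<le> 12 * h / (norm v)\<^sup>2" by simp
qed

text \<open>\<open>Phi\<close> in the variable v, up to conjugation by \<open>sigma1\<close>; see
  \<open>Phi_eq\<close>.\<close>

definition Phiv :: "complex \<Rightarrow> complex^2^2" where
  "Phiv v = (let r = exp (Ln v / 2) / (csqrt 2 * csqrt (1 + v\<^sup>2))
             in mat2 (r * (1 + v)) (r * (1 / v - 1)) (r * (v - 1)) (r * (1 / v + 1)))"

definition al1 :: "complex \<Rightarrow> complex \<Rightarrow> complex" where "al1 a v = ee a * (1 + ee a) / (1 + (ee a)\<^sup>2) * n1 a v"
definition al2 :: "complex \<Rightarrow> complex \<Rightarrow> complex" where "al2 a v = ee a * (ee a - 1) / (1 + (ee a)\<^sup>2) * n2 a v"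
definition al3 :: "complex \<Rightarrow> complex \<Rightarrow> complex" where "al3 a v = ee a * (ee a - 1) / (1 + (ee a)\<^sup>2) * n3 a v"
definition al4 :: "complex \<Rightarrow> complex \<Rightarrow> complex" where "al4 a v = ee a * (1 + ee a) / (1 + (ee a)\<^sup>2) * n4 a v"

text \<open>What is left of \<open>Gx\<close> once \<open>Phiv\<close> and the exponentials are
  split off. It is the identity when \<open>al1\<close> to \<open>al4\<close> equal 1.\<close>

definition Pm :: "complex \<Rightarrow> complex \<Rightarrow> complex^2^2" where
  "Pm a v = mat2 ((al1 a v + al2 a v * v\<^sup>2) / (1 + v\<^sup>2)) ((al4 a v - al3 a v) / (1 + v\<^sup>2))
                 (v\<^sup>2 * (al2 a v - al1 a v) / (1 + v\<^sup>2)) ((al4 a v + al3 a v * v\<^sup>2) / (1 + v\<^sup>2))"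

text \<open>An exact identity. All exponentials are in the right factor, built from
  \<open>W = v^(a-1/2)\<close>; the half power of v belongs to \<open>Phiv\<close>.\<close>

lemma Gx_factor:
  assumes v: "v \<noteq> 0" "1 + v\<^sup>2 \<noteq> 0" and a: "Im a \<noteq> 0"
  defines "W \<equiv> exp (a * Ln v - Ln v / 2)"
  shows "Gx a v = Phiv v ** Pm a v ** mat2 W (- W / ee a) (1 / (W * ee a)) (1 / W)"
proof -
  define e where "e = ee a"
  define s where "s = exp (Ln v / 2)"
  define r where "r = 1 / (csqrt 2 * csqrt (1 + v\<^sup>2))"
  define A1 A2 A3 A4 where "A1 = al1 a v" and "A2 = al2 a v" and "A3 = al3 a v" and "A4 = al4 a v"
  note en = ee_ne[OF a, folded e_def]
  have s0: "s \<noteq> 0" "W \<noteq> 0" by (simp_all add: s_def W_def)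
  have ss: "s * s = v" using v by (simp add: s_def flip: exp_add)
  have U1: "exp (a * Ln v) = s * W" by (simp add: s_def W_def flip: exp_add)
  have U: "exp (a * Ln v) = s * W" "exp (- (a * Ln v)) = 1 / (s * W)"
    by (rule U1) (simp only: exp_minus U1 inverse_eq_divide)
  have P: "Phiv v = mat2 (r * s * (1 + v)) (r * s * (1 / v - 1)) (r * s * (v - 1)) (r * s * (1 / v + 1))"
    by (simp add: Phiv_def Let_def r_def s_def)
  have PP: "Phiv v ** Pm a v = mat2 (r * s * (A1 + A2 * v)) (r * s * ((A4 - A3 * v) / v)) (r * s * (- A1 + A2 * v)) (r * s * ((A4 + A3 * v) / v))"
  proof -
    define d where "d = 1 + v\<^sup>2"
    have d0: "d \<noteq> 0" using v by (simp add: d_def)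
    have vi: "1 / v * v\<^sup>2 = v" using v by (simp add: power2_eq_square)
    have i: "(1 + v) * (A1 + A2 * v\<^sup>2) + (1 / v - 1) * (v\<^sup>2 * (A2 - A1)) = d * (A1 + A2 * v)"
      "(1 + v) * (A4 - A3) + (1 / v - 1) * (A4 + A3 * v\<^sup>2) = d * ((A4 - A3 * v) / v)"
      "(v - 1) * (A1 + A2 * v\<^sup>2) + (1 / v + 1) * (v\<^sup>2 * (A2 - A1)) = d * (- A1 + A2 * v)"
      "(v - 1) * (A4 - A3) + (1 / v + 1) * (A4 + A3 * v\<^sup>2) = d * ((A4 + A3 * v) / v)"
      unfolding d_def using v by (simp_all add: divide_simps) (simp_all add: power2_eq_square algebra_simps)
    have g: "r * s * x * (X / d) + r * s * y * (Z / d) = r * s * ((x * X + y * Z) / d)" for x y X Z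
      by (simp add: algebra_simps add_divide_distrib)
    show ?thesis unfolding P Pm_def mat2_mult A1_def[symmetric] A2_def[symmetric] A3_def[symmetric] A4_def[symmetric] d_def[symmetric] g i
      using d0 by simp
  qed
  define f where "f = 1 / (1 + e\<^sup>2)"
  have kk: "kk a v = r * f" by (simp add: kk_def r_def f_def e_def)
  have A: "A1 = e * f * ((1 + e) * n1 a v)" "A2 = e * f * ((e - 1) * n2 a v)" "A3 = e * f * ((e - 1) * n3 a v)" "A4 = e * f * ((1 + e) * n4 a v)"
    by (simp_all add: A1_def A2_def A3_def A4_def al1_def al2_def al3_def al4_def f_def e_def)
  have sv: "s / v = 1 / s" using s0 by (simp add: ss[symmetric])
  have "Phiv v ** Pm a v ** mat2 W (- W / e) (1 / (W * e)) (1 / W) =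
     mat2 (r * (s * W) * (A1 + A2 * v) + r * (s / v) * (A4 - A3 * v) / (W * e)) (- r * (s * W) * (A1 + A2 * v) / e + r * (s / v) * (A4 - A3 * v) / W)
          (r * (s * W) * (- A1 + A2 * v) + r * (s / v) * (A4 + A3 * v) / (W * e)) (- r * (s * W) * (- A1 + A2 * v) / e + r * (s / v) * (A4 + A3 * v) / W)"
    unfolding PP mat2_mult mat2_eq by (simp add: mult_ac)
  also have "\<dots> = Gx a v"
    unfolding Gx_def mat2_eq kk Aa_def Bb_def Cc_def Dd_def U e_def[symmetric] sv A
    using en s0 by (simp add: field_simps)
  finally show ?thesis by (simp add: e_def)
qed

text \<open>There are two sources of error: \<open>n1\<close> to \<open>n4\<close>, and the
  quotients in \<open>ee a\<close>, which are within h of 1 because |\<open>ee a\<close>| = exp(-pi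
  Im a) is at least 2|Im a|. The constant 96 is 12 times 8, where 8 = (3+3)/(3/4) comes from the
  division by 1 + v^2.\<close>

lemma Pm_bounds:
  assumes a: "- 1/2 \<le> Re a" "Re a \<le> 1/2" and Y: "2 * (hyp_bound + 1) \<le> - Im a"
    and v: "v \<noteq> 0" "norm v \<le> 1/2"
  defines "h \<equiv> (hyp_bound + 1) / (- Im a)"
  obtains x11 x12 x21 x22 where "Pm a v = mat2 (1 + x11) x12 x21 (1 + x22)"
    "norm x11 \<le> 96 * h / (norm v)\<^sup>2" "norm x12 \<le> 96 * h / (norm v)\<^sup>2" "norm x21 \<le> 96 * h / (norm v)\<^sup>2" "norm x22 \<le> 96 * h / (norm v)\<^sup>2"
proof -
  have "2 * (hyp_bound + 1) \<ge> 2" using hyp_bound_nonneg by simp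
  hence "2 \<le> - Im a" using Y by (rule order_trans)
  hence Yp: "- Im a > 1" by simp
  have ha: "(hyp_bound + 1) / \<bar>Im a\<bar> = h" using Yp by (simp add: h_def)
  define B where "B = 12 * h / (norm v)\<^sup>2"
  have Y': "2 * (hyp_bound + 1) \<le> \<bar>Im a\<bar>" using Y by linarith
  note nb = n_bounds[OF a Y' v, unfolded ha, folded B_def]
  have h0: "h \<ge> 0" unfolding h_def using hyp_bound_nonneg Yp by (intro divide_nonneg_pos) auto
  have vp: "norm v > 0" using v by simp
  have v1: "(norm v)\<^sup>2 \<le> 1" using v power_mono[of "norm v" 1 2] by simp
  have hB: "h \<le> B"
  proof -
    have "h \<le> 12 * h / 1" using h0 by simp
    also have "\<dots> \<le> B" unfolding B_def by (rule frac_le) (use h0 vp v1 in auto)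
    finally show ?thesis .
  qed
  define e where "e = ee a"
  have en: "norm e \<ge> 2 * (- Im a)"
  proof -
    have "1 + pi * (- Im a) \<le> exp (pi * (- Im a))" by (rule exp_ge_add_one_self)
    moreover have "2 * (- Im a) \<le> pi * (- Im a)" using pi_ge_two Yp by (intro mult_right_mono) auto
    ultimately show ?thesis by (simp add: e_def norm_ee)
  qed
  have e2: "norm e \<ge> 2" using en Yp by linarith
  have he: "2 / norm e \<le> h"
  proof -
    have "2 / norm e \<le> 2 / (2 * (- Im a))" by (rule frac_le) (use en Yp in auto)
    also have "\<dots> = 1 / (- Im a)" by simp
    also have "\<dots> \<le> h" unfolding h_def by (rule divide_right_mono) (use hyp_bound_nonneg Yp in auto)
    finally show ?thesis .
  qed
  have e1: "norm (1 + e\<^sup>2) \<ge> (norm e)\<^sup>2 - 1" using norm_diff_ineq[of "e\<^sup>2" 1] by (simp add: norm_power add.commute)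
  have ep: "(norm e)\<^sup>2 - 1 > 0" using power_mono[OF e2, of 2] by simp
  have e0: "1 + e\<^sup>2 \<noteq> 0" using e1 ep by auto
  have small: "norm (s / (1 + e\<^sup>2)) \<le> h" if "norm s \<le> norm e + 1" for s
  proof -
    have "norm (s / (1 + e\<^sup>2)) \<le> (norm e + 1) / ((norm e)\<^sup>2 - 1)"
      unfolding norm_divide by (rule frac_le) (use that e1 ep in auto)
    also have "\<dots> = 1 / (norm e - 1)"
    proof -
      have "(norm e)\<^sup>2 - 1 = (norm e + 1) * (norm e - 1)" by (simp add: power2_eq_square algebra_simps)
      thus ?thesis using e2 by simp
    qed
    also have "\<dots> \<le> 1 / (norm e / 2)" by (rule frac_le) (use e2 in auto)
    also have "\<dots> = 2 / norm e" by simp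
    finally show ?thesis using he by simp
  qed
  have c1: "norm (e * (1 + e) / (1 + e\<^sup>2) - 1) \<le> h"
  proof -
    have "e * (1 + e) / (1 + e\<^sup>2) - 1 = (e - 1) / (1 + e\<^sup>2)" using e0 by (simp add: field_simps power2_eq_square)
    thus ?thesis using small[of "e - 1"] norm_triangle_ineq4[of e 1] by simp
  qed
  have c2: "norm (e * (e - 1) / (1 + e\<^sup>2) - 1) \<le> h"
  proof -
    have "e * (e - 1) / (1 + e\<^sup>2) - 1 = - (e + 1) / (1 + e\<^sup>2)" using e0 by (simp add: field_simps power2_eq_square)
    thus ?thesis using small[of "- (e + 1)"] norm_triangle_ineq[of e 1] by (simp only: norm_minus_cancel norm_one)
  qed
  have h1: "h \<le> 1" using Y Yp by (simp add: h_def field_simps)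
  have al: "norm (c * n - 1) \<le> 3 * B" if "norm (c - 1) \<le> h" "norm (n - 1) \<le> B" for c n :: complex
  proof -
    have nc: "norm c \<le> 2" using norm_triangle_ineq[of 1 "c - 1"] that h1 by simp
    have "c * n - 1 = c * (n - 1) + (c - 1)" by (simp add: algebra_simps)
    also have "norm \<dots> \<le> norm c * norm (n - 1) + norm (c - 1)" by (metis norm_mult norm_triangle_ineq)
    also have "\<dots> \<le> 2 * B + h" using nc that by (intro add_mono mult_mono) auto
    finally show ?thesis using hB by simp
  qed
  have A: "norm (al1 a v - 1) \<le> 3 * B" "norm (al2 a v - 1) \<le> 3 * B" "norm (al3 a v - 1) \<le> 3 * B" "norm (al4 a v - 1) \<le> 3 * B"
    unfolding al1_def al2_def al3_def al4_def e_def[symmetric] by (rule al; use c1 c2 nb in simp)+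
  note n = norm_one_plus_sq[OF v(2)]
  have B0: "B \<ge> 0" using h0 hB by linarith
  have D: "norm ((X + V * Z) / (1 + v\<^sup>2)) \<le> 8 * B" if "norm X \<le> 3 * B" "norm Z \<le> 3 * B" "norm V \<le> 1" for X V Z
  proof -
    have "norm (V * Z) \<le> 1 * (3 * B)" unfolding norm_mult using that B0 by (intro mult_mono) auto
    hence "norm (X + V * Z) \<le> 3 * B + 1 * (3 * B)" by (intro norm_triangle_le add_mono that)
    hence "norm ((X + V * Z) / (1 + v\<^sup>2)) \<le> (3 * B + 1 * (3 * B)) / (3/4)"
      unfolding norm_divide using n(3) B0 by (intro frac_le) auto
    thus ?thesis by simp
  qed
  define b1 b2 b3 b4 where "b1 = al1 a v - 1" and "b2 = al2 a v - 1" and "b3 = al3 a v - 1" and "b4 = al4 a v - 1"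
  have nv: "norm (v\<^sup>2) \<le> 1" using n(5) by simp
  have P0: "Pm a v = mat2 (1 + (b1 + v\<^sup>2 * b2) / (1 + v\<^sup>2)) ((b4 + (-1) * b3) / (1 + v\<^sup>2)) ((0 + v\<^sup>2 * (b2 - b1)) / (1 + v\<^sup>2)) (1 + (b4 + v\<^sup>2 * b3) / (1 + v\<^sup>2))"
    unfolding Pm_def mat2_eq b1_def b2_def b3_def b4_def using n(4) by (simp add: field_simps)
  have bs: "norm ((b1 + v\<^sup>2 * b2) / (1 + v\<^sup>2)) \<le> 8 * B" "norm ((b4 + (-1) * b3) / (1 + v\<^sup>2)) \<le> 8 * B" "norm ((b4 + v\<^sup>2 * b3) / (1 + v\<^sup>2)) \<le> 8 * B"
    by (rule D; use A nv in \<open>simp add: b1_def b2_def b3_def b4_def\<close>)+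
  have bt: "norm ((0 + v\<^sup>2 * (b2 - b1)) / (1 + v\<^sup>2)) \<le> 8 * B"
  proof -
    have "norm (b2 - b1) \<le> 6 * B" using norm_triangle_ineq4[of b2 b1] A by (simp add: b1_def b2_def)
    hence "norm (v\<^sup>2 * (b2 - b1)) \<le> 1/4 * (6 * B)" unfolding norm_mult using n(5) B0 by (intro mult_mono) auto
    hence "norm (v\<^sup>2 * (b2 - b1) / (1 + v\<^sup>2)) \<le> (1/4 * (6 * B)) / (3/4)"
      unfolding norm_divide using n(3) B0 by (intro frac_le) auto
    thus ?thesis using B0 by simp
  qed
  have B8: "8 * B = 96 * h / (norm v)\<^sup>2" by (simp add: B_def)
  show ?thesis by (rule that[OF P0 bs(1,2)[unfolded B8] bt[unfolded B8] bs(3)[unfolded B8]])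
qed

text \<open>An entry of the error is an entry of each factor's error plus two products, each of
  which is at most s because p \<le> 1.\<close>

lemma mat_error_bound:
  assumes x: "norm x11 \<le> p" "norm x12 \<le> p" "norm x21 \<le> p" "norm x22 \<le> p" "p \<le> 1"
    and y: "norm y11 \<le> s" "norm y12 \<le> s" "norm y21 \<le> s" "norm y22 \<le> s"
  shows "\<exists>E. mat 1 + E = mat2 (1 + x11) x12 x21 (1 + x22) ** mat2 (1 + y11) y12 y21 (1 + y22) \<and> (\<forall>i j. cmod (E $ i $ j) \<le> p + 3 * s)"
proof -
  have pr: "norm (a * b) \<le> s" if "norm a \<le> p" "norm b \<le> s" for a b :: complex
  proof -
    have "norm a * norm b \<le> 1 * s" using that x(5) order_trans[OF norm_ge_zero that(2)] by (intro mult_mono) auto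
    thus ?thesis by (simp add: norm_mult)
  qed
  have t: "norm (a + b + (c + d)) \<le> p + 3 * s" if "norm a \<le> p" "norm b \<le> s" "norm c \<le> s" "norm d \<le> s" for a b c d :: complex
    using norm_triangle_ineq[of "a + b" "c + d"] norm_triangle_ineq[of a b] norm_triangle_ineq[of c d] that by linarith
  define E where "E = mat2 (x11 + y11 + (x11 * y11 + x12 * y21)) (x12 + y12 + (x11 * y12 + x12 * y22))
                           (x21 + y21 + (x21 * y11 + x22 * y21)) (x22 + y22 + (x21 * y12 + x22 * y22))"
  have "mat 1 + E = mat2 (1 + x11) x12 x21 (1 + x22) ** mat2 (1 + y11) y12 y21 (1 + y22)"
    unfolding E_def mat2_one mat2_add mat2_mult mat2_eq by (simp add: algebra_simps)
  moreover have "\<forall>i j. cmod (E $ i $ j) \<le> p + 3 * s"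
    unfolding E_def mat2_def forall_2 using x y by (simp add: vector_2) (intro conjI t pr; assumption)
  ultimately show ?thesis by blast
qed

section \<open>The three expansions in v for the upper side of \<lambda>\<close>

text \<open>By \<open>S0\<close> the exponential matrix of \<open>Gx_factor\<close> is a matrix with
  off-diagonal entries close to \<open>tR\<close> and \<open>tL\<close>, times
  \<open>exp_sigma3 (- k * g)\<close>. Multiplying the former by the inverse of T gives S, and S is
  near the identity because the entry not removed by T is small and the other one is removed up to a
  factor O(\<sigma>). The number \<sigma> measures the effect of \<delta>.\<close>

lemma core_upper:
  fixes k \<delta> v :: complex and \<theta> \<sigma> :: real
  assumes \<theta>: "0 < \<theta>" "\<theta> < pi / 2" and k: "Im k \<le> 0" "- pi \<le> Im k" "0 \<le> Re k"
    and a: "a = 1/2 - \<i> * k / pi + \<delta>" "- 1/2 \<le> Re a" "Re a \<le> 1/2" "2 * (hyp_bound + 1) \<le> - Im a"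
    and v: "v \<noteq> 0" "0 \<le> Re v" "norm v \<le> 1/2"
    and \<sigma>: "norm (exp (\<delta> * Ln v) - 1) \<le> \<sigma>" "norm (exp (- (\<delta> * Ln v)) - 1) \<le> \<sigma>" "norm (exp (- (\<i> * pi * \<delta>)) - 1) \<le> \<sigma>" "\<sigma> \<le> 1/2"
  defines "h \<equiv> (hyp_bound + 1) / (- Im a)" and "g \<equiv> \<i> / pi * Ln v"
  assumes p: "96 * h / (norm v)\<^sup>2 \<le> 1"
  defines "ex \<equiv> \<lambda>T. \<exists>E. (\<forall>i j. cmod (E $ i $ j) \<le> 96 * h / (norm v)\<^sup>2 + 15 * (exp (- Re k * (\<theta> / pi)) + \<sigma>) / (norm v)\<^sup>2) \<and>
            Gx a v = Phiv v ** (mat 1 + E) ** T ** exp_sigma3 (- k * g)"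
  shows "\<bar>Im (Ln v)\<bar> \<le> pi / 2 - \<theta> / 2 \<Longrightarrow> ex (mat 1)"
    and "Im (Ln v) \<le> pi / 4 \<Longrightarrow> ex (tri_left Lower k g)"
    and "- pi / 4 \<le> Im (Ln v) \<Longrightarrow> ex (tri_right Lower k g)"
proof -
  define \<psi> where "\<psi> = Im (Ln v)"
  define X where "X = Re k"
  define \<mu> E0 where "\<mu> = exp (\<delta> * Ln v)" and "E0 = exp (\<i> * pi * \<delta>)"
  define tR tL where "tR = \<i> * exp (- k * (2 * g + 1))" and "tL = - \<i> * exp (k * (2 * g - 1))"
  have ne: "\<mu> \<noteq> 0" "E0 \<noteq> 0" by (simp_all add: \<mu>_def E0_def)
  have "2 * (hyp_bound + 1) \<ge> 2" using hyp_bound_nonneg by simp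
  hence "2 \<le> - Im a" using a(4) by (rule order_trans)
  hence ia: "Im a \<noteq> 0" by simp
  note n = norm_one_plus_sq[OF v(3)]
  have pis: "pi > 0" by simp
  \<comment> \<open>From a = 1/2 - \<i>k/pi + \<delta>; for k = \<kappa> this says that
    \<open>ee a\<close> is close to \<i>/\<lambda>.\<close>
  have e: "ee a = \<i> * exp k * E0"
  proof -
    have "a * pi * \<i> = \<i> * complex_of_real (pi / 2) + k + \<i> * pi * \<delta>"
      unfolding a(1) by (simp add: field_simps)
    hence "ee a = exp (\<i> * complex_of_real (pi / 2)) * exp k * E0" unfolding ee_def E0_def by (simp only: exp_add)
    moreover have "exp (\<i> * complex_of_real (pi / 2)) = \<i>" by (simp add: exp_Euler cos_of_real sin_of_real del: of_real_divide)
    ultimately show ?thesis by simp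
  qed
  define W where "W = exp (a * Ln v - Ln v / 2)"
  have W: "W = \<mu> * exp (- k * g)"
  proof -
    have "a * Ln v - Ln v / 2 = \<delta> * Ln v + (- k * g)" unfolding a(1) g_def by (simp add: field_simps)
    thus ?thesis unfolding W_def \<mu>_def by (simp only: exp_add)
  qed
  have S0: "mat2 W (- W / ee a) (1 / (W * ee a)) (1 / W) = mat2 \<mu> (\<mu> * tR / E0) (tL / (\<mu> * E0)) (1 / \<mu>) ** exp_sigma3 (- k * g)"
  proof -
    have i: "1 / \<i> = - \<i>" by simp
    have r: "exp (- k * (2 * g + 1)) * exp (k * g) = exp (- k * g) / exp k" "exp (k * (2 * g - 1)) * exp (- k * g) = exp (k * g) / exp k"
    proof -
      have q: "- k * (2 * g + 1) + k * g = - k * g - k" "k * (2 * g - 1) + - k * g = k * g - k" by (simp_all add: algebra_simps)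
      show "exp (- k * (2 * g + 1)) * exp (k * g) = exp (- k * g) / exp k" unfolding exp_add[symmetric] exp_diff[symmetric] q(1) by (rule refl)
      show "exp (k * (2 * g - 1)) * exp (- k * g) = exp (k * g) / exp k" unfolding exp_add[symmetric] exp_diff[symmetric] q(2) by (rule refl)
    qed
    have m: "exp (- (k * g)) = 1 / exp (k * g)" by (simp add: exp_minus divide_inverse)
    have "- W / ee a = \<mu> * tR / E0 * exp (k * g)"
    proof -
      have "\<mu> * tR / E0 * exp (k * g) = \<i> * \<mu> / E0 * (exp (- k * (2 * g + 1)) * exp (k * g))" by (simp add: tR_def)
      also have "\<dots> = - W / ee a" unfolding r e W using ne by (simp add: field_simps)
      finally show ?thesis ..
    qed
    moreover have "1 / (W * ee a) = tL / (\<mu> * E0) * exp (- k * g)"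
    proof -
      have "tL / (\<mu> * E0) * exp (- k * g) = - \<i> / (\<mu> * E0) * (exp (k * (2 * g - 1)) * exp (- k * g))" by (simp add: tL_def)
      also have "\<dots> = 1 / (W * ee a)" unfolding r e W using ne m by (simp add: field_simps)
      finally show ?thesis ..
    qed
    moreover have "1 / W = 1 / \<mu> * exp (k * g)"
    proof -
      have y: "exp (k * g) = 1 / exp (- k * g)" by (subst eq_divide_eq) (simp flip: exp_add)
      show ?thesis unfolding W y by simp
    qed
    ultimately show ?thesis by (simp add: exp_sigma3_def mat2_mult mat2_eq W)
  qed
  have fac: "Gx a v = Phiv v ** (Pm a v ** S) ** T ** exp_sigma3 (- k * g)"
    if "S ** T = mat2 \<mu> (\<mu> * tR / E0) (tL / (\<mu> * E0)) (1 / \<mu>)" for S T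
  proof -
    have "Gx a v = Phiv v ** Pm a v ** (S ** T ** exp_sigma3 (- k * g))"
      unfolding that S0[symmetric] W_def by (rule Gx_factor[OF v(1) n(4) ia])
    thus ?thesis by (simp add: matrix_mul_assoc)
  qed
  obtain x11 x12 x21 x22 where P: "Pm a v = mat2 (1 + x11) x12 x21 (1 + x22)"
    and x: "norm x11 \<le> 96 * h / (norm v)\<^sup>2" "norm x12 \<le> 96 * h / (norm v)\<^sup>2" "norm x21 \<le> 96 * h / (norm v)\<^sup>2" "norm x22 \<le> 96 * h / (norm v)\<^sup>2"
    using Pm_bounds[OF a(2,3,4) v(1,3)] unfolding h_def by metis
  \<comment> \<open>R majorizes the four quantities in \<open>R1\<close>. All entries of S - 1 are
    kept below 5R; the factor 3 of \<open>mat_error_bound\<close> then produces the constant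
    15.\<close>
  define R where "R = (exp (- X * (\<theta> / pi)) + \<sigma>) / (norm v)\<^sup>2"
  have exI: "ex T" if "S ** T = mat2 \<mu> (\<mu> * tR / E0) (tL / (\<mu> * E0)) (1 / \<mu>)" "S = mat2 (1 + y11) y12 y21 (1 + y22)"
    "norm y11 \<le> 5 * R" "norm y12 \<le> 5 * R" "norm y21 \<le> 5 * R" "norm y22 \<le> 5 * R" for S T y11 y12 y21 y22
  proof -
    note t = that
    obtain E :: "complex^2^2" where E: "mat 1 + E = Pm a v ** S" "\<forall>i j. cmod (E $ i $ j) \<le> 96 * h / (norm v)\<^sup>2 + 3 * (5 * R)"
      using mat_error_bound[OF x p t(3-6)] unfolding P t(2) by blast
    have "3 * (5 * R) = 15 * (exp (- Re k * (\<theta> / pi)) + \<sigma>) / (norm v)\<^sup>2" by (simp add: R_def X_def)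
    thus ?thesis unfolding ex_def using E fac[OF t(1)] by metis
  qed
  have vp: "norm v > 0" using v by simp
  have v1: "0 < (norm v)\<^sup>2" "(norm v)\<^sup>2 \<le> 1" using v power_mono[of "norm v" 1 2] by auto
  have s0: "\<sigma> \<ge> 0" using \<sigma>(1) order_trans[OF norm_ge_zero] by blast
  have R1: "exp (- X * (\<theta> / pi)) \<le> R" "\<sigma> \<le> R" "exp (- X * (\<theta> / pi)) / (norm v)\<^sup>2 \<le> R" "\<sigma> / (norm v)\<^sup>2 \<le> R"
  proof -
    have f: "x \<le> x / (norm v)\<^sup>2" if "x \<ge> 0" for x using v1 that by (simp add: le_divide_eq mult_left_le)
    show A: "exp (- X * (\<theta> / pi)) / (norm v)\<^sup>2 \<le> R" "\<sigma> / (norm v)\<^sup>2 \<le> R"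
      unfolding R_def by (rule divide_right_mono; use s0 in simp)+
    show "exp (- X * (\<theta> / pi)) \<le> R" using f[of "exp (- X * (\<theta> / pi))"] A(1) by simp
    show "\<sigma> \<le> R" using f[OF s0] A(2) by simp
  qed
  have R0: "R \<ge> 0" using R1(2) s0 by simp
  have nm: "norm \<mu> \<le> 3/2" "norm (1 / \<mu>) \<le> 3/2" "norm (1 / E0) \<le> 3/2" "norm (1 / \<mu> - 1) \<le> \<sigma>" "norm (1 / E0 - 1) \<le> \<sigma>" "norm (\<mu> - 1) \<le> \<sigma>"
  proof -
    have i: "1 / \<mu> = exp (- (\<delta> * Ln v))" "1 / E0 = exp (- (\<i> * pi * \<delta>))" by (simp_all add: \<mu>_def E0_def exp_minus divide_inverse)
    show A: "norm (1 / \<mu> - 1) \<le> \<sigma>" "norm (1 / E0 - 1) \<le> \<sigma>" "norm (\<mu> - 1) \<le> \<sigma>" unfolding i using \<sigma> by (auto simp: \<mu>_def)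
    have B: "norm x \<le> 3/2" if "norm (x - 1) \<le> \<sigma>" for x :: complex using norm_triangle_ineq[of 1 "x - 1"] that \<sigma>(4) by simp
    show "norm \<mu> \<le> 3/2" "norm (1 / \<mu>) \<le> 3/2" "norm (1 / E0) \<le> 3/2" by (intro B A)+
  qed
  have lnv: "ln (norm v) \<le> 0" using v by simp
  have psi: "\<bar>\<psi>\<bar> \<le> pi / 2" unfolding \<psi>_def using Re_Ln_pos_le[OF v(1)] v(2) by blast
  have L: "Ln v = of_real (ln (norm v)) + \<i> * of_real \<psi>" using v(1) by (simp add: \<psi>_def complex_eq_iff)
  have reg: "Re (k * (2 * g + c)) = X * (c - 2 * \<psi> / pi) - Im k * (2 / pi * ln (norm v))" for c :: real
    unfolding g_def L by (simp add: X_def field_simps)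
  \<comment> \<open>As Im k lies in [-pi, 0], the factor |v|^(2 Im k/pi) in the modulus of
    \<open>tR\<close> is between 1 and |v|^-2. In \<open>tL\<close> its reciprocal appears and is
    estimated by 1.\<close>
  have kl: "0 \<le> - Im k * - (2 / pi * ln (norm v))" "- Im k * - (2 / pi * ln (norm v)) \<le> - 2 * ln (norm v)"
  proof -
    have "2 / pi * ln (norm v) \<le> 0" by (rule mult_nonneg_nonpos) (use lnv in auto)
    hence q: "0 \<le> - (2 / pi * ln (norm v))" by linarith
    show "0 \<le> - Im k * - (2 / pi * ln (norm v))" using k(1) q by (intro mult_nonneg_nonneg) auto
    have "- Im k * - (2 / pi * ln (norm v)) \<le> pi * - (2 / pi * ln (norm v))" using k(2) q by (intro mult_right_mono) auto
    thus "- Im k * - (2 / pi * ln (norm v)) \<le> - 2 * ln (norm v)" by simp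
  qed
  have tLb: "norm tL \<le> exp (- X * (1 + 2 * \<psi> / pi))"
  proof -
    have "norm tL = exp (Re (k * (2 * g - 1)))" by (simp add: tL_def norm_mult)
    also have "Re (k * (2 * g - 1)) = X * (- 1 - 2 * \<psi> / pi) - Im k * (2 / pi * ln (norm v))" using reg[of "-1"] by simp
    also have "\<dots> \<le> - X * (1 + 2 * \<psi> / pi)" using kl(1) by (simp add: algebra_simps)
    finally show ?thesis by simp
  qed
  have tRb: "norm tR \<le> exp (- X * (1 - 2 * \<psi> / pi)) / (norm v)\<^sup>2"
  proof -
    have "norm tR = exp (- Re (k * (2 * g + 1)))" by (simp add: tR_def norm_mult)
    also have "- Re (k * (2 * g + 1)) = - X * (1 - 2 * \<psi> / pi) + Im k * (2 / pi * ln (norm v))" using reg[of 1] by simp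
    also have "\<dots> \<le> - X * (1 - 2 * \<psi> / pi) - 2 * ln (norm v)" using kl(2) by simp
    finally have "norm tR \<le> exp (- X * (1 - 2 * \<psi> / pi) - 2 * ln (norm v))" by simp
    also have "\<dots> = exp (- X * (1 - 2 * \<psi> / pi)) / (exp (ln (norm v)))\<^sup>2" by (simp add: exp_diff exp_double)
    finally show ?thesis using vp by simp
  qed
  have mono: "exp (- X * c) \<le> exp (- X * d)" if "d \<le> c" for c d using k(3) that by (simp add: X_def mult_left_mono)
  have th: "\<theta> / pi \<le> 1/2" using \<theta> by (simp add: field_simps)
  have pr3: "norm (a * b * c) \<le> 9/4 * r" if "norm a \<le> 3/2" "norm b \<le> r" "norm c \<le> 3/2" "r \<ge> 0" for a b c :: complex and r
  proof -
    have "norm a * norm b * norm c \<le> (3/2 * r) * (3/2)" using that by (intro mult_mono) auto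
    thus ?thesis by (simp add: norm_mult)
  qed
  have pr2: "norm (a * b) \<le> 3/2 * r" if "norm a \<le> 3/2" "norm b \<le> r" for a b :: complex and r
    unfolding norm_mult using that by (intro mult_mono) auto
  show "ex (mat 1)" if "\<bar>Im (Ln v)\<bar> \<le> pi / 2 - \<theta> / 2"
  proof -
    have "\<theta> / pi \<le> 1 + 2 * \<psi> / pi" "\<theta> / pi \<le> 1 - 2 * \<psi> / pi" using that pis by (auto simp: \<psi>_def[symmetric] field_simps abs_le_iff)
    hence t: "norm tL \<le> R" "norm tR \<le> R"
      using order_trans[OF tLb mono] R1(1) order_trans[OF tRb divide_right_mono[OF mono]] R1(3) by (force intro: order_trans)+
    show ?thesis
    proof (rule exI)
      show "mat2 \<mu> (\<mu> * tR / E0) (tL / (\<mu> * E0)) (1 / \<mu>) ** mat 1 = mat2 \<mu> (\<mu> * tR / E0) (tL / (\<mu> * E0)) (1 / \<mu>)" by simp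
      show "mat2 \<mu> (\<mu> * tR / E0) (tL / (\<mu> * E0)) (1 / \<mu>) = mat2 (1 + (\<mu> - 1)) (\<mu> * tR * (1 / E0)) (1 / \<mu> * tL * (1 / E0)) (1 + (1 / \<mu> - 1))"
        by (simp add: mat2_eq)
      show "norm (\<mu> - 1) \<le> 5 * R" "norm (1 / \<mu> - 1) \<le> 5 * R" using nm R1(2) R0 by linarith+
      show "norm (\<mu> * tR * (1 / E0)) \<le> 5 * R" using pr3[OF nm(1) t(2) nm(3) R0] R0 by linarith
      show "norm (1 / \<mu> * tL * (1 / E0)) \<le> 5 * R" using pr3[OF nm(2) t(1) nm(3) R0] R0 by linarith
    qed
  qed
  show "ex (tri_left Lower k g)" if "Im (Ln v) \<le> pi / 4"
  proof -
    \<comment> \<open>Up to the angle pi/4 the exponent 1 - 2\<psi>/pi is at least 1/2, and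
      \<theta>/pi is at most 1/2.\<close>
    have "\<theta> / pi \<le> 1 - 2 * \<psi> / pi" using that pis th by (simp add: \<psi>_def[symmetric] field_simps)
    hence tR: "norm tR \<le> R" using order_trans[OF tRb divide_right_mono[OF mono]] R1(3) by (force intro: order_trans)
    have "0 \<le> 1 + 2 * \<psi> / pi" using psi pis by (simp add: field_simps abs_le_iff)
    hence tL: "norm tL \<le> 1" using order_trans[OF tLb mono[of 0]] by simp
    have tt: "norm (tR * tL) \<le> R" unfolding norm_mult using mult_mono[OF tR tL R0] by simp
    have T: "tri_left Lower k g = mat2 1 0 tL 1" by (simp add: tri_left_def tL_def)
    show ?thesis unfolding T
    proof (rule exI)
      \<comment> \<open>This S arises from multiplication by the inverse of T. Its lower left entry
        keeps \<open>tL\<close> only with the factor \<open>1/E0 - 1\<close>, so \<open>tL\<close>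
        itself need not be small.\<close>
      show "mat2 (\<mu> - \<mu> * (tR * tL) * (1 / E0)) (\<mu> * tR * (1 / E0)) (tL * (1 / \<mu> * (1 / E0 - 1))) (1 / \<mu>) ** mat2 1 0 tL 1 = mat2 \<mu> (\<mu> * tR / E0) (tL / (\<mu> * E0)) (1 / \<mu>)"
        using ne by (simp add: mat2_mult mat2_eq field_simps)
      show "mat2 (\<mu> - \<mu> * (tR * tL) * (1 / E0)) (\<mu> * tR * (1 / E0)) (tL * (1 / \<mu> * (1 / E0 - 1))) (1 / \<mu>)
        = mat2 (1 + ((\<mu> - 1) - \<mu> * (tR * tL) * (1 / E0))) (\<mu> * tR * (1 / E0)) (tL * (1 / \<mu> * (1 / E0 - 1))) (1 + (1 / \<mu> - 1))"
        by (simp add: mat2_eq)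
      show "norm (1 / \<mu> - 1) \<le> 5 * R" using nm R1(2) R0 by linarith
      show "norm (\<mu> * tR * (1 / E0)) \<le> 5 * R" using pr3[OF nm(1) tR nm(3) R0] R0 by linarith
      show "norm ((\<mu> - 1) - \<mu> * (tR * tL) * (1 / E0)) \<le> 5 * R"
        using norm_triangle_ineq4[of "\<mu> - 1" "\<mu> * (tR * tL) * (1 / E0)"] pr3[OF nm(1) tt nm(3) R0] nm(6) R1(2) R0 by linarith
      have "norm (tL * (1 / \<mu> * (1 / E0 - 1))) \<le> 1 * (3/2 * \<sigma>)"
        unfolding norm_mult[of tL] using tL pr2[OF nm(2,5)] by (intro mult_mono) auto
      thus "norm (tL * (1 / \<mu> * (1 / E0 - 1))) \<le> 5 * R" using R1(2) R0 by linarith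
    qed
  qed
  show "ex (tri_right Lower k g)" if "- pi / 4 \<le> Im (Ln v)"
  proof -
    have "\<theta> / pi \<le> 1 + 2 * \<psi> / pi" using that pis th by (simp add: \<psi>_def[symmetric] field_simps)
    hence tL1: "norm tL \<le> exp (- X * (\<theta> / pi))" using order_trans[OF tLb mono] by blast
    hence tL: "norm tL \<le> R" using R1(1) by linarith
    have "0 \<le> 1 - 2 * \<psi> / pi" using psi pis by (simp add: field_simps abs_le_iff)
    hence tR: "norm tR \<le> 1 / (norm v)\<^sup>2" using order_trans[OF tRb divide_right_mono[OF mono[of 0]]] by simp
    \<comment> \<open>Here \<open>tR\<close> is bounded by |v|^-2 only; the decay of the product
      comes from \<open>tL1\<close>.\<close>
    have "norm tR * norm tL \<le> 1 / (norm v)\<^sup>2 * exp (- X * (\<theta> / pi))" using tR tL1 by (intro mult_mono) auto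
    hence tt: "norm (tR * tL) \<le> R" using R1(3) by (simp add: norm_mult)
    have T: "tri_right Lower k g = mat2 1 tR 0 1" by (simp add: tri_right_def tR_def)
    show ?thesis unfolding T
    proof (rule exI)
      show "mat2 \<mu> (tR * (\<mu> * (1 / E0 - 1))) (1 / \<mu> * tL * (1 / E0)) (1 / \<mu> - 1 / \<mu> * (tR * tL) * (1 / E0)) ** mat2 1 tR 0 1 = mat2 \<mu> (\<mu> * tR / E0) (tL / (\<mu> * E0)) (1 / \<mu>)"
        using ne by (simp add: mat2_mult mat2_eq field_simps)
      show "mat2 \<mu> (tR * (\<mu> * (1 / E0 - 1))) (1 / \<mu> * tL * (1 / E0)) (1 / \<mu> - 1 / \<mu> * (tR * tL) * (1 / E0))
        = mat2 (1 + (\<mu> - 1)) (tR * (\<mu> * (1 / E0 - 1))) (1 / \<mu> * tL * (1 / E0)) (1 + ((1 / \<mu> - 1) - 1 / \<mu> * (tR * tL) * (1 / E0)))"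
        by (simp add: mat2_eq)
      show "norm (\<mu> - 1) \<le> 5 * R" using nm R1(2) R0 by linarith
      show "norm (1 / \<mu> * tL * (1 / E0)) \<le> 5 * R" using pr3[OF nm(2) tL nm(3) R0] R0 by linarith
      show "norm ((1 / \<mu> - 1) - 1 / \<mu> * (tR * tL) * (1 / E0)) \<le> 5 * R"
        using norm_triangle_ineq4[of "1 / \<mu> - 1" "1 / \<mu> * (tR * tL) * (1 / E0)"] pr3[OF nm(2) tt nm(3) R0] nm(4) R1(2) R0 by linarith
      have "norm (tR * (\<mu> * (1 / E0 - 1))) \<le> 1 / (norm v)\<^sup>2 * (3/2 * \<sigma>)"
        unfolding norm_mult[of tR] using tR pr2[OF nm(1,5)] by (intro mult_mono) auto
      thus "norm (tR * (\<mu> * (1 / E0 - 1))) \<le> 5 * R" using R1(4) R0 by simp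
    qed
  qed
qed

section \<open>Complex conjugation of the explicit matrix\<close>

lemma HS_cnj: "norm x < 1 \<Longrightarrow> HS (cnj A) (cnj B) (cnj C) (cnj x) = cnj (HS A B C x)"
proof -
  assume x: "norm x < 1"
  have p: "pochhammer (cnj z) n = cnj (pochhammer z n)" for z n by (simp add: pochhammer_prod)
  have "(\<lambda>n. cnj (hyp_coeff A B C n * x ^ n)) sums cnj (HS A B C x)"
    using HS_sums[OF x] by (simp only: sums_cnj)
  moreover have "(\<lambda>n. cnj (hyp_coeff A B C n * x ^ n)) = (\<lambda>n. hyp_coeff (cnj A) (cnj B) (cnj C) n * cnj x ^ n)"
    by (rule ext) (simp add: hyp_coeff_def p[symmetric])
  ultimately have s: "(\<lambda>n. hyp_coeff (cnj A) (cnj B) (cnj C) n * cnj x ^ n) sums cnj (HS A B C x)" by simp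
  have "(\<lambda>n. hyp_coeff (cnj A) (cnj B) (cnj C) n * cnj x ^ n) sums HS (cnj A) (cnj B) (cnj C) (cnj x)"
    by (rule HS_sums) (use x in simp)
  thus ?thesis using s by (rule sums_unique2)
qed

text \<open>Conjugating a inverts \<open>ee\<close>: \<open>ee (cnj a) = 1 / cnj (ee a)\<close>.
  Clearing this denominator exchanges \<open>Aa\<close> with \<open>Cc\<close> and \<open>Bb\<close>
  with \<open>Dd\<close>, which is why the entries are permuted as well as conjugated.\<close>

lemma Gx_cnj:
  assumes a: "Im a \<noteq> 0" and v: "v \<noteq> 0" "0 \<le> Re v" "norm v \<le> 1/2"
  assumes G: "Gx a v = mat2 g11 g12 g21 g22"
  shows "Gx (cnj a) (cnj v) = mat2 (cnj g22) (cnj g21) (cnj g12) (cnj g11)"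
proof -
  have nx: "norm (xx v) < 1" "norm (1/2 :: complex) < 1" using norm_xx[OF v(3)] by auto
  note n = norm_one_plus_sq[OF v(3)]
  have xc: "xx (cnj v) = cnj (xx v)" by (simp add: xx_def)
  have ac: "- cnj a - 1 = cnj (- a - 1)" by simp
  have GJ: "Gh (cnj \<nu>) (cnj x) = cnj (Gh \<nu> x)" "Jh (cnj \<nu>) (cnj x) = cnj (Jh \<nu> x)" if "norm x < 1" for \<nu> x
    using HS_cnj[OF that, of "-1/2" "3/2" "\<nu> + 3/2"] HS_cnj[OF that, of "1/2" "1/2" "\<nu> + 3/2"] by (simp_all add: Gh_def Jh_def)
  have GJ2: "Gh (cnj \<nu>) (1/2) = cnj (Gh \<nu> (1/2))" "Jh (cnj \<nu>) (1/2) = cnj (Jh \<nu> (1/2))" for \<nu>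
    using GJ[OF nx(2)] by simp_all
  have nn: "n1 (cnj a) (cnj v) = cnj (n1 a v)" "n2 (cnj a) (cnj v) = cnj (n2 a v)" "n3 (cnj a) (cnj v) = cnj (n3 a v)" "n4 (cnj a) (cnj v) = cnj (n4 a v)"
    unfolding n1_def n2_def n3_def n4_def xc ac GJ[OF nx(1)] GJ2 by simp_all
  define e where "e = cnj (ee a)"
  have e0: "e \<noteq> 0" "1 + e\<^sup>2 \<noteq> 0" using ee_ne[OF a] unfolding e_def by (simp, metis complex_cnj_add complex_cnj_one complex_cnj_power complex_cnj_zero_iff)
  have ec: "ee (cnj a) = 1 / e" by (simp add: e_def ee_def exp_cnj exp_minus divide_inverse[symmetric] flip: exp_minus) (simp add: exp_minus divide_inverse)
  have nr: "v \<notin> \<real>\<^sub>\<le>\<^sub>0" using v by (auto simp: complex_nonpos_Reals_iff complex_eq_iff)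
  have "Re (1 + v\<^sup>2) > 0" using complex_Re_le_cmod[of "- v\<^sup>2"] n(5) by simp
  hence nr2: "1 + v\<^sup>2 \<notin> \<real>\<^sub>\<le>\<^sub>0" by (auto simp: complex_nonpos_Reals_iff)
  have U: "exp (cnj a * Ln (cnj v)) = cnj (exp (a * Ln v))" "exp (- (cnj a * Ln (cnj v))) = cnj (exp (- (a * Ln v)))"
    by (simp_all add: cnj_Ln[OF nr, symmetric] exp_cnj)
  have q: "csqrt (1 + (cnj v)\<^sup>2) = cnj (csqrt (1 + v\<^sup>2))" using cnj_csqrt[OF nr2] by simp
  have k: "kk (cnj a) (cnj v) = e\<^sup>2 * cnj (kk a v)"
  proof -
    have "1 + (1 / e)\<^sup>2 = (1 + e\<^sup>2) / e\<^sup>2" using e0 by (simp add: field_simps)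
    thus ?thesis unfolding kk_def ec q using e0 by (simp add: e_def[symmetric])
  qed
  have A: "Aa (cnj a) (cnj v) = - cnj (Cc a v) / e" "Bb (cnj a) (cnj v) = cnj (Dd a v) / e"
    "Cc (cnj a) (cnj v) = - cnj (Aa a v) / e" "Dd (cnj a) (cnj v) = cnj (Bb a v) / e"
    unfolding Aa_def Bb_def Cc_def Dd_def nn U ec using e0 by (simp_all add: e_def[symmetric] field_simps)
  have g: "g11 = kk a v * (ee a * Aa a v + Bb a v)" "g12 = kk a v * (ee a * Bb a v - Aa a v)"
    "g21 = kk a v * (ee a * Cc a v + Dd a v)" "g22 = kk a v * (ee a * Dd a v - Cc a v)"
    using G unfolding Gx_def mat2_eq by simp_all
  show ?thesis unfolding Gx_def mat2_eq k A ec g using e0 by (simp add: e_def[symmetric] field_simps power2_eq_square)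
qed

section \<open>Shores: boundary values of a, g and \<kappa>\<close>

lemma sg_cases: "sg p = 1 \<or> sg p = -1" by (cases p) auto
lemma sg_square [simp]: "complex_of_real (sg p) * complex_of_real (sg p) = 1" by (cases p) auto

lemma half_plane_nontrivial:
  assumes "on_side p w" shows "at w within {u. 0 < sg p * Im u} \<noteq> bot"
proof -
  have "w islimpt {u. 0 < sg p * Im u}" unfolding islimpt_approachable
  proof (intro allI impI)
    fix d :: real assume d: "d > 0"
    define x where "x = w + \<i> * of_real (sg p * (d / 2))"
    have "0 < sg p * Im x" using assms d by (cases p) (auto simp: x_def on_side_def)
    moreover have "dist x w < d" using d by (cases p) (auto simp: x_def dist_norm norm_mult)
    moreover have "x \<noteq> w" using d by (cases p) (auto simp: x_def)
    ultimately show "\<exists>x'\<in>{u. 0 < sg p * Im u}. x' \<noteq> w \<and> dist x' w < d" by auto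
  qed
  thus ?thesis using trivial_limit_within[of w] by (simp add: trivial_limit_def[symmetric])
qed

text \<open>The rule behind all boundary values below: a formula that holds in the open half-plane
  near w and is continuous at w also gives the value on the shore.\<close>

lemma bval_eqI:
  assumes s: "on_side p w" and e: "e > 0" and f: "\<And>u. 0 < sg p * Im u \<Longrightarrow> dist u w < e \<Longrightarrow> f u = F u"
    and F: "(F \<longlongrightarrow> F w) (at w)"
  shows "bval f p w = F w"
proof (cases "Im w = 0")
  case False
  hence "0 < sg p * Im w" using s by (cases p) (auto simp: on_side_def)
  thus ?thesis using f[of w] e False by (simp add: bval_def)
next
  case True
  have "eventually (\<lambda>u. f u = F u) (at w within {u. 0 < sg p * Im u})"
    unfolding eventually_at using e f by blast
  hence "(f \<longlongrightarrow> F w) (at w within {u. 0 < sg p * Im u})"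
    using tendsto_within_subset[OF F] tendsto_cong by blast
  from tendsto_Lim[OF half_plane_nontrivial[OF s] this] True show ?thesis by (simp add: bval_def)
qed

lemma tendsto_mat2:
  assumes "(a \<longlongrightarrow> a') F" "(b \<longlongrightarrow> b') F" "(c \<longlongrightarrow> c') F" "(d \<longlongrightarrow> d') F"
  shows "((\<lambda>x. mat2 (a x) (b x) (c x) (d x)) \<longlongrightarrow> mat2 a' b' c' d') F"
proof (intro vec_tendstoI)
  fix i j :: 2
  show "((\<lambda>x. mat2 (a x) (b x) (c x) (d x) $ i $ j) \<longlongrightarrow> mat2 a' b' c' d' $ i $ j) F"
    using exhaust_2[of i] exhaust_2[of j] assms by (auto simp: mat2_def vector_2)
qed

text \<open>The small root w of z = 2w/(1+w^2), i.e. 1/z = (w + 1/w)/2, in the form that does not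
  cancel near z = 0.\<close>

definition wz :: "complex \<Rightarrow> complex" where "wz z = z / (1 + csqrt (1 - z\<^sup>2))"

lemma wz_facts:
  assumes z: "z \<noteq> 0" "norm z \<le> 1/2"
  shows "Re (1 - z\<^sup>2) > 0" "Re (csqrt (1 - z\<^sup>2)) > 0" "1 + csqrt (1 - z\<^sup>2) \<noteq> 0" "wz z \<noteq> 0"
    "wz z = (1 - csqrt (1 - z\<^sup>2)) / z" "1 / z = (wz z + 1 / wz z) / 2" "norm (wz z) \<le> norm z" "norm z / 3 \<le> norm (wz z)"
    "0 < r * Im z \<longleftrightarrow> 0 < r * Im (wz z)" "Im z = 0 \<longleftrightarrow> Im (wz z) = 0"
proof -
  define s where "s = csqrt (1 - z\<^sup>2)"
  have nz: "norm (z\<^sup>2) \<le> 1/4" unfolding norm_power using power_mono[OF z(2), of 2] by (simp add: power2_eq_square)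
  show r1: "Re (1 - z\<^sup>2) > 0" using complex_Re_le_cmod[of "z\<^sup>2"] nz by simp
  have rs: "Re s > 0" unfolding s_def by (rule Re_csqrt_pos) (use r1 in \<open>auto simp: complex_nonpos_Reals_iff\<close>)
  thus "Re (csqrt (1 - z\<^sup>2)) > 0" by (simp add: s_def)
  have s1: "1 + s \<noteq> 0" using rs by (auto simp: complex_eq_iff)
  thus "1 + csqrt (1 - z\<^sup>2) \<noteq> 0" by (simp add: s_def)
  have ss: "s * s = 1 - z * z" unfolding s_def by (metis power2_csqrt power2_eq_square)
  have w: "wz z = z / (1 + s)" by (simp add: wz_def s_def)
  show w0: "wz z \<noteq> 0" using z s1 by (simp add: w)
  have zz: "(1 - s) * (1 + s) = z * z" using ss by (simp add: algebra_simps)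
  have w': "wz z = (1 - s) / z" using z s1 zz by (simp add: w field_simps)
  thus "wz z = (1 - csqrt (1 - z\<^sup>2)) / z" by (simp add: s_def)
  have "1 / wz z = (1 + s) / z" by (simp add: w)
  hence "wz z + 1 / wz z = 2 / z" unfolding w' by (simp flip: add_divide_distrib)
  thus x: "1 / z = (wz z + 1 / wz z) / 2" by simp
  have "norm (1 + s) \<ge> Re (1 + s)" by (rule complex_Re_le_cmod)
  hence n1: "norm (1 + s) \<ge> 1" using rs by simp
  have nw: "norm (wz z) = norm z / norm (1 + s)" by (simp add: w norm_divide)
  also have "\<dots> \<le> norm z / 1" by (rule divide_left_mono) (use n1 in auto)
  finally show wle: "norm (wz z) \<le> norm z" by simp
  have "norm (1 - z\<^sup>2) \<le> 4" using norm_triangle_ineq4[of 1 "z\<^sup>2"] nz by simp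
  hence "sqrt (norm (1 - z\<^sup>2)) \<le> sqrt 4" by (rule real_sqrt_le_mono)
  hence "norm s \<le> 2" by (simp add: s_def)
  hence n3: "norm (1 + s) \<le> 3" using norm_triangle_ineq[of 1 s] by simp
  show "norm z / 3 \<le> norm (wz z)" unfolding nw by (rule divide_left_mono) (use n1 n3 in auto)
  have im: "Im (1 / y) = - Im y / (norm y)\<^sup>2" for y by (simp add: Im_divide cmod_power2)
  define N where "N = 1 / (norm (wz z))\<^sup>2 - 1"
  have "norm (wz z) < 1" using wle z by simp
  hence "(norm (wz z))\<^sup>2 < 1" by (simp add: abs_square_less_1)
  hence N: "N > 0" using w0 by (simp add: N_def field_simps)
  define Z where "Z = (norm z)\<^sup>2"
  have Z: "Z > 0" using z by (simp add: Z_def)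
  have "Im (1 / z) = (Im (wz z) + Im (1 / wz z)) / 2" unfolding x by simp
  hence "- Im z / Z = (Im (wz z) - Im (wz z) / (norm (wz z))\<^sup>2) / 2" unfolding im Z_def by simp
  hence "- Im z / Z = - (Im (wz z) * N) / 2" by (simp add: N_def algebra_simps)
  \<comment> \<open>Im z is a positive multiple of Im w, so both points lie on the same
    side.\<close>
  hence I: "Im z = Im (wz z) * (N * Z / 2)" using Z by (simp add: field_simps)
  have NZ: "N * Z / 2 > 0" using N Z by simp
  show "0 < r * Im z \<longleftrightarrow> 0 < r * Im (wz z)" 
  proof -
    have "0 < x * c \<longleftrightarrow> 0 < x" if "c > 0" for x c :: real using that by (simp add: zero_less_mult_iff)
    from this[OF NZ, of "r * Im (wz z)"] show ?thesis unfolding I by (simp only: mult.assoc)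
  qed
  show "Im z = 0 \<longleftrightarrow> Im (wz z) = 0" 
  proof -
    have "N * Z / 2 \<noteq> 0" using NZ by linarith
    thus ?thesis unfolding I by (simp only: mult_eq_0_iff simp_thms)
  qed
qed

text \<open>A quarter turn takes side q of w into the right half-plane. The relation 1/z = \<i>(1/v
  - v)/2 then holds for z on the lower side and for -z on the upper side.\<close>

definition vq :: "side \<Rightarrow> complex \<Rightarrow> complex" where "vq q z = - of_real (sg q) * \<i> * wz z"

lemma vq_facts:
  assumes z: "z \<noteq> 0" "norm z \<le> 1/2"
  shows "vq q z \<noteq> 0" "norm (vq q z) \<le> norm z" "norm z / 3 \<le> norm (vq q z)" "Re (vq q z) = sg q * Im (wz z)"
    "0 < sg q * Im z \<Longrightarrow> 0 < Re (vq q z)" "on_side q z \<Longrightarrow> 0 \<le> Re (vq q z)" "on_side q z \<Longrightarrow> vq q z \<notin> \<real>\<^sub>\<le>\<^sub>0"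
    "(vq q \<longlongrightarrow> vq q z) (at z)"
proof -
  note w = wz_facts[OF z]
  show v0: "vq q z \<noteq> 0" "norm (vq q z) \<le> norm z" "norm z / 3 \<le> norm (vq q z)" using w(4,7,8) by (cases q; simp add: vq_def norm_mult)+
  show re: "Re (vq q z) = sg q * Im (wz z)" by (simp add: vq_def)
  show "0 < sg q * Im z \<Longrightarrow> 0 < Re (vq q z)" using re w(9)[of "sg q"] by simp
  show r: "on_side q z \<Longrightarrow> 0 \<le> Re (vq q z)"
    using re w(9)[of "sg q"] w(10) by (cases "Im z = 0") (auto simp: on_side_def less_le)
  show "on_side q z \<Longrightarrow> vq q z \<notin> \<real>\<^sub>\<le>\<^sub>0"
    using r v0(1) by (auto simp: complex_nonpos_Reals_iff complex_eq_iff)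
  have c: "isCont (\<lambda>z. csqrt (1 - z\<^sup>2)) z"
    using w(1) by (intro isCont_o2[OF _ continuous_at_csqrt] continuous_intros) (auto simp: complex_nonpos_Reals_iff)
  have "isCont (vq q) z" unfolding vq_def[abs_def] wz_def using w(3) by (intro continuous_intros c) auto
  thus "(vq q \<longlongrightarrow> vq q z) (at z)" by (simp add: isCont_def)
qed

text \<open>The point 2l - 1 is close to -1, on the cut of the principal root, and the side of l
  decides between the factors \<i> and -\<i>. The two remaining roots have arguments in the right
  half-plane, so they multiply.\<close>

lemma sqrt_cut_side:
  assumes l: "0 < sg p * Im l" "norm l \<le> 1/4"
  shows "sqrt_cut l = of_real (sg p) * \<i> * csqrt (1 - (2 * l)\<^sup>2)"
proof -
  have r: "Re (1 - 2 * l) > 0" "Re (1 + 2 * l) > 0"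
    using complex_Re_le_cmod[of "2 * l"] complex_Re_le_cmod[of "- 2 * l"] l(2) by (simp_all add: norm_mult)
  have m: "csqrt (2 * l - 1) = of_real (sg p) * \<i> * csqrt (1 - 2 * l)"
  proof (cases p)
    case Upper
    thus ?thesis using csqrt_minus[of "1 - 2 * l"] l by simp
  next
    case Lower
    have "csqrt (- (2 * l - 1)) = \<i> * csqrt (2 * l - 1)" by (rule csqrt_minus) (use l Lower in simp)
    hence "\<i> * csqrt (1 - 2 * l) = \<i> * (\<i> * csqrt (2 * l - 1))" by simp
    thus ?thesis using Lower by (simp add: minus_equation_iff[of "csqrt (2 * l - 1)"])
  qed
  have "csqrt ((1 - 2 * l) * (1 + 2 * l)) = csqrt (1 - 2 * l) * csqrt (1 + 2 * l)"
  proof (rule csqrt_mult)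
    have "\<bar>Arg (1 - 2 * l)\<bar> < pi / 2" "\<bar>Arg (1 + 2 * l)\<bar> < pi / 2" unfolding Arg_Re_pos using r by simp_all
    thus "Arg (1 - 2 * l) + Arg (1 + 2 * l) \<in> {- pi<..pi}" unfolding greaterThanAtMost_iff by linarith
  qed
  moreover have "(1 - 2 * l) * (1 + 2 * l) = 1 - (2 * l)\<^sup>2" by (simp add: power2_eq_square algebra_simps)
  moreover have "2 * l + 1 = 1 + 2 * l" by simp
  ultimately show ?thesis unfolding sqrt_cut_def m by (simp add: add.commute)
qed

text \<open>With s the principal root, (1+s)(1-s) = (2l)^2. So the argument of the logarithm is 1/v
  on the upper and v on the lower side, and the sign follows.\<close>

lemma a_fun_side:
  assumes l: "0 < sg p * Im l" "norm l \<le> 1/4"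
  shows "a_fun l = of_real (sg p) * (\<i> / pi) * Ln (vq p (2 * l))"
proof -
  define s where "s = csqrt (1 - (2 * l)\<^sup>2)"
  have l0: "2 * l \<noteq> 0" "norm (2 * l) \<le> 1/2" "on_side p (2 * l)" using l by (cases p; auto simp: norm_mult on_side_def)+
  note w = wz_facts[OF l0(1,2)] and v = vq_facts[OF l0(1,2), of p]
  have i: "1 / (\<i> * complex_of_real pi) = - (\<i> / pi)" by (simp add: field_simps)
  show ?thesis
  proof (cases p)
    case Upper
    have w1: "wz (2 * l) = 2 * l / (1 + s)" by (simp add: wz_def s_def)
    have "(\<i> + sqrt_cut l) / (2 * l) = \<i> * ((1 + s) / (2 * l))" using sqrt_cut_side[OF l] Upper by (simp add: s_def field_simps)
    also have "\<dots> = inverse (vq p (2 * l))"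
    proof -
      have ii: "inverse (- \<i>) = \<i>" by simp
      have g: "\<i> * (A / B) = inverse (- \<i> * (B / A))" for A B :: complex
        by (simp only: inverse_mult_distrib inverse_divide ii)
      have "vq p (2 * l) = - \<i> * (2 * l / (1 + s))" using Upper by (simp add: vq_def w1)
      thus ?thesis by (simp only: g)
    qed
    finally have e: "(\<i> + sqrt_cut l) / (2 * l) = inverse (vq p (2 * l))" .
    show ?thesis unfolding a_fun_def e i Ln_inverse[OF v(7)[OF l0(3)]] using Upper by simp
  next
    case Lower
    have "(\<i> + sqrt_cut l) / (2 * l) = \<i> * ((1 - s) / (2 * l))" using sqrt_cut_side[OF l] Lower by (simp add: s_def field_simps)
    also have "\<dots> = vq p (2 * l)" using Lower unfolding vq_def w(5) s_def by simp
    finally have e: "(\<i> + sqrt_cut l) / (2 * l) = vq p (2 * l)" .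
    show ?thesis unfolding a_fun_def e i using Lower by simp
  qed
qed

lemma bval_a_fun:
  assumes l: "on_side p l" "l \<noteq> 0" "norm l < 1/4"
  shows "bval a_fun p l = of_real (sg p) * (\<i> / pi) * Ln (vq p (2 * l))"
proof (rule bval_eqI[OF l(1), of "1/4 - norm l"])
  show "1/4 - norm l > 0" using l by simp
  fix u assume u: "0 < sg p * Im u" "dist u l < 1/4 - norm l"
  have "norm u \<le> 1/4" using norm_triangle_ineq2[of u l] u(2) by (simp add: dist_norm)
  thus "a_fun u = of_real (sg p) * (\<i> / pi) * Ln (vq p (2 * u))" by (rule a_fun_side[OF u(1)])
next
  have l2: "2 * l \<noteq> 0" "norm (2 * l) \<le> 1/2" "on_side p (2 * l)" using l by (cases p; auto simp: norm_mult on_side_def)+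
  have c: "isCont (vq p) (2 * l)" using vq_facts(8)[OF l2(1,2)] by (simp add: isCont_def)
  have "isCont (\<lambda>u. vq p (2 * u)) l" by (rule isCont_o2[where f = "\<lambda>u. 2 * u" and g = "vq p"]) (use c in simp_all)
  hence "isCont (\<lambda>u. of_real (sg p) * (\<i> / pi) * Ln (vq p (2 * u))) l"
    using vq_facts(7)[OF l2] by (intro continuous_intros) auto
  thus "((\<lambda>u. of_real (sg p) * (\<i> / pi) * Ln (vq p (2 * u))) \<longlongrightarrow> of_real (sg p) * (\<i> / pi) * Ln (vq p (2 * l))) (at l)"
    by (simp add: isCont_def)
qed

lemma vq_minus: "vq Upper (- z) = vq Lower z" "vq Lower (- z) = vq Upper z"
  by (simp_all add: vq_def wz_def)

text \<open>g(z) is a at -z/2, which lies on the opposite side; hence the minus sign.\<close>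

lemma bval_g_fun:
  assumes z: "on_side q z" "z \<noteq> 0" "norm z < 1/2"
  shows "bval g_fun q z = - of_real (sg q) * (\<i> / pi) * Ln (vq q z)"
proof (rule bval_eqI[OF z(1), of "1/2 - norm z"])
  show "1/2 - norm z > 0" using z by simp
  fix u assume u: "0 < sg q * Im u" "dist u z < 1/2 - norm z"
  have n: "norm (- u / 2) \<le> 1/4" using norm_triangle_ineq2[of u z] u(2) by (simp add: dist_norm norm_divide)
  show "g_fun u = - of_real (sg q) * (\<i> / pi) * Ln (vq q u)"
  proof (cases q)
    case Upper
    thus ?thesis using a_fun_side[of Lower "- u / 2"] u n vq_minus[of u] by (simp add: g_fun_def)
  next
    case Lower
    thus ?thesis using a_fun_side[of Upper "- u / 2"] u n vq_minus[of u] by (simp add: g_fun_def)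
  qed
next
  have z2: "norm z \<le> 1/2" using z by simp
  have "isCont (vq q) z" using vq_facts(8)[OF z(2) z2] by (simp add: isCont_def)
  hence "isCont (\<lambda>u. - of_real (sg q) * (\<i> / pi) * Ln (vq q u)) z"
    using vq_facts(7)[OF z(2) z2 z(1)] by (intro continuous_intros) auto
  thus "((\<lambda>u. - of_real (sg q) * (\<i> / pi) * Ln (vq q u)) \<longlongrightarrow> - of_real (sg q) * (\<i> / pi) * Ln (vq q z)) (at z)"
    by (simp add: isCont_def)
qed

lemma Ln_mult_quarter_turn:
  assumes c: "exp c = u" "\<bar>Im c\<bar> = pi / 2" and m: "Re m > 0"
  shows "Ln (m * u) = Ln m + c"
proof (rule Ln_unique)
  have m0: "m \<noteq> 0" using m by auto
  have b: "\<bar>Im (Ln m)\<bar> < pi / 2" using Re_Ln_pos_lt[OF m0] m by blast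
  show "exp (Ln m + c) = m * u" by (simp only: exp_add exp_Ln[OF m0] c(1))
  show "- pi < Im (Ln m + c)" "Im (Ln m + c) \<le> pi" unfolding plus_complex.sel using b c(2) by linarith+
qed

lemma Ln_rotate:
  assumes l: "0 < sg p * Im l" shows "Ln l = Ln (- of_real (sg p) * \<i> * l) + of_real (sg p) * (\<i> * pi / 2)"
proof (cases p)
  case Upper
  have e: "exp (\<i> * pi / 2) = \<i>" using cis_pi_half by (simp add: cis_conv_exp)
  have "Ln ((- \<i> * l) * \<i>) = Ln (- \<i> * l) + \<i> * pi / 2"
    by (rule Ln_mult_quarter_turn[OF e]) (use l Upper in simp_all)
  moreover have "(- \<i> * l) * \<i> = l" by (simp add: complex_eq_iff)
  ultimately show ?thesis using Upper by simp
next
  case Lower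
  have "exp (- (\<i> * pi / 2)) = inverse (exp (\<i> * pi / 2))" by (rule exp_minus)
  also have "exp (\<i> * pi / 2) = \<i>" using cis_pi_half by (simp add: cis_conv_exp)
  finally have e: "exp (- (\<i> * pi / 2)) = - \<i>" by simp
  have "Ln ((\<i> * l) * - \<i>) = Ln (\<i> * l) + - (\<i> * pi / 2)"
    by (rule Ln_mult_quarter_turn[OF e]) (use l Lower in simp_all)
  moreover have "(\<i> * l) * - \<i> = l" by (simp add: complex_eq_iff)
  ultimately show ?thesis using Lower by simp
qed

text \<open>After the quarter turn \<open>Ln\<close> is continuous up to the shore, including the
  negative half-axis. The constant restores the prescribed range of arg \<lambda>.\<close>

lemma kap_eq:
  assumes l: "on_side p l" "l \<noteq> 0"
  shows "kap p l = - Ln (- of_real (sg p) * \<i> * l) - of_real (sg p) * (\<i> * pi / 2)"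
proof -
  have "bval Ln p l = Ln (- of_real (sg p) * \<i> * l) + of_real (sg p) * (\<i> * pi / 2)"
  proof (rule bval_eqI[OF l(1), of 1])
    have "- of_real (sg p) * \<i> * l \<notin> \<real>\<^sub>\<le>\<^sub>0"
      using l sg_cases[of p] by (auto simp: complex_nonpos_Reals_iff on_side_def complex_eq_iff)
    hence "isCont (\<lambda>l. Ln (- of_real (sg p) * \<i> * l) + of_real (sg p) * (\<i> * pi / 2)) l"
      by (intro continuous_intros) auto
    thus "((\<lambda>l. Ln (- of_real (sg p) * \<i> * l) + of_real (sg p) * (\<i> * pi / 2)) \<longlongrightarrow> Ln (- of_real (sg p) * \<i> * l) + of_real (sg p) * (\<i> * pi / 2)) (at l)"
      by (simp add: isCont_def)
  qed (use Ln_rotate in auto)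
  thus ?thesis by (simp add: kap_def)
qed

section \<open>Boundary values of the matrices \<Gamma> and \<Phi>\<close>

text \<open>The upper side is the conjugated one because there v belongs to -z, the second case of
  \<open>Gamma_off_Gx\<close>.\<close>

definition conj1 :: "side \<Rightarrow> complex^2^2 \<Rightarrow> complex^2^2" where
  "conj1 q X = (case q of Lower \<Rightarrow> X | Upper \<Rightarrow> sigma1 ** X ** sigma1)"

lemma conj1_mat2: "conj1 Upper (mat2 a b c d) = mat2 d c b a" "conj1 Lower X = X"
  by (simp_all add: conj1_def sigma1_conj)

lemma mat2_ex: "\<exists>a b c d. X = mat2 a b c d"
  by (rule exI[of _ "X$1$1"], rule exI[of _ "X$1$2"], rule exI[of _ "X$2$1"], rule exI[of _ "X$2$2"])
     (simp add: mat2_def vec_eq_iff forall_2 vector_2)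

lemma conj1_mult: "conj1 q (X ** Y) = conj1 q X ** conj1 q Y"
proof (cases q)
  case Upper
  obtain a b c d a' b' c' d' where "X = mat2 a b c d" "Y = mat2 a' b' c' d'" using mat2_ex by metis
  thus ?thesis using Upper by (simp add: mat2_mult conj1_mat2 mat2_eq)
qed (simp add: conj1_mat2)

lemma isCont_HS:
  assumes f: "isCont f z" and n: "norm (f z) < 1" shows "isCont (\<lambda>z. HS A B C (f z)) z"
proof -
  have "(HS A B C has_field_derivative HD A B C (f z)) (at (f z))" using HS_deriv[OF DERIV_ident] n by auto
  from isCont_o2[OF f DERIV_isCont[OF this]] show ?thesis .
qed

lemma Gx_entries_cont:
  assumes a: "Im a \<noteq> 0" and v: "isCont v z" "v z \<noteq> 0" "norm (v z) \<le> 1/2" "v z \<notin> \<real>\<^sub>\<le>\<^sub>0"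
  shows "isCont (\<lambda>z. kk a (v z)) z" "isCont (\<lambda>z. Aa a (v z)) z" "isCont (\<lambda>z. Bb a (v z)) z" "isCont (\<lambda>z. Cc a (v z)) z" "isCont (\<lambda>z. Dd a (v z)) z"
proof -
  have in1: "Im (- a - 1) \<noteq> 0" using a by simp
  note n = norm_one_plus_sq[OF v(3)] and h = half_nonzero[OF a] half_nonzero[OF in1]
  have "Re (1 + (v z)\<^sup>2) > 0" using complex_Re_le_cmod[of "- (v z)\<^sup>2"] n(5) by simp
  hence q: "1 + (v z)\<^sup>2 \<notin> \<real>\<^sub>\<le>\<^sub>0" by (auto simp: complex_nonpos_Reals_iff)
  have x: "isCont (\<lambda>z. xx (v z)) z" unfolding xx_def using n(4) by (intro continuous_intros v(1)) auto
  have x1: "norm (xx (v z)) < 1" using norm_xx[OF v(3)] by simp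
  have G: "isCont (\<lambda>z. Gh \<nu> (xx (v z))) z" "isCont (\<lambda>z. Jh \<nu> (xx (v z))) z" for \<nu>
    unfolding Gh_def Jh_def by (intro isCont_HS x x1)+
  have N: "isCont (\<lambda>z. n1 a (v z)) z" "isCont (\<lambda>z. n2 a (v z)) z" "isCont (\<lambda>z. n3 a (v z)) z" "isCont (\<lambda>z. n4 a (v z)) z"
    unfolding n1_def n2_def n3_def n4_def using h v(2) by (intro continuous_intros G v(1); simp)+
  have "isCont (\<lambda>z. 1 + (v z)\<^sup>2) z" by (intro continuous_intros v(1))
  hence cq: "isCont (\<lambda>z. csqrt (1 + (v z)\<^sup>2)) z" by (rule isCont_o2[where g = csqrt]) (rule continuous_at_csqrt[OF q])
  show "isCont (\<lambda>z. kk a (v z)) z" unfolding kk_def using ee_ne[OF a] n(4) by (intro continuous_intros cq) auto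
  show "isCont (\<lambda>z. Aa a (v z)) z" "isCont (\<lambda>z. Bb a (v z)) z" "isCont (\<lambda>z. Cc a (v z)) z" "isCont (\<lambda>z. Dd a (v z)) z"
    unfolding Aa_def Bb_def Cc_def Dd_def by (intro continuous_intros N v(1) v(4))+
qed

text \<open>\<open>Gamma_off_Gx\<close> needs Re v > 0, so it applies off the reals; continuity of
  \<open>Gx\<close> carries the formula to the shore, where Re v = 0.\<close>

lemma bval_Gamma_off:
  assumes a: "Im a \<noteq> 0" and z: "on_side q z" "z \<noteq> 0" "norm z < 1/2"
  shows "bval (Gamma_off a) q z = conj1 q (Gx a (vq q z))"
proof (rule bval_eqI[OF z(1), of "1/2 - norm z"])
  show "1/2 - norm z > 0" using z by simp
  fix u assume u: "0 < sg q * Im u" "dist u z < 1/2 - norm z"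
  have nu: "norm u \<le> 1/2" using norm_triangle_ineq2[of u z] u(2) by (simp add: dist_norm)
  have u0: "u \<noteq> 0" using u(1) by auto
  note v = vq_facts[OF u0 nu, of q] and w = wz_facts[OF u0 nu]
  have v1: "norm (vq q u) \<le> 1/2" using v(2) nu by linarith
  note n = norm_one_plus_sq[OF v1]
  have v2: "Re ((vq q u)\<^sup>2) > - 1/2" using complex_Re_le_cmod[of "- (vq q u)\<^sup>2"] n(5) by simp
  have v3: "norm (vq q u) < 1" using v1 by simp
  have i: "1 / (- of_real (sg q) * u) = \<i> * (1 / vq q u - vq q u) / 2"
  proof -
    have g: "\<i> * (1 / (\<i> * W) - \<i> * W) / 2 = (W + 1 / W) / 2" "\<i> * (1 / (- \<i> * W) - - \<i> * W) / 2 = - ((W + 1 / W) / 2)"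
      if "W \<noteq> 0" for W using that by (simp_all add: field_simps)
    have "1 / (- of_real (sg q) * u) = - of_real (sg q) * (1 / u)" by (cases q) simp_all
    also have "\<dots> = - of_real (sg q) * ((wz u + 1 / wz u) / 2)" unfolding w(6) ..
    also have "\<dots> = \<i> * (1 / vq q u - vq q u) / 2"
    proof (cases q)
      case Upper
      hence v: "vq q u = - \<i> * wz u" by (simp add: vq_def)
      show ?thesis unfolding v g(2)[OF w(4)]
        by ((simp only: Upper sg.simps of_real_1 mult_minus_left mult_1_left; fail) | (simp add: Upper field_simps w(4)))
    next
      case Lower
      hence v: "vq q u = \<i> * wz u" by (simp add: vq_def)
      show ?thesis unfolding v g(1)[OF w(4)] using Lower by simp
    qed
    finally show ?thesis .
  qed
  note G = Gamma_off_Gx[OF a v(5)[OF u(1)] v3 v2 i]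
  show "Gamma_off a u = conj1 q (Gx a (vq q u))" using G by (cases q) (simp_all add: conj1_def)
next
  have z2: "norm z \<le> 1/2" using z by simp
  note v = vq_facts[OF z(2) z2, of q]
  have v1: "norm (vq q z) \<le> 1/2" using v(2) z2 by linarith
  have c: "isCont (vq q) z" using v(8) by (simp add: isCont_def)
  note C = Gx_entries_cont[OF a c v(1) v1 v(7)[OF z(1)], unfolded isCont_def]
  show "((\<lambda>z. conj1 q (Gx a (vq q z))) \<longlongrightarrow> conj1 q (Gx a (vq q z))) (at z)"
  proof (cases q)
    case Upper
    show ?thesis unfolding Upper Gx_def conj1_mat2 by (intro tendsto_mat2 tendsto_intros C[unfolded Upper])
  next
    case Lower
    show ?thesis unfolding Lower Gx_def conj1_mat2 by (intro tendsto_mat2 tendsto_intros C[unfolded Lower])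
  qed
qed

text \<open>With m = (v + 1/v)/2 the argument of the fourth root is m^2. Since Re m > 0, \<beta> is
  the principal root of m, and \<i>/z is \<plusminus>(v - 1/v)/2, so all entries become rational in
  v up to the common factor r.\<close>

lemma Phi_eq:
  assumes z: "0 < sg q * Im z" "norm z \<le> 1/2"
  shows "Phi z = conj1 q (Phiv (vq q z))"
proof -
  define v where "v = vq q z"
  have z0: "z \<noteq> 0" using z(1) by auto
  have s: "on_side q z" using z(1) by (simp add: on_side_def)
  note w = wz_facts[OF z0 z(2)] and vf = vq_facts[OF z0 z(2), of q, folded v_def]
  have v1: "norm v \<le> 1/2" using vf(2) z(2) by linarith
  have rv: "Re v > 0" using vf(5)[OF z(1)] .
  hence v0: "v \<noteq> 0" by auto
  note n = norm_one_plus_sq[OF v1]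
  have iz: "\<i> / z = - of_real (sg q) * (v - 1 / v) / 2"
  proof -
    have g: "\<i> * ((W + 1 / W) / 2) = (\<i> * W - 1 / (\<i> * W)) / 2" "\<i> * ((W + 1 / W) / 2) = - ((- \<i> * W - 1 / (- \<i> * W)) / 2)"
      if "W \<noteq> 0" for W using that by (simp_all add: field_simps)
    have "\<i> / z = \<i> * (1 / z)" by simp
    also have "\<dots> = \<i> * ((wz z + 1 / wz z) / 2)" unfolding w(6) ..
    also have "\<dots> = - of_real (sg q) * (v - 1 / v) / 2"
    proof (cases q)
      case Upper
      hence v: "v = - \<i> * wz z" by (simp add: v_def vq_def)
      show ?thesis unfolding v g(2)[OF w(4)]
        by ((simp only: Upper sg.simps of_real_1 mult_minus_left mult_1_left minus_divide_left; fail) | (simp add: Upper field_simps w(4)))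
    next
      case Lower
      hence v: "v = \<i> * wz z" by (simp add: v_def vq_def)
      show ?thesis unfolding v g(1)[OF w(4)] using Lower by simp
    qed
    finally show ?thesis .
  qed
  define m where "m = (v + 1 / v) / 2"
  have m: "m = (1 + v\<^sup>2) / (2 * v)" unfolding m_def using v0 by (simp add: field_simps power2_eq_square)
  have y: "(z\<^sup>2 - 1) / z\<^sup>2 = m\<^sup>2"
  proof -
    have "(z\<^sup>2 - 1) / z\<^sup>2 = 1 + (\<i> / z)\<^sup>2" using z0 by (simp add: field_simps power_divide)
    also have "(\<i> / z)\<^sup>2 = ((v - 1 / v) / 2)\<^sup>2" unfolding iz using sg_cases[of q] by (auto simp: power_divide power_mult_distrib power2_commute)
    also have "1 + \<dots> = m\<^sup>2" unfolding m_def using v0 by (simp add: field_simps power2_eq_square)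
    finally show ?thesis .
  qed
  have "Re (1 / v) = Re v / (norm v)\<^sup>2" by (simp add: Re_divide cmod_power2)
  moreover have "Re v / (norm v)\<^sup>2 > 0" using rv v0 by simp
  ultimately have rem: "Re m > 0" using rv by (simp add: m_def)
  hence m0: "m \<noteq> 0" by auto
  \<comment> \<open>The logarithm of m is assembled from those of v and 1 + v^2, to match the roots
    in r. It is principal, and Re m > 0 makes 2t principal for m^2.\<close>
  define t where "t = Ln (1 + v\<^sup>2) - Ln v - of_real (ln 2)"
  have et: "exp t = m"
  proof -
    have "exp (complex_of_real (ln 2)) = 2" by (metis exp_ln exp_of_real of_real_numeral zero_less_numeral)
    thus ?thesis unfolding t_def m using n(4) v0 by (simp add: exp_diff)
  qed
  have "Re (1 + v\<^sup>2) > 0" using complex_Re_le_cmod[of "- v\<^sup>2"] n(5) by simp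
  hence q2: "\<bar>Im (Ln (1 + v\<^sup>2))\<bar> < pi / 2" using Re_Ln_pos_lt[OF n(4)] by blast
  have q3: "\<bar>Im (Ln v)\<bar> < pi / 2" using Re_Ln_pos_lt[OF v0] rv by blast
  have "\<bar>Im t\<bar> < pi" using q2 q3 by (simp add: t_def)
  hence "Ln m = t" by (intro Ln_unique[OF et]) auto
  hence t2: "\<bar>Im t\<bar> < pi / 2" using Re_Ln_pos_lt[OF m0] rem by blast
  have "Ln (m\<^sup>2) = 2 * t" by (rule Ln_unique) (use t2 in \<open>auto simp: exp_double et\<close>)
  hence b: "beta_fun z = exp (t / 2)" unfolding beta_fun_def y powr_def using m0 by simp
  define r where "r = exp (Ln v / 2) / (csqrt 2 * csqrt (1 + v\<^sup>2))"
  have br: "exp (t / 2) * r = 1 / 2"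
  proof -
    have c: "csqrt 2 * csqrt 2 = 2" by (metis power2_csqrt power2_eq_square)
    have "Ln 2 = complex_of_real (ln 2)" using Ln_of_real[of 2] by simp
    hence c2: "csqrt 2 = exp (of_real (ln 2) / 2)" by (subst csqrt_exp_Ln) simp_all
    have "exp (t / 2) = csqrt (1 + v\<^sup>2) / exp (Ln v / 2) / csqrt 2"
      unfolding c2 t_def diff_divide_distrib exp_diff csqrt_exp_Ln[OF n(4)] by (rule refl)
    hence e: "exp (t / 2) * r = csqrt (1 + v\<^sup>2) / exp (Ln v / 2) / csqrt 2 * (exp (Ln v / 2) / (csqrt 2 * csqrt (1 + v\<^sup>2)))"
      unfolding r_def by (rule arg_cong)
    have g: "A / B / S * (B / (S * A)) = 1 / (S * S)" if "A \<noteq> 0" "B \<noteq> 0" for A B S :: complex using that by simp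
    have h: "csqrt (1 + v\<^sup>2) \<noteq> 0" using n(4) by simp
    show ?thesis by (simp only: e g[OF h exp_not_eq_zero] c)
  qed
  have r0: "r \<noteq> 0" using br by auto
  have mrr: "4 * (m * r) * r = 1"
  proof -
    have em: "exp (t / 2) * exp (t / 2) = m" using et by (simp flip: exp_add)
    have "4 * (m * r) * r = 4 * (exp (t / 2) * r) * (exp (t / 2) * r)" unfolding em[symmetric] by (simp only: mult_ac)
    also have "\<dots> = 1" unfolding br by simp
    finally show ?thesis .
  qed
  have B: "beta_fun z / 2 = m * r" "1 / (2 * beta_fun z) = r" "- 1 / (2 * beta_fun z) = - r"
  proof -
    have e: "exp (t / 2) = 1 / (2 * r)" using br r0 by (simp add: field_simps)
    have "m * r = 1 / (4 * r)" using mrr r0 by (simp add: eq_divide_eq mult_ac)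
    thus "beta_fun z / 2 = m * r" unfolding b e by simp
    show "1 / (2 * beta_fun z) = r" "- 1 / (2 * beta_fun z) = - r" unfolding b e using r0 by simp_all
  qed
  define \<zeta> where "\<zeta> = \<i> / (2 * z)"
  have ze: "2 * \<zeta> = - of_real (sg q) * (v - 1 / v) / 2" "- \<i> / (2 * z) = - \<zeta>" using iz by (simp_all add: \<zeta>_def)
  have "Phi z = mat2 (r * (m + 1 + 2 * \<zeta>)) (r * (m - 1 - 2 * \<zeta>)) (r * (m - 1 + 2 * \<zeta>)) (r * (m + 1 - 2 * \<zeta>))"
    unfolding Phi_def pow_sigma1_def B ze(2) \<zeta>_def[symmetric] mat2_one mat2_add mat2_mult mat2_eq by (simp add: algebra_simps)
  also have "\<dots> = conj1 q (Phiv v)"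
  proof (cases q)
    case Upper
    have z2: "2 * \<zeta> = - ((v - 1 / v) / 2)" unfolding ze(1) Upper
      by ((simp only: sg.simps of_real_1 mult_minus_left mult_1_left minus_divide_left; fail) | (simp add: v0 field_simps))
    have h: "m + 1 + 2 * \<zeta> = 1 / v + 1" "m - 1 - 2 * \<zeta> = v - 1" "m - 1 + 2 * \<zeta> = 1 / v - 1" "m + 1 - 2 * \<zeta> = 1 + v"
      unfolding z2 m_def using v0 by (simp_all add: field_simps)
    show ?thesis unfolding h Upper Phiv_def Let_def conj1_mat2 r_def[symmetric] by (rule refl)
  next
    case Lower
    have z2: "2 * \<zeta> = (v - 1 / v) / 2" using ze(1) Lower by simp
    have h: "m + 1 + 2 * \<zeta> = 1 + v" "m - 1 - 2 * \<zeta> = 1 / v - 1" "m - 1 + 2 * \<zeta> = v - 1" "m + 1 - 2 * \<zeta> = 1 / v + 1"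
      unfolding z2 m_def using v0 by (simp_all add: field_simps)
    show ?thesis unfolding h Lower Phiv_def Let_def conj1_mat2 r_def[symmetric] by (rule refl)
  qed
  finally show ?thesis by (simp add: v_def)
qed

lemma bval_Phi:
  assumes z: "on_side q z" "z \<noteq> 0" "norm z < 1/2"
  shows "bval Phi q z = conj1 q (Phiv (vq q z))"
proof (rule bval_eqI[OF z(1), of "1/2 - norm z"])
  show "1/2 - norm z > 0" using z by simp
  fix u assume u: "0 < sg q * Im u" "dist u z < 1/2 - norm z"
  have "norm u \<le> 1/2" using norm_triangle_ineq2[of u z] u(2) by (simp add: dist_norm)
  thus "Phi u = conj1 q (Phiv (vq q u))" by (rule Phi_eq[OF u(1)])
next
  have z2: "norm z \<le> 1/2" using z by simp
  note v = vq_facts[OF z(2) z2, of q]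
  have v1: "norm (vq q z) \<le> 1/2" using v(2) z2 by linarith
  note n = norm_one_plus_sq[OF v1]
  have "Re (1 + (vq q z)\<^sup>2) > 0" using complex_Re_le_cmod[of "- (vq q z)\<^sup>2"] n(5) by simp
  hence nr: "1 + (vq q z)\<^sup>2 \<notin> \<real>\<^sub>\<le>\<^sub>0" by (auto simp: complex_nonpos_Reals_iff)
  have c: "isCont (vq q) z" using v(8) by (simp add: isCont_def)
  define r where "r = (\<lambda>z. exp (Ln (vq q z) / 2) / (csqrt 2 * csqrt (1 + (vq q z)\<^sup>2)))"
  have "isCont (\<lambda>z. 1 + (vq q z)\<^sup>2) z" by (intro continuous_intros c)
  hence "isCont (\<lambda>z. csqrt (1 + (vq q z)\<^sup>2)) z" by (rule isCont_o2[where g = csqrt]) (rule continuous_at_csqrt[OF nr])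
  hence r: "isCont r z" unfolding r_def using n(4) v(7)[OF z(1)] by (intro continuous_intros c) auto
  have R: "isCont (\<lambda>z. r z * (1 + vq q z)) z" "isCont (\<lambda>z. r z * (1 / vq q z - 1)) z"
    "isCont (\<lambda>z. r z * (vq q z - 1)) z" "isCont (\<lambda>z. r z * (1 / vq q z + 1)) z"
    using v(1) by (intro continuous_intros r c; simp)+
  note R' = R[unfolded isCont_def]
  show "((\<lambda>z. conj1 q (Phiv (vq q z))) \<longlongrightarrow> conj1 q (Phiv (vq q z))) (at z)"
  proof (cases q)
    case Upper
    have P: "conj1 q (Phiv (vq q y)) = mat2 (r y * (1 / vq q y + 1)) (r y * (vq q y - 1)) (r y * (1 / vq q y - 1)) (r y * (1 + vq q y))" for y
      by (simp add: Upper Phiv_def Let_def conj1_mat2 r_def)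
    show ?thesis unfolding P by (rule tendsto_mat2[OF R'(4,3,2,1)])
  next
    case Lower
    have P: "conj1 q (Phiv (vq q y)) = mat2 (r y * (1 + vq q y)) (r y * (1 / vq q y - 1)) (r y * (vq q y - 1)) (r y * (1 / vq q y + 1))" for y
      by (simp add: Lower Phiv_def Let_def conj1_mat2 r_def)
    show ?thesis unfolding P by (rule tendsto_mat2[OF R'])
  qed
qed

section \<open>Symmetries: from one side to all four combinations\<close>

text \<open>Entrywise conjugation followed by conjugation with \<open>sigma1\<close>, hence
  multiplicative. It is the permutation found in \<open>Gx_cnj\<close>.\<close>

definition cj :: "complex^2^2 \<Rightarrow> complex^2^2" where
  "cj X = mat2 (cnj (X$2$2)) (cnj (X$2$1)) (cnj (X$1$2)) (cnj (X$1$1))"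

lemma cj_mat2: "cj (mat2 a b c d) = mat2 (cnj d) (cnj c) (cnj b) (cnj a)"
  by (simp add: cj_def mat2_def vector_2)

lemma cj_mult: "cj (X ** Y) = cj X ** cj Y"
proof -
  obtain a b c d a' b' c' d' where "X = mat2 a b c d" "Y = mat2 a' b' c' d'" using mat2_ex by metis
  thus ?thesis by (simp add: mat2_mult cj_mat2 mat2_eq)
qed

lemma cj_one_add: "cj (mat 1 + X) = mat 1 + cj X"
proof -
  obtain a b c d where "X = mat2 a b c d" using mat2_ex by metis
  thus ?thesis by (simp add: mat2_one mat2_add cj_mat2)
qed

lemma cj_bound: fixes E :: "complex^2^2" assumes "\<forall>i j. cmod (E $ i $ j) \<le> B" shows "\<forall>i j. cmod (cj E $ i $ j) \<le> B"
  using assms by (simp add: cj_def mat2_def forall_2 vector_2)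

lemma conj1_one_add: "conj1 q (mat 1 + X) = mat 1 + conj1 q X"
proof -
  obtain a b c d where "X = mat2 a b c d" using mat2_ex by metis
  thus ?thesis by (cases q) (simp_all add: mat2_one mat2_add conj1_mat2)
qed

lemma conj1_bound: fixes E :: "complex^2^2" assumes "\<forall>i j. cmod (E $ i $ j) \<le> B" shows "\<forall>i j. cmod (conj1 q E $ i $ j) \<le> B"
proof -
  obtain a b c d where E: "E = mat2 a b c d" using mat2_ex by metis
  show ?thesis using assms unfolding E by (cases q; simp only: conj1_mat2; simp add: mat2_def forall_2 vector_2)
qed

lemma Gx_cj:
  assumes "Im a \<noteq> 0" "v \<noteq> 0" "0 \<le> Re v" "norm v \<le> 1/2"
  shows "Gx (cnj a) (cnj v) = cj (Gx a v)"
proof -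
  obtain g11 g12 g21 g22 where G: "Gx a v = mat2 g11 g12 g21 g22" using mat2_ex by blast
  show ?thesis unfolding Gx_cnj[OF assms G] G cj_mat2 by (rule refl)
qed

lemma cj_Phiv:
  assumes v: "v \<noteq> 0" "0 \<le> Re v" "norm v \<le> 1/2"
  shows "cj (Phiv (cnj v)) = sigma1 ** Phiv v ** sigma1"
proof -
  note n = norm_one_plus_sq[OF v(3)]
  have nr: "v \<notin> \<real>\<^sub>\<le>\<^sub>0" using v by (auto simp: complex_nonpos_Reals_iff complex_eq_iff)
  have "Re (1 + v\<^sup>2) > 0" using complex_Re_le_cmod[of "- v\<^sup>2"] n(5) by simp
  hence nr2: "1 + v\<^sup>2 \<notin> \<real>\<^sub>\<le>\<^sub>0" by (auto simp: complex_nonpos_Reals_iff)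
  have c2: "cnj (csqrt 2) = csqrt 2" using cnj_csqrt[of 2] by simp
  have q: "csqrt (1 + (cnj v)\<^sup>2) = cnj (csqrt (1 + v\<^sup>2))" using cnj_csqrt[OF nr2] by simp
  define r where "r = exp (Ln v / 2) / (csqrt 2 * csqrt (1 + v\<^sup>2))"
  have r: "exp (Ln (cnj v) / 2) / (csqrt 2 * csqrt (1 + (cnj v)\<^sup>2)) = cnj r"
    unfolding r_def q by (simp add: cnj_Ln[OF nr, symmetric] exp_cnj c2)
  show ?thesis unfolding Phiv_def Let_def r r_def[symmetric] by (simp add: cj_mat2 sigma1_conj)
qed

definition PP :: "side \<Rightarrow> complex \<Rightarrow> complex^2^2" where
  "PP p v = (case p of Upper \<Rightarrow> Phiv v | Lower \<Rightarrow> sigma1 ** Phiv v ** sigma1)"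

definition approx :: "side \<Rightarrow> complex \<Rightarrow> complex \<Rightarrow> complex \<Rightarrow> real \<Rightarrow> complex^2^2 \<Rightarrow> bool" where
  "approx p k a v B T \<longleftrightarrow> (\<exists>E :: complex^2^2. (\<forall>i j. cmod (E $ i $ j) \<le> B) \<and>
     Gx a v = PP p v ** (mat 1 + E) ** T ** exp_sigma3 (- k * (\<i> / pi * Ln v)))"

lemma approx_mono:
  assumes A: "approx p k a v B T" and B: "B \<le> B'" shows "approx p k a v B' T"
proof -
  obtain E :: "complex^2^2" where E: "\<forall>i j. cmod (E $ i $ j) \<le> B"
    "Gx a v = PP p v ** (mat 1 + E) ** T ** exp_sigma3 (- k * (\<i> / pi * Ln v))"
    using A unfolding approx_def by blast
  have "\<forall>i j. cmod (E $ i $ j) \<le> B'" using E(1) B order_trans by blast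
  thus ?thesis unfolding approx_def using E(2) by blast
qed

lemma approx_cj:
  assumes A: "approx Upper (cnj k) (cnj a) (cnj v) B T" and a: "Im a \<noteq> 0" and v: "v \<noteq> 0" "0 \<le> Re v" "norm v \<le> 1/2"
  shows "approx Lower k a v B (cj T)"
proof -
  have nr: "v \<notin> \<real>\<^sub>\<le>\<^sub>0" using v by (auto simp: complex_nonpos_Reals_iff complex_eq_iff)
  obtain E :: "complex^2^2" where E: "\<forall>i j. cmod (E $ i $ j) \<le> B"
    "Gx (cnj a) (cnj v) = Phiv (cnj v) ** (mat 1 + E) ** T ** exp_sigma3 (- cnj k * (\<i> / pi * Ln (cnj v)))"
    using A unfolding approx_def PP_def by auto
  have e: "cj (exp_sigma3 (- cnj k * (\<i> / pi * Ln (cnj v)))) = exp_sigma3 (- k * (\<i> / pi * Ln v))"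
    by (simp add: exp_sigma3_def cj_mat2 mat2_eq exp_cnj cnj_Ln[OF nr, symmetric])
  have "Gx a v = cj (Gx (cnj a) (cnj v))" using Gx_cj[of "cnj a" "cnj v"] a v by simp
  also have "\<dots> = PP Lower v ** (mat 1 + cj E) ** cj T ** exp_sigma3 (- k * (\<i> / pi * Ln v))"
    unfolding E(2) cj_mult cj_one_add e cj_Phiv[OF v] PP_def by simp
  finally show ?thesis unfolding approx_def using cj_bound[OF E(1)] by blast
qed

definition cp :: "side \<Rightarrow> complex \<Rightarrow> complex" where
  "cp p x = (case p of Upper \<Rightarrow> x | Lower \<Rightarrow> cnj x)"

lemma cp_simps [simp]: "cp Upper x = x" "cp Lower x = cnj x" by (simp_all add: cp_def)

text \<open>The hypotheses of \<open>core_upper\<close> on k, a and v in one predicate;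
  \<open>err\<close> is the bound in its conclusion.\<close>

definition adm :: "real \<Rightarrow> complex \<Rightarrow> complex \<Rightarrow> complex \<Rightarrow> complex \<Rightarrow> bool" where
  "adm \<sigma> k a \<delta> v \<longleftrightarrow> Im k \<le> 0 \<and> - pi \<le> Im k \<and> 0 \<le> Re k \<and> a = 1/2 - \<i> * k / pi + \<delta> \<and>
     - 1/2 \<le> Re a \<and> Re a \<le> 1/2 \<and> 2 * (hyp_bound + 1) \<le> - Im a \<and> v \<noteq> 0 \<and> 0 \<le> Re v \<and> norm v \<le> 1/2 \<and>
     norm (exp (\<delta> * Ln v) - 1) \<le> \<sigma> \<and> norm (exp (- (\<delta> * Ln v)) - 1) \<le> \<sigma> \<and> norm (exp (- (\<i> * pi * \<delta>)) - 1) \<le> \<sigma> \<and> \<sigma> \<le> 1/2 \<and>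
     96 * ((hyp_bound + 1) / (- Im a)) / (norm v)\<^sup>2 \<le> 1"

definition err :: "real \<Rightarrow> real \<Rightarrow> complex \<Rightarrow> complex \<Rightarrow> complex \<Rightarrow> real" where
  "err \<theta> \<sigma> k a v = 96 * ((hyp_bound + 1) / (- Im a)) / (norm v)\<^sup>2 + 15 * (exp (- Re k * (\<theta> / pi)) + \<sigma>) / (norm v)\<^sup>2"

lemma core_adm:
  assumes \<theta>: "0 < \<theta>" "\<theta> < pi / 2" and A: "adm \<sigma> k a \<delta> v"
  shows "\<bar>Im (Ln v)\<bar> \<le> pi / 2 - \<theta> / 2 \<Longrightarrow> approx Upper k a v (err \<theta> \<sigma> k a v) (mat 1)"
    and "Im (Ln v) \<le> pi / 4 \<Longrightarrow> approx Upper k a v (err \<theta> \<sigma> k a v) (tri_left Lower k (\<i> / pi * Ln v))"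
    and "- pi / 4 \<le> Im (Ln v) \<Longrightarrow> approx Upper k a v (err \<theta> \<sigma> k a v) (tri_right Lower k (\<i> / pi * Ln v))"
proof -
  have A': "Im k \<le> 0" "- pi \<le> Im k" "0 \<le> Re k" "a = 1/2 - \<i> * k / pi + \<delta>" "- 1/2 \<le> Re a" "Re a \<le> 1/2"
    "2 * (hyp_bound + 1) \<le> - Im a" "v \<noteq> 0" "0 \<le> Re v" "norm v \<le> 1/2"
    "norm (exp (\<delta> * Ln v) - 1) \<le> \<sigma>" "norm (exp (- (\<delta> * Ln v)) - 1) \<le> \<sigma>" "norm (exp (- (\<i> * pi * \<delta>)) - 1) \<le> \<sigma>" "\<sigma> \<le> 1/2"
    "96 * ((hyp_bound + 1) / (- Im a)) / (norm v)\<^sup>2 \<le> 1"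
    using A unfolding adm_def by blast+
  note C = core_upper[OF \<theta> A']
  show "\<bar>Im (Ln v)\<bar> \<le> pi / 2 - \<theta> / 2 \<Longrightarrow> approx Upper k a v (err \<theta> \<sigma> k a v) (mat 1)"
    "Im (Ln v) \<le> pi / 4 \<Longrightarrow> approx Upper k a v (err \<theta> \<sigma> k a v) (tri_left Lower k (\<i> / pi * Ln v))"
    "- pi / 4 \<le> Im (Ln v) \<Longrightarrow> approx Upper k a v (err \<theta> \<sigma> k a v) (tri_right Lower k (\<i> / pi * Ln v))"
    unfolding approx_def err_def PP_def side.case by (fact C)+
qed

lemma cj_tri:
  assumes nr: "v \<notin> \<real>\<^sub>\<le>\<^sub>0"
  shows "cj (tri_left Lower (cnj k) (\<i> / pi * Ln (cnj v))) = tri_right Lower k (\<i> / pi * Ln v)"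
    "cj (tri_right Lower (cnj k) (\<i> / pi * Ln (cnj v))) = tri_left Lower k (\<i> / pi * Ln v)"
  by (simp_all add: tri_left_def tri_right_def cj_mat2 mat2_eq exp_cnj cnj_Ln[OF nr, symmetric] algebra_simps minus_diff_commute)

lemma adm_Im: assumes "adm \<sigma> k (cp p a) \<delta> v" shows "Im a \<noteq> 0"
proof -
  have "2 * (hyp_bound + 1) \<le> - Im (cp p a)" using assms unfolding adm_def by blast
  moreover have "2 \<le> 2 * (hyp_bound + 1)" using hyp_bound_nonneg by simp
  ultimately have "2 \<le> - Im (cp p a)" by (rule order_trans[rotated])
  thus ?thesis by (cases p) auto
qed

text \<open>The lower side of \<lambda> is reached through \<open>approx_cj\<close>. Conjugation
  negates arg v, so it exchanges the two triangular cases and preserves the middle one.\<close>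

lemma core_sides:
  assumes \<theta>: "0 < \<theta>" "\<theta> < pi / 2" and A: "adm \<sigma> (cp p k) (cp p a) \<delta> (cp p v)"
    and B: "err \<theta> \<sigma> (cp p k) (cp p a) (cp p v) \<le> B"
  shows "\<bar>Im (Ln v)\<bar> \<le> pi / 2 - \<theta> / 2 \<Longrightarrow> approx p k a v B (mat 1)"
    and "Im (Ln v) \<le> pi / 4 \<Longrightarrow> approx p k a v B (tri_left Lower k (\<i> / pi * Ln v))"
    and "- pi / 4 \<le> Im (Ln v) \<Longrightarrow> approx p k a v B (tri_right Lower k (\<i> / pi * Ln v))"
proof -
  have a: "Im a \<noteq> 0" using adm_Im[OF A] .
  have v: "v \<noteq> 0" "0 \<le> Re v" "norm v \<le> 1/2" using A unfolding adm_def by (cases p; simp)+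
  have nr: "v \<notin> \<real>\<^sub>\<le>\<^sub>0" using v by (auto simp: complex_nonpos_Reals_iff complex_eq_iff)
  have i: "Im (Ln (cnj v)) = - Im (Ln v)" unfolding cnj_Ln[OF nr, symmetric] by simp
  have o: "cj (mat 1) = mat 1" by (simp add: mat2_one cj_mat2)
  note C = core_adm[OF \<theta> A, THEN approx_mono[OF _ B]]
  show "approx p k a v B (mat 1)" if "\<bar>Im (Ln v)\<bar> \<le> pi / 2 - \<theta> / 2"
  proof (cases p)
    case Lower
    have "approx Upper (cnj k) (cnj a) (cnj v) B (mat 1)" using C(1) that i Lower by simp
    from approx_cj[OF this a v] show ?thesis unfolding o Lower .
  qed (use C(1) that in simp)
  show "approx p k a v B (tri_left Lower k (\<i> / pi * Ln v))" if "Im (Ln v) \<le> pi / 4"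
  proof (cases p)
    case Lower
    thus ?thesis using approx_cj[OF _ a v, of k B "tri_right Lower (cnj k) (\<i> / pi * Ln (cnj v))"] C(3) that i cj_tri(2)[OF nr] by simp
  qed (use C(2) that in simp)
  show "approx p k a v B (tri_right Lower k (\<i> / pi * Ln v))" if "- pi / 4 \<le> Im (Ln v)"
  proof (cases p)
    case Lower
    thus ?thesis using approx_cj[OF _ a v, of k B "tri_left Lower (cnj k) (\<i> / pi * Ln (cnj v))"] C(2) that i cj_tri(1)[OF nr] by simp
  qed (use C(3) that in simp)
qed

lemma expansion_transport:
  assumes A: "approx p k (bval a_fun p l) (vq q z) B T" and a: "Im (bval a_fun p l) \<noteq> 0"
    and z: "on_side q z" "z \<noteq> 0" "norm z < 1/2"
  shows "\<exists>E :: complex^2^2. (\<forall>i j. cmod (E $ i $ j) \<le> B) \<and>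
     Gamma_mat p q z l = Psi0 p q z ** (mat 1 + E) ** conj1 q T ** exp_sigma3 (- k * bval g_fun q z)"
proof -
  obtain E :: "complex^2^2" where E: "\<forall>i j. cmod (E $ i $ j) \<le> B"
    "Gx (bval a_fun p l) (vq q z) = PP p (vq q z) ** (mat 1 + E) ** T ** exp_sigma3 (- k * (\<i> / pi * Ln (vq q z)))"
    using A unfolding approx_def by blast
  have e: "conj1 q (exp_sigma3 (- k * (\<i> / pi * Ln (vq q z)))) = exp_sigma3 (- k * bval g_fun q z)"
    unfolding bval_g_fun[OF z] by (cases q) (simp_all add: exp_sigma3_def conj1_mat2)
  have P: "conj1 q (PP p (vq q z)) = Psi0 p q z"
    unfolding Psi0_def bval_Phi[OF z] PP_def by (cases p; cases q) (simp_all add: conj1_def)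
  have "Gamma_mat p q z l = Psi0 p q z ** (mat 1 + conj1 q E) ** conj1 q T ** exp_sigma3 (- k * bval g_fun q z)"
    unfolding Gamma_mat_def bval_Gamma_off[OF a z] E(2) conj1_mult conj1_one_add e P by simp
  thus ?thesis using conj1_bound[OF E(1)] by blast
qed

text \<open>The place where the off-diagonal sign becomes tied to the side of z: conjugation by
  \<open>sigma1\<close> exchanges the two triangular types, and the sign of g, which also changes
  with the side, keeps the exponents in form.\<close>

lemma conj1_tri:
  "conj1 Upper (tri_right Lower k g) = tri_left Upper k (- g)" "conj1 Upper (tri_left Lower k g) = tri_right Upper k (- g)"
  by (simp_all add: tri_left_def tri_right_def conj1_mat2 mat2_eq algebra_simps minus_diff_commute)

section \<open>Small \<lambda>\<close>

lemma not_nonpos_if_Re_nonneg: "w \<noteq> 0 \<Longrightarrow> 0 \<le> Re w \<Longrightarrow> w \<notin> \<real>\<^sub>\<le>\<^sub>0"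
  by (auto simp: complex_nonpos_Reals_iff complex_eq_iff)

lemma vq_cnj:
  assumes z: "z \<noteq> 0" "norm z \<le> 1/2" shows "vq Upper (cnj z) = cnj (vq Lower z)"
proof -
  have "1 - z\<^sup>2 \<notin> \<real>\<^sub>\<le>\<^sub>0" using wz_facts(1)[OF z] by (auto simp: complex_nonpos_Reals_iff)
  hence "csqrt (1 - (cnj z)\<^sup>2) = cnj (csqrt (1 - z\<^sup>2))" using cnj_csqrt[of "1 - z\<^sup>2"] by simp
  thus ?thesis by (simp add: vq_def wz_def)
qed

lemma cp_facts:
  assumes l: "on_side p l" "l \<noteq> 0" "norm l < 1/4"
  shows "cp p (kap p l) = kap Upper (cp p l)" "cp p (bval a_fun p l) = bval a_fun Upper (cp p l)" "on_side Upper (cp p l)"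
proof -
  show s: "on_side Upper (cp p l)" using l(1) by (cases p) (auto simp: on_side_def)
  show "cp p (kap p l) = kap Upper (cp p l)"
  proof (cases p)
    case Lower
    have "\<i> * l \<notin> \<real>\<^sub>\<le>\<^sub>0" by (rule not_nonpos_if_Re_nonneg) (use l Lower in \<open>auto simp: on_side_def\<close>)
    hence "cnj (Ln (\<i> * l)) = Ln (- \<i> * cnj l)" using cnj_Ln[of "\<i> * l"] by simp
    thus ?thesis using kap_eq[OF l(1,2)] kap_eq[OF s] l(2) Lower by simp
  qed simp
  show "cp p (bval a_fun p l) = bval a_fun Upper (cp p l)"
  proof (cases p)
    case Lower
    have l2: "2 * l \<noteq> 0" "norm (2 * l) \<le> 1/2" "on_side Lower (2 * l)" using l Lower by (auto simp: norm_mult on_side_def)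
    have "vq Upper (2 * cnj l) = cnj (vq Lower (2 * l))" using vq_cnj[OF l2(1,2)] by simp
    moreover have "cnj (Ln (vq Lower (2 * l))) = Ln (cnj (vq Lower (2 * l)))" by (rule cnj_Ln[OF vq_facts(7)[OF l2]])
    ultimately show ?thesis using bval_a_fun[OF l] bval_a_fun[OF s] l Lower by simp
  qed simp
qed

text \<open>Here V = \<open>vq Upper (2 * l)\<close> equals -\<i>l(1+u) with |u| \<le> 4|l|^2, so
  \<delta> = (\<i>/pi) Ln(1+u) is quadratically small in \<lambda>. The bounds on Re a express Re V
  \<ge> 0, and Im a is controlled by |V| \<le> 2|l|.\<close>

lemma a_kap_upper:
  assumes l: "on_side Upper l" "l \<noteq> 0" "norm l < 1/8"
  defines "a \<equiv> bval a_fun Upper l" and "k \<equiv> kap Upper l"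
  shows "\<exists>\<delta>. a = 1/2 - \<i> * k / pi + \<delta> \<and> norm \<delta> \<le> 3 * (norm l)\<^sup>2"
    "Re k = - ln (norm l)" "Im k \<le> 0" "- pi \<le> Im k" "- 1/2 \<le> Re a" "Re a \<le> 1/2" "(- ln (norm l) - ln 2) / pi \<le> - Im a"
proof -
  have l2: "2 * l \<noteq> 0" "norm (2 * l) \<le> 1/2" "on_side Upper (2 * l)" using l by (auto simp: norm_mult on_side_def)
  have l4: "norm l < 1/4" using l by simp
  note w = wz_facts[OF l2(1,2)] and vf = vq_facts[OF l2(1,2), of Upper]
  define V where "V = vq Upper (2 * l)"
  define s where "s = csqrt (1 - (2 * l)\<^sup>2)"
  define u where "u = (1 - s) / (1 + s)"
  have rs: "Re s > 0" "1 + s \<noteq> 0" using w(2,3) by (simp_all add: s_def)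
  have aV: "a = \<i> / pi * Ln V" unfolding a_def V_def bval_a_fun[OF l(1,2) l4] by simp
  have kV: "k = - Ln (- \<i> * l) - \<i> * pi / 2" unfolding k_def kap_eq[OF l(1,2)] by simp
  have m: "- \<i> * l \<noteq> 0" "0 \<le> Re (- \<i> * l)" using l by (auto simp: on_side_def)
  have mi: "\<bar>Im (Ln (- \<i> * l))\<bar> \<le> pi / 2" using Re_Ln_pos_le[OF m(1)] m(2) by blast
  have "s * s = 1 - (2 * l)\<^sup>2" unfolding s_def by (metis power2_csqrt power2_eq_square)
  hence ss: "s * s = 1 - 4 * l\<^sup>2" by (simp add: power2_eq_square)
  have n1: "1 \<le> norm (1 + s)" using complex_Re_le_cmod[of "1 + s"] rs by simp
  have u: "norm u \<le> 4 * (norm l)\<^sup>2"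
  proof -
    have e: "(1 - s) * (1 + s) = 4 * l\<^sup>2" using ss by (simp add: algebra_simps)
    have "u = ((1 - s) * (1 + s)) / (1 + s)\<^sup>2" unfolding u_def using rs(2) by (simp add: power2_eq_square)
    hence "u = 4 * l\<^sup>2 / (1 + s)\<^sup>2" unfolding e .
    hence "norm u = 4 * (norm l)\<^sup>2 / (norm (1 + s))\<^sup>2" by (simp add: norm_divide norm_mult norm_power)
    also have "\<dots> \<le> 4 * (norm l)\<^sup>2 / 1" by (rule divide_left_mono) (use n1 in \<open>auto simp: one_le_power\<close>)
    finally show ?thesis by simp
  qed
  have "(norm l)\<^sup>2 \<le> (1/8)\<^sup>2" using l by (intro power_mono) auto
  hence u2: "norm u \<le> 1/16" using u by (simp add: power2_eq_square)
  have Lu: "norm (Ln (1 + u)) \<le> 2 * norm u" by (rule norm_Ln_le) (use u2 in simp)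
  have iu: "\<bar>Im (Ln (1 + u))\<bar> < 1" using abs_Im_le_cmod[of "Ln (1 + u)"] Lu u2 by linarith
  have u0: "1 + u \<noteq> 0"
  proof
    assume "1 + u = 0"
    hence "u = - 1" by (simp add: eq_neg_iff_add_eq_0 add.commute)
    thus False using u2 by simp
  qed
  have V: "V = (- \<i> * l) * (1 + u)"
    unfolding V_def vq_def wz_def u_def s_def[symmetric] using rs by (simp add: field_simps)
  have LV: "Ln V = Ln (- \<i> * l) + Ln (1 + u)"
    unfolding V by (rule Ln_times_simple[OF m(1) u0]) (use mi iu pi_gt3 in auto)
  have "a = 1/2 - \<i> * k / pi + \<i> / pi * Ln (1 + u)" unfolding aV LV kV by (simp add: field_simps)
  moreover have "norm (\<i> / pi * Ln (1 + u)) \<le> 3 * (norm l)\<^sup>2"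
  proof -
    have "norm (\<i> / pi * Ln (1 + u)) = norm (Ln (1 + u)) / pi" by (simp add: norm_mult norm_divide)
    also have "\<dots> \<le> norm (Ln (1 + u)) / 3" by (rule divide_left_mono) (use pi_gt3 in auto)
    finally show ?thesis using Lu u zero_le_power2[of "norm l"] by linarith
  qed
  ultimately show "\<exists>\<delta>. a = 1/2 - \<i> * k / pi + \<delta> \<and> norm \<delta> \<le> 3 * (norm l)\<^sup>2" by blast
  show "Re k = - ln (norm l)" unfolding kV using m(1) by (simp add: norm_mult)
  show "Im k \<le> 0" "- pi \<le> Im k" unfolding kV using mi by auto
  have "V \<noteq> 0" "0 \<le> Re V" unfolding V_def using vf(1,6) l2(3) by auto
  hence b: "\<bar>Im (Ln V)\<bar> \<le> pi / 2" using Re_Ln_pos_le by blast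
  have ra: "Re a = - Im (Ln V) / pi" unfolding aV by ((simp; fail) | (simp add: Re_divide power2_eq_square))
  have "pi * Re a = - Im (Ln V)" unfolding ra by simp
  hence "pi * (- 1/2) \<le> pi * Re a" "pi * Re a \<le> pi * (1/2)" using b by linarith+
  thus "- 1/2 \<le> Re a" "Re a \<le> 1/2" by (simp_all only: mult_le_cancel_left_pos[OF pi_gt_zero])
  have "norm V \<le> 2 * norm l" unfolding V_def using vf(2) by (simp add: norm_mult)
  hence "ln (norm V) \<le> ln (2 * norm l)" using \<open>V \<noteq> 0\<close> by (subst ln_le_cancel_iff) (use l in auto)
  hence lV: "ln (norm V) \<le> ln 2 + ln (norm l)" using l by (simp add: ln_mult)
  have ima: "- Im a = - ln (norm V) / pi" unfolding aV using \<open>V \<noteq> 0\<close> by simp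
  show "(- ln (norm l) - ln 2) / pi \<le> - Im a" unfolding ima by (rule divide_right_mono, use lV in linarith, simp)
qed

lemma exp_decay: assumes "0 < c" "0 < X" "4 / c\<^sup>2 \<le> X" shows "2 * X * exp (- X * c) \<le> (1 :: real)"
proof -
  have "2 * X \<le> (X * c)\<^sup>2 / 2"
  proof -
    have "4 \<le> X * c\<^sup>2" using assms by (simp add: field_simps)
    hence "X * 4 \<le> X * (X * c\<^sup>2)" using assms by (intro mult_left_mono) auto
    thus ?thesis by (simp add: power2_eq_square mult_ac)
  qed
  also have "\<dots> \<le> exp (X * c)"
  proof -
    have "0 \<le> X * c" using assms by simp
    thus ?thesis using exp_lower_Taylor_quadratic[of "X * c"] by linarith
  qed
  finally show ?thesis by (simp add: exp_minus field_simps)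
qed

lemma exp_near_one: "norm w \<le> 1/2 \<Longrightarrow> norm (exp w - 1) \<le> 2 * norm (w :: complex)"
proof -
  assume w: "norm w \<le> 1/2"
  have "norm (exp w - (\<Sum>i\<le>0. w ^ i / fact i)) \<le> exp \<bar>Re w\<bar> * norm w ^ Suc 0 / fact 0" by (rule Taylor_exp)
  hence "norm (exp w - 1) \<le> exp \<bar>Re w\<bar> * norm w" by simp
  also have "\<dots> \<le> 2 * norm w"
  proof (rule mult_right_mono)
    have "\<bar>Re w\<bar> \<le> 1/2" using abs_Re_le_cmod[of w] w by linarith
    hence "exp \<bar>Re w\<bar> \<le> exp (1/2)" by simp
    also have "\<dots> \<le> 2" using exp_bound_half[of "1/2 :: real"] by simp
    finally show "exp \<bar>Re w\<bar> \<le> 2" .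
  qed simp
  finally show ?thesis .
qed

text \<open>Here 324 = 18^2 comes from |v| \<ge> 1/(18M), 1152 = 96 * 12 from |\<kappa>| \<le> 12|Im
  a|, and 30 = 15 * 2 from the exponential and \<sigma>, each at most 1/|\<kappa>|.\<close>

definition CC :: real where "CC = 324 * (1152 * (hyp_bound + 1) + 30)"

text \<open>\<epsilon> depends on M and \<theta>, but the constant in the final bound does not: the
  M-dependence of the estimates is the factor M^2 from |v|^-2.\<close>

lemma adm_small:
  assumes \<theta>: "0 < \<theta>" and M: "1 \<le> M"
  shows "\<exists>\<epsilon>>0. \<epsilon> \<le> 1/8 \<and> (\<forall>l v. on_side Upper l \<longrightarrow> l \<noteq> 0 \<longrightarrow> norm l < \<epsilon> \<longrightarrow> v \<noteq> 0 \<longrightarrow> 0 \<le> Re v \<longrightarrow> norm v \<le> 1/2 \<longrightarrow> 1 / (18 * M) \<le> norm v \<longrightarrow>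
     (\<exists>\<sigma> \<delta>. adm \<sigma> (kap Upper l) (bval a_fun Upper l) \<delta> v \<and>
       err \<theta> \<sigma> (kap Upper l) (bval a_fun Upper l) v \<le> CC * (M\<^sup>2 / norm (kap Upper l))))"
proof -
  define H where "H = hyp_bound + 1"
  \<comment> \<open>L dominates |Ln v| on the annulus: ln(18M) for the modulus and 4 > pi/2 for the
    argument.\<close>
  define L where "L = ln (18 * M) + 4"
  \<comment> \<open>The sum of all lower bounds on Re \<kappa> needed below; each summand serves one
    of the facts \<open>X4\<close> to \<open>XM\<close>.\<close>
  define K where "K = 4 + 12 * H + 4 / (\<theta> / pi)\<^sup>2 + 6 * L + 96 * 6 * H * (324 * M\<^sup>2)"
  have H: "H \<ge> 1" using hyp_bound_nonneg by (simp add: H_def)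
  have L: "L \<ge> 4" using M by (simp add: L_def)
  have nn: "0 \<le> 4 / (\<theta> / pi)\<^sup>2" "0 \<le> 96 * 6 * H * (324 * M\<^sup>2)" using H by auto
  define \<epsilon> where "\<epsilon> = min (1/8) (exp (- K))"
  have main: "\<exists>\<sigma> \<delta>. adm \<sigma> (kap Upper l) (bval a_fun Upper l) \<delta> v \<and>
       err \<theta> \<sigma> (kap Upper l) (bval a_fun Upper l) v \<le> CC * (M\<^sup>2 / norm (kap Upper l))"
    if l: "on_side Upper l" "l \<noteq> 0" "norm l < \<epsilon>" and v: "v \<noteq> 0" "0 \<le> Re v" "norm v \<le> 1/2" "1 / (18 * M) \<le> norm v" for l v
  proof -
    have l8: "norm l < 1/8" using l by (simp add: \<epsilon>_def)
    define k a where "k = kap Upper l" and "a = bval a_fun Upper l"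
    note AK = a_kap_upper[OF l(1,2) l8, folded k_def a_def]
    obtain \<delta> where \<delta>: "a = 1/2 - \<i> * k / pi + \<delta>" "norm \<delta> \<le> 3 * (norm l)\<^sup>2" using AK(1) by blast
    define X where "X = Re k"
    have X: "X = - ln (norm l)" by (simp add: X_def AK(2))
    have "norm l < exp (- K)" using l by (simp add: \<epsilon>_def)
    hence "ln (norm l) < ln (exp (- K))" using l(2) by (subst ln_less_cancel_iff) auto
    hence XK: "X > K" by (simp add: X)
    have X4: "X \<ge> 4" and XH: "12 * H \<le> X" and X\<theta>: "4 / (\<theta> / pi)\<^sup>2 \<le> X" and XL: "6 * L \<le> X" and XM: "96 * 6 * H * (324 * M\<^sup>2) \<le> X"
      using XK H L nn unfolding K_def by linarith+
    have X0: "X > 0" using X4 by simp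
    have kn: "X \<le> norm k" "norm k \<le> 2 * X"
    proof -
      show "X \<le> norm k" using complex_Re_le_cmod[of k] by (simp add: X_def)
      have "norm k \<le> \<bar>Re k\<bar> + \<bar>Im k\<bar>" by (rule cmod_le)
      thus "norm k \<le> 2 * X" using AK(3,4) X4 pi_less_4 by (simp add: X_def)
    qed
    have k0: "norm k > 0" using kn X0 by linarith
    have ia: "X / 6 \<le> - Im a"
    proof -
      have "X / 6 \<le> 3/4 * X / pi" using X0 pi_less_4 by (simp add: field_simps)
      also have "\<dots> \<le> (X - ln 2) / pi" using X4 ln_2_less_1 by (intro divide_right_mono) auto
      also have "\<dots> \<le> - Im a" using AK(7) by (simp add: X)
      finally show ?thesis .
    qed
    have h: "H / (- Im a) \<le> 6 * H / X"
    proof -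
      have "0 < - Im a * (X / 6)" by (rule mult_pos_pos) (use ia X0 in linarith)+
      hence "H / (- Im a) \<le> H / (X / 6)" by (intro divide_left_mono) (use ia H in auto)
      thus ?thesis by (simp add: field_simps)
    qed
    have v2: "1 / (norm v)\<^sup>2 \<le> 324 * M\<^sup>2"
    proof -
      have "(1 / (18 * M))\<^sup>2 \<le> (norm v)\<^sup>2" using v(4) M by (intro power_mono) auto
      hence "1 / (norm v)\<^sup>2 \<le> 1 / (1 / (18 * M))\<^sup>2" using v M by (intro divide_left_mono) auto
      thus ?thesis by (simp add: power2_eq_square)
    qed
    have dv: "x / (norm v)\<^sup>2 \<le> y * (324 * M\<^sup>2)" if "x \<le> y" "0 \<le> x" for x y
      using mult_mono[OF that(1) v2] that by simp
    have ih0: "0 \<le> H / (- Im a)" using ia X0 H by (intro divide_nonneg_nonneg) auto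
    have p: "96 * (H / (- Im a)) / (norm v)\<^sup>2 \<le> 1"
    proof -
      have "96 * (H / (- Im a)) / (norm v)\<^sup>2 \<le> 96 * (6 * H / X) * (324 * M\<^sup>2)" by (rule dv) (use h ih0 in auto)
      also have "\<dots> \<le> 1" using XM X0 by (simp add: field_simps)
      finally show ?thesis .
    qed
    have l2: "(norm l)\<^sup>2 = exp (- X) * exp (- X)" using l(2) by (simp add: X power2_eq_square)
    have e1: "2 * X * exp (- X) \<le> 1" using exp_decay[of 1 X] X4 by simp
    have "6 * L \<le> exp X" using XL exp_ge_add_one_self[of X] by linarith
    hence e2: "6 * L * exp (- X) \<le> 1" by (simp add: exp_minus field_simps)
    have sm: "12 * X * L * (norm l)\<^sup>2 \<le> 1"
    proof -
      have "(2 * X * exp (- X)) * (6 * L * exp (- X)) \<le> 1 * 1" by (rule mult_mono) (use e1 e2 X0 L in auto)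
      thus ?thesis unfolding l2 by (simp add: mult_ac)
    qed
    have ex: "norm (exp w - 1) \<le> 1 / norm k" if "norm w \<le> 3 * (norm l)\<^sup>2 * L" for w :: complex
    proof -
      have s: "6 * (norm l)\<^sup>2 * L \<le> 1 / (2 * X)" using sm X0 by (simp add: field_simps)
      also have "1 / (2 * X) \<le> 1 / 8" using X4 by (intro divide_left_mono) auto
      finally have "norm w \<le> 1/2" using that by linarith
      hence "norm (exp w - 1) \<le> 2 * norm w" by (rule exp_near_one)
      also have "\<dots> \<le> 1 / (2 * X)" using that s by linarith
      also have "\<dots> \<le> 1 / norm k" by (rule frac_le) (use kn X0 k0 in auto)
      finally show ?thesis .
    qed
    have vL: "norm (Ln v) \<le> L"
    proof -
      have "norm (Ln v) \<le> \<bar>Re (Ln v)\<bar> + \<bar>Im (Ln v)\<bar>" by (rule cmod_le)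
      moreover have "\<bar>Im (Ln v)\<bar> \<le> pi / 2" using Re_Ln_pos_le[OF v(1)] v(2) by blast
      moreover have "\<bar>Re (Ln v)\<bar> \<le> ln (18 * M)"
      proof -
        have "ln (1 / (18 * M)) \<le> ln (norm v)" using v M by (subst ln_le_cancel_iff) auto
        hence "- ln (18 * M) \<le> ln (norm v)" using M by (simp add: ln_div)
        moreover have "ln (norm v) \<le> 0" using v by simp
        ultimately show ?thesis using v(1) by simp
      qed
      ultimately show ?thesis using pi_less_4 unfolding L_def by linarith
    qed
    have d1: "norm (\<delta> * Ln v) \<le> 3 * (norm l)\<^sup>2 * L" unfolding norm_mult using \<delta>(2) vL L by (intro mult_mono) auto
    have d2: "norm (- (\<i> * pi * \<delta>)) \<le> 3 * (norm l)\<^sup>2 * L"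
    proof -
      have "norm (- (\<i> * pi * \<delta>)) = norm \<delta> * pi" by (simp add: norm_mult)
      also have "\<dots> \<le> 3 * (norm l)\<^sup>2 * L" using \<delta>(2) pi_less_4 L by (intro mult_mono) auto
      finally show ?thesis .
    qed
    \<comment> \<open>The choice \<sigma> = 1/|\<kappa>| is generous: the exponents involving
      \<delta> are O(|\<lambda>|^2).\<close>
    have adm: "adm (1 / norm k) k a \<delta> v" unfolding adm_def
    proof (intro conjI)
      show "0 \<le> Re k" using X0 by (simp add: X_def)
      show "2 * (hyp_bound + 1) \<le> - Im a" using ia XH by (simp add: H_def)
      show "1 / norm k \<le> 1 / 2" by (rule frac_le) (use kn X4 in linarith)+
      show "norm (exp (- (\<delta> * Ln v)) - 1) \<le> 1 / norm k" using ex[of "- (\<delta> * Ln v)"] d1 by simp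
    qed (use AK \<delta> v ex[OF d1] ex[OF d2] p in \<open>auto simp: H_def\<close>)
    have "err \<theta> (1 / norm k) k a v \<le> 1152 * H / norm k * (324 * M\<^sup>2) + 30 / norm k * (324 * M\<^sup>2)"
      unfolding err_def H_def[symmetric]
    proof (rule add_mono)
      have Xk: "6 * H / X \<le> 12 * H / norm k"
      proof -
        have "H * norm k \<le> H * (2 * X)" using kn H by (intro mult_left_mono) auto
        thus ?thesis using X0 k0 by (simp add: field_simps)
      qed
      show "96 * (H / - Im a) / (cmod v)\<^sup>2 \<le> 1152 * H / norm k * (324 * M\<^sup>2)"
        by (rule dv) (use h Xk ih0 in auto)
      have "exp (- Re k * (\<theta> / pi)) \<le> 1 / (2 * X)" using exp_decay[of "\<theta> / pi" X] \<theta> X0 X\<theta> by (simp add: X_def[symmetric] field_simps)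
      also have "\<dots> \<le> 1 / norm k" by (rule frac_le) (use kn X0 k0 in auto)
      finally show "15 * (exp (- Re k * (\<theta> / pi)) + 1 / norm k) / (cmod v)\<^sup>2 \<le> 30 / norm k * (324 * M\<^sup>2)"
        by (intro dv) (auto intro: add_nonneg_nonneg)
    qed
    also have "\<dots> = CC * (M\<^sup>2 / norm k)"
    proof -
      have c: "CC = 324 * (1152 * H + 30)" by (simp only: CC_def H_def)
      show ?thesis unfolding c using k0 by (simp add: field_simps)
    qed
    finally have er: "err \<theta> (1 / norm k) k a v \<le> CC * (M\<^sup>2 / norm k)" .
    show ?thesis unfolding k_def[symmetric] a_def[symmetric] by (intro exI conjI, rule adm, rule er)
  qed
  show ?thesis
  proof (rule exI[of _ \<epsilon>], intro conjI allI impI)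
    show "\<epsilon> > 0" "\<epsilon> \<le> 1/8" by (simp_all add: \<epsilon>_def)
  qed (rule main; assumption)
qed

section \<open>Arguments of z and v, and the annulus\<close>

text \<open>This angle is the difference between the arguments of \<plusminus>\<i>z and v
  (\<open>vq_angle\<close>). The radius \<rho> makes it harmless and enters the lower bound for
  M.\<close>

lemma angle_close:
  assumes "0 < \<theta>"
  shows "\<exists>\<rho>>0. \<forall>z. norm z < \<rho> \<longrightarrow> \<bar>Im (Ln (1 + csqrt (1 - z\<^sup>2)))\<bar> < \<theta> / 2"
proof -
  have c: "isCont (\<lambda>z::complex. csqrt (1 - z\<^sup>2)) 0"
    by (rule isCont_o2[OF _ continuous_at_csqrt]) (auto intro!: continuous_intros)
  have "isCont (\<lambda>z. Im (Ln (1 + csqrt (1 - z\<^sup>2)))) 0" by (intro continuous_Im isCont_Ln' isCont_add continuous_const c) auto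
  moreover have "Im (Ln 2) = 0" using Ln_of_real[of 2] by simp
  ultimately have "((\<lambda>z. Im (Ln (1 + csqrt (1 - z\<^sup>2)))) \<longlongrightarrow> 0) (at 0)" by (simp add: isCont_def)
  from tendstoD[OF this, of "\<theta> / 2"] assms obtain \<rho> where \<rho>: "\<rho> > 0" "\<forall>z. z \<noteq> 0 \<and> norm z < \<rho> \<longrightarrow> \<bar>Im (Ln (1 + csqrt (1 - z\<^sup>2)))\<bar> < \<theta> / 2"
    unfolding eventually_at by auto
  have z0: "\<bar>Im (Ln (1 + csqrt (1 - 0\<^sup>2)))\<bar> < \<theta> / 2" using \<open>Im (Ln 2) = 0\<close> assms by simp
  have "\<bar>Im (Ln (1 + csqrt (1 - z\<^sup>2)))\<bar> < \<theta> / 2" if "norm z < \<rho>" for z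
  proof (cases "z = 0")
    case True
    show ?thesis unfolding True by (rule z0)
  next
    case False
    thus ?thesis using \<rho>(2) that by blast
  qed
  thus ?thesis using \<rho>(1) by blast
qed

lemma vq_angle:
  assumes z: "z \<noteq> 0" "norm z \<le> 1/2" "on_side q z"
  shows "Im (Ln (vq q z)) = Im (Ln (- of_real (sg q) * \<i> * z)) - Im (Ln (1 + csqrt (1 - z\<^sup>2)))"
    "\<bar>Im (Ln (- of_real (sg q) * \<i> * z))\<bar> \<le> pi / 2"
proof -
  define A B where "A = - of_real (sg q) * \<i> * z" and "B = 1 + csqrt (1 - z\<^sup>2)"
  have A: "A \<noteq> 0" "0 \<le> Re A" using z sg_cases[of q] by (auto simp: A_def on_side_def)
  have "0 < 1 + Re (csqrt (1 - z\<^sup>2))" using wz_facts(2)[OF z(1,2)] by (rule add_pos_pos[OF zero_less_one])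
  hence B: "0 < Re B" "B \<noteq> 0" using wz_facts(3)[OF z(1,2)] unfolding B_def plus_complex.sel one_complex.sel by blast+
  show i: "\<bar>Im (Ln (- of_real (sg q) * \<i> * z))\<bar> \<le> pi / 2" using Re_Ln_pos_le[OF A(1)] A(2) unfolding A_def by blast
  have j: "\<bar>Im (Ln B)\<bar> < pi / 2" using Re_Ln_pos_lt[OF B(2)] B(1) by blast
  have "vq q z = A / B" by (simp add: vq_def wz_def A_def B_def)
  moreover have "Ln (A / B) = Ln A - Ln B"
    by (rule Ln_unique) (use A B i[folded A_def] j in \<open>auto simp: exp_diff\<close>)
  ultimately show "Im (Ln (vq q z)) = Im (Ln (- of_real (sg q) * \<i> * z)) - Im (Ln (1 + csqrt (1 - z\<^sup>2)))"
    by (simp add: A_def B_def)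
qed

text \<open>The angle condition excludes real z, and off the reals the quarter turn shifts
  \<open>Arg\<close> by pi/2. Of the margin \<theta>, half is later spent on the difference between
  z and v.\<close>

lemma angle_middle:
  assumes z: "z \<noteq> 0" "norm z \<le> 1/2" "on_side q z" and \<theta>: "0 < \<theta>" "\<theta> < \<bar>Arg z\<bar>" "\<bar>Arg z\<bar> < pi - \<theta>"
  shows "\<bar>Im (Ln (- of_real (sg q) * \<i> * z))\<bar> \<le> pi / 2 - \<theta>"
proof -
  have "Im z \<noteq> 0"
  proof
    assume i: "Im z = 0"
    show False
    proof (cases "Re z < 0")
      case True
      hence "Arg z = pi" using i Arg_eq_pi by simp
      thus False using \<theta> by simp
    next
      case False
      hence "Arg z = 0" using i by (simp add: Arg_eq_0 complex_is_Real_iff)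
      thus False using \<theta> by simp
    qed
  qed
  hence "0 < sg q * Im z" using z(3) by (cases q) (auto simp: on_side_def)
  from Ln_rotate[OF this] have "Arg z = Im (Ln (- of_real (sg q) * \<i> * z)) + sg q * pi / 2"
    using Arg_eq_Im_Ln[OF z(1)] by simp
  thus ?thesis using vq_angle(2)[OF z] \<theta> by (cases q) (auto simp: abs_le_iff abs_less_iff)
qed

lemma Im_Ln_sign: "Im w < 0 \<Longrightarrow> Im (Ln w) < 0" "Im w > 0 \<Longrightarrow> Im (Ln w) > 0"
proof -
  show "Im (Ln w) < 0" if "Im w < 0"
  proof -
    have w: "w \<noteq> 0" using that by auto
    thus ?thesis using Im_Ln_pos_le[OF w] Im_Ln_le_pi[OF w] that by (meson not_le)
  qed
  show "Im (Ln w) > 0" if "Im w > 0"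
  proof -
    have w: "w \<noteq> 0" using that by auto
    thus ?thesis using Im_Ln_pos_lt[OF w] that by blast
  qed
qed

lemma Arg2pi_Re_neg: "pi / 2 < Arg2pi z \<Longrightarrow> Arg2pi z < 3 * pi / 2 \<Longrightarrow> z \<noteq> 0 \<Longrightarrow> Re z < 0"
proof -
  assume a: "pi / 2 < Arg2pi z" "Arg2pi z < 3 * pi / 2" "z \<noteq> 0"
  have "0 < cos (Arg2pi z - pi)" by (rule cos_gt_zero_pi) (use a in auto)
  hence "cos (Arg2pi z) < 0" by (simp add: cos_diff)
  hence "cmod z * cos (Arg2pi z) < 0" using a(3) by (simp add: mult_pos_neg)
  thus ?thesis using cos_Arg2pi[of z] by simp
qed

text \<open>|z+1| differs from 1 by at most |z|, and |z| \<le> M|z| because M \<ge> 1. Both bounds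
  follow by absorbing this into the terms with M|z|.\<close>

lemma Omega_bounds:
  assumes M: "1 \<le> M" and z: "z \<in> Omega M"
  shows "z \<noteq> 0" "norm z \<le> 1 / M" "1 / (6 * M) \<le> norm z"
proof -
  have O: "M \<le> cmod ((z + 1) / (2 * z))" "cmod ((z + 1) / (2 * z)) \<le> 2 * M" using z by (auto simp: Omega_def)
  show z0: "z \<noteq> 0"
  proof
    assume "z = 0"
    thus False using O(1) M by simp
  qed
  define r where "r = norm z"
  have r: "0 < r" using z0 by (simp add: r_def)
  have c: "cmod ((z + 1) / (2 * z)) = norm (z + 1) / (2 * r)" by (simp add: norm_divide norm_mult r_def)
  have O1: "M * (2 * r) \<le> norm (z + 1)" using O(1) r unfolding c by (simp add: le_divide_eq)
  have O2: "norm (z + 1) \<le> 2 * M * (2 * r)" using O(2) r unfolding c by (simp add: divide_le_eq)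
  have t: "norm (z + 1) \<le> r + 1" using norm_triangle_ineq[of z 1] by (simp add: r_def)
  have t2: "1 \<le> norm (z + 1) + r" using norm_triangle_ineq4[of "z + 1" z] by (simp add: r_def)
  have Mr: "r \<le> M * r" using M r by simp
  have "M * r \<le> 1" using O1 t Mr by linarith
  thus "norm z \<le> 1 / M" using M by (simp add: r_def field_simps)
  have "1 \<le> 6 * (M * r)" using O2 t2 Mr by linarith
  thus "1 / (6 * M) \<le> norm z" using M by (simp add: r_def field_simps)
qed

section \<open>Assembly of the uniform expansion\<close>

theorem theorem5p10:
  fixes \<theta> :: real
  assumes "0 < \<theta>" and "\<theta> < pi / 2"
  shows "\<exists>M0 > 0. \<exists>C :: real. \<forall>M \<ge> M0. \<exists>\<epsilon> > 0. \<forall>p q :: side. \<forall>l z :: complex.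
     l \<noteq> 0 \<and> cmod l < \<epsilon> \<and> on_side p l \<and> z \<in> Omega M \<and> on_side q z \<longrightarrow>
     (let k = kap p l; g = bval g_fun q z;
          expansion = (\<lambda>T :: complex^2^2. \<exists>E :: complex^2^2.
            (\<forall>i j. cmod (E $ i $ j) \<le> C * (M\<^sup>2 / cmod k)) \<and>
            Gamma_mat p q z l = Psi0 p q z ** (mat 1 + E) ** T ** exp_sigma3 (- k * g))
      in (\<theta> < \<bar>Arg z\<bar> \<and> \<bar>Arg z\<bar> < pi - \<theta> \<longrightarrow> expansion (mat 1)) \<and>
         (pi - \<theta> < Arg2pi z \<and> Arg2pi z < pi + \<theta> \<longrightarrow> expansion (tri_left q k g)) \<and>
         (- \<theta> < Arg z \<and> Arg z < \<theta> \<longrightarrow> expansion (tri_right q k g)))"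
proof -
  obtain \<rho> where \<rho>: "\<rho> > 0" "\<And>z. norm z < \<rho> \<Longrightarrow> \<bar>Im (Ln (1 + csqrt (1 - z\<^sup>2)))\<bar> < \<theta> / 2"
    using angle_close[OF assms(1)] by blast
  \<comment> \<open>3 gives |z| \<le> 1/3 < 1/2, and 2/\<rho> gives |z| \<le> \<rho>/2 <
    \<rho>.\<close>
  define M0 where "M0 = max 3 (2 / \<rho>)"
  have main: "\<exists>\<epsilon>>0. \<forall>p q :: side. \<forall>l z :: complex.
     l \<noteq> 0 \<and> cmod l < \<epsilon> \<and> on_side p l \<and> z \<in> Omega M \<and> on_side q z \<longrightarrow>
     (let k = kap p l; g = bval g_fun q z;
          expansion = (\<lambda>T :: complex^2^2. \<exists>E :: complex^2^2.
            (\<forall>i j. cmod (E $ i $ j) \<le> CC * (M\<^sup>2 / cmod k)) \<and>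
            Gamma_mat p q z l = Psi0 p q z ** (mat 1 + E) ** T ** exp_sigma3 (- k * g))
      in (\<theta> < \<bar>Arg z\<bar> \<and> \<bar>Arg z\<bar> < pi - \<theta> \<longrightarrow> expansion (mat 1)) \<and>
         (pi - \<theta> < Arg2pi z \<and> Arg2pi z < pi + \<theta> \<longrightarrow> expansion (tri_left q k g)) \<and>
         (- \<theta> < Arg z \<and> Arg z < \<theta> \<longrightarrow> expansion (tri_right q k g)))"
    if M: "M \<ge> M0" for M
  proof -
    have M1: "1 \<le> M" "3 \<le> M" "2 / \<rho> \<le> M" using M by (auto simp: M0_def)
    from adm_small[OF assms(1) M1(1)] obtain \<epsilon> where \<epsilon>: "\<epsilon> > 0" "\<epsilon> \<le> 1/8"
      and small0: "\<forall>l v. on_side Upper l \<longrightarrow> l \<noteq> 0 \<longrightarrow> norm l < \<epsilon> \<longrightarrow> v \<noteq> 0 \<longrightarrow> 0 \<le> Re v \<longrightarrow> norm v \<le> 1/2 \<longrightarrow> 1 / (18 * M) \<le> norm v \<longrightarrow>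
       (\<exists>\<sigma> \<delta>. adm \<sigma> (kap Upper l) (bval a_fun Upper l) \<delta> v \<and>
         err \<theta> \<sigma> (kap Upper l) (bval a_fun Upper l) v \<le> CC * (M\<^sup>2 / norm (kap Upper l)))"
      by (elim exE conjE)
    note small = small0[rule_format]
    show ?thesis
    proof (intro exI[of _ \<epsilon>] conjI allI impI \<epsilon>(1), elim conjE)
      fix p q l z
      assume l: "l \<noteq> 0" "cmod l < \<epsilon>" "on_side p l" and z: "z \<in> Omega M" "on_side q z"
      note O = Omega_bounds[OF M1(1) z(1)]
      have "1 / M \<le> 1 / 3" using M1 by (intro divide_left_mono) auto
      hence z2: "norm z < 1/2" "norm z \<le> 1/2" using O(2) by linarith+
      have "1 / M \<le> \<rho> / 2" using M1 \<rho>(1) by (simp add: field_simps)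
      hence z\<rho>: "norm z < \<rho>" using O(2) \<rho>(1) by linarith
      define v where "v = vq q z"
      define k a where "k = kap p l" and "a = bval a_fun p l"
      note vf = vq_facts[OF O(1) z2(2), of q, folded v_def]
      have v: "v \<noteq> 0" "0 \<le> Re v" "norm v \<le> 1/2" using vf(1,2,6) z(2) z2 by auto
      have "1 / (18 * M) = 1 / (6 * M) / 3" by simp
      also have "\<dots> \<le> norm z / 3" by (rule divide_right_mono[OF O(3)]) simp
      also have "\<dots> \<le> norm v" by (rule vf(3))
      finally have v4: "1 / (18 * M) \<le> norm v" .
      have l4: "norm l < 1/4" using l(2) \<epsilon>(2) by simp
      note cf = cp_facts[OF l(3,1) l4, folded k_def a_def]
      have nc: "norm (cp p x) = norm x" "Re (cp p x) = Re x" "cp p x = 0 \<longleftrightarrow> x = 0" for x by (cases p; simp)+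
      have "\<exists>\<sigma> \<delta>. adm \<sigma> (kap Upper (cp p l)) (bval a_fun Upper (cp p l)) \<delta> (cp p v) \<and>
        err \<theta> \<sigma> (kap Upper (cp p l)) (bval a_fun Upper (cp p l)) (cp p v) \<le> CC * (M\<^sup>2 / norm (kap Upper (cp p l)))"
        \<comment> \<open>The estimate for the upper side is applied to the conjugated data when
          \<lambda> lies on the lower side.\<close>
        by (rule small[OF cf(3)]) (insert l v v4, simp_all only: nc simp_thms)
      then obtain \<sigma> \<delta> where A: "adm \<sigma> (cp p k) (cp p a) \<delta> (cp p v)" "err \<theta> \<sigma> (cp p k) (cp p a) (cp p v) \<le> CC * (M\<^sup>2 / norm k)"
        unfolding cf(1,2)[symmetric] nc by (elim exE conjE)
      note S = core_sides[OF assms A]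
      have tr: "\<exists>E :: complex^2^2. (\<forall>i j. cmod (E $ i $ j) \<le> CC * (M\<^sup>2 / cmod k)) \<and>
          Gamma_mat p q z l = Psi0 p q z ** (mat 1 + E) ** conj1 q T ** exp_sigma3 (- k * bval g_fun q z)"
        if "approx p k a v (CC * (M\<^sup>2 / norm k)) T" for T
        using that adm_Im[OF A(1)] unfolding a_def v_def by (rule expansion_transport[OF _ _ z(2) O(1) z2(1)])
      define \<psi> where "\<psi> = Im (Ln (- of_real (sg q) * \<i> * z))"
      have ang: "\<bar>Im (Ln v) - \<psi>\<bar> < \<theta> / 2" using vq_angle(1)[OF O(1) z2(2) z(2)] \<rho>(2)[OF z\<rho>] by (simp add: v_def \<psi>_def)
      have G: "bval g_fun q z = - of_real (sg q) * (\<i> / pi * Ln v)" using bval_g_fun[OF z(2) O(1) z2(1)] by (simp add: v_def)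
      \<comment> \<open>In the triangular cases only the sign of Re z matters: it fixes the sign of
        \<psi>, and arg v is within \<theta>/2 < pi/4 of \<psi>.\<close>
      have neg: "\<psi> < 0" if "0 < sg q * Re z" unfolding \<psi>_def by (rule Im_Ln_sign(1)) (use that in simp)
      have pos: "\<psi> > 0" if "sg q * Re z < 0" unfolding \<psi>_def by (rule Im_Ln_sign(2)) (use that in simp)
      have lo: "Im (Ln v) \<le> pi / 4" if "0 < sg q * Re z" using ang neg[OF that] assms by linarith
      have hi: "- pi / 4 \<le> Im (Ln v)" if "sg q * Re z < 0" using ang pos[OF that] assms by linarith
      have mid: "\<exists>E :: complex^2^2. (\<forall>i j. cmod (E $ i $ j) \<le> CC * (M\<^sup>2 / cmod k)) \<and>
          Gamma_mat p q z l = Psi0 p q z ** (mat 1 + E) ** mat 1 ** exp_sigma3 (- k * bval g_fun q z)"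
        if "\<theta> < \<bar>Arg z\<bar>" "\<bar>Arg z\<bar> < pi - \<theta>"
      proof -
        have "\<bar>\<psi>\<bar> \<le> pi / 2 - \<theta>" unfolding \<psi>_def by (rule angle_middle[OF O(1) z2(2) z(2) assms(1) that])
        hence b: "\<bar>Im (Ln v)\<bar> \<le> pi / 2 - \<theta> / 2" using ang by linarith
        have c: "conj1 q (mat 1) = mat 1" by (cases q) (simp_all add: mat2_one conj1_mat2)
        show ?thesis using tr[OF S(1)[OF b]] unfolding c .
      qed
      have left: "\<exists>E :: complex^2^2. (\<forall>i j. cmod (E $ i $ j) \<le> CC * (M\<^sup>2 / cmod k)) \<and>
          Gamma_mat p q z l = Psi0 p q z ** (mat 1 + E) ** tri_left q k (bval g_fun q z) ** exp_sigma3 (- k * bval g_fun q z)"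
        if "pi - \<theta> < Arg2pi z" "Arg2pi z < pi + \<theta>"
      proof -
        have Rez: "Re z < 0" by (rule Arg2pi_Re_neg) (use that assms O(1) in auto)
        show ?thesis
        proof (cases q)
          case Upper
          \<comment> \<open>On the upper side the sector around the negative half-axis of z is the
            one with arg v \<ge> -pi/4, and \<open>sigma1\<close> turns its right factor into the
            left one.\<close>
          have eq: "conj1 q (tri_right Lower k (\<i> / pi * Ln v)) = tri_left q k (bval g_fun q z)" unfolding G using Upper by (simp add: conj1_tri)
          have c: "sg q * Re z < 0" using Rez Upper by simp
          show ?thesis using tr[OF S(3)[OF hi[OF c]]] unfolding eq .
        next
          case Lower
          have eq: "conj1 q (tri_left Lower k (\<i> / pi * Ln v)) = tri_left q k (bval g_fun q z)" unfolding G using Lower by (simp add: conj1_mat2)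
          have c: "0 < sg q * Re z" using Rez Lower by simp
          show ?thesis using tr[OF S(2)[OF lo[OF c]]] unfolding eq .
        qed
      qed
      have right: "\<exists>E :: complex^2^2. (\<forall>i j. cmod (E $ i $ j) \<le> CC * (M\<^sup>2 / cmod k)) \<and>
          Gamma_mat p q z l = Psi0 p q z ** (mat 1 + E) ** tri_right q k (bval g_fun q z) ** exp_sigma3 (- k * bval g_fun q z)"
        if "- \<theta> < Arg z" "Arg z < \<theta>"
      proof -
        have "\<bar>Arg z\<bar> < pi / 2" using that assms by linarith
        hence Rez: "Re z > 0" using O(1) Arg_Re_pos[of z] by blast
        show ?thesis
        proof (cases q)
          case Upper
          have eq: "conj1 q (tri_left Lower k (\<i> / pi * Ln v)) = tri_right q k (bval g_fun q z)" unfolding G using Upper by (simp add: conj1_tri)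
          have c: "0 < sg q * Re z" using Rez Upper by simp
          show ?thesis using tr[OF S(2)[OF lo[OF c]]] unfolding eq .
        next
          case Lower
          have eq: "conj1 q (tri_right Lower k (\<i> / pi * Ln v)) = tri_right q k (bval g_fun q z)" unfolding G using Lower by (simp add: conj1_mat2)
          have c: "sg q * Re z < 0" using Rez Lower by simp
          show ?thesis using tr[OF S(3)[OF hi[OF c]]] unfolding eq .
        qed
      qed
      show "let k = kap p l; g = bval g_fun q z;
          expansion = (\<lambda>T :: complex^2^2. \<exists>E :: complex^2^2.
            (\<forall>i j. cmod (E $ i $ j) \<le> CC * (M\<^sup>2 / cmod k)) \<and>
            Gamma_mat p q z l = Psi0 p q z ** (mat 1 + E) ** T ** exp_sigma3 (- k * g))
      in (\<theta> < \<bar>Arg z\<bar> \<and> \<bar>Arg z\<bar> < pi - \<theta> \<longrightarrow> expansion (mat 1)) \<and>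
         (pi - \<theta> < Arg2pi z \<and> Arg2pi z < pi + \<theta> \<longrightarrow> expansion (tri_left q k g)) \<and>
         (- \<theta> < Arg z \<and> Arg z < \<theta> \<longrightarrow> expansion (tri_right q k g))"
        unfolding Let_def k_def[symmetric] by (intro conjI impI; elim conjE; (rule mid left right; assumption))
    qed
  qed
  show ?thesis
  proof (rule exI[of _ M0], rule conjI)
    show "M0 > 0" by (simp add: M0_def)
  qed (rule exI[of _ CC], intro allI impI, rule main, assumption)
qed

end
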